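(* Let $k$ be a field and let $H$ be a semisimple and cosemisimple Hopf algebra over $k$ which is commutative or cocommutative. Let $R$ be a unital $k$-algebra which is a twisted $H$-module algebra with map $\sigma:H\otimes H\to R$, such that the crossed product $R\#_\sigma H$ is an (associative) algebra with unit. Suppose there exists an algebraic closure $F$ of $k$ such that $$r_j(R\otimes_k F)=r_j(R)\otimes_k F\quad\text{and}\quad r_j((R\#_\sigma H)\otimes_k F)=r_j(R\#_\sigma H)\otimes_k F.$$ Then: (1) $r_j(R)=r_{Hj}(R)=r_{jH}(R)$; (2) $r_j(R\#_\sigma H)=r_{Hj}(R)\#_\sigma H$.
   Context: $r_j(A)$ denotes the Jacobson radical of an algebra $A$. Sweedler notation $\Delta(h)=\sum h_1\otimes h_2$ is used. A Hopf algebra $H$ weakly acts on $R$ if there is a $k$-linear map $H\otimes R\to R$, $h\otimes r\mapsto h\cdot r$, with $h\cdot(rs)=\sum (h_1\cdot r)(h_2\cdot s)$ and $1_H\cdot r=r$. $R$ is a twisted $H$-module algebra if $H$ weakly acts on $R$ and there is a convolution-invertible $\sigma\in \mathrm{Hom}_k(H\otimes H,R)$ with $h\cdot(g\cdot r)=\sum\sigma(h_1,g_1)(h_2g_2\cdot r)\sigma^{-1}(h_3,g_3)$ for all $h,g\in H$, $r\in R$. The crossed product $R\#_\sigma H$ is the vector space $R\otimes H$ (elements $a\# h$) with multiplication $(a\# h)(b\# g)=\sum a(h_1\cdot b)\sigma(h_2,g_1)\# h_3g_2$; it is assumed to be associative with unit $1\#1$. For an ideal $I$ of $R$, $(I:H)=\{x\in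 R\mid h\cdot x\in I \text{ for all } h\in H\}$. Put $r_{jH}(R)=(r_j(R):H)$. An $R$-$H$-module is a left $R$-module $M$ with a $k$-linear map $H\otimes M\to M$ satisfying $1_Hm=m$, $h(am)=\sum(h_1\cdot a)(h_2m)$ and $h(gm)=\sum\sigma(h_1,g_1)(h_2g_2m)$ for $h,g\in H$, $a\in R$, $m\in M$. It is $R$-$H$-irreducible if $RM\neq0$ and $M$ has no $R$-$H$-submodules other than $0$ and $M$. The $H$-Jacobson radical $r_{Hj}(R)$ is the intersection of the annihilators in $R$ of all $R$-$H$-irreducible modules (equal to $R$ if there are none). For a subspace $I\subseteq R$, $I\#_\sigma H$ denotes the image of $I\otimes H$ in $R\#_\sigma H$. *)

theory Defs
  imports "HOL-Algebra.Algebra"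
begin

text \<open>
  Everything is stated relative to a field \<open>K\<close>, with vector spaces and algebras as records of type
  \<open>module\<close>.  The library locale \<open>algebra\<close> only covers commutative algebras.  Linear maps out of a
  tensor product that occur as data (actions, cocycles) are given as bilinear maps.
\<close>

section \<open>Algebras and linear maps\<close>

locale assoc_algebra = K?: field K + module K A + A?: ring A
  for K (structure) and A (structure) +
  assumes smult_mult_left:
      "\<lbrakk>c \<in> carrier K; x \<in> carrier A; y \<in> carrier A\<rbrakk> \<Longrightarrow>
        (c \<odot>\<^bsub>A\<^esub> x) \<otimes>\<^bsub>A\<^esub> y = c \<odot>\<^bsub>A\<^esub> (x \<otimes>\<^bsub>A\<^esub> y)"
    and smult_mult_right:
      "\<lbrakk>c \<in> carrier K; x \<in> carrier A; y \<in> carrier A\<rbrakk> \<Longrightarrow>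
        x \<otimes>\<^bsub>A\<^esub> (c \<odot>\<^bsub>A\<^esub> y) = c \<odot>\<^bsub>A\<^esub> (x \<otimes>\<^bsub>A\<^esub> y)"

definition linear_map ::
  "('k, 'n) ring_scheme \<Rightarrow> ('k, 'v, 'm) module_scheme \<Rightarrow> ('k, 'w, 'l) module_scheme \<Rightarrow>
    ('v \<Rightarrow> 'w) \<Rightarrow> bool"
  where "linear_map K V W f \<longleftrightarrow>
    f \<in> carrier V \<rightarrow> carrier W \<and>
    (\<forall>x\<in>carrier V. \<forall>y\<in>carrier V. f (x \<oplus>\<^bsub>V\<^esub> y) = f x \<oplus>\<^bsub>W\<^esub> f y) \<and>
    (\<forall>c\<in>carrier K. \<forall>x\<in>carrier V. f (c \<odot>\<^bsub>V\<^esub> x) = c \<odot>\<^bsub>W\<^esub> f x)"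

definition bilinear_map ::
  "('k, 'n) ring_scheme \<Rightarrow> ('k, 'v, 'm) module_scheme \<Rightarrow> ('k, 'w, 'l) module_scheme \<Rightarrow>
    ('k, 'x, 'p) module_scheme \<Rightarrow> ('v \<Rightarrow> 'w \<Rightarrow> 'x) \<Rightarrow> bool"
  where "bilinear_map K V W U B \<longleftrightarrow>
    (\<forall>v\<in>carrier V. linear_map K W U (B v)) \<and>
    (\<forall>w\<in>carrier W. linear_map K V U (\<lambda>v. B v w))"

definition subspace_span ::
  "('k, 'n) ring_scheme \<Rightarrow> ('k, 'v, 'm) module_scheme \<Rightarrow> 'v set \<Rightarrow> 'v set"
  where "subspace_span K V S = \<Inter>{N. submodule N K V \<and> S \<subseteq> N}"

text \<open>A ring \<open>F\<close> as an algebra over \<open>K\<close>, by means of a homomorphism \<open>\<iota>\<close> from \<open>K\<close> to \<open>F\<close>.\<close>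

definition ext_algebra :: "('f, 'n) ring_scheme \<Rightarrow> ('k \<Rightarrow> 'f) \<Rightarrow> ('k, 'f) module"
  where "ext_algebra F \<iota> =
    \<lparr>carrier = carrier F, monoid.mult = monoid.mult F, monoid.one = \<one>\<^bsub>F\<^esub>, ring.zero = \<zero>\<^bsub>F\<^esub>, add = ring.add F,
     smult = (\<lambda>c x. \<iota> c \<otimes>\<^bsub>F\<^esub> x)\<rparr>"


section \<open>Tensor products\<close>

text \<open>The vector space with basis \<open>S\<close>: finitely supported functions vanishing outside \<open>S\<close>.
  It is a mere vector space; \<open>mult\<close> and \<open>one\<close> only fill the record.\<close>

definition free_space :: "('k, 'n) ring_scheme \<Rightarrow> 's set \<Rightarrow> ('k, 's \<Rightarrow> 'k) module"
  where "free_space K S =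
    \<lparr>carrier = {f. range f \<subseteq> carrier K \<and> (\<forall>s. s \<notin> S \<longrightarrow> f s = \<zero>\<^bsub>K\<^esub>) \<and> finite {s. f s \<noteq> \<zero>\<^bsub>K\<^esub>}},
     monoid.mult = undefined, monoid.one = undefined,
     ring.zero = (\<lambda>s. \<zero>\<^bsub>K\<^esub>), add = (\<lambda>f g s. f s \<oplus>\<^bsub>K\<^esub> g s),
     smult = (\<lambda>c f s. c \<otimes>\<^bsub>K\<^esub> f s)\<rparr>"

definition free_gen :: "('k, 'n) ring_scheme \<Rightarrow> 's \<Rightarrow> 's \<Rightarrow> 'k"
  where "free_gen K s = (\<lambda>s'. if s' = s then \<one>\<^bsub>K\<^esub> else \<zero>\<^bsub>K\<^esub>)"

abbreviation pair_space ::
  "('k, 'n) ring_scheme \<Rightarrow> ('k, 'v, 'm) module_scheme \<Rightarrow> ('k, 'w, 'l) module_scheme \<Rightarrow>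
    ('k, 'v \<times> 'w \<Rightarrow> 'k) module"
  where "pair_space K V W \<equiv> free_space K (carrier V \<times> carrier W)"

definition tensor_relations ::
  "('k, 'n) ring_scheme \<Rightarrow> ('k, 'v, 'm) module_scheme \<Rightarrow> ('k, 'w, 'l) module_scheme \<Rightarrow>
    ('v \<times> 'w \<Rightarrow> 'k) set"
  where "tensor_relations K V W =
    subspace_span K (pair_space K V W)
     ({free_gen K (x \<oplus>\<^bsub>V\<^esub> x', y) \<ominus>\<^bsub>pair_space K V W\<^esub>
         (free_gen K (x, y) \<oplus>\<^bsub>pair_space K V W\<^esub> free_gen K (x', y)) |x x' y.
         x \<in> carrier V \<and> x' \<in> carrier V \<and> y \<in> carrier W} \<union>
      {free_gen K (x, y \<oplus>\<^bsub>W\<^esub> y') \<ominus>\<^bsub>pair_space K V W\<^esub>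
         (free_gen K (x, y) \<oplus>\<^bsub>pair_space K V W\<^esub> free_gen K (x, y')) |x y y'.
         x \<in> carrier V \<and> y \<in> carrier W \<and> y' \<in> carrier W} \<union>
      {free_gen K (c \<odot>\<^bsub>V\<^esub> x, y) \<ominus>\<^bsub>pair_space K V W\<^esub>
         (c \<odot>\<^bsub>pair_space K V W\<^esub> free_gen K (x, y)) |c x y.
         c \<in> carrier K \<and> x \<in> carrier V \<and> y \<in> carrier W} \<union>
      {free_gen K (x, c \<odot>\<^bsub>W\<^esub> y) \<ominus>\<^bsub>pair_space K V W\<^esub>
         (c \<odot>\<^bsub>pair_space K V W\<^esub> free_gen K (x, y)) |c x y.
         c \<in> carrier K \<and> x \<in> carrier V \<and> y \<in> carrier W})"

text \<open>The tensor product of two vector spaces over \<open>K\<close>, as the quotient of the free space on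
  pairs; \<open>mult\<close> and \<open>one\<close> only fill the record.\<close>

definition tensor_space ::
  "('k, 'n) ring_scheme \<Rightarrow> ('k, 'v, 'm) module_scheme \<Rightarrow> ('k, 'w, 'l) module_scheme \<Rightarrow>
    ('k, ('v \<times> 'w \<Rightarrow> 'k) set) module"
  where "tensor_space K V W =
    \<lparr>carrier = a_rcosets\<^bsub>pair_space K V W\<^esub> (tensor_relations K V W),
     monoid.mult = undefined, monoid.one = undefined,
     ring.zero = tensor_relations K V W, add = set_add (pair_space K V W),
     smult = (\<lambda>c t. \<Union>f\<in>t. tensor_relations K V W +>\<^bsub>pair_space K V W\<^esub>
                              (c \<odot>\<^bsub>pair_space K V W\<^esub> f))\<rparr>"

definition tensor ::
  "('k, 'n) ring_scheme \<Rightarrow> ('k, 'v, 'm) module_scheme \<Rightarrow> ('k, 'w, 'l) module_scheme \<Rightarrow>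
    'v \<Rightarrow> 'w \<Rightarrow> ('v \<times> 'w \<Rightarrow> 'k) set"
  where "tensor K V W x y = tensor_relations K V W +>\<^bsub>pair_space K V W\<^esub> free_gen K (x, y)"

text \<open>The linear map to \<open>U\<close> induced by a bilinear map \<open>B\<close>, evaluated on a representative of the
  coset \<open>t\<close>.  Bilinearity of \<open>B\<close> makes the value independent of the representative, see
  \<open>tensor_lift_eq\<close>, \<open>tensor_lift_tensor\<close> and \<open>tensor_lift_linear\<close> below.\<close>

definition formal_sum ::
  "('k, 'n) ring_scheme \<Rightarrow> ('k, 'x, 'p) module_scheme \<Rightarrow> ('v \<Rightarrow> 'w \<Rightarrow> 'x) \<Rightarrow>
    ('v \<times> 'w \<Rightarrow> 'k) \<Rightarrow> 'x"
  where "formal_sum K U B f =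
    (\<Oplus>\<^bsub>U\<^esub>p\<in>{p. f p \<noteq> \<zero>\<^bsub>K\<^esub>}. f p \<odot>\<^bsub>U\<^esub> B (fst p) (snd p))"

definition tensor_lift ::
  "('k, 'n) ring_scheme \<Rightarrow> ('k, 'x, 'p) module_scheme \<Rightarrow> ('v \<Rightarrow> 'w \<Rightarrow> 'x) \<Rightarrow>
    ('v \<times> 'w \<Rightarrow> 'k) set \<Rightarrow> 'x"
  where "tensor_lift K U B t = formal_sum K U B (SOME f. f \<in> t)"

text \<open>The image of \<open>I \<otimes> J\<close> in \<open>V \<otimes> W\<close>, for subspaces \<open>I\<close> of \<open>V\<close> and \<open>J\<close> of \<open>W\<close>.\<close>

definition tensor_image ::
  "('k, 'n) ring_scheme \<Rightarrow> ('k, 'v, 'm) module_scheme \<Rightarrow> ('k, 'w, 'l) module_scheme \<Rightarrow>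
    'v set \<Rightarrow> 'w set \<Rightarrow> ('v \<times> 'w \<Rightarrow> 'k) set set"
  where "tensor_image K V W I J =
    subspace_span K (tensor_space K V W) {tensor K V W x y |x y. x \<in> I \<and> y \<in> J}"

definition tensor_algebra ::
  "('k, 'n) ring_scheme \<Rightarrow> ('k, 'v, 'm) module_scheme \<Rightarrow> ('k, 'w, 'l) module_scheme \<Rightarrow>
    ('k, ('v \<times> 'w \<Rightarrow> 'k) set) module"
  where "tensor_algebra K A B = (tensor_space K A B)
    \<lparr>monoid.mult := (\<lambda>s t.
        tensor_lift K (tensor_space K A B) (\<lambda>a b.
          tensor_lift K (tensor_space K A B) (\<lambda>a' b'.
            tensor K A B (a \<otimes>\<^bsub>A\<^esub> a') (b \<otimes>\<^bsub>B\<^esub> b')) t) s),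
     one := tensor K A B \<one>\<^bsub>A\<^esub> \<one>\<^bsub>B\<^esub>\<rparr>"


section \<open>The Jacobson radical and semisimple algebras\<close>

definition left_ideal :: "('a, 'm) ring_scheme \<Rightarrow> 'a set \<Rightarrow> bool"
  where "left_ideal A L \<longleftrightarrow>
    additive_subgroup L A \<and> (\<forall>a\<in>carrier A. \<forall>x\<in>L. a \<otimes>\<^bsub>A\<^esub> x \<in> L)"

definition maximal_left_ideal :: "('a, 'm) ring_scheme \<Rightarrow> 'a set \<Rightarrow> bool"
  where "maximal_left_ideal A L \<longleftrightarrow>
    left_ideal A L \<and> L \<noteq> carrier A \<and>
    (\<forall>J. left_ideal A J \<and> L \<subseteq> J \<longrightarrow> J = L \<or> J = carrier A)"

definition jacobson_radical :: "('a, 'm) ring_scheme \<Rightarrow> 'a set"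
  where "jacobson_radical A = carrier A \<inter> \<Inter>{L. maximal_left_ideal A L}"

text \<open>Semisimple as a left module over itself: every left ideal is a direct summand.\<close>

definition semisimple_algebra :: "('a, 'm) ring_scheme \<Rightarrow> bool"
  where "semisimple_algebra A \<longleftrightarrow>
    (\<forall>L. left_ideal A L \<longrightarrow>
      (\<exists>L'. left_ideal A L' \<and> L \<inter> L' = {\<zero>\<^bsub>A\<^esub>} \<and> L <+>\<^bsub>A\<^esub> L' = carrier A))"


section \<open>Coalgebras and Hopf algebras\<close>

record ('k, 'h) coalgebra = "('k, 'h) module" +
  comult :: "'h \<Rightarrow> ('h \<times> 'h \<Rightarrow> 'k) set"
  counit :: "'h \<Rightarrow> 'k"

record ('k, 'h) hopf_algebra = "('k, 'h) coalgebra" +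
  antipode :: "'h \<Rightarrow> 'h"

text \<open>Sweedler notation: \<open>sweedler2 K C U h B\<close> is the sum of \<open>B h\<^sub>1 h\<^sub>2\<close> in \<open>U\<close>, and
  \<open>sweedler3 K C U h T\<close> is the sum of \<open>T h\<^sub>1 h\<^sub>2 h\<^sub>3\<close>, the legs being those of
  \<open>(id \<otimes> \<Delta>) \<Delta> h\<close>.\<close>

definition sweedler2 ::
  "('k, 'n) ring_scheme \<Rightarrow> ('k, 'h, 'm) coalgebra_scheme \<Rightarrow> ('k, 'x, 'p) module_scheme \<Rightarrow>
    'h \<Rightarrow> ('h \<Rightarrow> 'h \<Rightarrow> 'x) \<Rightarrow> 'x"
  where "sweedler2 K C U h B = tensor_lift K U B (comult C h)"

definition sweedler3 ::
  "('k, 'n) ring_scheme \<Rightarrow> ('k, 'h, 'm) coalgebra_scheme \<Rightarrow> ('k, 'x, 'p) module_scheme \<Rightarrow>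
    'h \<Rightarrow> ('h \<Rightarrow> 'h \<Rightarrow> 'h \<Rightarrow> 'x) \<Rightarrow> 'x"
  where "sweedler3 K C U h T =
    sweedler2 K C U h (\<lambda>h\<^sub>1 h'. sweedler2 K C U h' (\<lambda>h\<^sub>2 h\<^sub>3. T h\<^sub>1 h\<^sub>2 h\<^sub>3))"

locale coalgebra = K?: field K + module K C
  for K :: "('k, 'n) ring_scheme" (structure) and C :: "('k, 'h, 'm) coalgebra_scheme" (structure) +
  assumes comult_linear: "linear_map K C (tensor_space K C C) (comult C)"
    and counit_linear: "linear_map K C (ext_algebra K id) (counit C)"
    and coassoc:
      "h \<in> carrier C \<Longrightarrow>
        sweedler2 K C (tensor_space K C (tensor_space K C C)) h (\<lambda>x y.
          sweedler2 K C (tensor_space K C (tensor_space K C C)) x (\<lambda>x\<^sub>1 x\<^sub>2.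
            tensor K C (tensor_space K C C) x\<^sub>1 (tensor K C C x\<^sub>2 y))) =
        sweedler2 K C (tensor_space K C (tensor_space K C C)) h (\<lambda>x y.
          tensor K C (tensor_space K C C) x (comult C y))"
    and counit_left: "h \<in> carrier C \<Longrightarrow> sweedler2 K C C h (\<lambda>x y. counit C x \<odot>\<^bsub>C\<^esub> y) = h"
    and counit_right: "h \<in> carrier C \<Longrightarrow> sweedler2 K C C h (\<lambda>x y. counit C y \<odot>\<^bsub>C\<^esub> x) = h"

locale hopf_algebra = assoc_algebra K H + coalgebra K H
  for K :: "('k, 'n) ring_scheme" (structure) and H :: "('k, 'h, 'm) hopf_algebra_scheme" (structure) +
  assumes comult_hom: "comult H \<in> ring_hom H (tensor_algebra K H H)"
    and counit_hom: "counit H \<in> ring_hom H K"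
    and antipode_linear: "linear_map K H H (antipode H)"
    and antipode_left:
      "h \<in> carrier H \<Longrightarrow>
        sweedler2 K H H h (\<lambda>x y. antipode H x \<otimes>\<^bsub>H\<^esub> y) = counit H h \<odot>\<^bsub>H\<^esub> \<one>\<^bsub>H\<^esub>"
    and antipode_right:
      "h \<in> carrier H \<Longrightarrow>
        sweedler2 K H H h (\<lambda>x y. x \<otimes>\<^bsub>H\<^esub> antipode H y) = counit H h \<odot>\<^bsub>H\<^esub> \<one>\<^bsub>H\<^esub>"

definition commutative_algebra :: "('a, 'm) ring_scheme \<Rightarrow> bool"
  where "commutative_algebra A \<longleftrightarrow>
    (\<forall>x\<in>carrier A. \<forall>y\<in>carrier A. x \<otimes>\<^bsub>A\<^esub> y = y \<otimes>\<^bsub>A\<^esub> x)"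

definition cocommutative :: "('k, 'n) ring_scheme \<Rightarrow> ('k, 'h, 'm) coalgebra_scheme \<Rightarrow> bool"
  where "cocommutative K C \<longleftrightarrow>
    (\<forall>h\<in>carrier C. sweedler2 K C (tensor_space K C C) h (\<lambda>x y. tensor K C C y x) = comult C h)"

definition subcoalgebra ::
  "('k, 'n) ring_scheme \<Rightarrow> ('k, 'h, 'm) coalgebra_scheme \<Rightarrow> 'h set \<Rightarrow> bool"
  where "subcoalgebra K C D \<longleftrightarrow>
    submodule D K C \<and> comult C ` D \<subseteq> tensor_image K C C D D"

definition simple_subcoalgebra ::
  "('k, 'n) ring_scheme \<Rightarrow> ('k, 'h, 'm) coalgebra_scheme \<Rightarrow> 'h set \<Rightarrow> bool"
  where "simple_subcoalgebra K C D \<longleftrightarrow>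
    subcoalgebra K C D \<and> D \<noteq> {\<zero>\<^bsub>C\<^esub>} \<and>
    (\<forall>E. subcoalgebra K C E \<and> E \<subseteq> D \<longrightarrow> E = {\<zero>\<^bsub>C\<^esub>} \<or> E = D)"

text \<open>A direct sum of simple subcoalgebras.\<close>

definition cosemisimple :: "('k, 'n) ring_scheme \<Rightarrow> ('k, 'h, 'm) coalgebra_scheme \<Rightarrow> bool"
  where "cosemisimple K C \<longleftrightarrow>
    (\<exists>\<D>. (\<forall>D\<in>\<D>. simple_subcoalgebra K C D) \<and>
      subspace_span K C (\<Union>\<D>) = carrier C \<and>
      (\<forall>D\<in>\<D>. D \<inter> subspace_span K C (\<Union>(\<D> - {D})) = {\<zero>\<^bsub>C\<^esub>}))"


section \<open>Twisted module algebras and crossed products\<close>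

text \<open>Two bilinear maps on \<open>H\<close> with values in \<open>R\<close> that are inverse to each other in the
  convolution algebra of linear maps from \<open>H \<otimes> H\<close> to \<open>R\<close>.\<close>

definition convolution_inverse ::
  "('k, 'n) ring_scheme \<Rightarrow> ('k, 'h, 'm) coalgebra_scheme \<Rightarrow> ('k, 'r, 'p) module_scheme \<Rightarrow>
    ('h \<Rightarrow> 'h \<Rightarrow> 'r) \<Rightarrow> ('h \<Rightarrow> 'h \<Rightarrow> 'r) \<Rightarrow> bool"
  where "convolution_inverse K H R \<sigma> \<tau> \<longleftrightarrow>
    bilinear_map K H H R \<sigma> \<and> bilinear_map K H H R \<tau> \<and>
    (\<forall>h\<in>carrier H. \<forall>g\<in>carrier H.
      sweedler2 K H R h (\<lambda>h\<^sub>1 h\<^sub>2. sweedler2 K H R g (\<lambda>g\<^sub>1 g\<^sub>2. \<sigma> h\<^sub>1 g\<^sub>1 \<otimes>\<^bsub>R\<^esub> \<tau> h\<^sub>2 g\<^sub>2)) =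
        (counit H h \<otimes>\<^bsub>K\<^esub> counit H g) \<odot>\<^bsub>R\<^esub> \<one>\<^bsub>R\<^esub> \<and>
      sweedler2 K H R h (\<lambda>h\<^sub>1 h\<^sub>2. sweedler2 K H R g (\<lambda>g\<^sub>1 g\<^sub>2. \<tau> h\<^sub>1 g\<^sub>1 \<otimes>\<^bsub>R\<^esub> \<sigma> h\<^sub>2 g\<^sub>2)) =
        (counit H h \<otimes>\<^bsub>K\<^esub> counit H g) \<odot>\<^bsub>R\<^esub> \<one>\<^bsub>R\<^esub>)"

locale weak_action = H: hopf_algebra K H + R: assoc_algebra K R
  for K :: "('k, 'n) ring_scheme" (structure) and H :: "('k, 'h, 'm) hopf_algebra_scheme" (structure)
    and R :: "('k, 'r, 'p) module_scheme" (structure) +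
  fixes act :: "'h \<Rightarrow> 'r \<Rightarrow> 'r"
  assumes act_bilinear: "bilinear_map K H R R act"
    and act_mult:
      "\<lbrakk>h \<in> carrier H; r \<in> carrier R; s \<in> carrier R\<rbrakk> \<Longrightarrow>
        act h (r \<otimes>\<^bsub>R\<^esub> s) = sweedler2 K H R h (\<lambda>h\<^sub>1 h\<^sub>2. act h\<^sub>1 r \<otimes>\<^bsub>R\<^esub> act h\<^sub>2 s)"
    and act_one: "r \<in> carrier R \<Longrightarrow> act \<one>\<^bsub>H\<^esub> r = r"

locale twisted_module_algebra = weak_action K H R act
  for K :: "('k, 'n) ring_scheme" (structure) and H :: "('k, 'h, 'm) hopf_algebra_scheme" (structure)
    and R :: "('k, 'r, 'p) module_scheme" (structure) and act +
  fixes \<sigma> :: "'h \<Rightarrow> 'h \<Rightarrow> 'r"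
  assumes twisted:
    "\<exists>\<tau>. convolution_inverse K H R \<sigma> \<tau> \<and>
      (\<forall>h\<in>carrier H. \<forall>g\<in>carrier H. \<forall>r\<in>carrier R.
        act h (act g r) =
          sweedler3 K H R h (\<lambda>h\<^sub>1 h\<^sub>2 h\<^sub>3. sweedler3 K H R g (\<lambda>g\<^sub>1 g\<^sub>2 g\<^sub>3.
            \<sigma> h\<^sub>1 g\<^sub>1 \<otimes>\<^bsub>R\<^esub> act (h\<^sub>2 \<otimes>\<^bsub>H\<^esub> g\<^sub>2) r \<otimes>\<^bsub>R\<^esub> \<tau> h\<^sub>3 g\<^sub>3)))"

definition crossed_product ::
  "('k, 'n) ring_scheme \<Rightarrow> ('k, 'h, 'm) coalgebra_scheme \<Rightarrow> ('k, 'r, 'p) module_scheme \<Rightarrow>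
    ('h \<Rightarrow> 'r \<Rightarrow> 'r) \<Rightarrow> ('h \<Rightarrow> 'h \<Rightarrow> 'r) \<Rightarrow> ('k, ('r \<times> 'h \<Rightarrow> 'k) set) module"
  where "crossed_product K H R act \<sigma> = (tensor_space K R H)
    \<lparr>monoid.mult := (\<lambda>s t.
        tensor_lift K (tensor_space K R H) (\<lambda>a h.
          tensor_lift K (tensor_space K R H) (\<lambda>b g.
            sweedler3 K H (tensor_space K R H) h (\<lambda>h\<^sub>1 h\<^sub>2 h\<^sub>3.
              sweedler2 K H (tensor_space K R H) g (\<lambda>g\<^sub>1 g\<^sub>2.
                tensor K R H (a \<otimes>\<^bsub>R\<^esub> act h\<^sub>1 b \<otimes>\<^bsub>R\<^esub> \<sigma> h\<^sub>2 g\<^sub>1) (h\<^sub>3 \<otimes>\<^bsub>H\<^esub> g\<^sub>2)))) t) s),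
     one := tensor K R H \<one>\<^bsub>R\<^esub> \<one>\<^bsub>H\<^esub>\<rparr>"


section \<open>\<open>H\<close>-radicals\<close>

text \<open>\<open>(I : H)\<close>\<close>

definition H_core ::
  "('k, 'h, 'm) module_scheme \<Rightarrow> ('k, 'r, 'p) module_scheme \<Rightarrow> ('h \<Rightarrow> 'r \<Rightarrow> 'r) \<Rightarrow> 'r set \<Rightarrow> 'r set"
  where "H_core H R act I = {x \<in> carrier R. \<forall>h\<in>carrier H. act h x \<in> I}"

text \<open>\<open>lact\<close> and \<open>hact\<close> are the actions of \<open>R\<close> and \<open>H\<close> on \<open>M\<close>; the \<open>R\<close>-module \<open>M\<close> need not be
  unital.\<close>

locale RH_module = module K M
  for K :: "('k, 'n) ring_scheme" (structure) and H :: "('k, 'h, 'm) coalgebra_scheme" (structure)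
    and R :: "('k, 'r, 'p) module_scheme" (structure) and act :: "'h \<Rightarrow> 'r \<Rightarrow> 'r" and \<sigma> :: "'h \<Rightarrow> 'h \<Rightarrow> 'r" 
    and M :: "('k, 'x, 'q) module_scheme" (structure) +
  fixes lact :: "'r \<Rightarrow> 'x \<Rightarrow> 'x" and hact :: "'h \<Rightarrow> 'x \<Rightarrow> 'x"
  assumes lact_bilinear: "bilinear_map K R M M lact"
    and lact_mult:
      "\<lbrakk>a \<in> carrier R; b \<in> carrier R; m \<in> carrier M\<rbrakk> \<Longrightarrow>
        lact (a \<otimes>\<^bsub>R\<^esub> b) m = lact a (lact b m)"
    and hact_bilinear: "bilinear_map K H M M hact"
    and hact_one: "m \<in> carrier M \<Longrightarrow> hact \<one>\<^bsub>H\<^esub> m = m"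
    and hact_lact:
      "\<lbrakk>h \<in> carrier H; a \<in> carrier R; m \<in> carrier M\<rbrakk> \<Longrightarrow>
        hact h (lact a m) = sweedler2 K H M h (\<lambda>h\<^sub>1 h\<^sub>2. lact (act h\<^sub>1 a) (hact h\<^sub>2 m))"
    and hact_hact:
      "\<lbrakk>h \<in> carrier H; g \<in> carrier H; m \<in> carrier M\<rbrakk> \<Longrightarrow>
        hact h (hact g m) =
          sweedler2 K H M h (\<lambda>h\<^sub>1 h\<^sub>2. sweedler2 K H M g (\<lambda>g\<^sub>1 g\<^sub>2.
            lact (\<sigma> h\<^sub>1 g\<^sub>1) (hact (h\<^sub>2 \<otimes>\<^bsub>H\<^esub> g\<^sub>2) m)))"

locale RH_irreducible = RH_module +
  assumes lact_nonzero: "\<exists>a\<in>carrier R. \<exists>m\<in>carrier M. lact a m \<noteq> \<zero>\<^bsub>M\<^esub>"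
    and irreducible:
      "\<lbrakk>submodule N K M; \<And>a n. \<lbrakk>a \<in> carrier R; n \<in> N\<rbrakk> \<Longrightarrow> lact a n \<in> N;
        \<And>h n. \<lbrakk>h \<in> carrier H; n \<in> N\<rbrakk> \<Longrightarrow> hact h n \<in> N\<rbrakk> \<Longrightarrow> N = {\<zero>\<^bsub>M\<^esub>} \<or> N = carrier M"

text \<open>A definition cannot quantify over modules of all types.  Elements of an irreducible module
  are finite sums of elements \<open>a (h m)\<close> for a fixed \<open>m\<close>, so every irreducible module is isomorphic
  to one carried by a set of lists of pairs \<open>(a, h)\<close>, and modules of this type suffice; see
  \<open>H_jacobson_radical_annihilates\<close> below.\<close>

definition H_jacobson_radical ::
  "('k, 'n) ring_scheme \<Rightarrow> ('k, 'h, 'm) coalgebra_scheme \<Rightarrow> ('k, 'r, 'p) module_scheme \<Rightarrow>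
    ('h \<Rightarrow> 'r \<Rightarrow> 'r) \<Rightarrow> ('h \<Rightarrow> 'h \<Rightarrow> 'r) \<Rightarrow> 'r set"
  where "H_jacobson_radical K H R act \<sigma> =
    {a \<in> carrier R. \<forall>(M :: ('k, ('r \<times> 'h) list) module) lact hact.
      RH_irreducible K H R act \<sigma> M lact hact \<longrightarrow> (\<forall>m\<in>carrier M. lact a m = \<zero>\<^bsub>M\<^esub>)}"


section \<open>Adequacy of the tensor product and of \<open>H_jacobson_radical\<close>\<close>

lemma free_space_simps:
  "f \<in> carrier (free_space K S) \<longleftrightarrow>
     range f \<subseteq> carrier K \<and> (\<forall>s. s \<notin> S \<longrightarrow> f s = \<zero>\<^bsub>K\<^esub>) \<and> finite {s. f s \<noteq> \<zero>\<^bsub>K\<^esub>}"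
  "\<zero>\<^bsub>free_space K S\<^esub> = (\<lambda>s. \<zero>\<^bsub>K\<^esub>)"
  "f \<oplus>\<^bsub>free_space K S\<^esub> g = (\<lambda>s. f s \<oplus>\<^bsub>K\<^esub> g s)"
  "c \<odot>\<^bsub>free_space K S\<^esub> f = (\<lambda>s. c \<otimes>\<^bsub>K\<^esub> f s)"
  by (auto simp: free_space_def)

lemma free_space_module:
  assumes "field K"
  shows "module K (free_space K S)"
proof -
  interpret K: field K by fact
  have in_K: "f s \<in> carrier K" if "f \<in> carrier (free_space K S)" for f s
    using that by (auto simp: free_space_simps)
  have add: "(\<lambda>s. f s \<oplus>\<^bsub>K\<^esub> g s) \<in> carrier (free_space K S)"
    if "f \<in> carrier (free_space K S)" "g \<in> carrier (free_space K S)" for f g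
  proof -
    have "finite ({s. f s \<noteq> \<zero>\<^bsub>K\<^esub>} \<union> {s. g s \<noteq> \<zero>\<^bsub>K\<^esub>})"
      using that by (auto simp: free_space_simps)
    then have "finite {s. f s \<oplus>\<^bsub>K\<^esub> g s \<noteq> \<zero>\<^bsub>K\<^esub>}"
      by (rule rev_finite_subset) auto
    then show ?thesis using that in_K by (auto simp: free_space_simps)
  qed
  have smult: "(\<lambda>s. c \<otimes>\<^bsub>K\<^esub> f s) \<in> carrier (free_space K S)"
    if "f \<in> carrier (free_space K S)" "c \<in> carrier K" for f c
  proof -
    have "finite {s. f s \<noteq> \<zero>\<^bsub>K\<^esub>}"
      using that by (auto simp: free_space_simps)
    then have "finite {s. c \<otimes>\<^bsub>K\<^esub> f s \<noteq> \<zero>\<^bsub>K\<^esub>}"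
      by (rule rev_finite_subset) (use that in auto)
    then show ?thesis using that in_K by (auto simp: free_space_simps)
  qed
  have zero: "(\<lambda>s. \<zero>\<^bsub>K\<^esub>) \<in> carrier (free_space K S)"
    by (auto simp: free_space_simps)
  have "abelian_group (free_space K S)"
  proof (rule abelian_groupI)
    fix f assume f: "f \<in> carrier (free_space K S)"
    show "\<exists>g\<in>carrier (free_space K S). g \<oplus>\<^bsub>free_space K S\<^esub> f = \<zero>\<^bsub>free_space K S\<^esub>"
    proof (rule bexI[of _ "\<lambda>s. \<ominus>\<^bsub>K\<^esub> \<one>\<^bsub>K\<^esub> \<otimes>\<^bsub>K\<^esub> f s"])
      show "(\<lambda>s. \<ominus>\<^bsub>K\<^esub> \<one>\<^bsub>K\<^esub> \<otimes>\<^bsub>K\<^esub> f s) \<in> carrier (free_space K S)"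
        by (rule smult) (use f in auto)
    qed (use f in_K in \<open>auto simp: free_space_simps(2-) K.l_minus K.l_neg\<close>)
  qed (auto simp: free_space_simps(2-) add zero in_K K.a_ac)
  then show ?thesis
    by (intro moduleI)
      (auto simp: free_space_simps(2-) smult in_K K.cring_axioms K.l_distr K.r_distr K.m_assoc)
qed

lemma free_gen_closed:
  assumes "field K" "s \<in> S"
  shows "free_gen K s \<in> carrier (free_space K S)"
proof -
  interpret K: field K by fact
  have "finite {s'. free_gen K s s' \<noteq> \<zero>\<^bsub>K\<^esub>}"
    by (rule finite_subset[of _ "{s}"]) (auto simp: free_gen_def)
  then show ?thesis
    using assms(2) by (auto simp: free_space_simps free_gen_def)
qed

lemma subspace_span_submodule:
  assumes "module K V" "S \<subseteq> carrier V"
  shows "submodule (subspace_span K V S) K V"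
proof -
  interpret V: module K V by fact
  show ?thesis
  proof (rule V.submoduleI)
    show "subspace_span K V S \<subseteq> carrier V"
      unfolding subspace_span_def using V.carrier_is_submodule assms(2) by blast
    show "\<zero>\<^bsub>V\<^esub> \<in> subspace_span K V S"
      unfolding subspace_span_def
      using subgroup.one_closed[OF submodule.axioms(1)] by fastforce
  qed (auto simp: subspace_span_def dest: V.submoduleE)
qed

lemma subspace_span_least:
  assumes "submodule N K V" "S \<subseteq> N"
  shows "subspace_span K V S \<subseteq> N"
  using assms by (auto simp: subspace_span_def)

lemma subspace_span_superset: "S \<subseteq> subspace_span K V S"
  by (auto simp: subspace_span_def)

lemma tensor_relations_submodule:
  assumes "field K" "module K V" "module K W"
  shows "submodule (tensor_relations K V W) K (pair_space K V W)"
proof -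
  interpret P: module K "pair_space K V W" by (rule free_space_module) fact
  interpret V: module K V by fact
  interpret W: module K W by fact
  show ?thesis
    unfolding tensor_relations_def
    by (rule subspace_span_submodule[OF P.module_axioms])
      (auto intro!: P.minus_closed P.add.m_closed P.smult_closed free_gen_closed assms(1))
qed

lemma formal_sum_superset:
  assumes "field K" "module K U" "bilinear_map K V W U B"
    "f \<in> carrier (pair_space K V W)" "finite T" "{p. f p \<noteq> \<zero>\<^bsub>K\<^esub>} \<subseteq> T" "T \<subseteq> carrier V \<times> carrier W"
  shows "formal_sum K U B f = (\<Oplus>\<^bsub>U\<^esub>p\<in>T. f p \<odot>\<^bsub>U\<^esub> B (fst p) (snd p))"
proof -
  interpret U: module K U by fact
  have B: "B x y \<in> carrier U" if "x \<in> carrier V" "y \<in> carrier W" for x y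
    using assms(3) that by (auto simp: bilinear_map_def linear_map_def)
  have f: "f p \<in> carrier K" for p using assms(4) by (auto simp: free_space_simps)
  show ?thesis
    unfolding formal_sum_def
    by (rule U.add.finprod_mono_neutral_cong_left) (use assms B f in \<open>auto 0 3\<close>)
qed

lemma formal_sum_linear:
  assumes "field K" "module K U" "bilinear_map K V W U B"
  shows "linear_map K (pair_space K V W) U (formal_sum K U B)"
proof -
  interpret U: module K U by fact
  interpret P: module K "pair_space K V W" by (rule free_space_module) fact
  have B: "B x y \<in> carrier U" if "x \<in> carrier V" "y \<in> carrier W" for x y
    using assms(3) that by (auto simp: bilinear_map_def linear_map_def)
  have f: "f p \<in> carrier K" "p \<notin> carrier V \<times> carrier W \<Longrightarrow> f p = \<zero>\<^bsub>K\<^esub>"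
     "finite {p. f p \<noteq> \<zero>\<^bsub>K\<^esub>}" if "f \<in> carrier (pair_space K V W)" for p f
    using that unfolding free_space_simps(1) by blast+
  have supp: "{p. f p \<noteq> \<zero>\<^bsub>K\<^esub>} \<subseteq> carrier V \<times> carrier W" if "f \<in> carrier (pair_space K V W)" for f
    using f(2)[OF that] by blast
  have tm: "f p \<odot>\<^bsub>U\<^esub> B (fst p) (snd p) \<in> carrier U"
    if "f \<in> carrier (pair_space K V W)" "p \<in> carrier V \<times> carrier W" for f p
    using that by (auto intro!: U.smult_closed B f)
  show ?thesis
    unfolding linear_map_def
  proof (intro conjI ballI funcsetI)
    fix g assume g: "g \<in> carrier (pair_space K V W)"
    show "formal_sum K U B g \<in> carrier U"
      unfolding formal_sum_def using supp[OF g] tm[OF g] by (intro U.finsum_closed) blast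
  next
    fix g h assume g: "g \<in> carrier (pair_space K V W)" and h: "h \<in> carrier (pair_space K V W)"
    let ?T = "{p. g p \<noteq> \<zero>\<^bsub>K\<^esub>} \<union> {p. h p \<noteq> \<zero>\<^bsub>K\<^esub>}"
    have gh: "g \<oplus>\<^bsub>pair_space K V W\<^esub> h \<in> carrier (pair_space K V W)"
      using g h by (rule P.add.m_closed)
    have T: "finite ?T" "?T \<subseteq> carrier V \<times> carrier W" using f g h supp by auto
    have supp_gh: "{p. (g \<oplus>\<^bsub>pair_space K V W\<^esub> h) p \<noteq> \<zero>\<^bsub>K\<^esub>} \<subseteq> ?T"
      by (auto simp: free_space_simps)
    have "formal_sum K U B (g \<oplus>\<^bsub>pair_space K V W\<^esub> h) =
        (\<Oplus>\<^bsub>U\<^esub>p\<in>?T. (g \<oplus>\<^bsub>pair_space K V W\<^esub> h) p \<odot>\<^bsub>U\<^esub> B (fst p) (snd p))"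
      by (rule formal_sum_superset[OF assms gh T(1) supp_gh T(2)])
    also have "\<dots> = (\<Oplus>\<^bsub>U\<^esub>p\<in>?T. g p \<odot>\<^bsub>U\<^esub> B (fst p) (snd p) \<oplus>\<^bsub>U\<^esub> h p \<odot>\<^bsub>U\<^esub> B (fst p) (snd p))"
    proof (rule U.add.finprod_cong')
      fix p assume p: "p \<in> ?T"
      then have "B (fst p) (snd p) \<in> carrier U" using T(2) B by fastforce
      then show "(g \<oplus>\<^bsub>pair_space K V W\<^esub> h) p \<odot>\<^bsub>U\<^esub> B (fst p) (snd p) =
        g p \<odot>\<^bsub>U\<^esub> B (fst p) (snd p) \<oplus>\<^bsub>U\<^esub> h p \<odot>\<^bsub>U\<^esub> B (fst p) (snd p)"
        using f(1) g h by (simp add: free_space_simps(3) U.smult_l_distr)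
    qed (use T(2) tm g h in \<open>blast intro: U.add.m_closed\<close>)+
    also have "\<dots> = (\<Oplus>\<^bsub>U\<^esub>p\<in>?T. g p \<odot>\<^bsub>U\<^esub> B (fst p) (snd p)) \<oplus>\<^bsub>U\<^esub>
        (\<Oplus>\<^bsub>U\<^esub>p\<in>?T. h p \<odot>\<^bsub>U\<^esub> B (fst p) (snd p))"
      by (rule U.finsum_addf) (use T(2) tm g h in blast)+
    also have "\<dots> = formal_sum K U B g \<oplus>\<^bsub>U\<^esub> formal_sum K U B h"
      using formal_sum_superset[OF assms g T(1) _ T(2)] formal_sum_superset[OF assms h T(1) _ T(2)]
      by simp
    finally show "formal_sum K U B (g \<oplus>\<^bsub>pair_space K V W\<^esub> h) =
      formal_sum K U B g \<oplus>\<^bsub>U\<^esub> formal_sum K U B h" .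
  next
    fix c g assume c: "c \<in> carrier K" and g: "g \<in> carrier (pair_space K V W)"
    let ?T = "{p. g p \<noteq> \<zero>\<^bsub>K\<^esub>}"
    have cg: "c \<odot>\<^bsub>pair_space K V W\<^esub> g \<in> carrier (pair_space K V W)"
      using c g by (rule P.smult_closed)
    have T: "finite ?T" "?T \<subseteq> carrier V \<times> carrier W" using f g supp by auto
    have supp_cg: "{p. (c \<odot>\<^bsub>pair_space K V W\<^esub> g) p \<noteq> \<zero>\<^bsub>K\<^esub>} \<subseteq> ?T"
      using c by (auto simp: free_space_simps)
    have "formal_sum K U B (c \<odot>\<^bsub>pair_space K V W\<^esub> g) =
        (\<Oplus>\<^bsub>U\<^esub>p\<in>?T. (c \<odot>\<^bsub>pair_space K V W\<^esub> g) p \<odot>\<^bsub>U\<^esub> B (fst p) (snd p))"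
      by (rule formal_sum_superset[OF assms cg T(1) supp_cg T(2)])
    also have "\<dots> = (\<Oplus>\<^bsub>U\<^esub>p\<in>?T. c \<odot>\<^bsub>U\<^esub> (g p \<odot>\<^bsub>U\<^esub> B (fst p) (snd p)))"
    proof (rule U.add.finprod_cong')
      fix p assume p: "p \<in> ?T"
      then have "B (fst p) (snd p) \<in> carrier U" using T(2) B by fastforce
      then show "(c \<odot>\<^bsub>pair_space K V W\<^esub> g) p \<odot>\<^bsub>U\<^esub> B (fst p) (snd p) =
        c \<odot>\<^bsub>U\<^esub> (g p \<odot>\<^bsub>U\<^esub> B (fst p) (snd p))"
        using f(1)[OF g] c by (simp add: free_space_simps(4) U.smult_assoc1)
    qed (use T(2) tm g c in \<open>blast intro: U.smult_closed\<close>)+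
    also have "\<dots> = c \<odot>\<^bsub>U\<^esub> (\<Oplus>\<^bsub>U\<^esub>p\<in>?T. g p \<odot>\<^bsub>U\<^esub> B (fst p) (snd p))"
      by (rule U.finsum_smult_ldistr[symmetric, OF T(1) c]) (use T(2) tm g in blast)
    finally show "formal_sum K U B (c \<odot>\<^bsub>pair_space K V W\<^esub> g) = c \<odot>\<^bsub>U\<^esub> formal_sum K U B g"
      by (simp add: formal_sum_def)
  qed
qed

lemma formal_sum_free_gen:
  assumes "field K" "module K U" "bilinear_map K V W U B" "x \<in> carrier V" "y \<in> carrier W"
  shows "formal_sum K U B (free_gen K (x, y)) = B x y"
proof -
  interpret K: field K by fact
  interpret U: module K U by fact
  have B: "B x y \<in> carrier U"
    using assms(3-5) by (auto simp: bilinear_map_def linear_map_def)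
  have "{p. free_gen K (x, y) p \<noteq> \<zero>\<^bsub>K\<^esub>} = {(x, y)}"
    by (auto simp: free_gen_def)
  then show ?thesis
    using B by (simp add: formal_sum_def free_gen_def)
qed

lemma linear_map_kernel:
  assumes "module K V" "module K W" "linear_map K V W f"
  shows "submodule {x \<in> carrier V. f x = \<zero>\<^bsub>W\<^esub>} K V"
proof -
  interpret V: module K V by fact
  interpret W: module K W by fact
  have f: "f x \<in> carrier W" if "x \<in> carrier V" for x
    using assms(3) that by (auto simp: linear_map_def)
  have sm: "f (c \<odot>\<^bsub>V\<^esub> x) = c \<odot>\<^bsub>W\<^esub> f x" if "x \<in> carrier V" "c \<in> carrier K" for c x
    using assms(3) that by (auto simp: linear_map_def)
  have ad: "f (x \<oplus>\<^bsub>V\<^esub> y) = f x \<oplus>\<^bsub>W\<^esub> f y" if "x \<in> carrier V" "y \<in> carrier V" for y x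
    using assms(3) that by (auto simp: linear_map_def)
  have zero: "f \<zero>\<^bsub>V\<^esub> = \<zero>\<^bsub>W\<^esub>"
    using sm[of "\<zero>\<^bsub>V\<^esub>" "\<zero>\<^bsub>K\<^esub>"] f[of "\<zero>\<^bsub>V\<^esub>"] by (simp add: V.smult_l_null W.smult_l_null)
  show ?thesis
  proof (rule V.submoduleI)
    fix x assume x: "x \<in> {x \<in> carrier V. f x = \<zero>\<^bsub>W\<^esub>}"
    then have "\<zero>\<^bsub>W\<^esub> = f (x \<oplus>\<^bsub>V\<^esub> \<ominus>\<^bsub>V\<^esub> x)" using zero by (simp add: V.r_neg)
    also have "\<dots> = f (\<ominus>\<^bsub>V\<^esub> x)" using x ad[of x "\<ominus>\<^bsub>V\<^esub> x"] f[of "\<ominus>\<^bsub>V\<^esub> x"] by simp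
    finally show "\<ominus>\<^bsub>V\<^esub> x \<in> {x \<in> carrier V. f x = \<zero>\<^bsub>W\<^esub>}" using x by simp
  qed (auto simp: zero ad sm)
qed

lemma linear_map_minus:
  assumes "module K V" "module K W" "linear_map K V W f" "x \<in> carrier V" "y \<in> carrier V" "f x = f y"
  shows "f (x \<ominus>\<^bsub>V\<^esub> y) = \<zero>\<^bsub>W\<^esub>"
proof -
  interpret V: module K V by fact
  interpret W: module K W by fact
  have ad: "f (x \<oplus>\<^bsub>V\<^esub> y) = f x \<oplus>\<^bsub>W\<^esub> f y" "f x \<in> carrier W" if "x \<in> carrier V" "y \<in> carrier V" for y x
    using assms(3) that by (auto simp: linear_map_def)
  have "f y \<oplus>\<^bsub>W\<^esub> f (\<ominus>\<^bsub>V\<^esub> y) = f (y \<oplus>\<^bsub>V\<^esub> \<ominus>\<^bsub>V\<^esub> y)" using ad assms by simp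
  also have "\<dots> = \<zero>\<^bsub>W\<^esub>"
    using submodule.axioms(1)[OF linear_map_kernel[OF assms(1-3)], THEN subgroup.one_closed] assms
    by (simp add: V.r_neg)
  finally show ?thesis using ad assms by (simp add: a_minus_def)
qed

lemma formal_sum_relations:
  assumes "field K" "module K V" "module K W" "module K U" "bilinear_map K V W U B"
    "f \<in> tensor_relations K V W"
  shows "formal_sum K U B f = \<zero>\<^bsub>U\<^esub>"
proof -
  interpret V: module K V by fact
  interpret W: module K W by fact
  interpret U: module K U by fact
  interpret P: module K "pair_space K V W" by (rule free_space_module) fact
  let ?k = "{f \<in> carrier (pair_space K V W). formal_sum K U B f = \<zero>\<^bsub>U\<^esub>}"
  note lin = formal_sum_linear[OF assms(1,4,5)]
  have ad: "formal_sum K U B (f \<oplus>\<^bsub>pair_space K V W\<^esub> g) = formal_sum K U B f \<oplus>\<^bsub>U\<^esub> formal_sum K U B g"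
    if "f \<in> carrier (pair_space K V W)" "g \<in> carrier (pair_space K V W)" for f g
    using lin that by (auto simp: linear_map_def)
  have sm: "formal_sum K U B (c \<odot>\<^bsub>pair_space K V W\<^esub> f) = c \<odot>\<^bsub>U\<^esub> formal_sum K U B f"
    if "f \<in> carrier (pair_space K V W)" "c \<in> carrier K" for f c
    using lin that by (auto simp: linear_map_def)
  have B: "B (x \<oplus>\<^bsub>V\<^esub> x') y = B x y \<oplus>\<^bsub>U\<^esub> B x' y" "B (c \<odot>\<^bsub>V\<^esub> x) y = c \<odot>\<^bsub>U\<^esub> B x y"
    if "x \<in> carrier V" "x' \<in> carrier V" "y \<in> carrier W" "c \<in> carrier K" for x x' y c
    using assms(5) that by (auto simp: linear_map_def bilinear_map_def)
  have B': "B x (y \<oplus>\<^bsub>W\<^esub> y') = B x y \<oplus>\<^bsub>U\<^esub> B x y'" "B x (c \<odot>\<^bsub>W\<^esub> y) = c \<odot>\<^bsub>U\<^esub> B x y"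
    if "x \<in> carrier V" "y' \<in> carrier W" "y \<in> carrier W" "c \<in> carrier K" for x y' y c
    using assms(5) that by (auto simp: linear_map_def bilinear_map_def)
  note gen = formal_sum_free_gen[OF assms(1,4,5)]
  note cl = free_gen_closed[OF assms(1), of _ "carrier V \<times> carrier W"]
  note m = linear_map_minus[OF P.module_axioms assms(4) lin]
  have "tensor_relations K V W \<subseteq> ?k"
    unfolding tensor_relations_def
  proof (rule subspace_span_least[OF linear_map_kernel[OF P.module_axioms assms(4) lin]], intro Un_least)
    note [intro!] = P.minus_closed P.add.m_closed P.smult_closed cl m
    show "{free_gen K (x \<oplus>\<^bsub>V\<^esub> x', y) \<ominus>\<^bsub>pair_space K V W\<^esub>
         (free_gen K (x, y) \<oplus>\<^bsub>pair_space K V W\<^esub> free_gen K (x', y)) |x x' y.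
         x \<in> carrier V \<and> x' \<in> carrier V \<and> y \<in> carrier W} \<subseteq> ?k"
      by (auto simp: ad cl gen B[of _ _ _ "\<zero>\<^bsub>K\<^esub>"])
    show "{free_gen K (x, y \<oplus>\<^bsub>W\<^esub> y') \<ominus>\<^bsub>pair_space K V W\<^esub>
         (free_gen K (x, y) \<oplus>\<^bsub>pair_space K V W\<^esub> free_gen K (x, y')) |x y y'.
         x \<in> carrier V \<and> y \<in> carrier W \<and> y' \<in> carrier W} \<subseteq> ?k"
      by (auto simp: ad cl gen B'[of _ _ _ "\<zero>\<^bsub>K\<^esub>"])
  qed (auto intro!: m P.minus_closed P.add.m_closed P.smult_closed cl simp: ad sm cl gen B B')
  then show ?thesis using assms(6) by blast
qed

lemma tensor_space_carrierE:
  assumes "field K" "module K V" "module K W" "t \<in> carrier (tensor_space K V W)"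
  obtains f where "f \<in> carrier (pair_space K V W)"
    "t = tensor_relations K V W +>\<^bsub>pair_space K V W\<^esub> f"
  using assms(4) by (auto simp: tensor_space_def A_RCOSETS_def' a_r_coset_def')

lemma tensor_space_rep:
  assumes "field K" "module K V" "module K W" "t \<in> carrier (tensor_space K V W)"
  shows "(SOME f. f \<in> t) \<in> t" "t \<subseteq> carrier (pair_space K V W)"
proof -
  interpret P: module K "pair_space K V W" by (rule free_space_module) fact
  interpret N: submodule "tensor_relations K V W" K "pair_space K V W"
    by (rule tensor_relations_submodule) fact+
  obtain f where f: "f \<in> carrier (pair_space K V W)"
    "t = tensor_relations K V W +>\<^bsub>pair_space K V W\<^esub> f"
    by (rule tensor_space_carrierE[OF assms])
  then have "\<zero>\<^bsub>pair_space K V W\<^esub> \<oplus>\<^bsub>pair_space K V W\<^esub> f \<in> t"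
    using N.one_closed unfolding a_r_coset_def' by (metis (mono_tags, lifting) UN_I monoid.select_convs(2) singletonI)
  then show "(SOME f. f \<in> t) \<in> t" by (rule someI[of "\<lambda>f. f \<in> t"])
  show "t \<subseteq> carrier (pair_space K V W)"
    using f N.subset by (auto simp: a_r_coset_def')
qed

lemma tensor_lift_rep:
  assumes "field K" "module K V" "module K W" "module K U" "bilinear_map K V W U B"
    "f \<in> carrier (pair_space K V W)"
  shows "tensor_lift K U B (tensor_relations K V W +>\<^bsub>pair_space K V W\<^esub> f) = formal_sum K U B f"
proof -
  interpret U: module K U by fact
  let ?t = "tensor_relations K V W +>\<^bsub>pair_space K V W\<^esub> f"
  have "?t \<in> carrier (tensor_space K V W)"
    using assms(6) by (auto simp: tensor_space_def A_RCOSETS_def' a_r_coset_def')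
  then have "(SOME f. f \<in> ?t) \<in> ?t" by (rule tensor_space_rep[OF assms(1-3)])
  then obtain n where n: "n \<in> tensor_relations K V W"
    "(SOME f. f \<in> ?t) = n \<oplus>\<^bsub>pair_space K V W\<^esub> f"
    by (auto simp: a_r_coset_def')
  have "n \<in> carrier (pair_space K V W)"
    using tensor_relations_submodule[OF assms(1-3), THEN submodule.axioms(1), THEN subgroup.subset] n(1)
    by auto
  then have "formal_sum K U B (n \<oplus>\<^bsub>pair_space K V W\<^esub> f) =
      formal_sum K U B n \<oplus>\<^bsub>U\<^esub> formal_sum K U B f" "formal_sum K U B f \<in> carrier U"
    using formal_sum_linear[OF assms(1,4,5)] assms(6) by (auto simp: linear_map_def)
  then show ?thesis
    unfolding tensor_lift_def n(2) using formal_sum_relations[OF assms(1-5) n(1)] by simp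
qed

lemma tensor_lift_eq:
  assumes "field K" "module K V" "module K W" "module K U" "bilinear_map K V W U B"
    and t: "t \<in> carrier (tensor_space K V W)" "f \<in> t"
  shows "tensor_lift K U B t = formal_sum K U B f"
proof -
  interpret P: module K "pair_space K V W" by (rule free_space_module) fact
  interpret N: submodule "tensor_relations K V W" K "pair_space K V W"
    by (rule tensor_relations_submodule) fact+
  interpret U: module K U by fact
  obtain g where g: "g \<in> carrier (pair_space K V W)"
    "t = tensor_relations K V W +>\<^bsub>pair_space K V W\<^esub> g"
    by (rule tensor_space_carrierE[OF assms(1-3) t(1)])
  obtain n where n: "n \<in> tensor_relations K V W" "f = n \<oplus>\<^bsub>pair_space K V W\<^esub> g"
    using t(2) g(2) by (auto simp: a_r_coset_def')
  have "formal_sum K U B f = formal_sum K U B n \<oplus>\<^bsub>U\<^esub> formal_sum K U B g"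
       "formal_sum K U B g \<in> carrier U"
    using formal_sum_linear[OF assms(1,4,5)] n g N.subset by (auto simp: linear_map_def)
  then show ?thesis
    using tensor_lift_rep[OF assms(1-5) g(1)] g(2) formal_sum_relations[OF assms(1-5) n(1)] by simp
qed

lemma tensor_lift_tensor:
  assumes "field K" "module K V" "module K W" "module K U" "bilinear_map K V W U B"
    and "x \<in> carrier V" "y \<in> carrier W"
  shows "tensor_lift K U B (tensor K V W x y) = B x y"
  unfolding tensor_def
  using assms by (simp add: tensor_lift_rep formal_sum_free_gen free_gen_closed)

lemma tensor_space_module:
  assumes "field K" "module K V" "module K W"
  shows "module K (tensor_space K V W)"
    "f \<in> carrier (pair_space K V W) \<Longrightarrow> c \<in> carrier K \<Longrightarrow>
     c \<odot>\<^bsub>tensor_space K V W\<^esub> (tensor_relations K V W +>\<^bsub>pair_space K V W\<^esub> f) = tensor_relations K V W +>\<^bsub>pair_space K V W\<^esub> (c \<odot>\<^bsub>pair_space K V W\<^esub> f)"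
    "f \<in> carrier (pair_space K V W) \<Longrightarrow> g \<in> carrier (pair_space K V W) \<Longrightarrow>
     (tensor_relations K V W +>\<^bsub>pair_space K V W\<^esub> f) \<oplus>\<^bsub>tensor_space K V W\<^esub> (tensor_relations K V W +>\<^bsub>pair_space K V W\<^esub> g) = tensor_relations K V W +>\<^bsub>pair_space K V W\<^esub> (f \<oplus>\<^bsub>pair_space K V W\<^esub> g)"
proof -
  let ?P = "pair_space K V W" let ?N = "tensor_relations K V W" let ?T = "tensor_space K V W"
  interpret P: module K ?P by (rule free_space_module) fact
  have N: "submodule ?N K ?P" by (rule tensor_relations_submodule) fact+
  then have "additive_subgroup ?N ?P" by (simp add: additive_subgroup_def submodule.axioms(1))
  then interpret N: abelian_subgroup ?N ?P by (rule abelian_subgroupI3) (rule P.abelian_group_axioms)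
  have add: "(?N +>\<^bsub>?P\<^esub> f) \<oplus>\<^bsub>?T\<^esub> (?N +>\<^bsub>?P\<^esub> g) = ?N +>\<^bsub>?P\<^esub> (f \<oplus>\<^bsub>?P\<^esub> g)"
    if "f \<in> carrier ?P" "g \<in> carrier ?P" for f g
    using that by (simp add: tensor_space_def N.a_rcos_sum)
  then show "f \<in> carrier ?P \<Longrightarrow> g \<in> carrier ?P \<Longrightarrow> (?N +>\<^bsub>?P\<^esub> f) \<oplus>\<^bsub>?T\<^esub> (?N +>\<^bsub>?P\<^esub> g) = ?N +>\<^bsub>?P\<^esub> (f \<oplus>\<^bsub>?P\<^esub> g)"
    by blast
  have zero: "\<zero>\<^bsub>?T\<^esub> = ?N +>\<^bsub>?P\<^esub> \<zero>\<^bsub>?P\<^esub>"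
    using N.a_subset by (simp add: tensor_space_def)
  have ca: "carrier ?T = (\<lambda>f. ?N +>\<^bsub>?P\<^esub> f) ` carrier ?P"
    by (auto simp: tensor_space_def A_RCOSETS_def' a_r_coset_def')
  have sm: "c \<odot>\<^bsub>?T\<^esub> (?N +>\<^bsub>?P\<^esub> f) = ?N +>\<^bsub>?P\<^esub> (c \<odot>\<^bsub>?P\<^esub> f)"
    if "f \<in> carrier ?P" "c \<in> carrier K" for f c
  proof -
    have "?N +>\<^bsub>?P\<^esub> (c \<odot>\<^bsub>?P\<^esub> h) = ?N +>\<^bsub>?P\<^esub> (c \<odot>\<^bsub>?P\<^esub> f)" if hh: "h \<in> ?N +>\<^bsub>?P\<^esub> f" for h
    proof -
      obtain n where n: "n \<in> ?N" "h = n \<oplus>\<^bsub>?P\<^esub> f" using hh by (auto simp: a_r_coset_def')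
      then have nc: "n \<in> carrier ?P" using N.a_subset by blast
      have "c \<odot>\<^bsub>?P\<^esub> n \<in> ?N" using \<open>c \<in> carrier K\<close> n N by (simp add: submodule.smult_closed)
      moreover have "c \<odot>\<^bsub>?P\<^esub> h = (c \<odot>\<^bsub>?P\<^esub> n) \<oplus>\<^bsub>?P\<^esub> (c \<odot>\<^bsub>?P\<^esub> f)"
        using nc n \<open>c \<in> carrier K\<close> \<open>f \<in> carrier ?P\<close> P.smult_r_distr by blast
      ultimately have "c \<odot>\<^bsub>?P\<^esub> h \<in> ?N +>\<^bsub>?P\<^esub> (c \<odot>\<^bsub>?P\<^esub> f)"
        unfolding a_r_coset_def' by blast
      then show ?thesis using \<open>c \<in> carrier K\<close> \<open>f \<in> carrier ?P\<close> P.smult_closed by (intro N.a_repr_independence'[symmetric]) blast+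
    qed
    note ind = this
    have "f \<in> ?N +>\<^bsub>?P\<^esub> f" using that N.a_rcos_self by blast
    then have ne: "?N +>\<^bsub>?P\<^esub> f \<noteq> {}" by blast
    have "c \<odot>\<^bsub>?T\<^esub> (?N +>\<^bsub>?P\<^esub> f) = (\<Union>h\<in>?N +>\<^bsub>?P\<^esub> f. ?N +>\<^bsub>?P\<^esub> (c \<odot>\<^bsub>?P\<^esub> h))"
      by (simp add: tensor_space_def)
    also have "\<dots> = (\<Union>h\<in>?N +>\<^bsub>?P\<^esub> f. ?N +>\<^bsub>?P\<^esub> (c \<odot>\<^bsub>?P\<^esub> f))"
      by (rule SUP_cong[OF refl]) (rule ind)
    also have "\<dots> = ?N +>\<^bsub>?P\<^esub> (c \<odot>\<^bsub>?P\<^esub> f)" using ne by (rule SUP_const)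
    finally show ?thesis .
  qed
  then show "f \<in> carrier ?P \<Longrightarrow> c \<in> carrier K \<Longrightarrow> c \<odot>\<^bsub>?T\<^esub> (?N +>\<^bsub>?P\<^esub> f) = ?N +>\<^bsub>?P\<^esub> (c \<odot>\<^bsub>?P\<^esub> f)" by blast
  have "abelian_group ?T"
  proof (rule abelian_groupI)
    fix x assume "x \<in> carrier ?T"
    then obtain f where "f \<in> carrier ?P" "x = ?N +>\<^bsub>?P\<^esub> f" by (auto simp: ca)
    then show "\<exists>y\<in>carrier ?T. y \<oplus>\<^bsub>?T\<^esub> x = \<zero>\<^bsub>?T\<^esub>"
      by (intro bexI[of _ "?N +>\<^bsub>?P\<^esub> (\<ominus>\<^bsub>?P\<^esub> f)"]) (auto simp: ca add zero P.l_neg)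
  qed (auto simp: ca add zero P.a_ac)
  then show "module K ?T"
    by (intro moduleI) (auto simp: ca add sm P.R.cring_axioms P.smult_l_distr P.smult_r_distr P.smult_assoc1)
qed


lemma tensor_bilinear:
  assumes "field K" "module K V" "module K W"
  shows "bilinear_map K V W (tensor_space K V W) (tensor K V W)"
proof -
  let ?P = "pair_space K V W" let ?N = "tensor_relations K V W" let ?T = "tensor_space K V W"
  interpret V: module K V by fact
  interpret W: module K W by fact
  interpret P: module K ?P by (rule free_space_module) fact
  have N: "submodule ?N K ?P" by (rule tensor_relations_submodule) fact+
  then have "additive_subgroup ?N ?P" by (simp add: additive_subgroup_def submodule.axioms(1))
  then interpret N: abelian_subgroup ?N ?P by (rule abelian_subgroupI3) (rule P.abelian_group_axioms)
  note cl = free_gen_closed[OF assms(1), of _ "carrier V \<times> carrier W"]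
  have eq: "?N +>\<^bsub>?P\<^esub> f = ?N +>\<^bsub>?P\<^esub> g" if "f \<ominus>\<^bsub>?P\<^esub> g \<in> ?N" "f \<in> carrier ?P" "g \<in> carrier ?P" for f g
    proof (rule N.a_repr_independence'[symmetric])
    show "f \<in> ?N +>\<^bsub>?P\<^esub> g" using that N.a_rcos_module[of g f] by (simp add: a_minus_def)
  qed (rule that)
  note ops = tensor_space_module(2,3)[OF assms]
  have ca: "tensor K V W x y \<in> carrier ?T" if "x \<in> carrier V" "y \<in> carrier W" for x y
    using that cl by (auto simp: tensor_def tensor_space_def A_RCOSETS_def' a_r_coset_def')
  have rel: 
    "x \<in> carrier V \<Longrightarrow> x' \<in> carrier V \<Longrightarrow> y \<in> carrier W \<Longrightarrow> free_gen K (x \<oplus>\<^bsub>V\<^esub> x', y) \<ominus>\<^bsub>?P\<^esub> (free_gen K (x, y) \<oplus>\<^bsub>?P\<^esub> free_gen K (x', y)) \<in> ?N"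
    "x \<in> carrier V \<Longrightarrow> y \<in> carrier W \<Longrightarrow> y' \<in> carrier W \<Longrightarrow> free_gen K (x, y \<oplus>\<^bsub>W\<^esub> y') \<ominus>\<^bsub>?P\<^esub> (free_gen K (x, y) \<oplus>\<^bsub>?P\<^esub> free_gen K (x, y')) \<in> ?N"
    "c \<in> carrier K \<Longrightarrow> x \<in> carrier V \<Longrightarrow> y \<in> carrier W \<Longrightarrow> free_gen K (c \<odot>\<^bsub>V\<^esub> x, y) \<ominus>\<^bsub>?P\<^esub> (c \<odot>\<^bsub>?P\<^esub> free_gen K (x, y)) \<in> ?N"
    "c \<in> carrier K \<Longrightarrow> x \<in> carrier V \<Longrightarrow> y \<in> carrier W \<Longrightarrow> free_gen K (x, c \<odot>\<^bsub>W\<^esub> y) \<ominus>\<^bsub>?P\<^esub> (c \<odot>\<^bsub>?P\<^esub> free_gen K (x, y)) \<in> ?N"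
    for x x' y y' c
    unfolding tensor_relations_def
    by (rule subsetD[OF subspace_span_superset]; blast)+
  have q: "x \<in> carrier V \<Longrightarrow> x' \<in> carrier V \<Longrightarrow> y \<in> carrier W \<Longrightarrow> tensor K V W (x \<oplus>\<^bsub>V\<^esub> x') y = tensor K V W x y \<oplus>\<^bsub>?T\<^esub> tensor K V W x' y"
     "x \<in> carrier V \<Longrightarrow> y \<in> carrier W \<Longrightarrow> y' \<in> carrier W \<Longrightarrow> tensor K V W x (y \<oplus>\<^bsub>W\<^esub> y') = tensor K V W x y \<oplus>\<^bsub>?T\<^esub> tensor K V W x y'"
     "c \<in> carrier K \<Longrightarrow> x \<in> carrier V \<Longrightarrow> y \<in> carrier W \<Longrightarrow> tensor K V W (c \<odot>\<^bsub>V\<^esub> x) y = c \<odot>\<^bsub>?T\<^esub> tensor K V W x y"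
     "c \<in> carrier K \<Longrightarrow> x \<in> carrier V \<Longrightarrow> y \<in> carrier W \<Longrightarrow> tensor K V W x (c \<odot>\<^bsub>W\<^esub> y) = c \<odot>\<^bsub>?T\<^esub> tensor K V W x y"
     for x x' y y' c
    unfolding tensor_def by (simp_all add: ops cl) ((rule eq, rule rel; simp add: cl)+)
  show ?thesis
    unfolding bilinear_map_def linear_map_def
    by (auto simp: ca q)
qed

lemma tensor_lift_linear:
  assumes "field K" "module K V" "module K W" "module K U" "bilinear_map K V W U B"
  shows "linear_map K (tensor_space K V W) U (tensor_lift K U B)"
proof -
  interpret P: module K "pair_space K V W" by (rule free_space_module) fact
  have ca: "carrier (tensor_space K V W) = (\<lambda>f. tensor_relations K V W +>\<^bsub>pair_space K V W\<^esub> f) ` carrier (pair_space K V W)"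
    by (auto simp: tensor_space_def A_RCOSETS_def' a_r_coset_def')
  note l = formal_sum_linear[OF assms(1,4,5)]
  note r = tensor_lift_rep[OF assms]
  show ?thesis
    using l unfolding linear_map_def ca
    by (auto simp: r tensor_space_module(2,3)[OF assms(1-3)])
qed

lemma tensor_lift_closed:
  assumes "field K" "module K V" "module K W" "module K U" "submodule N K U"
    "t \<in> carrier (tensor_space K V W)"
    "\<And>x y. \<lbrakk>x \<in> carrier V; y \<in> carrier W\<rbrakk> \<Longrightarrow> B x y \<in> N"
  shows "tensor_lift K U B t \<in> N"
proof -
  interpret U: module K U by fact
  define f where "f = (SOME f. f \<in> t)"
  have "f \<in> carrier (pair_space K V W)"
    using tensor_space_rep[OF assms(1-3,6)] by (auto simp: f_def)
  then have f: "f p \<in> carrier K" "p \<notin> carrier V \<times> carrier W \<Longrightarrow> f p = \<zero>\<^bsub>K\<^esub>"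
    "finite {p. f p \<noteq> \<zero>\<^bsub>K\<^esub>}" for p
    unfolding free_space_simps(1) by blast+
  note N = U.submoduleE[OF assms(5)]
  have tm: "f p \<odot>\<^bsub>U\<^esub> B (fst p) (snd p) \<in> N" if "f p \<noteq> \<zero>\<^bsub>K\<^esub>" for p
    using that f(1,2)[of p] assms(7)[of "fst p" "snd p"] N(4) by fastforce
  have "(\<Oplus>\<^bsub>U\<^esub>p\<in>T. f p \<odot>\<^bsub>U\<^esub> B (fst p) (snd p)) \<in> N"
    if "finite T" "T \<subseteq> {p. f p \<noteq> \<zero>\<^bsub>K\<^esub>}" for T
    using that
  proof (induction T)
    case empty
    then show ?case
      using subgroup.one_closed[OF submodule.axioms(1)[OF assms(5)]] by simp
  next
    case (insert p T)
    have "(\<Oplus>\<^bsub>U\<^esub>p\<in>insert p T. f p \<odot>\<^bsub>U\<^esub> B (fst p) (snd p)) =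
        f p \<odot>\<^bsub>U\<^esub> B (fst p) (snd p) \<oplus>\<^bsub>U\<^esub> (\<Oplus>\<^bsub>U\<^esub>p\<in>T. f p \<odot>\<^bsub>U\<^esub> B (fst p) (snd p))"
      by (rule U.finsum_insert) (use insert tm N(1) in \<open>blast+\<close>)
    then show ?case using insert tm N(5) by auto
  qed
  then show ?thesis
    using f(3) by (simp add: tensor_lift_def formal_sum_def flip: f_def)
qed

lemma tensor_lift_hom:
  assumes "field K" "module K V" "module K W" "module K U" "module K U'"
    "linear_map K U U' e"
    "t \<in> carrier (tensor_space K V W)"
    "\<And>x y. \<lbrakk>x \<in> carrier V; y \<in> carrier W\<rbrakk> \<Longrightarrow> B x y \<in> carrier U"
    "\<And>x y. \<lbrakk>x \<in> carrier V; y \<in> carrier W\<rbrakk> \<Longrightarrow> B' x y = e (B x y)"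
  shows "tensor_lift K U' B' t = e (tensor_lift K U B t)"
proof -
  interpret U: module K U by fact
  interpret U': module K U' by fact
  define f where "f = (SOME f. f \<in> t)"
  have "f \<in> carrier (pair_space K V W)"
    using tensor_space_rep[OF assms(1-3,7)] by (auto simp: f_def)
  then have f: "f p \<in> carrier K" "p \<notin> carrier V \<times> carrier W \<Longrightarrow> f p = \<zero>\<^bsub>K\<^esub>"
    "finite {p. f p \<noteq> \<zero>\<^bsub>K\<^esub>}" for p
    unfolding free_space_simps(1) by blast+
  have e1: "e x \<in> carrier U'" if "x \<in> carrier U" for x
    using assms(6) that by (auto simp: linear_map_def)
  have e: "e (x \<oplus>\<^bsub>U\<^esub> y) = e x \<oplus>\<^bsub>U'\<^esub> e y"
      "e (c \<odot>\<^bsub>U\<^esub> x) = c \<odot>\<^bsub>U'\<^esub> e x"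
    if "x \<in> carrier U" "y \<in> carrier U" "c \<in> carrier K" for x y c
    using assms(6) that by (auto simp: linear_map_def)
  have e0: "e \<zero>\<^bsub>U\<^esub> = \<zero>\<^bsub>U'\<^esub>"
    using subgroup.one_closed[OF submodule.axioms(1)[OF linear_map_kernel[OF assms(4-6)]]] by simp
  have B: "B (fst p) (snd p) \<in> carrier U" "B' (fst p) (snd p) = e (B (fst p) (snd p))"
    if "f p \<noteq> \<zero>\<^bsub>K\<^esub>" for p
    using f(2)[of p] that assms(8,9)[of "fst p" "snd p"] by force+
  have "(\<Oplus>\<^bsub>U'\<^esub>p\<in>T. f p \<odot>\<^bsub>U'\<^esub> B' (fst p) (snd p)) =
      e (\<Oplus>\<^bsub>U\<^esub>p\<in>T. f p \<odot>\<^bsub>U\<^esub> B (fst p) (snd p))"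
    if "finite T" "T \<subseteq> {p. f p \<noteq> \<zero>\<^bsub>K\<^esub>}" for T
    using that
  proof (induction T)
    case empty
    then show ?case using e0 by simp
  next
    case (insert p T)
    have "(\<Oplus>\<^bsub>U\<^esub>p\<in>insert p T. f p \<odot>\<^bsub>U\<^esub> B (fst p) (snd p)) =
        f p \<odot>\<^bsub>U\<^esub> B (fst p) (snd p) \<oplus>\<^bsub>U\<^esub> (\<Oplus>\<^bsub>U\<^esub>p\<in>T. f p \<odot>\<^bsub>U\<^esub> B (fst p) (snd p))"
      by (rule U.finsum_insert) (use insert B[of p] B f in \<open>auto intro!: U.smult_closed\<close>)
    moreover have "(\<Oplus>\<^bsub>U'\<^esub>p\<in>insert p T. f p \<odot>\<^bsub>U'\<^esub> B' (fst p) (snd p)) =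
        f p \<odot>\<^bsub>U'\<^esub> B' (fst p) (snd p) \<oplus>\<^bsub>U'\<^esub> (\<Oplus>\<^bsub>U'\<^esub>p\<in>T. f p \<odot>\<^bsub>U'\<^esub> B' (fst p) (snd p))"
      by (rule U'.finsum_insert) (use insert B[of p] B f e1 in \<open>auto intro!: U'.smult_closed\<close>)
    moreover have "(\<Oplus>\<^bsub>U\<^esub>p\<in>T. f p \<odot>\<^bsub>U\<^esub> B (fst p) (snd p)) \<in> carrier U"
      by (rule U.finsum_closed) (use insert B[of p] B f in \<open>auto intro!: U.smult_closed\<close>)
    ultimately show ?case using insert B[of p] f(1)[of p] e by (auto intro!: U.smult_closed)
  qed
  then show ?thesis
    using f(3) by (simp add: tensor_lift_def formal_sum_def flip: f_def)
qed

text \<open>Transport of an irreducible module along an injection of its carrier.\<close>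

definition transport_module :: "('k, 'x, 'q) module_scheme \<Rightarrow> ('x \<Rightarrow> 'y) \<Rightarrow> ('k, 'y) module"
  where "transport_module M e =
    (let d = inv_into (carrier M) e in
     \<lparr>carrier = e ` carrier M, monoid.mult = undefined, monoid.one = undefined,
      ring.zero = e \<zero>\<^bsub>M\<^esub>, ring.add = (\<lambda>x y. e (d x \<oplus>\<^bsub>M\<^esub> d y)),
      smult = (\<lambda>c x. e (c \<odot>\<^bsub>M\<^esub> d x))\<rparr>)"

context
  fixes K :: "('k, 'n) ring_scheme" and M :: "('k, 'x, 'q) module_scheme" and e :: "'x \<Rightarrow> 'y"
  assumes M: "module K M" and e: "inj_on e (carrier M)"
begin

interpretation M: module K M by (rule M)

lemma transport_simps:
  "carrier (transport_module M e) = e ` carrier M"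
  "\<zero>\<^bsub>transport_module M e\<^esub> = e \<zero>\<^bsub>M\<^esub>"
  "x \<in> carrier M \<Longrightarrow> y \<in> carrier M \<Longrightarrow> e x \<oplus>\<^bsub>transport_module M e\<^esub> e y = e (x \<oplus>\<^bsub>M\<^esub> y)"
  "x \<in> carrier M \<Longrightarrow> c \<odot>\<^bsub>transport_module M e\<^esub> e x = e (c \<odot>\<^bsub>M\<^esub> x)"
  using e by (auto simp: transport_module_def Let_def)

lemma transport_is_module: "module K (transport_module M e)"
proof -
  have "abelian_group (transport_module M e)"
  proof (rule abelian_groupI)
    fix x assume "x \<in> carrier (transport_module M e)"
    then obtain m where m: "m \<in> carrier M" "x = e m" by (auto simp: transport_simps)
    then show "\<exists>y\<in>carrier (transport_module M e).
        y \<oplus>\<^bsub>transport_module M e\<^esub> x = \<zero>\<^bsub>transport_module M e\<^esub>"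
      by (intro bexI[of _ "e (\<ominus>\<^bsub>M\<^esub> m)"]) (auto simp: transport_simps M.l_neg)
  qed (auto simp: transport_simps M.a_ac)
  then show ?thesis
    by (intro moduleI)
      (auto simp: transport_simps M.R.cring_axioms M.smult_l_distr M.smult_r_distr M.smult_assoc1)
qed

lemma transport_linear: "linear_map K M (transport_module M e) e"
  by (auto simp: linear_map_def transport_simps)

lemma transport_submodule:
  assumes "submodule N K (transport_module M e)"
  shows "submodule {m \<in> carrier M. e m \<in> N} K M"
proof -
  interpret T: module K "transport_module M e" by (rule transport_is_module)
  note N = T.submoduleE[OF assms]
  have 0: "e \<zero>\<^bsub>M\<^esub> \<in> N"
    using subgroup.one_closed[OF submodule.axioms(1)[OF assms]] by (simp add: transport_simps)
  have neg: "\<ominus>\<^bsub>M\<^esub> m = (\<ominus>\<^bsub>K\<^esub> \<one>\<^bsub>K\<^esub>) \<odot>\<^bsub>M\<^esub> m" if "m \<in> carrier M" for m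
    using that by (simp add: M.smult_l_minus)
  show ?thesis
  proof (rule M.submoduleI)
    fix m n assume "m \<in> {m \<in> carrier M. e m \<in> N}" "n \<in> {m \<in> carrier M. e m \<in> N}"
    then show "m \<oplus>\<^bsub>M\<^esub> n \<in> {m \<in> carrier M. e m \<in> N}"
      using N(5)[of "e m" "e n"] by (auto simp: transport_simps)
  next
    fix c m assume "c \<in> carrier K" "m \<in> {m \<in> carrier M. e m \<in> N}"
    then show "c \<odot>\<^bsub>M\<^esub> m \<in> {m \<in> carrier M. e m \<in> N}"
      using N(4)[of c "e m"] by (auto simp: transport_simps)
  next
    fix m assume "m \<in> {m \<in> carrier M. e m \<in> N}"
    then show "\<ominus>\<^bsub>M\<^esub> m \<in> {m \<in> carrier M. e m \<in> N}"
      using N(4)[of "\<ominus>\<^bsub>K\<^esub> \<one>\<^bsub>K\<^esub>" "e m"] by (auto simp: transport_simps neg)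
  qed (use 0 in auto)
qed

end

lemma (in twisted_module_algebra) RH_irreducible_transport:
  fixes M :: "('k, 'x, 'q) module_scheme" and e :: "'x \<Rightarrow> 'y"
  assumes irr: "RH_irreducible K H R act \<sigma> M lact hact" and e: "inj_on e (carrier M)"
  defines "d \<equiv> inv_into (carrier M) e"
  shows "RH_irreducible K H R act \<sigma> (transport_module M e)
    (\<lambda>a x. e (lact a (d x))) (\<lambda>h x. e (hact h (d x)))"
proof -
  interpret M: RH_irreducible K H R act \<sigma> M lact hact by (rule irr)
  let ?T = "transport_module M e"
  note ts = transport_simps[OF M.module_axioms e]
  interpret T: module K ?T by (rule transport_is_module[OF M.module_axioms e])
  have d: "d (e m) = m" if "m \<in> carrier M" for m
    unfolding d_def using e that by simp
  have K: "field K" by (rule H.K.field_axioms)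
  have Hm: "module K H" by (rule H.module_axioms)
  have Rm: "module K R" by (rule R.module_axioms)
  have l: "lact a m \<in> carrier M" if "a \<in> carrier R" "m \<in> carrier M" for a m
    using M.lact_bilinear that by (auto simp: bilinear_map_def linear_map_def)
  have h: "hact a m \<in> carrier M" if "a \<in> carrier H" "m \<in> carrier M" for a m
    using M.hact_bilinear that by (auto simp: bilinear_map_def linear_map_def)
  have act: "act a r \<in> carrier R" if "a \<in> carrier H" "r \<in> carrier R" for a r
    using act_bilinear that by (auto simp: bilinear_map_def linear_map_def)
  have sig: "\<sigma> a b \<in> carrier R" if "a \<in> carrier H" "b \<in> carrier H" for a b
    using twisted that by (auto simp: bilinear_map_def linear_map_def convolution_inverse_def)
  have cm: "comult H a \<in> carrier (tensor_space K H H)" if "a \<in> carrier H" for a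
    using H.comult_linear that by (auto simp: linear_map_def)
  note lh = tensor_lift_hom[OF K Hm Hm M.module_axioms T.module_axioms
      transport_linear[OF M.module_axioms e]]
  note lc = tensor_lift_closed[OF K Hm Hm M.module_axioms M.carrier_is_submodule]
  show ?thesis
  proof unfold_locales
    show "bilinear_map K R ?T ?T (\<lambda>a x. e (lact a (d x)))"
      using M.lact_bilinear by (auto simp: bilinear_map_def linear_map_def ts d l)
    show "bilinear_map K H ?T ?T (\<lambda>a x. e (hact a (d x)))"
      using M.hact_bilinear by (auto simp: bilinear_map_def linear_map_def ts d h)
  next
    fix a b m assume "a \<in> carrier R" "b \<in> carrier R" "m \<in> carrier ?T"
    then show "e (lact (a \<otimes>\<^bsub>R\<^esub> b) (d m)) = e (lact a (d (e (lact b (d m)))))"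
      by (auto simp: ts d l M.lact_mult)
  next
    fix m assume "m \<in> carrier ?T"
    then show "e (hact \<one>\<^bsub>H\<^esub> (d m)) = m" by (auto simp: ts d M.hact_one)
  next
    fix g a m assume *: "g \<in> carrier H" "a \<in> carrier R" "m \<in> carrier ?T"
    then obtain n where n: "n \<in> carrier M" "m = e n" by (auto simp: ts)
    show "e (hact g (d (e (lact a (d m))))) = sweedler2 K H ?T g
        (\<lambda>h\<^sub>1 h\<^sub>2. e (lact (act h\<^sub>1 a) (d (e (hact h\<^sub>2 (d m))))))"
      using * n unfolding sweedler2_def
      by (subst lh[where B = "\<lambda>h\<^sub>1 h\<^sub>2. lact (act h\<^sub>1 a) (hact h\<^sub>2 n)"])
        (auto simp: d l h act cm M.hact_lact sweedler2_def)
  next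
    fix g a m assume *: "g \<in> carrier H" "a \<in> carrier H" "m \<in> carrier ?T"
    then obtain n where n: "n \<in> carrier M" "m = e n" by (auto simp: ts)
    have 1: "sweedler2 K H ?T a (\<lambda>g\<^sub>1 g\<^sub>2. e (lact (\<sigma> x g\<^sub>1) (d (e (hact (y \<otimes>\<^bsub>H\<^esub> g\<^sub>2) (d m)))))) =
        e (sweedler2 K H M a (\<lambda>g\<^sub>1 g\<^sub>2. lact (\<sigma> x g\<^sub>1) (hact (y \<otimes>\<^bsub>H\<^esub> g\<^sub>2) n)))"
      if "x \<in> carrier H" "y \<in> carrier H" for x y
      using * n that unfolding sweedler2_def
      by (intro lh) (auto simp: d l h sig cm)
    have 2: "sweedler2 K H M a (\<lambda>g\<^sub>1 g\<^sub>2. lact (\<sigma> x g\<^sub>1) (hact (y \<otimes>\<^bsub>H\<^esub> g\<^sub>2) n)) \<in> carrier M"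
      if "x \<in> carrier H" "y \<in> carrier H" for x y
      using * n that unfolding sweedler2_def by (intro lc) (auto simp: l h sig cm)
    have "sweedler2 K H ?T g (\<lambda>x y. sweedler2 K H ?T a
        (\<lambda>g\<^sub>1 g\<^sub>2. e (lact (\<sigma> x g\<^sub>1) (d (e (hact (y \<otimes>\<^bsub>H\<^esub> g\<^sub>2) (d m))))))) =
        e (sweedler2 K H M g (\<lambda>x y. sweedler2 K H M a
          (\<lambda>g\<^sub>1 g\<^sub>2. lact (\<sigma> x g\<^sub>1) (hact (y \<otimes>\<^bsub>H\<^esub> g\<^sub>2) n))))"
      unfolding sweedler2_def[of K H ?T g] sweedler2_def[of K H M g]
      by (rule lh) (use * in \<open>auto simp: cm 1 2\<close>)
    then show "e (hact g (d (e (hact a (d m))))) = sweedler2 K H ?T g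
        (\<lambda>h\<^sub>1 h\<^sub>2. sweedler2 K H ?T a
          (\<lambda>g\<^sub>1 g\<^sub>2. e (lact (\<sigma> h\<^sub>1 g\<^sub>1) (d (e (hact (h\<^sub>2 \<otimes>\<^bsub>H\<^esub> g\<^sub>2) (d m)))))))"
      using * n by (simp add: d h M.hact_hact)
  next
    obtain a m where "a \<in> carrier R" "m \<in> carrier M" "lact a m \<noteq> \<zero>\<^bsub>M\<^esub>"
      using M.lact_nonzero by blast
    then show "\<exists>a\<in>carrier R. \<exists>m\<in>carrier ?T. e (lact a (d m)) \<noteq> \<zero>\<^bsub>?T\<^esub>"
      using e by (intro bexI[of _ a] bexI[of _ "e m"]) (auto simp: ts d l inj_on_eq_iff)
  next
    fix N assume N: "submodule N K ?T" "\<And>a n. a \<in> carrier R \<Longrightarrow> n \<in> N \<Longrightarrow> e (lact a (d n)) \<in> N"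
      "\<And>h n. h \<in> carrier H \<Longrightarrow> n \<in> N \<Longrightarrow> e (hact h (d n)) \<in> N"
    have "{m \<in> carrier M. e m \<in> N} = {\<zero>\<^bsub>M\<^esub>} \<or> {m \<in> carrier M. e m \<in> N} = carrier M"
    proof (rule M.irreducible)
      show "submodule {m \<in> carrier M. e m \<in> N} K M"
        by (rule transport_submodule[OF M.module_axioms e N(1)])
    qed (use N(2,3) d l h in fastforce)+
    moreover have "N = e ` {m \<in> carrier M. e m \<in> N}"
      using T.submoduleE(1)[OF N(1)] by (auto simp: ts)
    ultimately show "N = {\<zero>\<^bsub>?T\<^esub>} \<or> N = carrier ?T" by (auto simp: ts)
  qed
qed

lemma (in twisted_module_algebra) RH_irreducible_inj:
  fixes M :: "('k, 'x, 'q) module_scheme"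
  assumes irr: "RH_irreducible K H R act \<sigma> M lact hact"
  shows "\<exists>e :: 'x \<Rightarrow> ('r \<times> 'h) list. inj_on e (carrier M)"
proof -
  interpret M: RH_irreducible K H R act \<sigma> M lact hact by (rule irr)
  have K: "field K" by (rule H.K.field_axioms)
  have Hm: "module K H" by (rule H.module_axioms)
  have l1: "lact a m \<in> carrier M" if "a \<in> carrier R" "m \<in> carrier M" for a m
    using M.lact_bilinear that by (auto simp: bilinear_map_def linear_map_def)
  have l: "c \<in> carrier K \<Longrightarrow> lact (c \<odot>\<^bsub>R\<^esub> a) m = c \<odot>\<^bsub>M\<^esub> lact a m"
      "n \<in> carrier M \<Longrightarrow> lact a (m \<oplus>\<^bsub>M\<^esub> n) = lact a m \<oplus>\<^bsub>M\<^esub> lact a n"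
    if "a \<in> carrier R" "m \<in> carrier M" for a m n c
    using M.lact_bilinear that by (auto simp: bilinear_map_def linear_map_def)
  note l = l1 l
  have h: "hact a m \<in> carrier M"
      "n \<in> carrier M \<Longrightarrow> hact a (m \<oplus>\<^bsub>M\<^esub> n) = hact a m \<oplus>\<^bsub>M\<^esub> hact a n"
    if "a \<in> carrier H" "m \<in> carrier M" for a m n
    using M.hact_bilinear that by (auto simp: bilinear_map_def linear_map_def)
  have lin0: "f \<zero>\<^bsub>M\<^esub> = \<zero>\<^bsub>M\<^esub>" if "linear_map K M M f" for f
    using subgroup.one_closed[OF submodule.axioms(1)[OF linear_map_kernel[OF M.module_axioms M.module_axioms that]]]
    by simp
  have l0: "lact a \<zero>\<^bsub>M\<^esub> = \<zero>\<^bsub>M\<^esub>" if "a \<in> carrier R" for a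
    using M.lact_bilinear that by (intro lin0) (auto simp: bilinear_map_def)
  have h0: "hact a \<zero>\<^bsub>M\<^esub> = \<zero>\<^bsub>M\<^esub>" if "a \<in> carrier H" for a
    using M.hact_bilinear that by (intro lin0) (auto simp: bilinear_map_def)
  have act: "act a r \<in> carrier R" if "a \<in> carrier H" "r \<in> carrier R" for a r
    using act_bilinear that by (auto simp: bilinear_map_def linear_map_def)
  have sig: "\<sigma> a b \<in> carrier R" if "a \<in> carrier H" "b \<in> carrier H" for a b
    using twisted that by (auto simp: bilinear_map_def linear_map_def convolution_inverse_def)
  have cm: "comult H a \<in> carrier (tensor_space K H H)" if "a \<in> carrier H" for a
    using H.comult_linear that by (auto simp: linear_map_def)
  note lc = tensor_lift_closed[OF K Hm Hm M.module_axioms]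
  obtain a\<^sub>0 m where am: "a\<^sub>0 \<in> carrier R" "m \<in> carrier M" "lact a\<^sub>0 m \<noteq> \<zero>\<^bsub>M\<^esub>"
    using M.lact_nonzero by blast
  define g where "g = (\<lambda>xs. foldr (\<lambda>(a, h) s. lact a (hact h m) \<oplus>\<^bsub>M\<^esub> s) xs \<zero>\<^bsub>M\<^esub>)"
  define L where "L = lists (carrier R \<times> carrier H)"
  have g_Nil: "g [] = \<zero>\<^bsub>M\<^esub>" and g_Cons: "g ((a, h) # xs) = lact a (hact h m) \<oplus>\<^bsub>M\<^esub> g xs" for a h xs
    by (auto simp: g_def)
  have g_closed: "g xs \<in> carrier M" if "xs \<in> L" for xs
    using that unfolding L_def
    by (induction xs rule: lists.induct) (auto simp: g_Nil g_Cons l h am(2))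
  have g_append: "g (xs @ ys) = g xs \<oplus>\<^bsub>M\<^esub> g ys" if "xs \<in> L" "ys \<in> L" for xs ys
    using that(1) unfolding L_def
    by (induction xs rule: lists.induct)
      (use that(2) g_closed[unfolded L_def in_lists_conv_set] in \<open>auto simp: g_Nil g_Cons l h am(2) M.a_assoc L_def\<close>)
  have g_smult: "c \<odot>\<^bsub>M\<^esub> g xs = g (map (\<lambda>(a, h). (c \<odot>\<^bsub>R\<^esub> a, h)) xs)" if "c \<in> carrier K" "xs \<in> L" for c xs
    using that(2) unfolding L_def
    by (induction xs rule: lists.induct)
      (use that(1) g_closed[unfolded L_def in_lists_conv_set] in \<open>auto simp: g_Nil g_Cons l h am(2) M.smult_r_distr\<close>)
  have g_lact: "lact b (g xs) = g (map (\<lambda>(a, h). (b \<otimes>\<^bsub>R\<^esub> a, h)) xs)" if "b \<in> carrier R" "xs \<in> L" for b xs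
    using that(2) unfolding L_def
    by (induction xs rule: lists.induct)
      (use that(1) g_closed[unfolded L_def in_lists_conv_set] in \<open>auto simp: g_Nil g_Cons l h l0 am(2) M.lact_mult\<close>)
  let ?N = "g ` L"
  have N_add: "x \<oplus>\<^bsub>M\<^esub> y \<in> ?N" if that': "x \<in> ?N" "y \<in> ?N" for x y
  proof -
    obtain xs ys where "xs \<in> L" "ys \<in> L" "x = g xs" "y = g ys" using that' by blast
    then show ?thesis by (intro image_eqI[of _ _ "xs @ ys"]) (auto simp: g_append L_def)
  qed
  have N_smult: "c \<odot>\<^bsub>M\<^esub> x \<in> ?N" if that': "c \<in> carrier K" "x \<in> ?N" for c x
  proof -
    obtain xs where "xs \<in> L" "x = g xs" using that' by blast
    then show ?thesis using that'(1)
      by (intro image_eqI[of _ _ "map (\<lambda>(a, h). (c \<odot>\<^bsub>R\<^esub> a, h)) xs"]) (force simp: g_smult L_def)+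
  qed
  have N_lact: "lact b x \<in> ?N" if that': "b \<in> carrier R" "x \<in> ?N" for b x
  proof -
    obtain xs where "xs \<in> L" "x = g xs" using that' by blast
    then show ?thesis using that'(1)
      by (intro image_eqI[of _ _ "map (\<lambda>(a, h). (b \<otimes>\<^bsub>R\<^esub> a, h)) xs"]) (force simp: g_lact L_def)+
  qed
  have N_sub: "?N \<subseteq> carrier M" using g_closed by blast
  have N: "submodule ?N K M"
  proof (rule M.submoduleI[OF N_sub])
    show "\<zero>\<^bsub>M\<^esub> \<in> ?N" by (intro image_eqI[of _ _ "[]"]) (auto simp: g_Nil L_def)
    show "\<ominus>\<^bsub>M\<^esub> x \<in> ?N" if "x \<in> ?N" for x
      using N_smult[of "\<ominus>\<^bsub>K\<^esub> \<one>\<^bsub>K\<^esub>" x] that N_sub by (auto simp: M.smult_l_minus)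
  qed (use N_add N_smult in auto)
  have N_gen: "lact a (hact k m) \<in> ?N" if "a \<in> carrier R" "k \<in> carrier H" for a k
    using that am(2) by (intro image_eqI[of _ _ "[(a, k)]"]) (auto simp: g_Nil g_Cons l h L_def)
  have N_hh: "lact b (hact k (hact k' m)) \<in> ?N" if "b \<in> carrier R" "k \<in> carrier H" "k' \<in> carrier H" for b k k'
  proof -
    have "hact k (hact k' m) \<in> ?N"
      unfolding M.hact_hact[OF that(2,3) am(2)] sweedler2_def
      by (intro lc[OF N] N_gen) (use that sig cm in auto)
    then show ?thesis using that by (intro N_lact)
  qed
  have N_hact1: "hact k (lact a (hact k' m)) \<in> ?N" if "a \<in> carrier R" "k \<in> carrier H" "k' \<in> carrier H" for a k k'
    unfolding M.hact_lact[OF that(2,1) h(1)[OF that(3) am(2)]] sweedler2_def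
    by (intro lc[OF N] N_hh) (use that act cm in auto)
  have N_hact: "hact k x \<in> ?N" if that': "k \<in> carrier H" "x \<in> ?N" for k x
  proof -
    obtain xs where xs: "xs \<in> L" "x = g xs" using that' by blast
    have "hact k (g xs) \<in> ?N" using xs(1) unfolding L_def
    proof (induction xs rule: lists.induct)
      case Nil
      then show ?case using h0[OF that'(1)] by (intro image_eqI[of _ _ "[]"]) (auto simp: g_Nil)
    next
      case (Cons p xs)
      then obtain a k' where p: "p = (a, k')" "a \<in> carrier R" "k' \<in> carrier H" by auto
      have "hact k (g (p # xs)) = hact k (lact a (hact k' m)) \<oplus>\<^bsub>M\<^esub> hact k (g xs)"
        using p Cons that'(1) am(2) g_closed by (simp add: g_Cons h l L_def)
      then show ?case using N_add N_hact1[OF p(2) that'(1) p(3)] Cons by (simp add: L_def)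
    qed
    then show ?thesis using xs by simp
  qed
  have "?N = {\<zero>\<^bsub>M\<^esub>} \<or> ?N = carrier M"
    by (rule M.irreducible[OF N N_lact N_hact])
  moreover have "lact a\<^sub>0 m \<in> ?N"
    using N_gen[OF am(1) H.A.one_closed] am(2) by (simp add: M.hact_one)
  ultimately have "?N = carrier M" using am(3) by blast
  then have "inj_on (inv_into L g) (carrier M)" by (metis inj_on_inv_into subset_refl)
  then show ?thesis by blast
qed

theorem (in twisted_module_algebra) H_jacobson_radical_annihilates:
  fixes M :: "('k, 'x, 'q) module_scheme"
  assumes "RH_irreducible K H R act \<sigma> M lact hact" and "a \<in> H_jacobson_radical K H R act \<sigma>"
    and "m \<in> carrier M"
  shows "lact a m = \<zero>\<^bsub>M\<^esub>"
proof -
  interpret M: RH_irreducible K H R act \<sigma> M lact hact by fact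
  obtain e :: "'x \<Rightarrow> ('r \<times> 'h) list" where e: "inj_on e (carrier M)"
    using RH_irreducible_inj[OF assms(1)] by blast
  note ts = transport_simps[OF M.module_axioms e]
  have "lact a m \<in> carrier M"
    using M.lact_bilinear assms(2,3)
    by (auto simp: bilinear_map_def linear_map_def H_jacobson_radical_def)
  moreover have "e (lact a (inv_into (carrier M) e (e m))) = \<zero>\<^bsub>transport_module M e\<^esub>"
    using assms(2,3) RH_irreducible_transport[OF assms(1) e]
    unfolding H_jacobson_radical_def by (fastforce simp: ts)
  ultimately show ?thesis
    using e assms(3) by (simp add: ts inj_on_eq_iff)
qed

end

theory Submission
  imports Defs "HOL-Algebra.Algebra"
begin

text \<open>Over the algebraic closure \<open>F\<close>, the Hopf algebra \<open>H\<close> becomes the group algebra of a finite group \<open>G\<close>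
  or its dual, and the order of \<open>G\<close> is invertible.  In both cases averaging over \<open>G\<close>, as in Maschke's
  theorem, shows that an element of the crossed product lies in the Jacobson radical if and only if its
  coordinates do.  Since the two Jacobson radicals commute with base change to \<open>F\<close>, the same holds for
  \<open>A = R # H\<close> over \<open>K\<close>.  Hence \<open>J(A) = J(R) # H\<close>, and \<open>J(R)\<close> is stable under \<open>H\<close>.

  For a maximal left ideal \<open>N\<close> of \<open>A\<close>, the quotient \<open>A / N\<close> is an irreducible \<open>R\<close>-\<open>H\<close>-module, so the
  \<open>H\<close>-Jacobson radical of \<open>R\<close> lies in \<open>J(A)\<close>, hence in \<open>J(R)\<close>.  Conversely, as \<open>H\<close> is finite-dimensional,
  an irreducible \<open>R\<close>-\<open>H\<close>-module \<open>M\<close> has a maximal \<open>R\<close>-submodule \<open>W\<close>; the largest \<open>H\<close>-stable subspace of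
  \<open>W\<close> is \<open>0\<close> and contains \<open>J(R) M\<close>.\<close>

text \<open>The Hopf algebra over \<open>F\<close> is never built. A finite basis of
  \<open>H\<close> over \<open>K\<close> turns its axioms into polynomial identities between
  structure constants, which \<open>\<iota>\<close> carries to \<open>F\<close>. The list of
  identities is closed under duality, so one analysis of commutative split Hopf algebras serves both
  cases. The inverse of the group order is computed, not quoted: semisimplicity gives an integral
  \<open>t\<close> in \<open>H\<close> with counit 1, cosemisimplicity an integral \<open>l\<close>
  on \<open>H\<close> with value 1 at 1, and l(t) is that inverse. The same \<open>t\<close> forces
  \<open>H\<close> to be finite-dimensional. The two kinds of group extension need different
  averagings: for group algebras one averages complements of submodules over the base ring, for dual
  group algebras complements of left ideals of the extension, which a trace then carries down to the
  base ring. A basis of \<open>H\<close> over \<open>K\<close> and the basis indexed by the group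
  differ by an invertible matrix of central scalars, so the condition that all coordinates lie in
  the radical does not see the choice of basis; linear functionals over \<open>K\<close> bring this
  condition back from \<open>F\<close> to \<open>K\<close>.\<close>

text \<open>Short forms: an index \<open>$G\<close> names the structure of an operation, \<open>+/\<close> is \<^const>\<open>finsum\<close>, and \<open>x:.S\<close>
  is membership in the carrier of \<open>S\<close>.\<close>

notation monoid.mult (infixl "*.\<index>" 70) and monoid.one ("1.\<index>")
notation ring.add (infixl "+.\<index>" 65) and ring.zero ("0.\<index>")
notation a_inv ("-.\<index> _" [81] 80) and a_minus ("_ -.\<index> _" [65, 66] 65)
notation module.smult (infixl ".*\<index>" 70)

abbreviation (input) in_carrier (infix ":." 50) where "x :. S \<equiv> x \<in> carrier S"
abbreviation (input) "car \<equiv> carrier"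
abbreviation (input) "rad \<equiv> jacobson_radical"
abbreviation (input) "lin \<equiv> linear_map"
abbreviation (input) "bil \<equiv> bilinear_map"

syntax "_structure_index" :: "logic \<Rightarrow> index" ("$_" [1000] 1000)
translations "_structure_index G" => "_index G"
syntax "_finite_sum" :: "index \<Rightarrow> idt \<Rightarrow> 'a set \<Rightarrow> 'b \<Rightarrow> 'b" ("(3+'/__:_. _)" [1000, 0, 51, 10] 10)
translations "_finite_sum G i A b" => "CONST finsum G (\<lambda>i. b) A"

no_notation Sum_Type.Plus (infixr \<open><+>\<close> 65)

section \<open>Groups with operators\<close>

context abelian_group
begin

lemma diff_diff:
	assumes "a:.G" "b:.G" "c:.G"
	shows "(a -. b) -. (c -. b) = a -. c"
proof -
	have "(a -. b) -. (c -. b) = a+.(-. b+.(b+.-. c))"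
		using assms by(simp add: a_minus_def minus_add a_ac)
	thus ?thesis using assms by(simp add: r_neg1 a_minus_def)
qed

lemma additive_zero:
	assumes "!!x. x:.G==>h x:.G"
		"!!x y. x:.G==>y:.G==>h (x+.y) = h x+.h y"
	shows "h 0. = 0."
proof -
	have "h 0.+.h 0. = h 0." using assms(2)[of \<zero> \<zero>] by simp
	thus ?thesis using assms(1)[of \<zero>] by(metis add.l_cancel_one' zero_closed)
qed

lemma additive_minus:
	assumes "!!x. x:.G==>h x:.G"
		"!!x y. x:.G==>y:.G==>h (x+.y) = h x+.h y"
		"x:.G" "y:.G"
	shows "h (x -. y) = h x -. h y"
proof -
	have "h (x -. y)+.h y = h x"
		using assms(2)[of "x -. y" y] assms(3,4) by(simp add: a_minus_def a_assoc l_neg)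
	thus ?thesis using assms(1)[of x] assms(1)[of y] assms(1)[of "x -. y"] assms(3,4)
		by(metis add.inv_solve_right minus_closed minus_eq)
qed

lemma additive_finsum:
	assumes "!!x. x:.G==>h x:.G"
		"!!x y. x:.G==>y:.G==>h (x+.y) = h x+.h y"
		"finite A" "!!a. a:A==>f a:.G"
	shows "h (+/a:A. f a) = (+/a:A. h (f a))"
	using assms(3,4)
proof (induction)
	case empty
	show ?case using additive_zero[OF assms(1,2)] by simp
next
	case (insert a A)
	hence "f:A \<rightarrow> car G" by auto
	moreover have "(%x. h (f x)):A \<rightarrow> car G" using insert assms(1) by auto
	ultimately show ?case using insert assms by simp
qed

end

text \<open>Operators are a bare set of additive maps, so that left ideals, submodules over a
  smaller ring and subspaces are all instances, and stability under a group of semilinear maps can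
  be treated on top of it.\<close>

locale op_group = abelian_group M for M (structure) +
	fixes \<Omega> :: "('a => 'a) set"
	assumes op_closed: "f:\<Omega>==>x:.M==>f x:.M"
		and op_add: "f:\<Omega>==>x:.M==>y:.M==>f (x+.y) = f x+.f y"
begin

definition osub :: "'a set => bool"
	where "osub N \<longleftrightarrow> additive_subgroup N M & (ALL f:\<Omega>. ALL x:N. f x:N)"

definition max_osub :: "'a set => bool"
	where "max_osub N \<longleftrightarrow> osub N & N ~= car M &
		(ALL N'. osub N' & N <= N' --> N' = N | N' = car M)"

text \<open>Semisimplicity of the quotient by \<open>Z\<close>, phrased inside the ambient group so
  that no quotient has to be formed.\<close>

definition complemented_above :: "'a set => bool"
	where "complemented_above Z \<longleftrightarrow>
		(ALL N. osub N & Z <= N --> (EX C. osub C & N Int C = Z & N <+> C = car M))"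

lemma osubI:
	assumes "N <= car M" "0.:N" "!!x y. x:N==>y:N==>x+.y:N"
		"!!x. x:N==>-. x:N" "!!f x. f:\<Omega>==>x:N==>f x:N"
	shows "osub N"
proof -
	have "subgroup N (add_monoid M)"
		using assms by(intro add.subgroupI) (auto simp: a_inv_def)
	thus ?thesis using assms by(auto simp: osub_def intro!: additive_subgroup.intro)
qed

lemma osubD:
	assumes "osub N"
	shows "N <= car M" "0.:N" "x:N==>y:N==>x+.y:N"
		"x:N==>-. x:N" "f:\<Omega>==>x:N==>f x:N" "x:N==>y:N==>x -. y:N"
		"x:N==>x:.M"
proof -
	interpret additive_subgroup N M using assms by(simp add: osub_def)
	show "N <= car M" "0.:N" "x:N==>y:N==>x+.y:N" "x:N==>x:.M"
		using a_subset by auto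
	have inv: "-. y:N" if "y:N" for y
		using that abelian_group_axioms by auto
	thus "x:N==>-. x:N" .
	show "x:N==>y:N==>x -. y:N"
		using inv by(auto simp: a_minus_def)
qed (use assms in "auto simp: osub_def")

lemma osub_carrier: "osub (car M)" by(rule osubI) (auto simp: op_closed)

lemma osub_Int: "osub N==>osub N'==>osub (N Int N')" by(rule osubI) (auto dest: osubD)

lemma osub_finsum:
	assumes "osub N" "finite A" "!!a. a:A==>f a:N" shows "(+/a:A. f a):N"
	using assms(2,3)
proof (induction)
	case (insert a A)
	hence "f a:.M" "f:A \<rightarrow> car M" using osubD(7)[OF assms(1)] by auto
	thus ?case using insert osubD(3)[OF assms(1)] by simp
qed (use osubD(2)[OF assms(1)] in simp)

lemma mem_set_add: "x:N <+> N' \<longleftrightarrow> (EX n:N. EX n':N'. x = n+.n')"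
	by(auto simp: set_add_def')

lemma osub_sum:
	assumes "osub N" "osub N'" shows "osub (N <+> N')"
proof (rule osubI)
	note N = osubD[OF assms(1)] and N' = osubD[OF assms(2)]
	show "N <+> N' <= car M" using N(7) N'(7) by(auto simp: mem_set_add)
	show "0.:N <+> N'" using N(2) N'(2) by(auto simp: mem_set_add intro!: bexI[of _ \<zero>])
	fix x assume "x:N <+> N'"
	then obtain a b where ab: "a:N" "b:N'" "x = a+.b" by(auto simp: mem_set_add)
	have car: "a:.M" "b:.M" using N(7) N'(7) ab by auto
	have "-. x = -. a+.-. b" using car by(simp add: ab minus_add)
	thus "-. x:N <+> N'" using ab N(4) N'(4) unfolding mem_set_add by blast
	show "f x:N <+> N'" if "f:\<Omega>" for f
		using op_add[OF that car] ab N(5)[OF that] N'(5)[OF that] unfolding mem_set_add by blast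
	fix y assume "y:N <+> N'"
	then obtain c d where cd: "c:N" "d:N'" "y = c+.d" by(auto simp: mem_set_add)
	have "x+.y = (a+.c)+.(b+.d)"
		using car cd N(7) N'(7) by(simp add: ab cd a_ac)
	thus "x+.y:N <+> N'" using ab cd N(3) N'(3) unfolding mem_set_add by metis
qed

lemma sum_superset:
	assumes "osub N" "osub N'" shows "N <= N <+> N'" "N' <= N <+> N'"
proof -
	note N = osubD[OF assms(1)] and N' = osubD[OF assms(2)]
	show "N <= N <+> N'"
	proof
		fix x assume "x:N"
		hence "x = x+.0." using N by simp
		thus "x:N <+> N'" using \<open>x : N\<close> N'(2) unfolding mem_set_add by blast
	qed
	show "N' <= N <+> N'"
	proof
		fix x assume "x:N'"
		hence "x = 0.+.x" using N' by simp
		thus "x:N <+> N'" using \<open>x : N'\<close> N(2) unfolding mem_set_add by blast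
	qed
qed

lemma sum_le: "osub N==>A <= N==>B <= N==>A <+> B <= N"
	using osubD(3) by(fastforce simp: mem_set_add)

text \<open>Finiteness of \<open>A\<close> lets Zorn's lemma run: if the union of a chain contains
  \<open>A\<close>, some member already does. A singleton \<open>A\<close> gives submodules maximal
  without a given element, a generating \<open>A\<close> gives maximal submodules.\<close>

lemma exists_osub_maximal_avoiding:
	assumes "osub Z" "finite A" "~ A <= Z"
	obtains N where "osub N" "Z <= N" "~ A <= N" "!!N'. osub N'==>N \<subset> N'==>A <= N'"
proof -
	let ?S = "{N. osub N & Z <= N & ~ A <= N}"
	have "EX N:?S. ALL N':?S. N <= N' --> N' = N"
	proof (rule subset_Zorn_nonempty)
		show "?S ~= {}" using assms by auto
		fix \<C> assume ne: "\<C> ~= {}" and ch: "subset.chain ?S \<C>"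
		have C: "osub N" "Z <= N" "~ A <= N" if "N:\<C>" for N
			using ch that by(auto simp: subset.chain_def)
		have tot: "N <= N' | N' <= N" if "N:\<C>" "N':\<C>" for N N'
			using ch that by(auto simp: subset.chain_def)
		have "osub (\<Union>\<C>)"
		proof (rule osubI)
			show "\<Union>\<C> <= car M" using C osubD(1) by blast
			show "0.:\<Union>\<C>" using ne C(1) osubD(2) by blast
			show "x+.y:\<Union>\<C>" if xy: "x:\<Union>\<C>" "y:\<Union>\<C>" for x y
			proof -
				obtain N N' where N: "N:\<C>" "x:N" "N':\<C>" "y:N'" using xy by blast
				obtain N'' where "N'':\<C>" "x:N''" "y:N''" using tot[OF N(1,3)] N by blast
				thus ?thesis using osubD(3)[OF C(1)] by blast
			qed
			show "-. x:\<Union>\<C>" if "x:\<Union>\<C>" for x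
				using that osubD(4)[OF C(1)] by blast
			show "f x:\<Union>\<C>" if "f:\<Omega>" "x:\<Union>\<C>" for f x
				using that osubD(5)[OF C(1)] by blast
		qed
		moreover have "~ A <= \<Union>\<C>"
		proof
			assume "A <= \<Union>\<C>"
			then obtain N where "N:\<C>" "A <= N"
				using finite_subset_Union_chain[OF assms(2) _ ne] ch by(auto simp: subset.chain_def)
			thus False using C by blast
		qed
		moreover have "Z <= \<Union>\<C>" using ne C by blast
		ultimately show "\<Union>\<C>:?S" by blast
	qed
	then obtain N where N: "osub N" "Z <= N" "~ A <= N" and max: "ALL N':?S. N <= N' --> N' = N" by auto
	have "A <= N'" if "osub N'" "N \<subset> N'" for N'
	proof (rule ccontr)
		assume "~ A <= N'"
		hence "N':?S" using that N(2) by auto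
		thus False using max that(2) by auto
	qed
	thus thesis by(rule that[OF N])
qed

lemma maximal_osubI:
	assumes "osub N" "N ~= car M" "!!N'. osub N'==>N \<subset> N'==>N' = car M"
	shows "max_osub N"
	unfolding max_osub_def
proof (intro conjI allI impI assms(1,2))
	fix N' assume "osub N' & N <= N'"
	thus "N' = N | N' = car M" using assms(3)[of N'] by(cases "N' = N") auto
qed

lemma exists_maximal_osub:
	assumes "osub Z" "finite A" "A <= car M" "Z ~= car M"
		"!!N. osub N==>A <= N==>N = car M"
	shows "EX N. max_osub N & Z <= N"
proof -
	have "~ A <= Z" using assms by blast
	then obtain N where
		N: "osub N" "Z <= N" "~ A <= N" "!!N'. osub N'==>N \<subset> N'==>A <= N'"
		by(rule exists_osub_maximal_avoiding[OF assms(1,2)]) (rule that)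
	have "max_osub N"
	proof (rule maximal_osubI[OF N(1)])
		show "N ~= car M" using N(3) assms(3) by auto
		show "N' = car M" if "osub N'" "N \<subset> N'" for N' by(rule assms(5)[OF that(1) N(4)[OF that]])
	qed
	thus ?thesis using N(2) by blast
qed

text \<open>Going through the finitely many maximal subgroups \<open>L\<close>, cut \<open>C\<close> down to \<open>C \<inter> L\<close> whenever
	\<open>N + (C \<inter> L)\<close> is still everything.\<close>

lemma complemented_above_Inter:
	assumes "finite \<L>" "!!L. L:\<L>==>max_osub L"
	shows "complemented_above (car M Int \<Inter>\<L>)"
	unfolding complemented_above_def
proof (intro allI impI)
	fix N assume N: "osub N & car M Int \<Inter>\<L> <= N"
	have "EX C. osub C & N <+> C = car M & N Int C <= \<Inter>\<L> & car M Int \<Inter>\<L> <= C"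
		using assms
	proof (induction)
		case empty
		have "N <+> car M = car M"
			using sum_superset[of N "car M"] sum_le[OF osub_carrier, of N "car M"] N osubD(1) osub_carrier by blast
		thus ?case using osub_carrier by(intro exI[of _ "car M"]) auto
	next
		case (insert L \<L>)
		then obtain C where C: "osub C" "N <+> C = car M" "N Int C <= \<Inter>\<L>" "car M Int \<Inter>\<L> <= C" by auto
		have L: "osub L" "L ~= car M" "!!N'. osub N'==>L <= N'==>N' = L | N' = car M"
			using insert(4)[of L] by(auto simp: max_osub_def)
		have CL: "osub (C Int L)" by(rule osub_Int) fact+
		show ?case
		proof (cases "N <+> (C Int L) = car M")
			case True
			thus ?thesis using C CL by(intro exI[of _ "C Int L"]) auto
		next
			case False
			have "N Int C <= L"
			proof (rule ccontr)
				assume "~ N Int C <= L"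
				moreover have NC: "osub (N Int C)" using N C by(intro osub_Int) auto
				ultimately have *: "L <+> (N Int C) = car M"
					using L(3)[OF osub_sum[OF L(1) NC]] sum_superset[OF L(1) NC] by blast
				\<comment> \<open>Modular law: subtracting from \<open>c\<close> a summand taken in N \<inter> C
				  leaves an \<open>L\<close>-part that is again in \<open>C\<close>. So N + (C \<inter> L) would
				  contain \<open>C\<close> and be everything, against the case assumption.\<close>
				have "C <= N <+> (C Int L)"
				proof
					fix c assume c: "c:C"
					hence "c:L <+> (N Int C)" using * osubD(1)[OF C(1)] by blast
					then obtain l n where ln: "l:L" "n:N" "n:C" "c = l+.n" by(auto simp: mem_set_add)
					have car: "l:.M" "n:.M" using ln osubD(7)[OF L(1)] osubD(7)[OF C(1)] by auto
					hence "l = c -. n" by(simp add: ln a_minus_def a_assoc r_neg)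
					hence "l:C" using osubD(6)[OF C(1) c ln(3)] by simp
					thus "c:N <+> (C Int L)" using ln car a_comm unfolding mem_set_add by blast
				qed
				hence "N <+> C <= N <+> (C Int L)"
					using N CL by(intro sum_le osub_sum sum_superset) auto
				thus False using False C(2) osubD(1)[OF osub_sum[OF _ CL]] N by blast
			qed
			thus ?thesis using C by(intro exI[of _ C]) auto
		qed
	qed
	then obtain C where C: "osub C" "N <+> C = car M" "N Int C <= \<Inter>\<L>" "car M Int \<Inter>\<L> <= C" by auto
	hence "N Int C = car M Int \<Inter>\<L>" using N osubD(1)[OF C(1)] by blast
	thus "EX C. osub C & N Int C = car M Int \<Inter>\<L> & N <+> C = car M" using C by blast
qed

text \<open>In the semisimple quotient by \<open>Z\<close> the maximal submodules meet in 0. An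
  \<open>N\<close> chosen maximal without \<open>x\<close> is a maximal submodule: a complement
  \<open>C\<close> of a larger \<open>N'\<close> lies in \<open>N\<close>, since otherwise x = n + c
  with \<open>c\<close> in N' \<inter> C = Z, and then \<open>x\<close> would be in
  \<open>N\<close>.\<close>

lemma exists_maximal_above:
	assumes "complemented_above Z" "osub Z" "x:.M" "x ~: Z"
	shows "EX N. max_osub N & Z <= N & x ~: N"
proof -
	obtain N where N: "osub N" "Z <= N" "~ {x} <= N" "!!N'. osub N'==>N \<subset> N'==>{x} <= N'"
	proof (rule exists_osub_maximal_avoiding[of Z "{x}"])
		show "osub Z" "finite {x}" "~ {x} <= Z" using assms by auto
	qed (rule that)
	have "N' = car M" if N': "osub N'" "N \<subset> N'" for N'
	proof -
		obtain C where C: "osub C" "N' Int C = Z" "N' <+> C = car M"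
			using assms(1) N' N(2) unfolding complemented_above_def by(metis order.trans psubsetE)
		have "C <= N"
		proof (rule ccontr)
			assume "~ C <= N"
			hence "N \<subset> N <+> C" using sum_superset[OF N(1) C(1)] by blast
			hence "x:N <+> C" using N(4) osub_sum[OF N(1) C(1)] by blast
			then obtain n c where nc: "n:N" "c:C" "x = n+.c" by(auto simp: mem_set_add)
			hence "c = x -. n" using osubD(7)[OF N(1)] osubD(7)[OF C(1)]
				by(simp add: a_minus_def a_ac r_neg1 r_neg)
			moreover have "x:N'" using N(4) N' by blast
			ultimately have "c:N'" using osubD(6)[OF N'(1)] nc N' by blast
			hence "c:N" using C nc N(2) by blast
			thus False using nc osubD(3)[OF N(1)] N(3) by blast
		qed
		hence "N' <+> C <= N'" using N' by(intro sum_le) auto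
		thus ?thesis using C osubD(1)[OF N'(1)] by blast
	qed
	moreover have "N ~= car M" using N(3) assms(3) by auto
	ultimately have "max_osub N" by(intro maximal_osubI[OF N(1)])
	thus ?thesis using N(2,3) by blast
qed

end

text \<open>Maschke's theorem.  Both \<open>T\<close> and \<open>Ti\<close> are families indexed by a group, with \<open>Ti g\<close> the
	inverse of \<open>T g\<close>, and \<open>T\<close> is multiplicative up to operators in \<open>\<Omega>\<close>.  The complement is the kernel
	of the averaged projection onto \<open>N\<close> along \<open>C\<close>, described without choosing a projection.\<close>

locale maschke = op_group M \<Omega> + G: group G
	for M :: "('a, 'm) ring_scheme" (structure) and \<Omega> and G :: "('g, 'y) monoid_scheme" and T Ti :: "'g => 'a => 'a" and de +
	assumes fin: "finite (car G)"
		and T_closed: "g:.G==>x:.M==>T g x:.M"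
		and Ti_closed: "g:.G==>x:.M==>Ti g x:.M"
		and T_add: "g:.G==>x:.M==>y:.M==>T g (x+.y) = T g x+.T g y"
		and T_Ti: "g:.G==>x:.M==>T g (Ti g x) = x"
		and Ti_T: "g:.G==>x:.M==>Ti g (T g x) = x"
		and T_semilinear: "g:.G==>f:\<Omega>==>EX f':\<Omega>. ALL x:car M. T g (f x) = f' (T g x)"
		and T_mult: "g:.G==>h:.G ==>
			EX f:\<Omega>. ALL x:car M. T g (T h x) = f (T (g*.$G h) x)"
		and de_op: "de:\<Omega>"
		and de_eq: "x:.M==>(+/g:car G. de x) = x"
begin

lemma Ti_add:
	assumes "g:.G" "x:.M" "y:.M"
	shows "Ti g (x+.y) = Ti g x+.Ti g y"
proof -
	have "T g (Ti g x+.Ti g y) = x+.y" using assms by(simp add: T_add T_Ti Ti_closed)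
	thus ?thesis using Ti_T[of g "Ti g x+.Ti g y"] assms by(simp add: Ti_closed)
qed

lemma semilinear:
	assumes "g:.G" "f:\<Omega>"
	shows "EX f':\<Omega>. ALL x:car M. T g (f x) = f' (T g x) & Ti g (f' x) = f (Ti g x)"
proof -
	obtain f' where f': "f':\<Omega>" "!!x. x:.M==>T g (f x) = f' (T g x)"
		using T_semilinear[OF assms] by blast
	have "Ti g (f' x) = f (Ti g x)" if "x:.M" for x
		using f'(2)[of "Ti g x"] that assms by(metis T_Ti Ti_T Ti_closed op_closed)
	thus ?thesis using f' by blast
qed

lemma invariant_complement:
	assumes Z: "osub Z" "!!g x. g:.G==>x:Z==>T g x:Z & Ti g x:Z"
		and N: "osub N" "!!g x. g:.G==>x:N==>T g x:N & Ti g x:N"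
		and C: "osub C" "N Int C = Z" "N <+> C = car M"
	shows "EX C'. osub C' & (ALL g:car G. ALL x:C'. T g x:C') & N Int C' = Z & N <+> C' = car M"
proof -
	note ND = osubD[OF N(1)] and CD = osubD[OF C(1)] and ZD = osubD[OF Z(1)]
	\<comment> \<open>\<open>n g\<close> plays the part of the projection of \<open>T g m\<close> to
	  \<open>N\<close> along \<open>C\<close>. It is determined only modulo \<open>Z\<close>, so the
	  sum is asked to lie in \<open>Z\<close> instead of vanishing; leaving out the factor 1/|G| does
	  not change a kernel.\<close>
	define C' where "C' = {m:car M. EX n. (ALL g:car G. n g:N & T g m -. n g:C) &
		(+/g:car G. Ti g (n g)):Z}"
	have C'I: "m:C'" if "m:.M" "!!g. g:.G==>n g:N"
		"!!g. g:.G==>T g m -. n g:C" "(+/g:car G. Ti g (n g)):Z" for m n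
		using that unfolding C'_def by blast
	have C'E: "EX n. (ALL g:car G. n g:N & T g m -. n g:C) & (+/g:car G. Ti g (n g)):Z & m:.M"
		if "m:C'" for m
		using that unfolding C'_def by blast
	have sub: "C' <= car M" by(auto simp: C'_def)
	have Td: "T g (x -. y) = T g x -. T g y" "Ti g (x -. y) = Ti g x -. Ti g y"
		if g: "g:.G" and "x:.M" "y:.M" for g x y
		by(rule additive_minus; use that in "simp add: T_closed T_add Ti_closed Ti_add")+
	have od: "h (x -. y) = h x -. h y" if h: "h:\<Omega>" and "x:.M" "y:.M" for h x y
		by(rule additive_minus) (use that in "simp_all add: op_closed op_add")
	have T0: "T g 0. = 0." "Ti g 0. = 0." if "g:.G" for g
		by(rule additive_zero; use that in "simp add: T_closed T_add Ti_closed Ti_add")+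
	have um: "T g (-. x) = -. T g x" "Ti g (-. x) = -. Ti g x"
		if g: "g:.G" and x: "x:.M" for g x
		using Td[OF g zero_closed x] x g by(simp_all add: a_minus_def T0 T_closed Ti_closed)
	have lincomb: "h m:C'" if m: "m:C'" and h: "h:\<Omega>" for h m
	proof -
		obtain n where n: "!!g. g:.G==>n g:N" "!!g. g:.G==>T g m -. n g:C"
			"(+/g:car G. Ti g (n g)):Z" "m:.M" using C'E[OF m] by blast
		have "EX k. ALL g:car G. k g:\<Omega> & (ALL x:car M. T g (h x) = k g (T g x) & Ti g (k g x) = h (Ti g x))"
			using semilinear[OF _ h] unfolding Bex_def by(intro bchoice ballI)
		then obtain k where k: "!!g. g:.G==>k g:\<Omega>"
			"!!g x. g:.G==>x:.M==>T g (h x) = k g (T g x) & Ti g (k g x) = h (Ti g x)" by blast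
		have nc: "n g:.M" if "g:.G" for g using ND(7)[OF n(1)[OF that]] .
		show ?thesis
		proof (rule C'I)
			show "h m:.M" using h n op_closed by blast
			fix g assume g: "g:.G"
			show "k g (n g):N" using ND(5)[OF k(1)[OF g] n(1)[OF g]] .
			show "T g (h m) -. k g (n g):C"
				using g k(2)[OF g n(4)] od[OF k(1)[OF g] T_closed[OF g n(4)] nc[OF g]] CD(5)[OF k(1)[OF g] n(2)[OF g]]
				by simp
		next
			have "(+/g:car G. Ti g (k g (n g))) = (+/g:car G. h (Ti g (n g)))"
				by(rule finsum_cong') (use k nc h op_closed Ti_closed in auto)
			also have "... = h (+/g:car G. Ti g (n g))"
				by(rule additive_finsum[symmetric, OF op_closed[OF h] op_add[OF h] fin]) (use nc Ti_closed in auto)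
			finally show "(+/g:car G. Ti g (k g (n g))):Z" using ZD(5)[OF h n(3)] by simp
		qed
	qed
	have add: "a+.b:C'" if a: "a:C'" and b: "b:C'" for a b
	proof -
		obtain n where n: "!!g. g:.G==>n g:N" "!!g. g:.G==>T g a -. n g:C"
			"(+/g:car G. Ti g (n g)):Z" "a:.M" using C'E[OF a] by blast
		obtain n' where n': "!!g. g:.G==>n' g:N" "!!g. g:.G==>T g b -. n' g:C"
			"(+/g:car G. Ti g (n' g)):Z" "b:.M" using C'E[OF b] by blast
		have nc: "n g:.M" "n' g:.M" if "g:.G" for g using ND(7)[OF n(1)[OF that]] ND(7)[OF n'(1)[OF that]] .
		show ?thesis
		proof (rule C'I)
			fix g assume g: "g:.G"
			have "T g (a+.b) -. (n g+.n' g) = (T g a -. n g)+.(T g b -. n' g)"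
				using g n(4) n'(4) nc[OF g] by(simp add: T_add T_closed a_minus_def minus_add a_ac)
			thus "T g (a+.b) -. (n g+.n' g):C" using CD(3) n(2)[OF g] n'(2)[OF g] by simp
		next
			have "(+/g:car G. Ti g (n g+.n' g)) = (+/g:car G. Ti g (n g)+.Ti g (n' g))"
				by(rule finsum_cong') (use nc Ti_add Ti_closed in auto)
			also have "... = (+/g:car G. Ti g (n g))+.(+/g:car G. Ti g (n' g))"
				by(rule finsum_addf) (use nc Ti_closed in auto)
			finally show "(+/g:car G. Ti g (n g+.n' g)):Z" using ZD(3) n(3) n'(3) by simp
		qed (use n n' ND(3) in auto)
	qed
	have neg: "-. a:C'" if a: "a:C'" for a
	proof -
		obtain n where n: "!!g. g:.G==>n g:N" "!!g. g:.G==>T g a -. n g:C"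
			"(+/g:car G. Ti g (n g)):Z" "a:.M" using C'E[OF a] by blast
		have nc: "n g:.M" if "g:.G" for g using ND(7)[OF n(1)[OF that]] .
		show ?thesis
		proof (rule C'I)
			fix g assume g: "g:.G"
			have "T g (-. a) -. (-. n g) = -. (T g a -. n g)"
				using um(1)[OF g n(4)] nc[OF g] T_closed[OF g n(4)] by(simp add: a_minus_def minus_add)
			thus "T g (-. a) -. (-. n g):C" using CD(4) n(2)[OF g] by simp
		next
			have "(+/g:car G. Ti g (-. n g)) = (+/g:car G. -. Ti g (n g))"
				by(rule finsum_cong') (use nc um(2) Ti_closed in auto)
			also have "... = -. (+/g:car G. Ti g (n g))"
				by(rule additive_finsum[symmetric, OF _ _ fin]) (use nc Ti_closed in "auto simp: minus_add")
			finally show "(+/g:car G. Ti g (-. n g)):Z" using ZD(4) n(3) by simp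
		qed (use n ND(4) in auto)
	qed
	have Zsub: "Z <= C'"
	proof
		fix z assume z: "z:Z"
		have "(+/g:car G. Ti g 0.) = 0." using T0 by(intro add.finprod_one_eqI) auto
		moreover have "T g z -. 0.:C" if "g:.G" for g
		proof -
			have "T g z:C" using Z(2)[OF that z] C(2) by blast
			thus ?thesis using CD(6)[OF _ CD(2)] by blast
		qed
		ultimately show "z:C'" using C'I[of z "%_. 0.", OF ZD(7)[OF z] ND(2)] ZD(2) by simp
	qed
	have T_inv: "T h m:C'" if h: "h:.G" and m: "m:C'" for h m
	proof -
		obtain n where n: "!!g. g:.G==>n g:N" "!!g. g:.G==>T g m -. n g:C"
			"(+/g:car G. Ti g (n g)):Z" "m:.M" using C'E[OF m] by blast
		have nc: "n g:.M" if "g:.G" for g using ND(7)[OF n(1)[OF that]] .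
		\<comment> \<open>These operators absorb the cocycle. If \<open>n\<close> is a witness for
		  \<open>m\<close>, then at \<open>g\<close> the witness for \<open>T h m\<close> is
		  \<open>f g\<close> applied to \<open>n\<close> at the product of \<open>g\<close> and
		  \<open>h\<close>; the sum is then reindexed by right translation with \<open>h\<close>.\<close>
		have "EX f. ALL g:car G. f g:\<Omega> & (ALL x:car M. T g (T h x) = f g (T (g*.$G h) x))"
			using T_mult[OF _ h] unfolding Bex_def by(intro bchoice ballI)
		then obtain f where f: "!!g. g:.G==>f g:\<Omega>"
			"!!g x. g:.G==>x:.M==>T g (T h x) = f g (T (g*.$G h) x)" by blast
		show ?thesis
		proof (rule C'I)
			fix g assume g: "g:.G"
			have gh: "g*.$G h:.G" using g h by simp
			show "f g (n (g*.$G h)):N" using ND(5)[OF f(1)[OF g] n(1)[OF gh]] .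
			show "T g (T h m) -. f g (n (g*.$G h)):C"
				using f(2)[OF g n(4)] od[OF f(1)[OF g] T_closed[OF gh n(4)] nc[OF gh]] CD(5)[OF f(1)[OF g] n(2)[OF gh]]
				by simp
		next
			have "Ti g (f g (n (g*.$G h))) = T h (Ti (g*.$G h) (n (g*.$G h)))" if g: "g:.G" for g
			proof -
				have gh: "g*.$G h:.G" using g h by simp
				note c = Ti_closed[OF gh nc[OF gh]]
				show ?thesis using f(2)[OF g c] Ti_T[OF g T_closed[OF h c]] T_Ti[OF gh nc[OF gh]] by simp
			qed
			hence "(+/g:car G. Ti g (f g (n (g*.$G h)))) = (+/g:car G. T h (Ti (g*.$G h) (n (g*.$G h))))"
				by(intro finsum_cong') (use nc Ti_closed T_closed h in auto)
			also have "... = (+/k:(%g. g*.$G h) ` car G. T h (Ti k (n k)))"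
				by(rule add.finprod_reindex[symmetric]) (use nc Ti_closed T_closed h in "auto simp: inj_on_def")
			also have "(%g. g*.$G h) ` car G = car G"
			proof -
				have "k = (k*.$G inv$G h)*.$G h" if "k:.G" for k using h that by(simp add: G.m_assoc)
				thus ?thesis using h by(auto intro!: image_eqI)
			qed
			also have "(+/k:car G. T h (Ti k (n k))) = T h (+/k:car G. Ti k (n k))"
				by(rule additive_finsum[symmetric, OF T_closed[OF h] T_add[OF h] fin]) (use nc Ti_closed in auto)
			finally show "(+/g:car G. Ti g (f g (n (g*.$G h)))):Z" using Z(2)[OF h n(3)] by simp
		qed (use h n T_closed in auto)
	qed
	have C': "osub C'" by(rule osubI) (use sub add neg lincomb Zsub ZD(2) in auto)
	have "N Int C' <= Z"
	proof
		fix m assume "m:N Int C'"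
		hence m: "m:N" "m:C'" by auto
		obtain n where n: "!!g. g:.G==>n g:N" "!!g. g:.G==>T g m -. n g:C"
			"(+/g:car G. Ti g (n g)):Z" "m:.M" using C'E[OF m(2)] by blast
		have nc: "n g:.M" if "g:.G" for g using ND(7)[OF n(1)[OF that]] .
		have "m -. Ti g (n g):Z" if g: "g:.G" for g
		proof -
			have "T g m -. n g:Z" using ND(6)[OF conjunct1[OF N(2)[OF g m(1)]] n(1)[OF g]] n(2)[OF g] C(2) by blast
			hence "Ti g (T g m -. n g):Z" using Z(2)[OF g] by blast
			thus ?thesis using Td(2)[OF g T_closed[OF g n(4)] nc[OF g]] Ti_T[OF g n(4)] by simp
		qed
		\<comment> \<open>Adding the sum of all \<open>Ti g (n g)\<close>, which is in \<open>Z\<close>,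
		  leaves |G| m in \<open>Z\<close>; division by |G| is the operator \<open>de\<close>.\<close>
		hence "(+/g:car G. m -. Ti g (n g)):Z" by(rule osub_finsum[OF Z(1) fin])
		hence "(+/g:car G. m -. Ti g (n g))+.(+/g:car G. Ti g (n g)):Z"
			using n(3) ZD(3) by blast
		also have "(+/g:car G. m -. Ti g (n g))+.(+/g:car G. Ti g (n g)) =
				(+/g:car G. (m -. Ti g (n g))+.Ti g (n g))"
			by(rule finsum_addf[symmetric]) (use n(4) nc Ti_closed in auto)
		also have "... = (+/g:car G. m)"
			by(rule finsum_cong') (use n(4) nc Ti_closed in "auto simp: a_minus_def a_assoc l_neg")
		finally have "de (+/g:car G. m):Z" using ZD(5)[OF de_op] by blast
		also have "de (+/g:car G. m) = (+/g:car G. de m)"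
			by(rule additive_finsum[OF op_closed[OF de_op] op_add[OF de_op] fin]) (use n(4) in auto)
		finally show "m:Z" using de_eq n(4) by simp
	qed
	hence inter: "N Int C' = Z" using Zsub C by blast
	have "car M <= N <+> C'"
	proof
		fix m assume m: "m:.M"
		have "EX n:N. T g m -. n:C" if g: "g:.G" for g
		proof -
			have "T g m:N <+> C" using C(3) T_closed[OF g m] by simp
			then obtain n c where nc: "n:N" "c:C" "T g m = n+.c" by(auto simp: mem_set_add)
			hence "T g m -. n = c" using ND(7) CD(7) by(simp add: a_minus_def a_ac r_neg1 r_neg)
			hence "T g m -. n:C" using nc(2) by simp
			thus ?thesis using nc(1) by blast
		qed
		hence "EX n. ALL g:car G. n g:N & T g m -. n g:C"
			unfolding Bex_def by(intro bchoice ballI)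
		then obtain n where n': "ALL g:car G. n g:N & T g m -. n g:C" ..
		have n: "!!g. g:.G==>n g:N" "!!g. g:.G==>T g m -. n g:C"
			using n' by simp_all
		have nc: "n g:.M" if "g:.G" for g using ND(7)[OF n(1)[OF that]] .
		\<comment> \<open>|G| times the averaged projection of \<open>m\<close>, so that
		  \<open>de s\<close> is the component of \<open>m\<close> in \<open>N\<close>.\<close>
		define s where "s = (+/g:car G. Ti g (n g))"
		have s: "s:N" unfolding s_def by(rule osub_finsum[OF N(1) fin]) (use n N(2) in blast)
		hence sN: "de s:N" using ND(5)[OF de_op] by blast
		have sc: "de s:.M" "s:.M" using ND(7)[OF sN] ND(7)[OF s] .
		have "m -. de s:C'"
		proof (rule C'I)
			fix g assume g: "g:.G"
			show "n g -. T g (de s):N" using ND(6)[OF n(1)[OF g] conjunct1[OF N(2)[OF g sN]]] .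
			have "T g (m -. de s) -. (n g -. T g (de s)) = T g m -. n g"
				using g m sc nc[OF g] T_closed[OF g m] T_closed[OF g sc(1)]
				by(simp only: Td(1)[OF g m sc(1)] diff_diff)
			thus "T g (m -. de s) -. (n g -. T g (de s)):C" using n(2)[OF g] by simp
		next
			have "(+/g:car G. Ti g (n g -. T g (de s)))+.s =
					(+/g:car G. Ti g (n g -. T g (de s)))+.(+/g:car G. de s)"
				using de_eq sc by simp
			also have "... = (+/g:car G. Ti g (n g -. T g (de s))+.de s)"
				by(rule finsum_addf[symmetric]) (use nc Ti_closed T_closed sc in auto)
			also have "... = (+/g:car G. Ti g (n g))"
			proof (rule finsum_cong')
				fix g assume g: "g:.G"
				show "Ti g (n g -. T g (de s))+.de s = Ti g (n g)"
					using Td(2)[OF g nc[OF g] T_closed[OF g sc(1)]] Ti_T[OF g sc(1)] sc Ti_closed[OF g nc[OF g]]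
					by(simp add: a_minus_def a_assoc l_neg)
			qed (use nc Ti_closed in auto)
			finally have "(+/g:car G. Ti g (n g -. T g (de s)))+.s = s" by(simp add: s_def)
			moreover have "(+/g:car G. Ti g (n g -. T g (de s))):.M"
				by(rule finsum_closed) (use nc Ti_closed T_closed sc in auto)
			ultimately have "(+/g:car G. Ti g (n g -. T g (de s))) = 0."
				using sc(2) by(metis add.r_cancel_one')
			thus "(+/g:car G. Ti g (n g -. T g (de s))):Z" using ZD(2) by simp
		qed (use m sc in auto)
		moreover have "m = de s+.(m -. de s)" using m sc by(simp add: a_minus_def a_ac r_neg1 r_neg r_neg2)
		ultimately show "m:N <+> C'" unfolding mem_set_add by(intro bexI[OF _ sN] bexI[of _ "m -. de s"])
	qed
	hence "N <+> C' = car M" by(rule subset_antisym[OF osubD(1)[OF osub_sum[OF N(1) C']]])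
	thus ?thesis using C' T_inv inter by(intro exI[of _ C'] conjI ballI)
qed

end

section \<open>The Jacobson radical\<close>

lemma add_finsum:
	assumes "abelian_group M" "abelian_group N" "!!x. x:.M==>h x:.N"
		"!!x y. x:.M==>y:.M==>h (x+.$M y) = h x+.$N h y"
		"finite A" "!!a. a:A==>f a:.M"
	shows "h (+/$M a:A. f a) = (+/$N a:A. h (f a))"
proof -
	interpret M: abelian_group M by fact
	interpret N: abelian_group N by fact
	have zero: "h 0.$M = 0.$N"
		using assms(4)[of "0.$M" "0.$M"] assms(3)[of "0.$M"] by(metis M.r_zero M.zero_closed N.add.l_cancel_one')
	show ?thesis
		using assms(5,6)
	proof (induction)
		case (insert a A)
		hence "f:A \<rightarrow> car M" by auto
		moreover have "(%x. h (f x)):A \<rightarrow> car N" using insert assms(3) by auto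
		ultimately show ?case using insert assms(3,4) by simp
	qed (simp add: zero)
qed

lemma (in abelian_monoid) finsum_bij:
	assumes "bij_betw p A A" "!!a. a:A==>f a:.G"
	shows "(+/a:A. f (p a)) = (+/a:A. f a)"
proof -
	have "(+/a:p ` A. f a) = (+/a:A. f (p a))" by(rule finsum_reindex) (use assms in "auto simp: bij_betw_def")
	thus ?thesis using assms(1) by(simp add: bij_betw_def)
qed

lemma (in abelian_monoid) finsum_swap:
	assumes "finite A" "finite A'" "!!a b. a:A==>b:A'==>f a b:.G"
	shows "(+/a:A. +/b:A'. f a b) = (+/b:A'. +/a:A. f a b)"
	using assms(1,3)
proof (induction)
	case empty
	thus ?case by simp
next
	case (insert a A)
	hence "(+/a:insert a A. +/b:A'. f a b) = (+/b:A'. f a b)+.(+/b:A'. +/a:A. f a b)"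
		by(subst finsum_insert) (auto intro!: finsum_closed)
	also have "... = (+/b:A'. f a b+.(+/a:A. f a b))"
		by(rule finsum_addf[symmetric]) (use insert in "auto intro!: finsum_closed")
	also have "... = (+/b:A'. +/a:insert a A. f a b)"
		by(rule finsum_cong') (use insert in "auto intro!: finsum_closed")
	finally show ?case .
qed

lemma (in abelian_monoid) finsum_delta:
	assumes "finite A" "a:A" "f a:.G"
	shows "(+/b:A. if b = a then f b else 0.) = f a"
proof -
	have "(+/b:A. if b = a then f b else 0.) = (+/b:A. if a = b then f b else 0.)"
		by(rule finsum_cong') (use assms in auto)
	also have "... = f a"
		using finsum_singleton[OF assms(2,1), of f] assms
			finsum_cong'[of A A "%b. if a = b then f b else 0." "%b. if a = b then (if b = a then f b else 0.) else 0."]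
		finsum_singleton[OF assms(2,1), of "%b. if b = a then f b else 0."] by fastforce
	finally show ?thesis .
qed

lemma (in group) bij_mult: "h:.G==>bij_betw (%g. g*.h) (car G) (car G)"
	by(rule bij_betw_byWitness[where f' = "%g. g*.inv h"]) (auto simp: m_assoc)

lemma (in group) bij_mult_left: "h:.G==>bij_betw (%g. h*.g) (car G) (car G)"
	by(rule bij_betw_byWitness[where f' = "%g. inv h*.g"]) (auto simp: m_assoc[symmetric])

lemma (in group) bij_inv: "bij_betw (%g. inv g) (car G) (car G)"
	by(rule bij_betw_byWitness[where f' = "%g. inv g"]) auto

section \<open>Left modules and their maximal submodules\<close>

locale left_action = S: ring S + M: abelian_group M
	for S :: "('s, 'm) ring_scheme" (structure) and M :: "('a, 'n) ring_scheme" (structure) +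
	fixes l :: "'s => 'a => 'a"
	assumes l_closed: "s:.S==>x:.M==>l s x:.M"
		and l_add: "s:.S==>x:.M==>y:.M==>l s (x+.$M y) = l s x+.$M l s y"
		and add_l: "s:.S==>s':.S==>x:.M==>l (s+.$S s') x = l s x+.$M l s' x"
		and mult_l: "s:.S==>s':.S==>x:.M==>l (s*.$S s') x = l s (l s' x)"
		and one_l: "x:.M==>l 1.$S x = x"
begin

sublocale op_group M "l ` car S" by unfold_locales (auto simp: l_closed l_add)

lemma zero_l: "x:.M==>l 0.$S x = 0.$M"
	using add_l[of "0.$S" "0.$S" x] l_closed[of "0.$S" x] by(simp add: M.add.l_cancel_one')

lemma uminus_l: "s:.S==>x:.M==>l (-.$S s) x = -.$M l s x"
	using add_l[of "-.$S s" s x] zero_l[of x] l_closed by(simp add: S.l_neg M.minus_equality)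

lemma cyclic_osub: "x:.M==>osub ((%s. l s x) ` car S)"
proof (rule osubI)
	assume x: "x:.M"
	show "0.$M:(%s. l s x) ` car S" using zero_l[OF x] by(intro image_eqI[of _ _ "0.$S"]) auto
qed (auto simp: l_closed simp flip: add_l uminus_l mult_l)

lemma osub_l: "osub N==>s:.S==>x:N==>l s x:N" by(rule osubD(5)) auto

lemma maximal_generate:
	assumes N: "max_osub N" and x: "x:.M" "x ~: N" and y: "y:.M"
	shows "EX n:N. EX s:car S. y = n+.$M l s x"
proof -
	have N': "osub N" "!!N'. osub N'==>N <= N'==>N' = N | N' = car M"
		using N by(auto simp: max_osub_def)
	note C = cyclic_osub[OF x(1)]
	have "x:(%s. l s x) ` car S" using one_l[OF x(1)] by(intro image_eqI[of _ _ "1.$S"]) auto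
	hence "N <+>$M (%s. l s x) ` car S = car M"
		using N'(2)[OF osub_sum[OF N'(1) C]] sum_superset[OF N'(1) C] x(2) by blast
	thus ?thesis using y by(auto simp: mem_set_add)
qed

end

lemma (in ring) left_mult_action: "left_action R R (\<otimes>)"
	by unfold_locales (auto simp: r_distr l_distr m_assoc)

section \<open>Maximal left ideals and quasi-regularity\<close>

context ring
begin

interpretation L: left_action R R "(\<otimes>)" by(rule left_mult_action)

lemma left_ideal_iff: "left_ideal R N \<longleftrightarrow> L.osub N"
	by(auto simp: left_ideal_def L.osub_def)

lemma maximal_left_ideal_iff: "maximal_left_ideal R N \<longleftrightarrow> L.max_osub N"
	by(auto simp: maximal_left_ideal_def L.max_osub_def left_ideal_iff)

lemma proper_left_ideal_maximal:
	assumes "L.osub N" "1. ~: N"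
	shows "EX N'. L.max_osub N' & N <= N'"
proof (rule L.exists_maximal_osub[of _ "{1.}"])
	show "N' = car R" if N': "L.osub N'" "{1.} <= N'" for N'
	proof -
		have "x:N'" if "x:.R" for x
			using L.osub_l[OF N'(1) that, of \<one>] N'(2) that by simp
		thus ?thesis using L.osubD(1)[OF N'(1)] by blast
	qed
qed (use assms in auto)

lemma one_notin_maximal: "L.max_osub N==>1. ~: N"
proof
	assume N: "L.max_osub N" "1.:N"
	hence "L.osub N" by(simp add: L.max_osub_def)
	hence "x:N" if "x:.R" for x
		using L.osub_l[of N x \<one>] N(2) that by simp
	thus False using N L.osubD(1) by(auto simp: L.max_osub_def)
qed

lemma radD:
	assumes "x:rad R"
	shows "x:.R" "L.max_osub N==>x:N"
	using assms by(auto simp: jacobson_radical_def maximal_left_ideal_iff)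

lemma radI:
	assumes "x:.R" "!!N. L.max_osub N==>x:N"
	shows "x:rad R"
	using assms by(auto simp: jacobson_radical_def maximal_left_ideal_iff)

text \<open>If 1 - r x had no left inverse, it would lie in a maximal left ideal, which also
  contains r x and hence 1.\<close>

lemma jacobson_left_inverse:
	assumes x: "x:rad R" and r: "r:.R"
	shows "EX y:car R. y*.(1. -. r*.x) = 1."
proof (rule ccontr)
	assume no: "~ ?thesis"
	have xc: "x:.R" by(rule radD[OF x])
	let ?I = "(%s. s*.(1. -. r*.x)) ` car R"
	have c: "1. -. r*.x:.R" using xc r by simp
	have "1. ~: ?I" using no by fastforce
	then obtain N where N: "L.max_osub N" "?I <= N"
		using proper_left_ideal_maximal[OF L.cyclic_osub[OF c]] by blast
	have oN: "L.osub N" using N by(simp add: L.max_osub_def)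
	have "r*.x:N" by(rule L.osub_l[OF oN r radD(2)[OF x N(1)]])
	moreover have "1. -. r*.x:N" using N(2) c by(auto intro!: image_eqI[of _ _ \<one>])
	ultimately have "(1. -. r*.x)+.r*.x:N" by(intro L.osubD(3)[OF oN])
	hence "1.:N" using xc r by(simp add: a_minus_def a_assoc l_neg)
	thus False using one_notin_maximal[OF N(1)] by blast
qed

text \<open>A maximal left ideal that misses \<open>x\<close> contains an element 1 - r x, whose
  left inverse then brings 1 into the ideal.\<close>

lemma jacobson_radicalI_left_inverse:
	assumes x: "x:.R" and inv: "!!r. r:.R==>EX y:car R. y*.(1. -. r*.x) = 1."
	shows "x:rad R"
proof (rule radI[OF x], rule ccontr)
	fix N assume N: "L.max_osub N" "x ~: N"
	have oN: "L.osub N" using N by(simp add: L.max_osub_def)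
	obtain n r where nr: "n:N" "r:.R" "1. = n+.r*.x"
		using L.maximal_generate[OF N(1) x N(2) one_closed] by blast
	have nc: "n:.R" by(rule L.osubD(7)[OF oN nr(1)])
	obtain y where y: "y:.R" "y*.(1. -. r*.x) = 1." using inv nr by blast
	have "1. -. r*.x = n" using nr(2) nc x by(simp add: nr(3) a_minus_def a_assoc r_neg)
	hence "1.:N" using L.osub_l[OF oN y(1) nr(1)] y(2) by simp
	thus False using one_notin_maximal[OF N(1)] by blast
qed

lemma jacobson_osub: "L.osub (rad R)"
proof (rule L.osubI)
	note o = L.max_osub_def
	show "0.:rad R" by(rule radI) (auto simp: o L.osubD)
	fix x assume x: "x:rad R"
	show "-. x:rad R" by(rule radI) (use radD[OF x] L.osubD(4) in "auto simp: o")
	show "x+.y:rad R" if y: "y:rad R" for y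
		by(rule radI) (use radD[OF x] radD[OF y] L.osubD(3) in "auto simp: o")
	show "f x:rad R" if f: "f:(\<otimes>) ` car R" for f
		by(rule radI) (use radD[OF x] L.osubD(5)[OF _ f] f in "auto simp: o")
qed (auto dest: radD)

lemmas jacobson_closed = L.osubD(3)[OF jacobson_osub] L.osubD(2)[OF jacobson_osub] L.osub_l[OF jacobson_osub]

text \<open>The radical is defined through left ideals, so absorption on the right needs an
  argument: if x r is outside a maximal \<open>N\<close>, then r = n + s x r, and the left inverse
  of 1 - s x puts \<open>r\<close> into \<open>N\<close>, hence also x r.\<close>

lemma jacobson_right_mult:
	assumes x: "x:rad R" and r: "r:.R"
	shows "x*.r:rad R"
proof (rule radI)
	have xc: "x:.R" by(rule radD[OF x])
	show "x*.r:.R" using xc r by simp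
	fix N assume N: "L.max_osub N"
	hence oN: "L.osub N" by(simp add: L.max_osub_def)
	show "x*.r:N"
	proof (rule ccontr)
		assume nN: "x*.r ~: N"
		obtain n s where ns: "n:N" "s:.R" "r = n+.s*.(x*.r)"
			using L.maximal_generate[OF N _ nN r] xc r by auto
		have nc: "n:.R" by(rule L.osubD(7)[OF oN ns(1)])
		obtain y where y: "y:.R" "y*.(1. -. s*.x) = 1."
			using jacobson_left_inverse[OF x ns(2)] by blast
		have "(1. -. s*.x)*.r = r -. s*.(x*.r)" using xc r ns(2)
			by(simp add: a_minus_def l_distr l_minus m_assoc)
		also have "... = n" using xc r ns(2) nc by(subst ns(3)) (simp add: a_minus_def a_assoc r_neg)
		finally have e: "(1. -. s*.x)*.r = n" .
		have "y*.n = (y*.(1. -. s*.x))*.r"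
			unfolding e[symmetric] using y(1) xc r ns(2) by(intro m_assoc[symmetric]) auto
		hence "r = y*.n" using y r by simp
		hence "r:N" using L.osub_l[OF oN y(1) ns(1)] by simp
		thus False using L.osub_l[OF oN xc] nN by blast
	qed
qed

text \<open>The left inverse \<open>y\<close> satisfies y = 1 + y x, so it is again of the form 1 -
  r x and has a left inverse itself.\<close>

lemma jacobson_one_minus_unit:
	assumes x: "x:rad R"
	shows "1. -. x:Units R"
proof -
	have xc: "x:.R" by(rule radD[OF x])
	have c: "1. -. x:.R" using xc by simp
	obtain y where y: "y:.R" "y*.(1. -. x) = 1."
		using jacobson_left_inverse[OF x one_closed] xc by auto
	have "1. -. (-. y)*.x = y"
	proof -
		have "y -. y*.x = 1." using y xc by(simp add: a_minus_def r_distr r_minus)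
		hence "y = 1.+.y*.x" using y(1) xc by(metis add.inv_solve_right' m_closed minus_eq one_closed)
		thus ?thesis using y(1) xc by(simp add: a_minus_def l_minus)
	qed
	then obtain z where z: "z:.R" "z*.y = 1."
		using jacobson_left_inverse[OF x a_inv_closed[OF y(1)]] by auto
	have "z = z*.(y*.(1. -. x))" using z(1) y(2) by simp
	also have "... = 1. -. x" using z y(1) c by(simp flip: m_assoc)
	finally have "(1. -. x)*.y = 1." using z(2) by simp
	thus ?thesis using y c by(auto simp: Units_def)
qed

text \<open>Left inverses are carried along by \<open>h\<close>, and surjectivity supplies a
  preimage of the multiplier \<open>r\<close>.\<close>

lemma jacobson_radical_hom:
	assumes h: "h:ring_hom R R" and surj: "!!y. y:.R==>EX x:car R. h x = y"
		and x: "x:rad R"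
	shows "h x:rad R"
proof (rule jacobson_radicalI_left_inverse)
	have xc: "x:.R" by(rule radD[OF x])
	show "h x:.R" using h xc by(rule ring_hom_closed)
	interpret h: ring_hom_ring R R h by(rule ring_hom_ringI2[OF ring_axioms ring_axioms h])
	fix r assume "r:.R"
	then obtain s where s: "s:.R" "h s = r" using surj by blast
	obtain y where y: "y:.R" "y*.(1. -. s*.x) = 1."
		using jacobson_left_inverse[OF x s(1)] by blast
	have "h y*.(1. -. r*.h x) = h (y*.(1. -. s*.x))"
		using y(1) s xc by(simp add: a_minus_def)
	thus "EX y:car R. y*.(1. -. r*.h x) = 1." using y by auto
qed

end

text \<open>Nakayama's argument for a single vector: if s x is outside \<open>N\<close>, then x = n
  + r s x, and the left inverse of 1 - r s returns \<open>x\<close> to \<open>N\<close>.\<close>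

lemma (in left_action) jacobson_maximal_osub:
	assumes N: "max_osub N" and s: "s:rad S" and x: "x:.M"
	shows "l s x:N"
proof (rule ccontr)
	assume nN: "l s x ~: N"
	have oN: "osub N" using N by(simp add: max_osub_def)
	have sc: "s:.S" by(rule S.radD[OF s])
	obtain n r where nr: "n:N" "r:.S" "x = n+.$M l r (l s x)"
		using maximal_generate[OF N l_closed[OF sc x] nN x] by blast
	have nc: "n:.M" by(rule osubD(7)[OF oN nr(1)])
	obtain y where y: "y:.S" "y*.$S (1.$S -.$S r*.$S s) = 1.$S"
		using S.jacobson_left_inverse[OF s nr(2)] by blast
	have "l (1.$S -.$S r*.$S s) x = x+.$M -.$M l r (l s x)"
		using sc x nr(2) by(simp add: a_minus_def add_l uminus_l mult_l one_l)
	also have "... = n"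
		using nc l_closed[OF nr(2) l_closed[OF sc x]] by(subst nr(3)) (simp add: M.a_assoc M.r_neg)
	finally have "l y n = x"
		using mult_l[OF y(1) _ x, of "1.$S -.$S r*.$S s"] y(2) nr(2) sc one_l[OF x] by simp
	hence "x:N" using osub_l[OF oN y(1) nr(1)] by simp
	thus False using osub_l[OF oN sc] nN by blast
qed

section \<open>Free extensions with a basis indexed by a finite group\<close>

text \<open>\<open>B\<close> is a free left module over the image of \<open>j\<close> with basis \<open>v\<close>; \<open>P\<close> are the coordinates, and
	\<open>d\<close> is the inverse of the group order.\<close>

locale group_free_extension = S: ring S + B: ring B + G: group G
	for S :: "('s, 'm) ring_scheme" and B :: "('b, 'n) ring_scheme" and G :: "('g, 'y) monoid_scheme" +
	fixes j :: "'s => 'b" and v :: "'g => 'b" and P :: "'g => 'b => 's" and d :: 's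
	assumes fin: "finite (car G)"
		and j_hom: "j:ring_hom S B"
		and v_closed[simp]: "g:.G==>v g:.B"
		and P_closed[simp]: "g:.G==>x:.B==>P g x:.S"
		and P_add: "g:.G==>x:.B==>y:.B==>P g (x+.$B y) = P g x+.$S P g y"
		and expand: "x:.B==>x = (+/$B g:car G. j (P g x)*.$B v g)"
		and P_basis: "g:.G==>h:.G==>s:.S ==>
			P g (j s*.$B v h) = (if h = g then s else 0.$S)"
		and d_closed[simp]: "d:.S"
		and d_sum: "(+/$S g:car G. d) = 1.$S"
begin

sublocale j: ring_hom_ring S B j by(rule ring_hom_ringI2[OF S.ring_axioms B.ring_axioms j_hom])

lemma P_coeff:
	assumes "g:.G" "!!h. h:.G==>f h:.S"
	shows "P g (+/$B h:car G. j (f h)*.$B v h) = f g"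
proof -
	have "P g (+/$B h:car G. j (f h)*.$B v h) = (+/$S h:car G. P g (j (f h)*.$B v h))"
		by(rule add_finsum[OF B.abelian_group_axioms S.abelian_group_axioms _ P_add fin])
			(use assms in auto)
	also have "... = (+/$S h:car G. if h = g then f h else 0.$S)"
		by(rule S.finsum_cong') (use assms in "auto simp: P_basis")
	also have "... = f g" by(rule S.finsum_delta[OF fin]) (use assms in auto)
	finally show ?thesis .
qed

lemma coords_eqI:
	assumes "x:.B" "y:.B" "!!g. g:.G==>P g x = P g y"
	shows "x = y"
proof -
	have "(+/$B g:car G. j (P g x)*.$B v g) = (+/$B g:car G. j (P g y)*.$B v g)"
		by(rule B.finsum_cong') (use assms in auto)
	thus ?thesis using expand[OF assms(1)] expand[OF assms(2)] by simp
qed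

lemma j_mult_expand:
	assumes "s:.S" "x:.B"
	shows "j s*.$B x = (+/$B g:car G. j (s*.$S P g x)*.$B v g)"
proof -
	have "j s*.$B x = j s*.$B (+/$B g:car G. j (P g x)*.$B v g)" using expand[OF assms(2)] by simp
	also have "... = (+/$B g:car G. j s*.$B (j (P g x)*.$B v g))"
		by(rule B.finsum_rdistr[OF fin]) (use assms in auto)
	also have "... = (+/$B g:car G. j (s*.$S P g x)*.$B v g)"
		by(rule B.finsum_cong') (use assms in "auto simp: B.m_assoc")
	finally show ?thesis .
qed

lemma P_mult: "g:.G==>s:.S==>x:.B==>P g (j s*.$B x) = s*.$S P g x" by(simp add: j_mult_expand P_coeff)

lemma finsum_d:
	assumes "x:.B"
	shows "(+/$B g:car G. j d*.$B x) = x"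
proof -
	have "(+/$B g:car G. j d*.$B x) = (+/$B g:car G. j d)*.$B x"
		by(rule B.finsum_ldistr[symmetric, OF fin]) (use assms in auto)
	also have "(+/$B g:car G. j d) = j (+/$S g:car G. d)"
		by(rule add_finsum[symmetric, OF S.abelian_group_axioms B.abelian_group_axioms _ _ fin]) auto
	finally show ?thesis using assms by(simp add: d_sum)
qed

lemma jacobson_radical_coords:
	assumes "!!s. s:rad S==>j s:rad B"
		and x: "x:.B" "!!g. g:.G==>P g x:rad S"
	shows "x:rad B"
proof -
	interpret L: left_action B B "(\<otimes>\<^bsub>B\<^esub>)" by(rule B.left_mult_action)
	have "(+/$B g:car G. j (P g x)*.$B v g):rad B"
		by(rule L.osub_finsum[OF B.jacobson_osub fin]) (use assms B.jacobson_right_mult in auto)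
	thus ?thesis using expand[OF x(1)] by simp
qed

lemma left_action_j: "left_action S B (%s x. j s*.$B x)"
proof (intro left_action.intro left_action_axioms.intro S.ring_axioms B.abelian_group_axioms)
qed (simp_all add: B.r_distr B.l_distr B.m_assoc)

sublocale SB: left_action S B "%s x. j s*.$B x" by(rule left_action_j)

sublocale BB: left_action B B "%a x. a*.$B x" by(rule B.left_mult_action)

sublocale SS: left_action S S "%a x. a*.$S x" by(rule S.left_mult_action)

lemma BB_osub_SB:
	assumes "BB.osub N" shows "SB.osub N"
	unfolding SB.osub_def
proof (intro conjI ballI)
	show "additive_subgroup N B" using assms unfolding BB.osub_def by(rule conjunct1)
	fix f x assume "f:(%s x. j s*.$B x) ` car S" and x: "x:N"
	then obtain s where "s:.S" "f = (%x. j s*.$B x)" by(elim imageE)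
	thus "f x:N" using BB.osub_l[OF assms j.hom_closed x] by simp
qed

end

section \<open>Crossed products with a finite group\<close>

text \<open>Neither an automorphism property of \<open>al\<close> nor a cocycle identity for
  \<open>sg\<close> is postulated; what is used of them comes from associativity of \<open>B\<close>
  and from the fact that the \<open>u g\<close> can be cancelled.\<close>

locale group_crossed_product = group_free_extension S B G j u P d
	for S :: "('s, 'm) ring_scheme" and B :: "('b, 'n) ring_scheme" and G :: "('g, 'y) monoid_scheme"
		and j u P d +
	fixes al :: "'g => 's => 's" and sg :: "'g => 'g => 's"
	assumes al_closed[simp]: "g:.G==>s:.S==>al g s:.S"
		and u_j: "g:.G==>s:.S==>u g*.$B j s = j (al g s)*.$B u g"
		and sg_unit: "g:.G==>h:.G==>sg g h:Units S"
		and u_u: "g:.G==>h:.G==>u g*.$B u h = j (sg g h)*.$B u (g*.$G h)"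
		and u_one: "u 1.$G = 1.$B"
begin

interpretation SB: left_action S B "%s x. j s*.$B x" by(rule left_action_j)

interpretation BB: left_action B B "%a x. a*.$B x" by(rule B.left_mult_action)

interpretation SS: left_action S S "%a x. a*.$S x" by(rule S.left_mult_action)

lemma sg_closed[simp]: "g:.G==>h:.G==>sg g h:.S"
	using sg_unit by blast

lemma j_Units: "s:Units S==>j s:Units B"
proof -
	assume s: "s:Units S"
	hence "j (inv$S s)*.$B j s = 1.$B" "j s*.$B j (inv$S s) = 1.$B"
		using S.Units_closed[OF s] by(simp_all flip: j.hom_mult)
	thus ?thesis using s S.Units_closed[OF s] by(auto simp: Units_def[of B] intro!: bexI[of _ "j (inv$S s)"])
qed

lemma j_inj: "s:.S==>s':.S==>j s = j s'==>s = s'"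
	using P_basis[of "1.$G" "1.$G" s] P_basis[of "1.$G" "1.$G" s'] by(simp add: u_one)

text \<open>Multiplying \<open>u g\<close> with \<open>u\<close> at the inverse element gives a unit
  from \<open>S\<close> in either order, hence a right inverse and a left inverse, and these
  agree.\<close>

lemma u_unit:
	assumes g: "g:.G"
	shows "u g:Units B"
proof -
	let ?h = "inv$G g"
	have h: "?h:.G" using g by simp
	let ?r = "u ?h*.$B inv$B j (sg g ?h)" and ?l = "inv$B j (sg ?h g)*.$B u ?h"
	note U = j_Units[OF sg_unit[OF g h]] j_Units[OF sg_unit[OF h g]]
	have r: "?r:.B" "u g*.$B ?r = 1.$B"
		using u_u[OF g h] g h U by(simp_all add: u_one flip: B.m_assoc)
	have l: "?l:.B" "?l*.$B u g = 1.$B"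
		using u_u[OF h g] g h U by(simp_all add: u_one B.m_assoc)
	have "?l = ?l*.$B (u g*.$B ?r)" unfolding r(2) using l(1) by simp
	also have "... = ?l*.$B u g*.$B ?r" by(rule B.m_assoc[symmetric]) (use l r g in auto)
	also have "... = ?r" unfolding l(2) using r(1) by simp
	finally have "?r*.$B u g = 1.$B" using l(2) by simp
	thus ?thesis using r g unfolding Units_def by(auto intro: bexI[OF _ r(1)])
qed

lemma u_inv_closed[simp]: "g:.G==>inv$B u g:.B"
	using u_unit by simp

lemma u_cancel:
	assumes "g:.G" "x:.B"
	shows "u g*.$B (inv$B u g*.$B x) = x" "inv$B u g*.$B (u g*.$B x) = x"
		"x*.$B u g*.$B inv$B u g = x"
	using assms u_unit[OF assms(1)] by(simp_all flip: B.m_assoc) (simp add: B.m_assoc)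

lemma u_inv_eq:
	assumes g: "g:.G"
	shows "inv$B u g = j (inv$S sg (inv$G g) g)*.$B u (inv$G g)"
proof -
	let ?h = "inv$G g"
	have h: "?h:.G" using g by simp
	note U = sg_unit[OF h g]
	have "(j (inv$S sg ?h g)*.$B u ?h)*.$B u g = j (inv$S sg ?h g*.$S sg ?h g)"
		using g h U u_u[OF h g] S.Units_closed[OF U] by(simp add: B.m_assoc u_one del: S.Units_l_inv)
	also have "... = 1.$B" using U by simp
	finally have "(j (inv$S sg ?h g)*.$B u ?h)*.$B u g*.$B inv$B u g = inv$B u g" using g by simp
	thus ?thesis using u_cancel(3)[OF g, of "j (inv$S sg ?h g)*.$B u ?h"] U h by simp
qed

text \<open>Conjugation by the inverse of \<open>u g\<close>, written inside \<open>S\<close> by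
  means of \<open>u\<close> at the inverse group element; it inverts \<open>al g\<close>.\<close>

definition be :: "'g => 's => 's"
	where "be g s = inv$S sg (inv$G g) g*.$S al (inv$G g) s*.$S sg (inv$G g) g"

lemma be_closed[simp]: "g:.G==>s:.S==>be g s:.S"
	using sg_unit[of "inv$G g" g] by(simp add: be_def)

lemma j_u:
	assumes g: "g:.G" and s: "s:.S"
	shows "j s*.$B u g = u g*.$B j (be g s)"
proof -
	let ?h = "inv$G g"
	have h: "?h:.G" using g by simp
	note U = sg_unit[OF h g]
	have "inv$B u g*.$B (j s*.$B u g) = j (inv$S sg ?h g)*.$B (u ?h*.$B j s*.$B u g)"
		unfolding u_inv_eq[OF g] using U g h s by(simp add: B.m_assoc)
	also have "... = j (inv$S sg ?h g)*.$B (j (al ?h s)*.$B (u ?h*.$B u g))"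
		using u_j[OF h s] g h s by(simp add: B.m_assoc)
	also have "... = j (be g s)" using u_u[OF h g] g h s U by(simp add: be_def u_one B.m_assoc)
	finally have "u g*.$B j (be g s) = u g*.$B (inv$B u g*.$B (j s*.$B u g))" by simp
	thus ?thesis using g s u_cancel(1)[OF g, of "j s*.$B u g"] by simp
qed

lemma u_right_cancel:
	assumes "g:.G" "x:.B" "y:.B" "x*.$B u g = y*.$B u g"
	shows "x = y"
	using u_cancel(3)[OF assms(1,2)] u_cancel(3)[OF assms(1,3)] unfolding assms(4) by(rule trans[OF sym])

lemma u_left_cancel:
	assumes "g:.G" "x:.B" "y:.B" "u g*.$B x = u g*.$B y"
	shows "x = y"
	using u_cancel(2)[OF assms(1,2)] u_cancel(2)[OF assms(1,3)] unfolding assms(4) by(rule trans[OF sym])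

lemma j_u_inj:
	assumes "g:.G" "s:.S" "s':.S" "j s*.$B u g = j s'*.$B u g"
	shows "s = s'" by(rule j_inj[OF assms(2,3) u_right_cancel[OF assms(1) _ _ assms(4)]]) (use assms in auto)

lemma u_j_inj:
	assumes "g:.G" "s:.S" "s':.S" "u g*.$B j s = u g*.$B j s'"
	shows "s = s'" by(rule j_inj[OF assms(2,3) u_left_cancel[OF assms(1) _ _ assms(4)]]) (use assms in auto)

lemma al_be:
	assumes g: "g:.G" and s: "s:.S" shows "al g (be g s) = s"
	by(rule j_u_inj[OF g _ s]) (use j_u[OF g s] u_j[OF g be_closed[OF g s]] g s in auto)

lemma be_al:
	assumes g: "g:.G" and s: "s:.S" shows "be g (al g s) = s"
	by(rule u_j_inj[OF g _ s]) (use u_j[OF g s] j_u[OF g al_closed[OF g s]] g s in auto)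

text \<open>Both sides are compared after multiplication by \<open>u g\<close>, which can be
  cancelled; there associativity and distributivity of \<open>B\<close> do the work.\<close>

lemma al_hom:
	assumes g: "g:.G"
	shows "al g:ring_hom S S"
proof (rule ring_hom_memI)
	fix s t assume st: "s:.S" "t:.S"
	show "al g (s*.$S t) = al g s*.$S al g t"
	proof (rule j_u_inj[OF g])
		have "j (al g (s*.$S t))*.$B u g = u g*.$B j s*.$B j t"
			using g st u_j[OF g, of "s*.$S t"] by(simp add: B.m_assoc)
		also have "... = j (al g s)*.$B (u g*.$B j t)" using g st by(simp add: u_j B.m_assoc)
		also have "... = j (al g s*.$S al g t)*.$B u g" using g st by(simp add: u_j B.m_assoc)
		finally show "j (al g (s*.$S t))*.$B u g = ..." .
	qed (use g st in auto)
	show "al g (s+.$S t) = al g s+.$S al g t"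
	proof (rule j_u_inj[OF g])
		have "j (al g (s+.$S t))*.$B u g = u g*.$B j s+.$B u g*.$B j t"
			using g st u_j[OF g, of "s+.$S t"] by(simp add: B.r_distr)
		thus "j (al g (s+.$S t))*.$B u g = j (al g s+.$S al g t)*.$B u g"
			using g st by(simp add: u_j B.l_distr)
	qed (use g st in auto)
next
	show "al g 1.$S = 1.$S" by(rule j_u_inj[OF g]) (use u_j[OF g, of "1.$S"] g in auto)
qed (use g in auto)

lemma al_jacobson: "g:.G==>s:rad S==>al g s:rad S"
	by(rule S.jacobson_radical_hom[OF al_hom]) (use al_be in \<open>auto intro!: bexI[of _ "be g _"]\<close>)

lemma BB_osubI:
	assumes "SB.osub N" "!!g x. g:.G==>x:N==>u g*.$B x:N"
	shows "BB.osub N"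
proof (rule BB.osubI)
	note D = SB.osubD[OF assms(1)]
	fix f x assume f: "f:(\<otimes>\<^bsub>B\<^esub>) ` car B" and x: "x:N"
	then obtain b where b: "b:.B" "f = (\<otimes>\<^bsub>B\<^esub>) b" by auto
	have "b*.$B x = (+/$B g:car G. j (P g b)*.$B u g)*.$B x"
		using expand[OF b(1)] by simp
	also have "... = (+/$B g:car G. j (P g b)*.$B u g*.$B x)"
		by(rule B.finsum_ldistr[OF fin]) (use D(7)[OF x] b in auto)
	also have "...:N"
	proof (rule SB.osub_finsum[OF assms(1) fin])
		fix g assume g: "g:.G"
		have "j (P g b)*.$B (u g*.$B x):N"
			using SB.osub_l[OF assms(1) P_closed[OF g b(1)] assms(2)[OF g x]] .
		thus "j (P g b)*.$B u g*.$B x:N" using g b(1) D(7)[OF x] by(simp add: B.m_assoc)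
	qed
	finally show "f x:N" using b by simp
qed (use SB.osubD[OF assms(1)] in auto)

text \<open>A maximal left ideal \<open>L\<close> of \<open>B\<close> is the largest left ideal inside a maximal \<open>S\<close>-submodule
	containing it.\<close>

lemma j_jacobson:
	assumes s: "s:rad S"
	shows "j s:rad B"
proof (rule B.radI)
	have sc: "s:.S" by(rule S.radD[OF s])
	show "j s:.B" using sc by simp
	fix L assume L: "BB.max_osub L"
	hence oL: "BB.osub L" "L ~= car B" "!!L'. BB.osub L'==>L <= L'==>L' = L | L' = car B"
		by(auto simp: BB.max_osub_def)
	have gen: "N = car B" if N: "SB.osub N" "u ` car G <= N" for N
	proof -
		have "x:N" if x: "x:.B" for x
			by(subst expand[OF x], rule SB.osub_finsum[OF N(1) fin], rule SB.osub_l[OF N(1)]) (use N(2) x in auto)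
		thus ?thesis using SB.osubD(1)[OF N(1)] by blast
	qed
	have "EX N. SB.max_osub N & L <= N"
		by(rule SB.exists_maximal_osub[of L "u ` car G"]) (use BB_osub_SB[OF oL(1)] fin oL(2) gen in auto)
	then obtain N where N: "SB.max_osub N" "L <= N" by blast
	hence oN: "SB.osub N" "N ~= car B" by(auto simp: SB.max_osub_def)
	note D = SB.osubD[OF oN(1)]
	\<comment> \<open>The largest left ideal of \<open>B\<close> inside \<open>N\<close>. It is stable
	  under \<open>S\<close> because \<open>al\<close> moves scalars past \<open>u g\<close>, and under
	  \<open>u\<close> because a product of two \<open>u\<close> is a scalar times a third.\<close>
	define C where "C = {x:car B. ALL g:car G. u g*.$B x:N}"
	have "SB.osub C"
	proof (rule SB.osubI)
		fix f x assume f: "f:(%s x. j s*.$B x) ` car S" and x: "x:C"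
		then obtain t where t: "t:.S" "f = (%x. j t*.$B x)" by auto
		have xc: "x:.B" using x by(simp add: C_def)
		have "u g*.$B (j t*.$B x):N" if g: "g:.G" for g
		proof -
			have "u g*.$B (j t*.$B x) = j (al g t)*.$B (u g*.$B x)"
				using g t xc u_j[OF g t(1)] by(simp flip: B.m_assoc)
			thus ?thesis using SB.osub_l[OF oN(1) al_closed[OF g t(1)], of "u g*.$B x"] x g by(simp add: C_def)
		qed
		thus "f x:C" using t xc by(simp add: C_def)
	next
		fix x y assume xy: "x:C" "y:C"
		thus "x+.$B y:C" using D(3) by(auto simp: C_def B.r_distr)
	next
		fix x assume "x:C"
		thus "-.$B x:C" using D(4) by(auto simp: C_def B.r_minus)
	qed (use D(2) in "auto simp: C_def")
	hence oC: "BB.osub C"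
	proof (rule BB_osubI)
		fix g x assume g: "g:.G" and x: "x:C"
		have xc: "x:.B" using x by(simp add: C_def)
		have "u h*.$B (u g*.$B x):N" if h: "h:.G" for h
		proof -
			have "u h*.$B (u g*.$B x) = j (sg h g)*.$B (u (h*.$G g)*.$B x)"
				using g h xc u_u[OF h g] by(simp flip: B.m_assoc)
			thus ?thesis
				using SB.osub_l[OF oN(1) sg_closed[OF h g], of "u (h*.$G g)*.$B x"] x g h by(simp add: C_def)
		qed
		thus "u g*.$B x:C" using g xc by(simp add: C_def)
	qed
	have "L <= C"
		using BB.osub_l[OF oL(1)] BB.osubD(7)[OF oL(1)] N(2) by(auto simp: C_def)
	moreover have "C ~= car B"
	proof
		assume "C = car B"
		hence "u g*.$B 1.$B:N" if "g:.G" for g using that unfolding C_def by blast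
		hence "u ` car G <= N" by auto
		thus False using gen oN by blast
	qed
	ultimately have "C = L" using oL(3)[OF oC] by blast
	moreover have "j s:C"
	proof -
		have "u g*.$B j s:N" if g: "g:.G" for g
			using SB.jacobson_maximal_osub[OF N(1) al_jacobson[OF g s] v_closed[OF g]] u_j[OF g sc] by simp
		thus ?thesis using sc by(simp add: C_def)
	qed
	ultimately show "j s:L" by simp
qed

text \<open>Coordinates with the scalars on the right: \<open>x\<close> is the sum of all u g j (Q g
  x). On the coordinates \<open>P\<close>, left multiplication by \<open>u h\<close> multiplies by
  values of \<open>sg\<close> from the right; on \<open>Q\<close> it multiplies from the left, which
  preserves membership in a left ideal of \<open>S\<close>.\<close>

definition Q :: "'g => 'b => 's"
	where "Q g x = be g (P g x)"

lemma Q_closed[simp]: "g:.G==>x:.B==>Q g x:.S" by(simp add: Q_def)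

lemma be_hom:
	assumes g: "g:.G"
	shows "be g:ring_hom S S"
proof -
	interpret a: ring_hom_ring S S "al g" by(rule ring_hom_ringI2[OF S.ring_axioms S.ring_axioms al_hom[OF g]])
	have inj: "x = y" if "x:.S" "y:.S" "al g x = al g y" for x y
		using be_al[OF g that(1)] be_al[OF g that(2)] unfolding that(3) by(rule trans[OF sym])
	show ?thesis
	proof (rule ring_hom_memI)
		show "be g (x*.$S y) = be g x*.$S be g y" "be g (x+.$S y) = be g x+.$S be g y"
			if "x:.S" "y:.S" for x y by(rule inj; use g that in "simp add: al_be")+
		show "be g 1.$S = 1.$S" by(rule inj) (use g in "simp_all add: al_be")
	qed (use g in simp)
qed

lemma Q_add: "g:.G==>x:.B==>y:.B==>Q g (x+.$B y) = Q g x+.$S Q g y"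
	using ring_hom_add[OF be_hom] by(simp add: Q_def P_add)

lemma Q_j_mult: "g:.G==>s:.S==>x:.B==>Q g (j s*.$B x) = be g s*.$S Q g x"
	using ring_hom_mult[OF be_hom] by(simp add: Q_def P_mult)

lemma Q_u_mult:
	assumes g: "g:.G" and h: "h:.G" and x: "x:.B"
	shows "Q (h*.$G g) (u h*.$B x) = be (h*.$G g) (sg h g)*.$S Q g x"
proof -
	have "u h*.$B x = u h*.$B (+/$B k:car G. j (P k x)*.$B u k)" using expand[OF x] by simp
	also have "... = (+/$B k:car G. u h*.$B (j (P k x)*.$B u k))"
		by(rule B.finsum_rdistr[OF fin]) (use h x in auto)
	also have "... = (+/$B k:car G. j (al h (P k x)*.$S sg h k)*.$B u (h*.$G k))"
	proof (rule B.finsum_cong')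
		fix k assume k: "k:.G"
		show "u h*.$B (j (P k x)*.$B u k) = j (al h (P k x)*.$S sg h k)*.$B u (h*.$G k)"
			using h k x u_j[OF h, of "P k x"] u_u[OF h k] by(simp add: B.m_assoc flip: B.m_assoc[of "u h"])
	qed (use h x in auto)
	also have "... = (+/$B k:car G. j (al h (P (inv$G h*.$G (h*.$G k)) x)*.$S sg h (inv$G h*.$G (h*.$G k)))*.$B u (h*.$G k))"
		by(rule B.finsum_cong') (use h x in "auto simp: G.m_assoc[symmetric]")
	also have "... = (+/$B k:car G. j (al h (P (inv$G h*.$G k) x)*.$S sg h (inv$G h*.$G k))*.$B u k)"
		by(rule B.finsum_bij[OF G.bij_mult_left[OF h], of "%k. j (al h (P (inv$G h*.$G k) x)*.$S sg h (inv$G h*.$G k))*.$B u k"])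
			(use h x in auto)
	finally have "P (h*.$G g) (u h*.$B x) = al h (P g x)*.$S sg h g"
		using P_coeff[of "h*.$G g" "%k. al h (P (inv$G h*.$G k) x)*.$S sg h (inv$G h*.$G k)"] g h x
		by(simp add: G.m_assoc[symmetric])
	moreover have "be (h*.$G g) (al h (P g x)*.$S sg h g) = be (h*.$G g) (sg h g)*.$S Q g x"
	proof (rule u_j_inj[of "h*.$G g"])
		let ?p = "P g x"
		have p: "?p:.S" and hg: "h*.$G g:.G" using g h x by auto
		have "u (h*.$G g)*.$B j (be (h*.$G g) (al h ?p*.$S sg h g)) = j (al h ?p)*.$B (j (sg h g)*.$B u (h*.$G g))"
			using g h p by(simp add: j_u[symmetric] B.m_assoc)
		also have "... = u h*.$B j ?p*.$B u g" using g h p by(simp add: u_u[symmetric] u_j B.m_assoc)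
		also have "... = u h*.$B u g*.$B j (Q g x)" using g h p x by(simp add: j_u B.m_assoc Q_def)
		also have "... = u (h*.$G g)*.$B j (be (h*.$G g) (sg h g))*.$B j (Q g x)" using g h by(simp add: u_u j_u)
		finally show "u (h*.$G g)*.$B j (be (h*.$G g) (al h ?p*.$S sg h g)) =
				u (h*.$G g)*.$B j (be (h*.$G g) (sg h g)*.$S Q g x)"
			using g h x by(simp add: B.m_assoc)
	qed (use g h x in auto)
	ultimately show ?thesis by(simp add: Q_def)
qed

end

context group_crossed_product
begin

text \<open>\<open>Q g\<close> is surjective and semilinear for the automorphism
  \<open>be g\<close>, so preimages of maximal submodules are maximal.\<close>

lemma Q_maximal:
	assumes L: "SS.max_osub L" and g: "g:.G"
	shows "SB.max_osub {x:car B. Q g x:L}"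
proof -
	have oL: "SS.osub L" using L by(simp add: SS.max_osub_def)
	note D = SS.osubD[OF oL]
	interpret b: ring_hom_ring S S "be g" by(rule ring_hom_ringI2[OF S.ring_axioms S.ring_axioms be_hom[OF g]])
	have Q0: "Q g 0.$B = 0.$S"
		using Q_j_mult[OF g S.zero_closed B.zero_closed] g by simp
	have Qm: "Q g (-.$B x) = -.$S Q g x" if x: "x:.B" for x
	proof -
		have "Q g (-.$B x)+.$S Q g x = 0.$S"
			using Q_add[OF g B.a_inv_closed[OF x] x] x by(simp add: B.l_neg Q0)
		thus ?thesis using g x S.minus_equality by auto
	qed
	show ?thesis
	proof (rule SB.maximal_osubI)
		show "SB.osub {x:car B. Q g x:L}"
		proof (rule SB.osubI)
			fix f x assume f: "f:(%s x. j s*.$B x) ` car S" and x: "x:{x:car B. Q g x:L}"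
			then obtain t where t: "t:.S" "f = (%x. j t*.$B x)" by auto
			have "Q g (f x):L"
				using x t SS.osub_l[OF oL be_closed[OF g t(1)], of "Q g x"] by(simp add: Q_j_mult[OF g])
			thus "f x:{x:car B. Q g x:L}" using x t by simp
		qed (use D(2,3,4) in "auto simp: Q0 Qm Q_add[OF g]")
		have "L ~= car S" using L by(simp add: SS.max_osub_def)
		then obtain s where s: "s:.S" "s ~: L" using D(1) by blast
		have "Q g (j (al g s)*.$B u g) = s"
			using g s P_basis[OF g g, of "al g s"] by(simp add: Q_def be_al)
		hence "j (al g s)*.$B u g ~: {x:car B. Q g x:L}" using s(2) by simp
		moreover have "j (al g s)*.$B u g:.B" using g s(1) by simp
		ultimately show "{x:car B. Q g x:L} ~= car B" by(rule_tac notI) (erule notE, erule ssubst)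
		fix N assume N: "SB.osub N" "{x:car B. Q g x:L} \<subset> N"
		note ND = SB.osubD[OF N(1)]
		obtain y where y: "y:N" "Q g y ~: L" using N(2) ND(7) by blast
		have yc: "y:.B" by(rule ND(7)[OF y(1)])
		have "x:N" if x: "x:.B" for x
		proof -
			obtain l r where lr: "l:L" "r:.S" "Q g x = l+.$S r*.$S Q g y"
				using SS.maximal_generate[OF L Q_closed[OF g yc] y(2) Q_closed[OF g x]] by blast
			let ?a = "j (al g r)*.$B y"
			have ac: "?a:.B" using yc g lr by simp
			have aN: "?a:N" by(rule SB.osub_l[OF N(1) al_closed[OF g lr(2)] y(1)])
			have Qa: "Q g ?a = r*.$S Q g y" using g lr(2) yc by(simp add: Q_j_mult be_al)
			have "Q g (x+.$B -.$B ?a) = l+.$S r*.$S Q g y+.$S -.$S (r*.$S Q g y)"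
				using Q_add[OF g x B.a_inv_closed[OF ac]] Qm[OF ac] Qa lr(3) by simp
			also have "... = l" using D(7)[OF lr(1)] lr(2) g yc by(simp add: S.a_assoc S.r_neg)
			finally have "Q g (x+.$B -.$B ?a):L" using lr(1) by simp
			hence "x+.$B -.$B ?a:{x:car B. Q g x:L}" using x ac by simp
			hence "x+.$B -.$B ?a:N" by(rule subsetD[OF psubset_imp_subset[OF N(2)]])
			hence "(x+.$B -.$B ?a)+.$B ?a:N" by(rule ND(3)[OF _ aN])
			thus ?thesis using x ac by(simp add: B.a_assoc B.l_neg)
		qed
		thus "N = car B" using ND(1) by blast
	qed
qed

text \<open>Moving \<open>u g\<close> past an operator from \<open>S\<close> twists it by
  \<open>al g\<close>, and two such multiplications compose up to a value of \<open>sg\<close>,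
  which is again an operator. The left ideals of \<open>B\<close> are the submodules over
  \<open>S\<close> that all \<open>u g\<close> preserve.\<close>

lemma maschke_j: "maschke B ((%s x. j s*.$B x) ` car S) G (%g x. u g*.$B x) (%g x. inv$B u g*.$B x) (%x. j d*.$B x)"
proof (intro maschke.intro maschke_axioms.intro SB.op_group_axioms G.group_axioms fin)
	fix g f assume g: "g:.G" and f: "f:(%s x. j s*.$B x) ` car S"
	then obtain t where t: "t:.S" "f = (%x. j t*.$B x)" by auto
	have "u g*.$B f x = j (al g t)*.$B (u g*.$B x)" if x: "x:.B" for x
		using g t x u_j[OF g t(1)] by(simp flip: B.m_assoc)
	thus "EX f':(%s x. j s*.$B x) ` car S. ALL x:car B. u g*.$B f x = f' (u g*.$B x)"
		using al_closed[OF g t(1)] by(intro bexI[of _ "%x. j (al g t)*.$B x"]) auto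
next
	fix g h assume g: "g:.G" and h: "h:.G"
	have "u g*.$B (u h*.$B x) = j (sg g h)*.$B (u (g*.$G h)*.$B x)" if x: "x:.B" for x
		using g h x u_u[OF g h] by(simp flip: B.m_assoc)
	thus "EX f:(%s x. j s*.$B x) ` car S. ALL x:car B. u g*.$B (u h*.$B x) = f (u (g*.$G h)*.$B x)"
		using sg_closed[OF g h] by(intro bexI[of _ "%x. j (sg g h)*.$B x"]) auto
qed (simp_all add: B.r_distr u_cancel finsum_d)

text \<open>For a maximal left ideal \<open>L\<close> of \<open>S\<close>, the elements with all
  \<open>Q g x\<close> in \<open>L\<close> form a left ideal \<open>Z\<close> of \<open>B\<close>.
  As a finite intersection of maximal submodules over \<open>S\<close> it has complements over
  \<open>S\<close>; Maschke makes them complements over \<open>B\<close>, so every element outside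
  \<open>Z\<close> is missed by some maximal left ideal of \<open>B\<close>.\<close>

lemma P_jacobson:
	assumes x: "x:rad B" and g: "g:.G"
	shows "P g x:rad S"
proof -
	have xc: "x:.B" by(rule B.radD[OF x])
	have "Q g x:L" if L: "SS.max_osub L" for L
	proof (rule ccontr)
		assume nL: "Q g x ~: L"
		have oL: "SS.osub L" using L by(simp add: SS.max_osub_def)
		define MM where "MM = (%g. {x:car B. Q g x:L}) ` car G"
		define Z where "Z = car B Int \<Inter>MM"
		have Zmem: "z:Z \<longleftrightarrow> z:.B & (ALL g:car G. Q g z:L)" for z by(auto simp: Z_def MM_def)
		have MM: "SB.max_osub N" if "N:MM" for N using that Q_maximal[OF L] by(auto simp: MM_def)
		have compl: "SB.complemented_above Z"
			unfolding Z_def by(rule SB.complemented_above_Inter[OF _ MM]) (simp_all add: MM_def fin)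
		have uZ: "u h*.$B z:Z" if h: "h:.G" and z: "z:Z" for h z
		proof -
			have zc: "z:.B" using z by(simp add: Zmem)
			have "Q k (u h*.$B z):L" if k: "k:.G" for k
			proof -
				let ?g = "inv$G h*.$G k"
				have k': "h*.$G ?g = k" using h k by(simp add: G.m_assoc[symmetric])
				have gg: "?g:.G" using h k by simp
				have "be k (sg h ?g)*.$S Q ?g z:L" by(rule SS.osub_l[OF oL]) (use z gg h k in "auto simp: Zmem")
				thus ?thesis using Q_u_mult[OF gg h zc] unfolding k' by simp
			qed
			thus ?thesis using h zc by(simp add: Zmem)
		qed
		have oZ: "SB.osub Z"
		proof (rule SB.osubI)
			fix a b assume "a:Z" "b:Z"
			thus "a+.$B b:Z" using SS.osubD(3)[OF oL] by(simp add: Zmem Q_add)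
		next
			fix f a assume f: "f:(%s x. j s*.$B x) ` car S" and a: "a:Z"
			then obtain t where t: "t:.S" "f = (%x. j t*.$B x)" by auto
			show "f a:Z" using SS.osub_l[OF oL] t a by(simp add: Zmem Q_j_mult)
		next
			have o: "SB.osub {x:car B. Q h x:L}" if "h:.G" for h
				using Q_maximal[OF L that] by(simp add: SB.max_osub_def)
			show "0.$B:Z" using SB.osubD(2)[OF o] by(simp add: Zmem)
			show "-.$B a:Z" if "a:Z" for a using SB.osubD(4)[OF o, of _ a] that by(simp add: Zmem)
		qed (auto simp: Zmem)
		have oBZ: "BB.osub Z" by(rule BB_osubI[OF oZ uZ])
		interpret MA: maschke B "(%s x. j s*.$B x) ` car S" G "%g x. u g*.$B x" "%g x. inv$B u g*.$B x" "%x. j d*.$B x"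
			by(rule maschke_j)
		have "BB.complemented_above Z"
			unfolding BB.complemented_above_def
		proof (intro allI impI, elim conjE)
			fix N assume N: "BB.osub N" "Z <= N"
			have sN: "SB.osub N" by(rule BB_osub_SB[OF N(1)])
			obtain C where C: "SB.osub C" "N Int C = Z" "N <+>$B C = car B"
				using compl sN N(2) unfolding SB.complemented_above_def by blast
			have st: "u h*.$B a:N' & inv$B u h*.$B a:N'" if "BB.osub N'" "h:.G" "a:N'" for N' h a
				using BB.osub_l[OF that(1) v_closed[OF that(2)] that(3)] BB.osub_l[OF that(1) u_inv_closed[OF that(2)] that(3)] ..
			obtain C' where C': "SB.osub C'" "ALL g:car G. ALL x:C'. u g*.$B x:C'" "N Int C' = Z" "N <+>$B C' = car B"
				using MA.invariant_complement[OF oZ st[OF oBZ] sN st[OF N(1)] C] by blast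
			have "BB.osub C'" by(rule BB_osubI[OF C'(1)]) (use C'(2) in simp)
			thus "EX C. BB.osub C & N Int C = Z & N <+>$B C = car B" using C' by blast
		qed
		moreover have "x ~: Z" using nL g by(auto simp: Zmem)
		ultimately obtain N where N: "BB.max_osub N" "x ~: N"
			using BB.exists_maximal_above[OF _ oBZ xc] by blast
		thus False using B.radD(2)[OF x N(1)] by blast
	qed
	hence "Q g x:rad S" by(rule S.radI[OF Q_closed[OF g xc]])
	hence "al g (Q g x):rad S" by(rule al_jacobson[OF g])
	thus ?thesis using g xc by(simp add: Q_def al_be)
qed

theorem jacobson_radical_iff:
	"x:rad B \<longleftrightarrow> x:.B & (ALL g:car G. P g x:rad S)"
	using P_jacobson jacobson_radical_coords[OF j_jacobson] B.radD(1) by blast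

end

section \<open>Extensions by the dual of a finite group algebra\<close>

text \<open>The situation dual to a crossed product: \<open>G\<close> acts on \<open>B\<close> by automorphisms permuting the basis
	\<open>v\<close>, with fixed ring \<open>j S\<close>.\<close>

locale cleft_group_extension = group_free_extension S B G j v P d
	for S :: "('s, 'm) ring_scheme" and B :: "('b, 'n) ring_scheme" and G :: "('g, 'y) monoid_scheme"
		and j v P d +
	fixes A :: "'g => 's => 's" and sg ta :: "'g => 'g => 's"
	assumes A_closed[simp]: "g:.G==>s:.S==>A g s:.S"
		and sg_closed[simp]: "g:.G==>h:.G==>sg g h:.S"
		and ta_closed[simp]: "g:.G==>h:.G==>ta g h:.S"
		and v_j: "g:.G==>s:.S ==>
			v g*.$B j s = (+/$B a:car G. j (A a s)*.$B v (inv$G a*.$G g))"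
		and v_v: "g:.G==>h:.G ==>
			v g*.$B v h = (+/$B k:car G. j (sg (g*.$G inv$G k) (h*.$G inv$G k))*.$B v k)"
		and ta_sg: "g:.G==>h:.G ==>
			(+/$S a:car G. +/$S c:car G. ta a c*.$S sg (inv$G a*.$G g) (inv$G c*.$G h)) =
				(if g = 1.$G & h = 1.$G then 1.$S else 0.$S)"
		and one_v: "1.$B = (+/$B g:car G. v g)"
begin

definition th :: "'g => 'b => 'b"
	where "th k x = (+/$B g:car G. j (P (g*.$G k) x)*.$B v g)"

lemma th_closed[simp]: "k:.G==>x:.B==>th k x:.B"
	unfolding th_def by(rule B.finsum_closed) auto

lemma P_th: "g:.G==>k:.G==>x:.B==>P g (th k x) = P (g*.$G k) x"
	unfolding th_def by(rule P_coeff) auto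

lemma th_add: "k:.G==>x:.B==>y:.B==>th k (x+.$B y) = th k x+.$B th k y"
	by(rule coords_eqI) (auto simp: P_th P_add)

lemma th_th: "k:.G==>l:.G==>x:.B==>th k (th l x) = th (k*.$G l) x"
	by(rule coords_eqI) (auto simp: P_th G.m_assoc)

lemma th_one: "x:.B==>th 1.$G x = x" by(rule coords_eqI) (auto simp: P_th)

lemma th_j_mult: "k:.G==>s:.S==>x:.B==>th k (j s*.$B x) = j s*.$B th k x"
	by(rule coords_eqI) (auto simp: P_th P_mult)

lemma P_v: "g:.G==>h:.G==>P g (v h) = (if h = g then 1.$S else 0.$S)"
	using P_basis[of g h "1.$S"] by simp

lemma th_v:
	assumes k: "k:.G" and h: "h:.G"
	shows "th k (v h) = v (h*.$G inv$G k)"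
proof (rule coords_eqI)
	fix g assume g: "g:.G"
	have "h = g*.$G k \<longleftrightarrow> h*.$G inv$G k = g"
		using g h k by(metis G.inv_solve_right')
	thus "P g (th k (v h)) = P g (v (h*.$G inv$G k))"
		using g h k by(simp add: P_th P_v)
qed (use k h in auto)

lemma th_finsum:
	"k:.G==>finite C==>(!!a. a:C==>f a:.B)==>th k (+/$B a:C. f a) = (+/$B a:C. th k (f a))"
	by(rule B.additive_finsum) (auto simp: th_add)

text \<open>The coefficient of \<open>v k\<close> in v g v h depends only on g k^-1 and h k^-1, so
  translating all indices on the right changes nothing.\<close>

lemma th_v_v:
	assumes k: "k:.G" and g: "g:.G" and h: "h:.G"
	shows "th k (v g*.$B v h) = th k (v g)*.$B th k (v h)"
proof (rule coords_eqI)
	let ?s = "%g h l. sg (g*.$G inv$G l) (h*.$G inv$G l)"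
	have Pvv: "P a (v g*.$B v h) = ?s g h a" if "a:.G" "g:.G" "h:.G" for a g h
		using that by(simp add: v_v P_coeff)
	fix a assume a: "a:.G"
	have e: "g*.$G inv$G (a*.$G k) = g*.$G inv$G k*.$G inv$G a" if "g:.G" for g
		using that a k by(simp add: G.inv_mult_group G.m_assoc)
	show "P a (th k (v g*.$B v h)) = P a (th k (v g)*.$B th k (v h))"
		using a k g h by(simp add: P_th th_v Pvv e)
qed (use k g h in auto)

text \<open>Commuting \<open>v g\<close> past a scalar, as in \<open>v_j\<close>, multiplies the
  index on the left, while \<open>th\<close> translates it on the right; the two do not
  interfere.\<close>

lemma th_v_j_v:
	assumes k: "k:.G" and g: "g:.G" and h: "h:.G" and s: "s:.S"
	shows "th k (v g*.$B (j s*.$B v h)) = th k (v g)*.$B (j s*.$B th k (v h))"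
proof -
	have vjv: "v g*.$B (j s*.$B x) = (+/$B a:car G. j (A a s)*.$B (v (inv$G a*.$G g)*.$B x))"
		if g: "g:.G" and x: "x:.B" for g x
	proof -
		have "v g*.$B (j s*.$B x) = (+/$B a:car G. j (A a s)*.$B v (inv$G a*.$G g))*.$B x"
			using g s x v_j[OF g s] by(simp flip: B.m_assoc)
		also have "... = (+/$B a:car G. j (A a s)*.$B v (inv$G a*.$G g)*.$B x)"
			by(rule B.finsum_ldistr[OF fin]) (use g s x in auto)
		also have "... = (+/$B a:car G. j (A a s)*.$B (v (inv$G a*.$G g)*.$B x))"
			by(rule B.finsum_cong') (use g s x in "auto simp: B.m_assoc")
		finally show ?thesis .
	qed
	have "th k (v g*.$B (j s*.$B v h)) = (+/$B a:car G. th k (j (A a s)*.$B (v (inv$G a*.$G g)*.$B v h)))"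
		unfolding vjv[OF g v_closed[OF h]] by(rule th_finsum[OF k fin]) (use g s h in auto)
	also have "... = (+/$B a:car G. j (A a s)*.$B (v (inv$G a*.$G (g*.$G inv$G k))*.$B th k (v h)))"
		by(rule B.finsum_cong') (use k g s h in "auto simp: th_j_mult th_v_v th_v G.m_assoc")
	also have "... = v (g*.$G inv$G k)*.$B (j s*.$B th k (v h))" by(rule vjv[symmetric]) (use k g h in auto)
	finally show ?thesis using k g by(simp add: th_v)
qed

lemma th_mult:
	assumes k: "k:.G" and x: "x:.B" and y: "y:.B"
	shows "th k (x*.$B y) = th k x*.$B th k y"
proof -
	have 1: "th k (v g*.$B y) = th k (v g)*.$B th k y" if g: "g:.G" for g
	proof -
		have "th k (v g*.$B y) = th k (v g*.$B (+/$B h:car G. j (P h y)*.$B v h))" using expand[OF y] by simp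
		also have "v g*.$B (+/$B h:car G. j (P h y)*.$B v h) = (+/$B h:car G. v g*.$B (j (P h y)*.$B v h))"
			by(rule B.finsum_rdistr[OF fin]) (use g y in auto)
		also have "th k ... = (+/$B h:car G. th k (v g*.$B (j (P h y)*.$B v h)))"
			by(rule th_finsum[OF k fin]) (use g y in auto)
		also have "... = (+/$B h:car G. th k (v g)*.$B th k (j (P h y)*.$B v h))"
			by(rule B.finsum_cong') (use k g y in "auto simp: th_v_j_v th_j_mult")
		also have "... = th k (v g)*.$B (+/$B h:car G. th k (j (P h y)*.$B v h))"
			by(rule B.finsum_rdistr[OF fin, symmetric]) (use k g y in auto)
		also have "(+/$B h:car G. th k (j (P h y)*.$B v h)) = th k (+/$B h:car G. j (P h y)*.$B v h)"
			by(rule th_finsum[OF k fin, symmetric]) (use y in auto)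
		also have "... = th k y" using expand[OF y] by simp
		finally show ?thesis .
	qed
	have "th k (x*.$B y) = th k ((+/$B h:car G. j (P h x)*.$B v h)*.$B y)" using expand[OF x] by simp
	also have "(+/$B h:car G. j (P h x)*.$B v h)*.$B y = (+/$B h:car G. (j (P h x)*.$B v h)*.$B y)"
		by(rule B.finsum_ldistr[OF fin]) (use x y in auto)
	also have "th k ... = (+/$B h:car G. th k ((j (P h x)*.$B v h)*.$B y))"
		by(rule th_finsum[OF k fin]) (use x y in auto)
	also have "... = (+/$B h:car G. th k (j (P h x)*.$B v h)*.$B th k y)"
		by(rule B.finsum_cong') (use k x y in "auto simp: B.m_assoc th_j_mult 1")
	also have "... = (+/$B h:car G. th k (j (P h x)*.$B v h))*.$B th k y"
		by(rule B.finsum_ldistr[OF fin, symmetric]) (use k x y in auto)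
	also have "(+/$B h:car G. th k (j (P h x)*.$B v h)) = th k (+/$B h:car G. j (P h x)*.$B v h)"
		by(rule th_finsum[OF k fin, symmetric]) (use x in auto)
	also have "... = th k x" using expand[OF x] by simp
	finally show ?thesis .
qed

lemma P_one: "g:.G==>P g 1.$B = 1.$S"
proof -
	assume g: "g:.G"
	have "1.$B = (+/$B g:car G. j 1.$S*.$B v g)"
		unfolding one_v by(rule B.finsum_cong') auto
	thus ?thesis using P_coeff[OF g, of "%_. 1.$S"] by simp
qed

lemma P_j: "g:.G==>s:.S==>P g (j s) = s"
	using P_mult[of g s "1.$B"] by(simp add: P_one)

lemma th_j: "k:.G==>s:.S==>th k (j s) = j s" by(rule coords_eqI) (auto simp: P_th P_j)

lemma th_hom: "k:.G==>th k:ring_hom B B"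
	using th_j[of k "1.$S"] by(intro ring_hom_memI) (auto simp: th_add th_mult)

text \<open>\<open>th\<close> permutes the coordinates transitively, so a fixed element has all
  coordinates equal. Since the \<open>v g\<close> add up to 1, it then lies in the image of
  \<open>j\<close>.\<close>

lemma fixed:
	assumes x: "x:.B" "!!k. k:.G==>th k x = x"
	shows "x = j (P 1.$G x)"
proof (rule coords_eqI)
	fix g assume g: "g:.G"
	have "P 1.$G (th g x) = P g x" using g x(1) by(simp add: P_th)
	thus "P g x = P g (j (P 1.$G x))" using g x by(simp add: P_j)
qed (use x in auto)

lemma th_inv: "k:.G==>x:.B==>th k (th (inv$G k) x) = x"
	"k:.G==>x:.B==>th (inv$G k) (th k x) = x" by(auto simp: th_th th_one)

lemma th_jacobson: "k:.G==>x:rad B==>th k x:rad B"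
	by(rule B.jacobson_radical_hom[OF th_hom]) (use th_inv(1) in \<open>auto intro!: bexI[of _ "th (inv$G k) _"]\<close>)

text \<open>Convolution inverse of \<open>v\<close>.\<close>

definition w :: "'g => 'b"
	where "w g = (+/$B b:car G. +/$B c:car G. j (ta b c)*.$B v (inv$G b*.$G c*.$G inv$G g))"

lemma w_closed[simp]: "g:.G==>w g:.B"
	unfolding w_def by(intro B.finsum_closed funcsetI) auto

lemma th_w:
	assumes k: "k:.G" and g: "g:.G"
	shows "th k (w g) = w (k*.$G g)"
proof -
	let ?f = "%g b c. j (ta b c)*.$B v (inv$G b*.$G c*.$G inv$G g)"
	have f: "?f g b c:.B" if "g:.G" "b:.G" "c:.G" for g b c using that by simp
	have "th k (w g) = (+/$B b:car G. th k (+/$B c:car G. ?f g b c))"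
		unfolding w_def by(rule th_finsum[OF k fin]) (use f g in "blast intro: B.finsum_closed")
	also have "... = (+/$B b:car G. +/$B c:car G. ?f (k*.$G g) b c)"
	proof (rule B.finsum_cong')
		fix b assume b: "b:.G"
		have "th k (+/$B c:car G. ?f g b c) = (+/$B c:car G. th k (?f g b c))"
			by(rule th_finsum[OF k fin]) (use f g b in blast)
		also have "... = (+/$B c:car G. ?f (k*.$G g) b c)"
			by(rule B.finsum_cong') (use k g b in "auto simp: th_j_mult th_v G.m_assoc G.inv_mult_group")
		finally show "th k (+/$B c:car G. ?f g b c) = ..." .
	qed (use k g f in "auto intro!: B.finsum_closed")
	finally show ?thesis by(simp add: w_def)
qed

text \<open>After reindexing, the coordinate at \<open>d\<close> is the double sum of
  \<open>ta_sg\<close> at the pair (n m, n), summed over all \<open>n\<close>, where m = d k^-1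
  d^-1. Only n = 1 contributes, and only if m = 1, that is k = 1.\<close>

lemma w_v:
	assumes k: "k:.G"
	shows "(+/$B h:car G. w (k*.$G inv$G h)*.$B v h) = (if k = 1.$G then 1.$B else 0.$B)"
proof (rule coords_eqI)
	show "(+/$B h:car G. w (k*.$G inv$G h)*.$B v h):.B" by(rule B.finsum_closed) (use k in auto)
	fix d assume d: "d:.G"
	have Psum: "P d (+/$B a:car G. f a) = (+/$S a:car G. P d (f a))"
		if "!!a. a:.G==>f a:.B" for f
		by(rule add_finsum[OF B.abelian_group_axioms S.abelian_group_axioms _ P_add fin]) (use d that in auto)
	have Pvv: "P d (v g*.$B v h) = sg (g*.$G inv$G d) (h*.$G inv$G d)" if "g:.G" "h:.G" for g h
		using that d by(simp add: v_v P_coeff)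
	let ?m = "d*.$G inv$G k*.$G inv$G d"
	have m: "?m:.G" using d k by simp
	have icancel: "inv$G a*.$G (a*.$G b) = b" if "a:.G" "b:.G" for a b
		using that by(simp flip: G.m_assoc)
	let ?F = "%n b c. ta b c*.$S sg (inv$G b*.$G (n*.$G ?m)) (inv$G c*.$G n)"
	have Pw: "P d (w (k*.$G inv$G h)*.$B v h) =
			(+/$S b:car G. +/$S c:car G. ?F (c*.$G (h*.$G inv$G d)) b c)" if h: "h:.G" for h
	proof -
		let ?f = "%b c. j (ta b c)*.$B v (inv$G b*.$G c*.$G inv$G (k*.$G inv$G h))"
		have f: "?f b c:.B" if "b:.G" "c:.G" for b c using that k h by simp
		have "w (k*.$G inv$G h)*.$B v h = (+/$B b:car G. (+/$B c:car G. ?f b c)*.$B v h)"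
			unfolding w_def by(rule B.finsum_ldistr[OF fin]) (use f h in "auto intro!: B.finsum_closed simp del: B.m_closed")
		also have "... = (+/$B b:car G. +/$B c:car G. ?f b c*.$B v h)"
			by(rule B.finsum_cong') (use f h in "auto intro!: B.finsum_closed B.finsum_ldistr[OF fin]")
		finally have "P d (w (k*.$G inv$G h)*.$B v h) = (+/$S b:car G. P d (+/$B c:car G. ?f b c*.$B v h))"
			using f h by(subst Psum[symmetric]) (auto intro!: B.finsum_closed)
		also have "... = (+/$S b:car G. +/$S c:car G. ?F (c*.$G (h*.$G inv$G d)) b c)"
		proof (rule S.finsum_cong')
			fix b assume b: "b:.G"
			have "P d (+/$B c:car G. ?f b c*.$B v h) = (+/$S c:car G. P d (?f b c*.$B v h))"
				by(rule Psum) (use f h b in auto)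
			also have "... = (+/$S c:car G. ?F (c*.$G (h*.$G inv$G d)) b c)"
			proof (rule S.finsum_cong')
				fix c assume c: "c:.G"
				have "P d (?f b c*.$B v h) = ta b c*.$S sg (inv$G b*.$G c*.$G inv$G (k*.$G inv$G h)*.$G inv$G d) (h*.$G inv$G d)"
					using b c d h k by(simp add: B.m_assoc P_mult Pvv)
				also have "inv$G b*.$G c*.$G inv$G (k*.$G inv$G h)*.$G inv$G d = inv$G b*.$G (c*.$G (h*.$G inv$G d)*.$G ?m)"
					using b c d h k icancel[OF d, of "inv$G k*.$G inv$G d"] by(simp add: G.inv_mult_group G.m_assoc)
				also have "h*.$G inv$G d = inv$G c*.$G (c*.$G (h*.$G inv$G d))"
					using c d h by(simp add: G.m_assoc[symmetric])
				finally show "P d (?f b c*.$B v h) = ?F (c*.$G (h*.$G inv$G d)) b c"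
					using c d h by(simp add: G.m_assoc[symmetric])
			qed (use b d h m in auto)
			finally show "P d (+/$B c:car G. ?f b c*.$B v h) = ..." .
		qed (use d h m in "auto intro!: S.finsum_closed")
		finally show ?thesis .
	qed
	have Fc: "?F n b c:.S" if "n:.G" "b:.G" "c:.G" for n b c
		using that m by simp
	have "P d (+/$B h:car G. w (k*.$G inv$G h)*.$B v h) =
			(+/$S h:car G. P d (w (k*.$G inv$G h)*.$B v h))" by(rule Psum) (use k in auto)
	also have "... = (+/$S h:car G. +/$S b:car G. +/$S c:car G. ?F (c*.$G (h*.$G inv$G d)) b c)"
		by(rule S.finsum_cong') (use Pw Fc d in "auto intro!: S.finsum_closed simp del: S.m_closed")
	also have "... = (+/$S b:car G. +/$S h:car G. +/$S c:car G. ?F (c*.$G (h*.$G inv$G d)) b c)"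
		by(rule S.finsum_swap[OF fin fin]) (use Fc d in "auto intro!: S.finsum_closed")
	also have "... = (+/$S b:car G. +/$S n:car G. +/$S c:car G. ?F n b c)"
	proof (rule S.finsum_cong')
		fix b assume b: "b:.G"
		have "(+/$S h:car G. +/$S c:car G. ?F (c*.$G (h*.$G inv$G d)) b c) =
				(+/$S c:car G. +/$S h:car G. ?F (c*.$G (h*.$G inv$G d)) b c)"
			by(rule S.finsum_swap[OF fin fin]) (use Fc d b in auto)
		also have "... = (+/$S c:car G. +/$S n:car G. ?F n b c)"
		proof (rule S.finsum_cong')
			fix c assume c: "c:.G"
			have bij: "bij_betw (%h. c*.$G (h*.$G inv$G d)) (car G) (car G)"
				using bij_betw_trans[OF G.bij_mult[of "inv$G d"] G.bij_mult_left[OF c]] d by(simp add: comp_def)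
			show "(+/$S h:car G. ?F (c*.$G (h*.$G inv$G d)) b c) = (+/$S n:car G. ?F n b c)"
				by(rule S.finsum_bij[OF bij, of "%n. ?F n b c"]) (rule Fc[OF _ b c])
		qed (use Fc b in "auto intro!: S.finsum_closed")
		also have "... = (+/$S n:car G. +/$S c:car G. ?F n b c)"
			by(rule S.finsum_swap[OF fin fin]) (use Fc b in auto)
		finally show "(+/$S h:car G. +/$S c:car G. ?F (c*.$G (h*.$G inv$G d)) b c) = ..." .
	qed (use Fc in "auto intro!: S.finsum_closed")
	also have "... = (+/$S n:car G. +/$S b:car G. +/$S c:car G. ?F n b c)"
		by(rule S.finsum_swap[OF fin fin]) (use Fc in "auto intro!: S.finsum_closed")
	also have "... = (+/$S n:car G. if n = 1.$G then (if k = 1.$G then 1.$S else 0.$S) else 0.$S)"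
	proof (rule S.finsum_cong')
		fix n assume n: "n:.G"
		have "k = 1.$G" if e: "?m = 1.$G"
		proof -
			have "d*.$G inv$G k = ?m*.$G d" using d k by(simp add: G.m_assoc)
			hence "d*.$G inv$G k = d" using d by(simp add: e)
			hence "inv$G k = 1.$G" using icancel[OF d G.inv_closed[OF k]] d by simp
			thus ?thesis using k G.inv_inv[OF k] by simp
		qed
		hence "?m = 1.$G \<longleftrightarrow> k = 1.$G" using d by auto
		thus "(+/$S b:car G. +/$S c:car G. ?F n b c) = (if n = 1.$G then (if k = 1.$G then 1.$S else 0.$S) else 0.$S)"
			using n m by(simp add: ta_sg)
	qed auto
	also have "... = (if k = 1.$G then 1.$S else 0.$S)" by(rule S.finsum_delta[OF fin]) auto
	also have "... = P d (if k = 1.$G then 1.$B else 0.$B)"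
		using d P_j[OF d, of "0.$S"] by(simp add: P_one)
	finally show "P d (+/$B h:car G. w (k*.$G inv$G h)*.$B v h) = ..." .
qed auto

end

context cleft_group_extension
begin

text \<open>The difference of \<open>v * w\<close> and the convolution unit takes values in \<open>j S\<close>, being fixed by
	\<open>th\<close>, and is annihilated by convolution with \<open>v\<close> on the right since \<open>w * v\<close> is the unit.\<close>

lemma v_w:
	assumes k: "k:.G"
	shows "(+/$B a:car G. v a*.$B w (inv$G a*.$G k)) = (if k = 1.$G then 1.$B else 0.$B)"
proof -
	define E where "E k = (+/$B a:car G. v a*.$B w (inv$G a*.$G k))" for k
	have Ec: "E k:.B" if "k:.G" for k
		unfolding E_def by(rule B.finsum_closed) (use that in auto)
	have thE: "th l (E k) = E k" if k: "k:.G" and l: "l:.G" for k l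
	proof -
		have "th l (E k) = (+/$B a:car G. th l (v a*.$B w (inv$G a*.$G k)))"
			unfolding E_def by(rule th_finsum[OF l fin]) (use k in auto)
		also have "... = (+/$B a:car G. v (a*.$G inv$G l)*.$B w (inv$G (a*.$G inv$G l)*.$G k))"
			by(rule B.finsum_cong') (use k l in "auto simp: th_mult th_v th_w G.inv_mult_group G.m_assoc")
		also have "... = E k"
			unfolding E_def by(rule B.finsum_bij[OF G.bij_mult, of _ "%a. v a*.$B w (inv$G a*.$G k)"]) (use k l in auto)
		finally show ?thesis .
	qed
	define s where "s k = P 1.$G (E k)" for k
	have sc: "s k:.S" if "k:.G" for k unfolding s_def using Ec[OF that] by simp
	have Ej: "E k = j (s k)" if k: "k:.G" for k
		unfolding s_def by(rule fixed[OF Ec[OF k] thE[OF k]])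
	have "(+/$B h:car G. j (s (k*.$G inv$G h))*.$B v h) =
			(+/$B h:car G. +/$B a:car G. v a*.$B (w (inv$G a*.$G k*.$G inv$G h)*.$B v h))"
	proof (rule B.finsum_cong')
		fix h assume h: "h:.G"
		have "j (s (k*.$G inv$G h))*.$B v h = E (k*.$G inv$G h)*.$B v h"
			using Ej[of "k*.$G inv$G h"] k h by simp
		also have "... = (+/$B a:car G. v a*.$B w (inv$G a*.$G (k*.$G inv$G h))*.$B v h)"
			unfolding E_def by(rule B.finsum_ldistr[OF fin]) (use k h in auto)
		also have "... = (+/$B a:car G. v a*.$B (w (inv$G a*.$G k*.$G inv$G h)*.$B v h))"
			by(rule B.finsum_cong') (use k h in "auto simp: B.m_assoc G.m_assoc")
		finally show "j (s (k*.$G inv$G h))*.$B v h = ..." .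
	qed (use k in "auto intro!: B.finsum_closed")
	also have "... = (+/$B a:car G. +/$B h:car G. v a*.$B (w (inv$G a*.$G k*.$G inv$G h)*.$B v h))"
		by(rule B.finsum_swap[OF fin fin]) (use k in auto)
	also have "... = (+/$B a:car G. if a = k then v a else 0.$B)"
	proof (rule B.finsum_cong')
		fix a assume a: "a:.G"
		have "(+/$B h:car G. v a*.$B (w (inv$G a*.$G k*.$G inv$G h)*.$B v h)) =
				v a*.$B (+/$B h:car G. w (inv$G a*.$G k*.$G inv$G h)*.$B v h)"
			by(rule B.finsum_rdistr[OF fin, symmetric]) (use k a in auto)
		also have "... = v a*.$B (if inv$G a*.$G k = 1.$G then 1.$B else 0.$B)"
			using w_v[of "inv$G a*.$G k"] a k by simp
		also have "inv$G a*.$G k = 1.$G \<longleftrightarrow> a = k"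
			using G.inv_solve_left'[OF G.one_closed a k] a k by auto
		finally show "(+/$B h:car G. v a*.$B (w (inv$G a*.$G k*.$G inv$G h)*.$B v h)) = (if a = k then v a else 0.$B)"
			using a k by simp
	qed auto
	also have "... = v k" by(rule B.finsum_delta[OF fin k]) (use k in auto)
	finally have "P 1.$G (+/$B h:car G. j (s (k*.$G inv$G h))*.$B v h) = P 1.$G (v k)" by simp
	hence "s k = (if k = 1.$G then 1.$S else 0.$S)"
		using k sc by(simp add: P_coeff P_v)
	thus ?thesis using Ej[OF k] by(simp add: E_def)
qed

text \<open>\<open>w\<close> extracts coordinates: the sum over \<open>k\<close> of th k x times w
  (k h^-1) collapses to j (P h x) by \<open>v_w\<close>. It stays in the radical, which is stable
  under automorphisms and under multiplication from the right.\<close>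

lemma coords_jacobson:
	assumes x: "x:rad B" and h: "h:.G"
	shows "j (P h x):rad B"
proof -
	have xc: "x:.B" by(rule B.radD[OF x])
	let ?c = "inv$G h"
	have cc: "?c:.G" using h by simp
	have thx: "th k x = (+/$B g:car G. j (P g x)*.$B v (g*.$G inv$G k))" if k: "k:.G" for k
	proof -
		have "th k x = th k (+/$B g:car G. j (P g x)*.$B v g)" using expand[OF xc] by simp
		also have "... = (+/$B g:car G. th k (j (P g x)*.$B v g))" by(rule th_finsum[OF k fin]) (use xc in auto)
		also have "... = (+/$B g:car G. j (P g x)*.$B v (g*.$G inv$G k))"
			by(rule B.finsum_cong') (use xc k in "auto simp: th_j_mult th_v")
		finally show ?thesis .
	qed
	have "(+/$B k:car G. th k x*.$B w (k*.$G ?c)) =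
			(+/$B k:car G. +/$B g:car G. j (P g x)*.$B (v (g*.$G inv$G k)*.$B w (k*.$G ?c)))"
	proof (rule B.finsum_cong')
		fix k assume k: "k:.G"
		have "th k x*.$B w (k*.$G ?c) = (+/$B g:car G. j (P g x)*.$B v (g*.$G inv$G k)*.$B w (k*.$G ?c))"
			unfolding thx[OF k] by(rule B.finsum_ldistr[OF fin]) (use xc k cc in auto)
		also have "... = (+/$B g:car G. j (P g x)*.$B (v (g*.$G inv$G k)*.$B w (k*.$G ?c)))"
			by(rule B.finsum_cong') (use xc k cc in "auto simp: B.m_assoc")
		finally show "th k x*.$B w (k*.$G ?c) = ..." .
	qed (use xc cc in "auto intro!: B.finsum_closed")
	also have "... = (+/$B g:car G. +/$B k:car G. j (P g x)*.$B (v (g*.$G inv$G k)*.$B w (k*.$G ?c)))"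
		by(rule B.finsum_swap[OF fin fin]) (use xc cc in auto)
	also have "... = (+/$B g:car G. if g = h then j (P g x) else 0.$B)"
	proof (rule B.finsum_cong')
		fix g assume g: "g:.G"
		have bij: "bij_betw (%k. g*.$G inv$G k) (car G) (car G)"
			using bij_betw_trans[OF G.bij_inv G.bij_mult_left[OF g]] by(simp add: comp_def)
		have "(+/$B k:car G. j (P g x)*.$B (v (g*.$G inv$G k)*.$B w (k*.$G ?c))) =
				j (P g x)*.$B (+/$B k:car G. v (g*.$G inv$G k)*.$B w (k*.$G ?c))"
			by(rule B.finsum_rdistr[OF fin, symmetric]) (use xc g cc in auto)
		also have "(+/$B k:car G. v (g*.$G inv$G k)*.$B w (k*.$G ?c)) =
				(+/$B k:car G. v (g*.$G inv$G k)*.$B w (inv$G (g*.$G inv$G k)*.$G (g*.$G ?c)))"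
		proof (rule B.finsum_cong')
			fix k assume k: "k:.G"
			have "inv$G g*.$G (g*.$G ?c) = ?c" using g cc by(simp flip: G.m_assoc)
			hence "inv$G (g*.$G inv$G k)*.$G (g*.$G ?c) = k*.$G ?c"
				using g k cc by(simp add: G.inv_mult_group G.m_assoc)
			thus "v (g*.$G inv$G k)*.$B w (k*.$G ?c) = v (g*.$G inv$G k)*.$B w (inv$G (g*.$G inv$G k)*.$G (g*.$G ?c))"
				using g cc by simp
		qed (use g cc in auto)
		also have "... = (+/$B a:car G. v a*.$B w (inv$G a*.$G (g*.$G ?c)))"
			by(rule B.finsum_bij[OF bij, of "%a. v a*.$B w (inv$G a*.$G (g*.$G ?c))"]) (use g cc in auto)
		also have "... = (if g*.$G ?c = 1.$G then 1.$B else 0.$B)" by(rule v_w) (use g cc in auto)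
		also have "g*.$G ?c = 1.$G \<longleftrightarrow> g = h"
			using G.inv_solve_right'[OF G.one_closed g h] g h by auto
		finally show "(+/$B k:car G. j (P g x)*.$B (v (g*.$G inv$G k)*.$B w (k*.$G ?c))) = (if g = h then j (P g x) else 0.$B)"
			using g h xc by simp
	qed (use xc in auto)
	also have "... = j (P h x)" by(rule B.finsum_delta[OF fin h]) (use xc h in auto)
	finally show ?thesis
		using BB.osub_finsum[OF B.jacobson_osub fin, of "%k. th k x*.$B w (k*.$G ?c)"]
			B.jacobson_right_mult[OF th_jacobson[OF _ x]] cc by simp
qed

text \<open>The inverse of 1 - j r j s in \<open>B\<close> is unique, hence fixed by every
  \<open>th k\<close>, hence in the image of \<open>j\<close>. So quasi-regularity descends to
  \<open>S\<close>.\<close>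

lemma jacobson_of_j:
	assumes s: "s:.S" "j s:rad B"
	shows "s:rad S"
proof (rule S.jacobson_radicalI_left_inverse[OF s(1)])
	fix r assume r: "r:.S"
	let ?t = "1.$S -.$S r*.$S s"
	have t: "?t:.S" using r s by simp
	have "j r*.$B j s:rad B" by(rule BB.osub_l[OF B.jacobson_osub]) (use r s in auto)
	from B.jacobson_one_minus_unit[OF this] have U: "j ?t:Units B"
		using r s by(simp add: a_minus_def)
	let ?y = "inv$B j ?t"
	have y: "?y:.B" "?y*.$B j ?t = 1.$B" "j ?t*.$B ?y = 1.$B"
		using U by auto
	have "th k ?y = ?y" if k: "k:.G" for k
	proof -
		have "th k ?y*.$B j ?t = th k (?y*.$B j ?t)"
			using th_mult[OF k y(1) j.hom_closed[OF t]] th_j[OF k t] by simp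
		also have "... = 1.$B" unfolding y(2) using th_j[OF k S.one_closed] by simp
		finally have e: "th k ?y*.$B j ?t = ..." .
		have "th k ?y = th k ?y*.$B (j ?t*.$B ?y)" unfolding y(3) using k y(1) by simp
		also have "... = (th k ?y*.$B j ?t)*.$B ?y" by(rule B.m_assoc[symmetric]) (use k y(1) t in auto)
		finally show ?thesis unfolding e using y(1) by simp
	qed
	from fixed[OF y(1) this] have yj: "?y = j (P 1.$G ?y)" .
	have pc: "P 1.$G ?y:.S" using y(1) by simp
	have "P 1.$G ?y*.$S ?t = P 1.$G (j (P 1.$G ?y*.$S ?t))" by(rule P_j[symmetric]) (use pc t in auto)
	also have "j (P 1.$G ?y*.$S ?t) = ?y*.$B j ?t"
		unfolding j.hom_mult[OF pc t] by(subst yj[symmetric]) (rule refl)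
	also have "P 1.$G ... = 1.$S" unfolding y(2) by(simp add: P_one)
	finally show "EX y:car S. y*.$S ?t = 1.$S" using pc by blast
qed

lemma maschke_th: "maschke B ((\<otimes>\<^bsub>B\<^esub>) ` car B) G th (%g. th (inv$G g)) ((\<otimes>\<^bsub>B\<^esub>) (j d))"
proof (intro maschke.intro maschke_axioms.intro BB.op_group_axioms G.group_axioms fin)
	fix g f assume g: "g:.G" and f: "f:(\<otimes>\<^bsub>B\<^esub>) ` car B"
	then obtain b where b: "b:.B" "f = (\<otimes>\<^bsub>B\<^esub>) b" by auto
	thus "EX f':(\<otimes>\<^bsub>B\<^esub>) ` car B. ALL x:car B. th g (f x) = f' (th g x)"
		using g by(intro bexI[of _ "(\<otimes>\<^bsub>B\<^esub>) (th g b)"]) (auto simp: th_mult)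
next
	fix g h assume "g:.G" "h:.G"
	thus "EX f:(\<otimes>\<^bsub>B\<^esub>) ` car B. ALL x:car B. th g (th h x) = f (th (g*.$G h) x)"
		by(intro bexI[of _ "(\<otimes>\<^bsub>B\<^esub>) 1.$B"]) (auto simp: th_th)
qed (simp_all add: th_add th_inv finsum_d)

text \<open>The Reynolds operator of the action: a projection of \<open>B\<close> onto the image of
  \<open>j\<close> that commutes with right multiplication by that image.\<close>

definition tr :: "'b => 'b"
	where "tr x = j d*.$B (+/$B k:car G. th k x)"

lemma tr_closed[simp]: "x:.B==>tr x:.B"
	unfolding tr_def by(intro B.m_closed B.finsum_closed) auto

lemma tr_add: "x:.B==>y:.B==>tr (x+.$B y) = tr x+.$B tr y"
proof -
	assume x: "x:.B" and y: "y:.B"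
	have "(+/$B k:car G. th k (x+.$B y)) = (+/$B k:car G. th k x+.$B th k y)"
		by(rule B.finsum_cong') (use x y in "auto simp: th_add")
	also have "... = (+/$B k:car G. th k x)+.$B (+/$B k:car G. th k y)"
		by(rule B.finsum_addf) (use x y in auto)
	finally show ?thesis unfolding tr_def using x y by(simp add: B.r_distr B.finsum_closed)
qed

lemma tr_mult_j:
	assumes x: "x:.B" and s: "s:.S"
	shows "tr (x*.$B j s) = tr x*.$B j s"
proof -
	have "(+/$B k:car G. th k (x*.$B j s)) = (+/$B k:car G. th k x*.$B j s)"
		by(rule B.finsum_cong') (use x s in "auto simp: th_mult th_j")
	also have "... = (+/$B k:car G. th k x)*.$B j s"
		by(rule B.finsum_ldistr[OF fin, symmetric]) (use x s in auto)
	finally show ?thesis unfolding tr_def using x s by(simp add: B.m_assoc B.finsum_closed)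
qed

lemma tr_j: "s:.S==>tr (j s) = j s"
proof -
	assume s: "s:.S"
	have "(+/$B k:car G. th k (j s)) = (+/$B k:car G. j s)"
		by(rule B.finsum_cong') (use s in "auto simp: th_j")
	hence "tr (j s) = (+/$B k:car G. j d*.$B j s)"
		unfolding tr_def using s by(simp add: B.finsum_rdistr fin)
	thus ?thesis using s by(simp add: finsum_d del: j.hom_mult)
qed

lemma tr_th:
	assumes x: "x:.B" and k: "k:.G"
	shows "tr (th k x) = tr x"
proof -
	have "(+/$B l:car G. th l (th k x)) = (+/$B l:car G. th (l*.$G k) x)"
		by(rule B.finsum_cong') (use x k in "auto simp: th_th")
	also have "... = (+/$B l:car G. th l x)"
		by(rule B.finsum_bij[OF G.bij_mult[OF k], of "%l. th l x"]) (use x in auto)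
	finally show ?thesis by(simp add: tr_def)
qed

lemma tr_fixed:
	assumes x: "x:.B"
	shows "tr x = j (P 1.$G (tr x))"
proof (rule fixed[OF tr_closed[OF x]])
	fix k assume k: "k:.G"
	have "th k (tr x) = j d*.$B th k (+/$B l:car G. th l x)"
		unfolding tr_def by(rule th_j_mult[OF k d_closed]) (use x in "auto intro!: B.finsum_closed")
	also have "th k (+/$B l:car G. th l x) = (+/$B l:car G. th k (th l x))"
		by(rule th_finsum[OF k fin]) (use x in auto)
	also have "... = (+/$B l:car G. th (k*.$G l) x)" by(rule B.finsum_cong') (use x k in "auto simp: th_th")
	also have "... = (+/$B l:car G. th l x)"
		by(rule B.finsum_bij[OF G.bij_mult_left[OF k], of "%l. th l x"]) (use x in auto)
	finally show "th k (tr x) = tr x" by(simp add: tr_def)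
qed

lemma th_maximal:
	assumes L: "BB.max_osub L" and g: "g:.G"
	shows "BB.max_osub {x:car B. th g x:L}"
proof -
	have oL: "BB.osub L" "L ~= car B" using L by(auto simp: BB.max_osub_def)
	note D = BB.osubD[OF oL(1)]
	let ?h = "inv$G g"
	have h: "?h:.G" using g by simp
	interpret t: ring_hom_ring B B "th g" by(rule ring_hom_ringI2[OF B.ring_axioms B.ring_axioms th_hom[OF g]])
	have o: "BB.osub {x:car B. th g x:L}"
	proof (rule BB.osubI)
		fix f x assume f: "f:(\<otimes>\<^bsub>B\<^esub>) ` car B" and x: "x:{x:car B. th g x:L}"
		then obtain b where b: "b:.B" "f = (\<otimes>\<^bsub>B\<^esub>) b" by(elim imageE)
		have "th g b*.$B th g x:L" by(rule BB.osub_l[OF oL(1)]) (use x b in simp_all)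
		thus "f x:{x:car B. th g x:L}" using x b by simp
	qed (use D(2,3,4) in auto)
	show ?thesis
	proof (rule BB.maximal_osubI[OF o])
		have "1.$B ~: L" by(rule B.one_notin_maximal[OF L])
		hence "1.$B ~: {x:car B. th g x:L}" by simp
		thus "{x:car B. th g x:L} ~= car B" using B.one_closed by(rule_tac notI) (erule notE, erule ssubst)
		fix N assume N: "BB.osub N" "{x:car B. th g x:L} \<subset> N"
		then obtain y where y: "y:N" "th g y ~: L" using BB.osubD(7)[OF N(1)] by blast
		have yc: "y:.B" by(rule BB.osubD(7)[OF N(1) y(1)])
		have "x:N" if x: "x:.B" for x
		proof -
			obtain l r where lr: "l:L" "r:.B" "th g x = l+.$B r*.$B th g y"
				using BB.maximal_generate[OF L _ y(2), of "th g x"] x yc g by auto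
			have lc: "l:.B" by(rule D(7)[OF lr(1)])
			have "x = th ?h (th g x)" using th_inv(2)[OF g x] by simp
			also have "... = th ?h l+.$B th ?h r*.$B y"
				using lr lc yc g h by(simp add: th_add th_mult th_inv)
			finally have e: "x = ..." .
			have "th ?h l:{x:car B. th g x:L}" using lr(1) lc h g by(simp add: th_inv)
			hence "th ?h l:N" by(rule subsetD[OF psubset_imp_subset[OF N(2)]])
			moreover have "th ?h r*.$B y:N" by(rule BB.osub_l[OF N(1) _ y(1)]) (use h lr in simp)
			ultimately show ?thesis by(subst e) (rule BB.osubD(3)[OF N(1)])
		qed
		thus "N = car B" using BB.osubD(1)[OF N(1)] by blast
	qed
qed

text \<open>With \<open>Z\<close> the intersection of the conjugates of a maximal left ideal \<open>L\<close>, the map sending a left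
	ideal \<open>U\<close> of \<open>S\<close> to the largest left ideal of \<open>B\<close> whose traces lie in \<open>U\<close> transfers complements
	from \<open>B\<close> above \<open>Z\<close> to \<open>S\<close>.\<close>

lemma j_jacobson:
	assumes s: "s:rad S"
	shows "j s:rad B"
proof (rule B.radI)
	have sc: "s:.S" by(rule S.radD[OF s])
	show "j s:.B" using sc by simp
	fix L assume L: "BB.max_osub L"
	hence oL: "BB.osub L" by(simp add: BB.max_osub_def)
	define MM where "MM = (%g. {x:car B. th g x:L}) ` car G"
	define Z where "Z = car B Int \<Inter>MM"
	have Zmem: "z:Z \<longleftrightarrow> z:.B & (ALL g:car G. th g z:L)" for z by(auto simp: Z_def MM_def)
	have MM: "BB.max_osub N" if "N:MM" for N using that th_maximal[OF L] by(auto simp: MM_def)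
	have compl: "BB.complemented_above Z"
		unfolding Z_def by(rule BB.complemented_above_Inter[OF _ MM]) (simp_all add: MM_def fin)
	have oM: "BB.osub {x:car B. th g x:L}" if "g:.G" for g
		using th_maximal[OF L that] by(simp add: BB.max_osub_def)
	have oZ: "BB.osub Z"
	proof (rule BB.osubI)
		show "a+.$B b:Z" if "a:Z" "b:Z" for a b
			using that BB.osubD(3)[OF oM, of _ a b] by(simp add: Zmem)
		show "0.$B:Z" using BB.osubD(2)[OF oM] by(simp add: Zmem)
		show "-.$B a:Z" if "a:Z" for a using BB.osubD(4)[OF oM, of _ a] that by(simp add: Zmem)
		fix f a assume f: "f:(\<otimes>\<^bsub>B\<^esub>) ` car B" and a: "a:Z"
		have ac: "a:.B" using a by(simp add: Zmem)
		have fc: "f a:.B" using f ac by auto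
		have "th g (f a):L" if g: "g:.G" for g
		proof -
			have "f a:{x:car B. th g x:L}" by(rule BB.osubD(5)[OF oM[OF g] f]) (use a g in "simp add: Zmem")
			thus ?thesis by simp
		qed
		thus "f a:Z" using fc by(simp add: Zmem)
	qed (simp add: Zmem subset_eq)
	have thZ: "th k z:Z" if k: "k:.G" and z: "z:Z" for k z
		using that by(simp add: Zmem th_th)
	interpret MA: maschke B "(\<otimes>\<^bsub>B\<^esub>) ` car B" G th "%g. th (inv$G g)" "(\<otimes>\<^bsub>B\<^esub>) (j d)" by(rule maschke_th)
	have trN: "tr x:N" if N: "BB.osub N" "!!k x. k:.G==>x:N==>th k x:N" and x: "x:N" for N x
		unfolding tr_def
		by(rule BB.osub_l[OF N(1) j.hom_closed[OF d_closed]], rule BB.osub_finsum[OF N(1) fin], rule N(2)[OF _ x])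
	define ZS where "ZS = {t:car S. j t:Z}"
	have pre: "SS.osub {t:car S. j t:N}" if N: "BB.osub N" for N
	proof (rule SS.osubI)
		fix f t assume f: "f:(\<otimes>\<^bsub>S\<^esub>) ` car S" and t: "t:{t:car S. j t:N}"
		then obtain r where r: "r:.S" "f = (\<otimes>\<^bsub>S\<^esub>) r" by(elim imageE)
		have "j r*.$B j t:N" by(rule BB.osub_l[OF N]) (use r t in simp_all)
		thus "f t:{t:car S. j t:N}" using r t by simp
	qed (use BB.osubD(2,3,4)[OF N] in auto)
	have oZS: "SS.osub ZS" unfolding ZS_def by(rule pre[OF oZ])
	have "SS.complemented_above ZS"
		unfolding SS.complemented_above_def
	proof (intro allI impI, elim conjE)
		fix U assume U: "SS.osub U" "ZS <= U"
		note UD = SS.osubD[OF U(1)]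
		define N where "N = {x:car B. ALL b:car B. P 1.$G (tr (b*.$B x)):U}"
		have NI: "x:N" if "x:.B" "!!b. b:.B==>P 1.$G (tr (b*.$B x)):U" for x
			using that by(simp add: N_def)
		have ND: "x:.B" "b:.B==>P 1.$G (tr (b*.$B x)):U" if "x:N" for x b
			using that by(simp_all add: N_def)
		have oN: "BB.osub N"
		proof (rule BB.osubI)
			fix x assume x: "x:N"
			show "f x:N" if f: "f:(\<otimes>\<^bsub>B\<^esub>) ` car B" for f
			proof -
				obtain a where a: "a:.B" "f = (\<otimes>\<^bsub>B\<^esub>) a" using f by(elim imageE)
				show ?thesis unfolding a(2)
				proof (rule NI)
					fix b assume b: "b:.B"
					have "b*.$B (a*.$B x) = (b*.$B a)*.$B x" using a b ND(1)[OF x] by(simp add: B.m_assoc)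
					thus "P 1.$G (tr (b*.$B (a*.$B x))):U" using ND(2)[OF x, of "b*.$B a"] a b by simp
				qed (use a ND(1)[OF x] in simp)
			qed
			show "-.$B x:N"
			proof (rule NI)
				fix b assume b: "b:.B"
				have "b*.$B -.$B x = (-.$B b)*.$B x" using b ND(1)[OF x] by(simp add: B.l_minus B.r_minus)
				thus "P 1.$G (tr (b*.$B -.$B x)):U" using ND(2)[OF x, of "-.$B b"] b by simp
			qed (use ND(1)[OF x] in simp)
			show "x+.$B y:N" if y: "y:N" for y
			proof (rule NI)
				fix b assume b: "b:.B"
				show "P 1.$G (tr (b*.$B (x+.$B y))):U"
					using UD(3)[OF ND(2)[OF x b] ND(2)[OF y b]] b ND(1)[OF x] ND(1)[OF y] by(simp add: B.r_distr tr_add P_add)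
			qed (use ND(1)[OF x] ND(1)[OF y] in simp)
		next
			have "P 1.$G (tr 0.$B) = 0.$S" using tr_j[OF S.zero_closed] P_j[OF G.one_closed S.zero_closed] by simp
			thus "0.$B:N" by(intro NI) (simp_all add: UD(2))
		qed (simp add: N_def subset_eq)
		have thN: "th k x:N" if k: "k:.G" and x: "x:N" for k x
		proof (rule NI)
			fix b assume b: "b:.B"
			let ?b = "th (inv$G k) b"
			have "b*.$B th k x = th k (?b*.$B x)" using k b ND(1)[OF x] by(simp add: th_mult th_inv)
			thus "P 1.$G (tr (b*.$B th k x)):U" using ND(2)[OF x, of ?b] k b ND(1)[OF x] by(simp add: tr_th)
		qed (use k ND(1)[OF x] in simp)
		have ZN: "Z <= N"
		proof
			fix z assume z: "z:Z"
			have zc: "z:.B" using z by(simp add: Zmem)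
			show "z:N"
			proof (rule NI[OF zc])
				fix b assume b: "b:.B"
				have bz: "b*.$B z:.B" using b zc by simp
				have "tr (b*.$B z):Z" by(rule trN[OF oZ thZ BB.osub_l[OF oZ b z]])
				hence "P 1.$G (tr (b*.$B z)):ZS" using tr_fixed[OF bz] bz by(simp add: ZS_def)
				thus "P 1.$G (tr (b*.$B z)):U" using U(2) by blast
			qed
		qed
		\<comment> \<open>By right linearity the trace of b j t is an element of \<open>S\<close> times
		  \<open>t\<close>, which stays in the left ideal \<open>U\<close>. Conversely the choice b = 1
		  recovers \<open>t\<close>.\<close>
		have jN: "j t:N \<longleftrightarrow> t:U" if t: "t:.S" for t
		proof
			assume "j t:N"
			from ND(2)[OF this B.one_closed] show "t:U" using t by(simp add: tr_j P_j)
		next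
			assume tU: "t:U"
			show "j t:N"
			proof (rule NI)
				fix b assume b: "b:.B"
				let ?p = "P 1.$G (tr b)"
				have p: "?p:.S" using b by simp
				have "tr (b*.$B j t) = j ?p*.$B j t" unfolding tr_mult_j[OF b t] by(subst tr_fixed[OF b]) (rule refl)
				also have "... = j (?p*.$S t)" using p t by simp
				finally have "P 1.$G (tr (b*.$B j t)) = ?p*.$S t" using P_j[OF G.one_closed S.m_closed[OF p t]] by simp
				thus "P 1.$G (tr (b*.$B j t)):U" using SS.osub_l[OF U(1) p tU] by simp
			qed (use t in simp)
		qed
		obtain C where C: "BB.osub C" "N Int C = Z" "N <+>$B C = car B"
			using compl oN ZN unfolding BB.complemented_above_def by blast
		have st: "th k x:N' & th (inv$G k) x:N'"
			if "!!k x. k:.G==>x:N'==>th k x:N'" "k:.G" "x:N'" for N' k x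
			using that by simp
		obtain C' where C': "BB.osub C'" "ALL g:car G. ALL x:C'. th g x:C'" "N Int C' = Z" "N <+>$B C' = car B"
			using MA.invariant_complement[OF oZ st[OF thZ] oN st[OF thN] C] by blast
		\<comment> \<open>Complements descend by preimage: taking traces in j t = n + c splits
		  \<open>t\<close> in \<open>S\<close>, because both \<open>N\<close> and the invariant complement
		  \<open>C'\<close> are preserved by the trace.\<close>
		let ?V = "{t:car S. j t:C'}"
		have V: "SS.osub ?V" by(rule pre[OF C'(1)])
		have "U Int ?V = ZS"
		proof (intro subset_antisym subsetI)
			fix t assume "t:U Int ?V"
			hence "t:.S" "j t:N Int C'" using jN by auto
			thus "t:ZS" using C'(3) by(simp add: ZS_def)
		next
			fix t assume t: "t:ZS"
			hence "t:.S" "j t:N Int C'" using C'(3) by(simp_all add: ZS_def)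
			thus "t:U Int ?V" using jN by simp
		qed
		moreover have "U <+>$S ?V = car S"
		proof (rule subset_antisym[OF SS.osubD(1)[OF SS.osub_sum[OF U(1) V]]], rule subsetI)
			fix t assume t: "t:.S"
			hence "j t:N <+>$B C'" using C'(4) by simp
			then obtain n c where nc: "n:N" "c:C'" "j t = n+.$B c" by(auto simp: BB.mem_set_add)
			have c: "n:.B" "c:.B" using ND(1)[OF nc(1)] BB.osubD(7)[OF C'(1) nc(2)] .
			let ?n = "P 1.$G (tr n)" and ?c = "P 1.$G (tr c)"
			have "tr (j t) = tr n+.$B tr c" unfolding nc(3) by(rule tr_add[OF c])
			hence "P 1.$G (j t) = ?n+.$S ?c" using t c by(simp add: tr_j P_add)
			hence e: "t = ?n+.$S ?c" using t by(simp add: P_j)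
			have "tr n:N" by(rule trN[OF oN thN nc(1)])
			hence "j ?n:N" using tr_fixed[OF c(1)] by simp
			hence n: "?n:U" using jN c by simp
			have "tr c:C'" by(rule trN[OF C'(1) _ nc(2)]) (use C'(2) in simp)
			hence "j ?c:C'" using tr_fixed[OF c(2)] by simp
			hence "?c:?V" using c by simp
			thus "t:U <+>$S ?V" unfolding SS.mem_set_add by(intro bexI[OF _ n] bexI[of _ ?c]) (rule e)
		qed
		ultimately show "EX V. SS.osub V & U Int V = ZS & U <+>$S V = car S" using V by blast
	qed
	have "s:ZS"
	proof (rule ccontr)
		assume "s ~: ZS"
		then obtain N where "SS.max_osub N" "s ~: N"
			using SS.exists_maximal_above[OF \<open>SS.complemented_above ZS\<close> oZS sc] by blast
		thus False using S.radD(2)[OF s] by blast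
	qed
	hence "th 1.$G (j s):L" by(simp add: ZS_def Zmem)
	thus "j s:L" using sc by(simp add: th_one)
qed

theorem jacobson_radical_iff:
	"x:rad B \<longleftrightarrow> x:.B & (ALL g:car G. P g x:rad S)"
	using jacobson_radical_coords[OF j_jacobson] B.radD(1) jacobson_of_j[OF P_closed coords_jacobson] by blast

end

section \<open>Common eigenvectors\<close>

text \<open>Gaussian elimination, by induction on the equations: a pivot unknown \<open>k\<close>
  with nonzero entry in the new equation is eliminated from the others, and its value is recovered
  at the end.\<close>

lemma (in field) homogeneous_system:
	assumes "finite I" "finite J" "card I < card J" "!!i j. i:I==>j:J==>x j i:.R"
	shows "EX c. (ALL j:J. c j:.R) & (EX j:J. c j ~= 0.) & (ALL i:I. (+/j:J. c j*.x j i) = 0.)"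
	using assms
proof (induction I arbitrary: J x)
	case empty
	hence "J ~= {}" by auto
	thus ?case by(intro exI[of _ "%_. 1."]) auto
next
	case (insert i I)
	show ?case
	proof (cases "ALL j:J. x j i = 0.")
		case True
		obtain c where c: "ALL j:J. c j:.R" "EX j:J. c j ~= 0." "ALL i:I. (+/j:J. c j*.x j i) = 0."
			using insert.IH[of J x] insert.prems insert.hyps by auto
		moreover have "(+/j:J. c j*.x j i) = (+/j:J. 0.)" by(rule finsum_cong') (use True c in auto)
		ultimately show ?thesis by(intro exI[of _ c]) auto
	next
		case False
		then obtain k where k: "k:J" "x k i ~= 0." by blast
		define J' where "J' = J - {k}"
		have J': "finite J'" "J = insert k J'" "k ~: J'" using k insert.prems by(auto simp: J'_def)
		have card: "card I < card J'" using insert.prems insert.hyps J' by simp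
		have xc: "x j h:.R" if "j:J" "h:insert i I" for j h using insert.prems that by blast
		have xk: "x k i:.R" "inv (x k i):.R" "inv (x k i)*.x k i = 1."
			using k xc[of k i] field_Units by(auto simp: Units_closed)
		define q where "q j = x j i*.inv (x k i)" for j
		have qc: "q j:.R" if "j:J" for j using xc[OF that, of i] xk by(simp add: q_def)
		obtain c where c: "ALL j:J'. c j:.R" "EX j:J'. c j ~= 0."
				"ALL h:I. (+/j:J'. c j*.(x j h -. q j*.x k h)) = 0."
			using insert.IH[of J' "%j h. x j h -. q j*.x k h"] J' card xc k qc by auto
		\<comment> \<open>Equation \<open>i\<close>, solved for the pivot unknown, gives it the value
		  -\<open>s\<close>.\<close>
		define s where "s = (+/j:J'. c j*.q j)"
		have s: "s:.R" unfolding s_def by(rule finsum_closed) (use c qc J' in auto)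
		define c' where "c' j = (if j = k then -. s else c j)" for j
		have sum: "(+/j:J. c' j*.x j h) = (+/j:J'. c j*.(x j h -. q j*.x k h))" if h: "h:insert i I" for h
		proof -
			have xkh: "x k h:.R" using xc h k by blast
			have "(+/j:J. c' j*.x j h) = -. s*.x k h+.(+/j:J'. c' j*.x j h)"
				unfolding J'(2) by(subst finsum_insert) (use J' c s xkh xc h in "auto simp: c'_def")
			also have "(+/j:J'. c' j*.x j h) = (+/j:J'. c j*.(x j h -. q j*.x k h)+.c j*.q j*.x k h)"
			proof (rule finsum_cong')
				fix j assume j: "j:J'"
				hence jJ: "j:J" using J' by blast
				have "j ~= k" using j J' by blast
				moreover have "x j h = (x j h -. q j*.x k h)+.q j*.x k h"
					using xc[OF jJ h] qc[OF jJ] xkh by(simp add: a_minus_def a_assoc l_neg)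
				ultimately show "c' j*.x j h = c j*.(x j h -. q j*.x k h)+.c j*.q j*.x k h"
					using c(1) j xc[OF jJ h] qc[OF jJ] xkh by(simp add: c'_def m_assoc flip: r_distr)
			qed (use c xc qc xkh h J' in auto)
			also have "... = (+/j:J'. c j*.(x j h -. q j*.x k h))+.(+/j:J'. c j*.q j*.x k h)"
				by(rule finsum_addf) (use c xc qc xkh h J' in auto)
			also have "(+/j:J'. c j*.q j*.x k h) = s*.x k h"
				unfolding s_def by(rule finsum_ldistr[symmetric]) (use c qc xkh J' in auto)
			finally have e: "(+/j:J. c' j*.x j h) = -. s*.x k h+.((+/j:J'. c j*.(x j h -. q j*.x k h))+.s*.x k h)" .
			have "(+/j:J'. c j*.(x j h -. q j*.x k h)):.R" by(rule finsum_closed) (use c xc qc xkh h J' in auto)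
			thus ?thesis using s xkh unfolding e by(simp add: l_minus a_ac r_neg1 r_neg2 r_neg l_neg)
		qed
		have "(+/j:J'. c j*.(x j i -. q j*.x k i)) = (+/j:J'. 0.)"
		proof (rule finsum_cong')
			fix j assume j: "j:J'"
			have "q j*.x k i = x j i" using xc[of j i] j J' xk by(simp add: q_def m_assoc)
			thus "c j*.(x j i -. q j*.x k i) = 0." using xc[of j i] j J' c by(simp add: a_minus_def r_neg)
		qed auto
		hence "ALL h:insert i I. (+/j:J. c' j*.x j h) = 0." using sum c(3) by auto
		moreover have "ALL j:J. c' j:.R" using c(1) s J' by(auto simp: c'_def)
		moreover have "EX j:J. c' j ~= 0." using c(2) J' by(auto simp: c'_def)
		ultimately show ?thesis by blast
	qed
qed

text \<open>A bound on independent families in place of a basis: every sequence has a nontrivial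
  relation among its first n + 1 terms. In this form it applies directly to the iterates of an
  operator at a vector.\<close>

definition finite_dimensional :: "('k, 'n) ring_scheme => ('k, 'v, 'm) module_scheme => bool"
	where "finite_dimensional K V \<longleftrightarrow> (EX n::nat. ALL x. (ALL k. x k:.V) -->
		(EX c. (\<forall>k\<le>n. c k:.K) & (\<exists>k\<le>n. c k ~= 0.$K) & (+/$V k:{..n}. c k.*$V x k) = 0.$V))"

lemma free_space_finsum_apply:
	assumes "field K" "finite A" "!!a. a:A==>f a:.(free_space K I)"
	shows "(+/$(free_space K I) a:A. f a) i = (+/$K a:A. f a i)"
proof -
	interpret K: field K by fact
	interpret V: module K "free_space K I" by(rule free_space_module) fact
	show ?thesis by(rule add_finsum[OF V.abelian_group_axioms K.abelian_group_axioms, of "%f. f i"])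
			(use assms in "auto simp: free_space_simps")
qed

text \<open>One equation for each of the \<open>card I\<close> coordinates, in \<open>card I\<close>
  + 1 unknowns.\<close>

lemma free_space_finite_dimensional:
	assumes "field K" "finite I"
	shows "finite_dimensional K (free_space K I)"
	unfolding finite_dimensional_def
proof (intro exI[of _ "card I"] allI impI)
	interpret K: field K by fact
	interpret V: module K "free_space K I" by(rule free_space_module) fact
	fix x :: "nat => _ => _" assume x: "ALL k. x k:.(free_space K I)"
	hence xc: "x k i:.K" "i ~: I==>x k i = 0.$K" for k i
		unfolding free_space_simps by blast+
	obtain c where c: "ALL j:{..card I}. c j:.K" "EX j:{..card I}. c j ~= 0.$K"
			"ALL i:I. (+/$K j:{..card I}. c j*.$K x j i) = 0.$K"
		using K.homogeneous_system[of I "{..card I}" x] assms(2) xc by auto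
	have cl: "c j.*$(free_space K I) x j:.(free_space K I)" if "j:{..card I}" for j
		using that c(1) x by(intro V.smult_closed) auto
	have "(+/$(free_space K I) k:{..card I}. c k.*$(free_space K I) x k) = 0.$(free_space K I)"
	proof (rule ext)
		fix i
		have e: "(+/$(free_space K I) k:{..card I}. c k.*$(free_space K I) x k) i =
				(+/$K j:{..card I}. c j*.$K x j i)"
			using free_space_finsum_apply[OF assms(1) _ cl, of "{..card I}" "%k. k" i] by(simp add: free_space_simps)
		show "(+/$(free_space K I) k:{..card I}. c k.*$(free_space K I) x k) i = 0.$(free_space K I) i"
		proof (cases "i:I")
			case False
			hence "(+/$K j:{..card I}. c j*.$K x j i) = (+/$K j:{..card I}. 0.$K)"
				by(intro K.finsum_cong') (use c xc in auto)
			thus ?thesis using e by(simp add: free_space_simps)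
		qed (use c e in "simp add: free_space_simps")
	qed
	thus "EX c. (\<forall>k\<le>card I. c k:.K) & (\<exists>k\<le>card I. c k ~= 0.$K) &
			(+/$(free_space K I) k:{..card I}. c k.*$(free_space K I) x k) = 0.$(free_space K I)"
		using c(1,2) by(intro exI[of _ c]) auto
qed

lemma (in algebraically_closed) exists_root:
	assumes "set p <= car L" "length p \<ge> 2" "hd p ~= 0."
	shows "EX x:car L. eval p x = 0."
proof -
	have p: "p:.(poly_ring L)"
		using assms by(cases p) (auto simp: univ_poly_carrier[symmetric] polynomial_def)
	have "roots p ~= {#}"
		using roots_over_carrier[OF p] assms(2) unfolding splitted_def by auto
	then obtain a where "a :# roots p" by auto
	hence "is_root p a" using roots_mem_iff_is_root[OF p] by simp
	thus ?thesis by(auto simp: is_root_def)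
qed

text \<open>\<open>horner V T p v\<close> is \<open>p(T) v\<close> for the polynomial \<open>p\<close> with coefficients listed from degree 0
	upwards, the reverse of the order used by \<open>eval\<close>.\<close>

primrec horner :: "('k, 'v, 'm) module_scheme => ('v => 'v) => 'k list => 'v => 'v"
	where "horner V T [] v = 0.$V"
	| "horner V T (c # p) v = c.*$V v+.$V T (horner V T p v)"

lemma (in module) smult_eq_zeroD:
	assumes "field R" "c:.R" "c ~= 0." "x:.M" "c.*$M x = 0.$M"
	shows "x = 0.$M"
proof -
	interpret field R by fact
	have "inv c:.R" "inv c*.c = 1." using assms field_Units by auto
	thus ?thesis using smult_assoc1[of "inv c" c x] assms by simp
qed

text \<open>A relation between the iterates of \<open>T\<close> at \<open>v\<close> gives a nonzero
  polynomial p with p(T) v = 0. For a root x of p one has p(T) = (T - x) q(T), so q(T) v is an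
  eigenvector unless it vanishes, and then the shorter q takes the place of p. All these vectors
  stay in the invariant subspace \<open>Q\<close>.\<close>

lemma eigenvector:
	assumes "algebraically_closed K" "module K V" "finite_dimensional K V" "lin K V V T"
		and Q: "submodule Q K V" "!!x. x:Q==>T x:Q" "Q ~= {0.$V}"
	shows "EX c:car K. EX x:Q. x ~= 0.$V & T x = c.*$V x"
proof -
	interpret K: algebraically_closed K by fact
	interpret V: module K V by fact
	note QD = V.submoduleE[OF Q(1)]
	have T: "T x:.V" "T (x+.$V y) = T x+.$V T y" "T (c.*$V x) = c.*$V T x"
		if "x:.V" "y:.V" "c:.K" for x y c
		using assms(4) that by(auto simp: linear_map_def)
	have T1: "T x:.V" if "x:.V" for x
		using T(1)[OF that that K.zero_closed] .
	have T0: "T 0.$V = 0.$V"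
		using T(3)[OF V.zero_closed V.zero_closed K.zero_closed] T1[OF V.zero_closed] by simp
	have Tminus: "T (x -.$V y) = T x -.$V T y" if "x:.V" "y:.V" for x y
		by(rule V.additive_minus) (use that T1 T(2)[OF _ _ K.zero_closed] in auto)
	have horner_closed: "horner V T p v:Q" if "set p <= car K" "v:Q" for p v
		using that(1)
	proof (induction p)
		case Nil
		thus ?case using subgroup.one_closed[OF submodule.axioms(1)[OF Q(1)]] by simp
	qed (use that(2) QD Q(2) in auto)
	have Tpow: "(T ^^ n) v:.V" if "v:.V" for n v
		using that T1 by(induction n) auto
	have horner_snoc: "horner V T (p @ [c]) v = horner V T p v+.$V c.*$V (T ^^ length p) v"
		if p: "set p <= car K" "c:.K" and v: "v:.V" for p c v
		using p(1)
	proof (induction p)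
		case Nil
		thus ?case using p v T0 by simp
	next
		case (Cons a p)
		have h: "horner V T p v:.V" using Cons(2)
		proof (induction p)
			case (Cons b p)
			thus ?case using v T1 by auto
		qed simp
		thus ?case
			using Cons p v T1[OF h] T1[OF Tpow[OF v]] Tpow[OF v]
			by(simp add: T(2)[OF _ _ K.zero_closed] T(3)[OF _ _ p(2)] V.a_assoc)
	qed
	\<comment> \<open>Synthetic division by X - x: the coefficients of the quotient are the partial
	  Horner values. The leading coefficient is kept, so that the quotient is again usable in the
	  descent.\<close>
	have division: "EX q. set q <= car K & length p = Suc (length q) & (q ~= [] --> last q = last p) &
			(ALL v:Q. horner V T p v = (T (horner V T q v) -.$V x.*$V horner V T q v)+.$V K.eval (rev p) x.*$V v)"
		if p: "set p <= car K" "p ~= []" and x: "x:.K" for p x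
		using p
	proof (induction p)
		case (Cons c p)
		show ?case
		proof (cases "p = []")
			case True
			thus ?thesis using Cons x QD(1) by(intro exI[of _ "[]"]) (auto simp: T0 a_minus_def)
		next
			case False
			let ?e = "K.eval (rev p) x"
			have e: "?e:.K" by(rule K.eval_in_carrier) (use Cons x in auto)
			have c: "c:.K" using Cons by simp
			have ev: "K.eval (rev (c # p)) x = ?e*.$K x+.$K c"
				using K.eval_append_aux[of "rev p" c x] Cons x by simp
			obtain q where q: "set q <= car K" "length p = Suc (length q)" "q ~= [] --> last q = last p"
				"!!v. v:Q==>horner V T p v = (T (horner V T q v) -.$V x.*$V horner V T q v)+.$V ?e.*$V v"
				using Cons False by auto
			have "horner V T (c # p) v = (T (horner V T (?e # q) v) -.$V x.*$V horner V T (?e # q) v)+.$V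
					K.eval (rev (c # p)) x.*$V v" if v: "v:Q" for v
			proof -
				let ?h = "horner V T q v"
				have vc: "v:.V" and h: "?h:.V" using QD(1) v horner_closed[OF q(1) v] by auto
				have Th: "T ?h:.V" "T (T ?h):.V" "T v:.V" using T1 h vc by auto
				have Tp: "T (horner V T p v) = (T (T ?h) -.$V x.*$V T ?h)+.$V ?e.*$V T v"
					unfolding q(4)[OF v] using Th h vc x e
					by(simp add: T(2)[OF _ _ K.zero_closed] Tminus T(3)[OF _ h x] T(3)[OF _ vc e] T(3)[OF h h x] T(3)[OF vc vc e])
				have Tq: "T (horner V T (?e # q) v) = ?e.*$V T v+.$V T (T ?h)"
					using Th h vc e by(simp add: T(2)[OF _ _ K.zero_closed] T(3)[OF vc vc e])
				have evv: "K.eval (rev (c # p)) x.*$V v = x.*$V (?e.*$V v)+.$V c.*$V v"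
					unfolding ev using e x vc c by(simp add: V.smult_l_distr V.smult_assoc1 K.m_comm[OF e x])
				have gen: "c'+.$V ((a -.$V b)+.$V f) = ((f+.$V a) -.$V (g+.$V b))+.$V (g+.$V c')"
					if "a:.V" "b:.V" "c':.V" "f:.V" "g:.V" for a b c' f g
				proof -
					have "((f+.$V a) -.$V (g+.$V b))+.$V (g+.$V c') = (c'+.$V ((a -.$V b)+.$V f))+.$V (-.$V g+.$V g)"
						using that by(simp add: a_minus_def V.minus_add V.a_ac del: V.l_neg V.r_neg)
					thus ?thesis using that by(simp add: V.l_neg)
				qed
				show ?thesis
					using Th h vc x e c gen[of "T (T ?h)" "x.*$V T ?h" "c.*$V v" "?e.*$V T v" "x.*$V (?e.*$V v)"]
					unfolding evv Tq unfolding horner.simps Tp by(simp add: V.smult_r_distr)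
			qed
			moreover have "?e # q ~= [] --> last (?e # q) = last (c # p)"
			proof (cases "q = []")
				case True
				then obtain a where a: "p = [a]" using q(2) by(cases p) auto
				thus ?thesis using True Cons by simp
			qed (use q(3) False in simp)
			ultimately show ?thesis using q(1,2) e by(intro exI[of _ "?e # q"]) auto
		qed
	qed simp
	have main: "EX c:car K. EX x:Q. x ~= 0.$V & T x = c.*$V x"
		if "set p <= car K" "p ~= []" "last p ~= 0.$K" "v:Q" "v ~= 0.$V" "horner V T p v = 0.$V" for p v
		using that
	proof (induction "length p" arbitrary: p rule: less_induct)
		case less
		have vc: "v:.V" using QD(1) less by blast
		show ?case
		proof (cases "length p \<ge> 2")
			case False
			hence "length p = 1" using less(3) by(cases p) (auto simp: not_le)
			then obtain a where a: "p = [a]" by(cases p) auto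
			hence "v = 0.$V"
				using V.smult_eq_zeroD[OF K.field_axioms, of a v] less vc T0 by simp
			thus ?thesis using less by simp
		next
			case True
			then obtain x where x: "x:.K" "K.eval (rev p) x = 0.$K"
				using K.exists_root[of "rev p"] less by(auto simp: hd_rev)
			obtain q where q: "set q <= car K" "length p = Suc (length q)" "q ~= [] --> last q = last p"
				"!!v. v:Q==>horner V T p v = (T (horner V T q v) -.$V x.*$V horner V T q v)+.$V K.eval (rev p) x.*$V v"
				using division[OF less(2,3) x(1)] by blast
			let ?w = "horner V T q v"
			have w: "?w:Q" "?w:.V" using horner_closed[OF q(1) less(5)] QD(1) by auto
			have z: "T ?w -.$V x.*$V ?w = 0.$V"
				using q(4)[OF less(5)] less(7) x(2) vc T1[OF w(2)] w x(1) by simp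
			have "T ?w = (T ?w -.$V x.*$V ?w)+.$V x.*$V ?w"
				using T1[OF w(2)] w x(1) by(simp add: a_minus_def V.a_assoc V.l_neg)
			hence e: "T ?w = x.*$V ?w" unfolding z using w x(1) by simp
			show ?thesis
			proof (cases "?w = 0.$V")
				case True
				have "q ~= []" using q(2) \<open>2 \<le> length p\<close> by auto
				thus ?thesis using less(1)[of q] q True less by auto
			qed (use e w x in blast)
		qed
	qed
	obtain v where v: "v:Q" "v ~= 0.$V"
		using Q(3) subgroup.one_closed[OF submodule.axioms(1)[OF Q(1)]] by auto
	have vc: "v:.V" using v QD(1) by blast
	obtain n :: nat where n: "ALL x. (ALL k. x k:.V) -->
			(EX c. (\<forall>k\<le>n. c k:.K) & (\<exists>k\<le>n. c k ~= 0.$K) & (+/$V k:{..n}. c k.*$V x k) = 0.$V)"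
		using assms(3) unfolding finite_dimensional_def by(elim exE)
	obtain c where c: "\<forall>k\<le>n. c k:.K" "\<exists>k\<le>n. c k ~= 0.$K" "(+/$V k:{..n}. c k.*$V (T ^^ k) v) = 0.$V"
		using n[THEN spec[of _ "%k. (T ^^ k) v"]] Tpow[OF vc] by auto
	have hs: "horner V T (map c [0 ..<Suc m]) v = (+/$V k:{..m}. c k.*$V (T ^^ k) v)" if "m \<le> n" for m
		using that
	proof (induction m)
		case 0
		thus ?case using c vc T0 by simp
	next
		case (Suc m)
		have cc: "set (map c [0 ..<Suc m]) <= car K" "c (Suc m):.K" using c(1) Suc(2) by auto
		have f: "(%k. c k.*$V (T ^^ k) v):{..Suc m} \<rightarrow> car V" using c(1) Suc(2) Tpow[OF vc] by auto
		have "horner V T (map c [0 ..<Suc (Suc m)]) v = horner V T (map c [0 ..<Suc m] @ [c (Suc m)]) v" by simp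
		also have "... = (+/$V k:{..m}. c k.*$V (T ^^ k) v)+.$V c (Suc m).*$V (T ^^ Suc m) v"
			unfolding horner_snoc[OF cc vc] using Suc by simp
		also have "... = (+/$V k:{..Suc m}. c k.*$V (T ^^ k) v)"
			using V.finsum_Suc[OF f] f by(subst V.a_comm) (auto intro!: V.finsum_closed simp del: funpow.simps)
		finally show ?case .
	qed
	\<comment> \<open>Zero coefficients at the top are dropped, since the descent starts from a nonzero
	  leading coefficient.\<close>
	have strip: "EX q. set q <= car K & q ~= [] & last q ~= 0.$K & horner V T q v = horner V T p v"
		if "set p <= car K" "EX a:set p. a ~= 0.$K" for p
		using that
	proof (induction p rule: rev_induct)
		case (snoc a p)
		show ?case
		proof (cases "a = 0.$K")
			case True
			have pc: "set p <= car K" using snoc by simp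
			have "horner V T (p @ [a]) v = horner V T p v"
				using horner_snoc[OF pc _ vc, of a] True Tpow[OF vc] horner_closed[OF pc v(1)] QD(1) by auto
			thus ?thesis using snoc True by auto
		next
			case False
			thus ?thesis using snoc by(intro exI[of _ "p @ [a]"]) auto
		qed
	qed simp
	have "set (map c [0 ..<Suc n]) <= car K" using c(1) by(auto simp: less_Suc_eq_le)
	moreover obtain k where "k \<le> n" "c k ~= 0.$K" using c(2) by blast
	hence "EX a:set (map c [0 ..<Suc n]). a ~= 0.$K"
		unfolding set_map by(intro bexI[of _ "c k"] imageI) (simp_all del: upt_Suc)
	ultimately have "set (map c [0 ..<Suc n]) <= car K" "EX a:set (map c [0 ..<Suc n]). a ~= 0.$K" .
	from strip[OF this] obtain q where "set q <= car K" "q ~= []" "last q ~= 0.$K" "horner V T q v = 0.$V"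
		using hs[of n] c(3) by auto
	thus ?thesis using main v by blast
qed

text \<open>Induction over the operators: the eigenspace of one operator inside \<open>Q\<close> is
  stable under the operators that commute with it. This is why the claim is made relative to an
  invariant subspace.\<close>

lemma common_eigenvector:
	assumes K: "algebraically_closed K" "module K V" "finite_dimensional K V"
		and I: "finite I" "!!i. i:I==>lin K V V (T i)"
			"!!i j x. i:I==>j:I==>x:.V==>T i (T j x) = T j (T i x)"
		and Q: "submodule Q K V" "!!i x. i:I==>x:Q==>T i x:Q" "Q ~= {0.$V}"
	shows "EX ch. (ALL i:I. ch i:.K) & (EX x:Q. x ~= 0.$V & (ALL i:I. T i x = ch i.*$V x))"
	using I Q
proof (induction I arbitrary: Q)
	interpret V: module K V by fact
	case empty
	thus ?case using subgroup.one_closed[OF submodule.axioms(1)[OF empty(3)]] by auto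
next
	interpret V: module K V by fact
	case (insert i I)
	note QD = V.submoduleE[OF insert.prems(3)]
	have lin: "lin K V V (T i)" by(rule insert.prems(1)) simp
	hence T: "T i (x+.$V y) = T i x+.$V T i y" "T i (c.*$V x) = c.*$V T i x"
		if "x:.V" "y:.V" "c:.K" for x y c
		using that by(auto simp: linear_map_def)
	obtain c x where c: "c:.K" "x:Q" "x ~= 0.$V" "T i x = c.*$V x"
		using eigenvector[OF K lin insert.prems(3) _ insert.prems(5)] insert.prems(4) by blast
	define Q' where "Q' = {x:Q. T i x = c.*$V x}"
	have Tc: "T j y:.V" if "j:insert i I" "y:.V" for j y
		using insert.prems(1)[OF that(1)] that(2) by(auto simp: linear_map_def)
	have "submodule Q' K V"
	proof (rule V.submoduleI)
		show "0.$V:Q'"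
			using T(2)[OF V.zero_closed V.zero_closed V.R.zero_closed] Tc[of i "0.$V"] c
				subgroup.one_closed[OF submodule.axioms(1)[OF insert.prems(3)]] by(simp add: Q'_def)
		show "a+.$V b:Q'" if "a:Q'" "b:Q'" for a b
			using that QD c T(1)[of a b c] by(auto simp: Q'_def V.smult_r_distr subset_eq)
		show sm: "d.*$V a:Q'" if "d:.K" "a:Q'" for d a
			using that QD c T(2)[of a a d] by(auto simp: Q'_def V.smult_assoc1[symmetric] V.R.m_comm subset_eq)
		show "-.$V a:Q'" if "a:Q'" for a
		proof -
			have "a:.V" using that QD(1) by(auto simp: Q'_def)
			hence "-.$V a = (-.$K 1.$K).*$V a" by(simp add: V.smult_l_minus)
			thus ?thesis using sm[of "-.$K 1.$K" a] that by simp
		qed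
	qed (use QD(1) in "auto simp: Q'_def")
	moreover have "T j y:Q'" if j: "j:I" and y: "y:Q'" for j y
	proof -
		have yc: "y:.V" "y:Q" "T i y = c.*$V y" using y QD(1) by(auto simp: Q'_def)
		have "T i (T j y) = T j (T i y)" by(rule insert.prems(2)) (use j yc in auto)
		also have "... = c.*$V T j y"
			using insert.prems(1)[of j] j yc c(1) by(auto simp: linear_map_def)
		finally show ?thesis using insert.prems(4)[of j y] j yc by(simp add: Q'_def)
	qed
	moreover have "Q' ~= {0.$V}" using c by(auto simp: Q'_def)
	ultimately have "EX ch. (ALL j:I. ch j:.K) & (EX x:Q'. x ~= 0.$V & (ALL j:I. T j x = ch j.*$V x))"
		by(intro insert.IH insert.prems) auto
	then obtain ch x where x: "ALL j:I. ch j:.K" "x:Q'" "x ~= 0.$V" "ALL j:I. T j x = ch j.*$V x" by blast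
	show ?case
		using x c(1) insert.hyps by(intro exI[of _ "ch(i := c)"] conjI bexI[of _ x]) (auto simp: Q'_def)
qed

section \<open>Split Hopf algebras in terms of structure constants\<close>

text \<open>A Hopf algebra with basis \<open>I\<close>: \<open>m i j k\<close> is the coefficient of \<open>k\<close> in the product of \<open>i\<close> and
	\<open>j\<close>, \<open>d i j k\<close> that of \<open>j \<otimes> k\<close> in the coproduct of \<open>i\<close>, \<open>S i j\<close> that of \<open>j\<close> in the antipode of \<open>i\<close>;
	\<open>u\<close> is the unit, \<open>t\<close> a left integral and \<open>l\<close> an integral in the dual.  The axioms are those needed
	below, closed under passing to the dual.  The last two say
	\<open>t\<^sub>1 \<otimes> h t\<^sub>2 = S h t\<^sub>1 \<otimes> t\<^sub>2\<close> for \<open>t\<close> and for \<open>l\<close>.\<close>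

locale hopf_constants = field L for L :: "('l, 'n) ring_scheme" (structure) +
	fixes I :: "'i set" and m d :: "'i => 'i => 'i => 'l" and S :: "'i => 'i => 'l" and u ep t l :: "'i => 'l"
	assumes fin: "finite I"
		and closed[simp]: "[|i:I; j:I; k:I|]==>m i j k:.L" "[|i:I; j:I; k:I|]==>d i j k:.L"
			"[|i:I; j:I|]==>S i j:.L" "i:I==>u i:.L" "i:I==>ep i:.L"
			"i:I==>t i:.L" "i:I==>l i:.L"
		and unit_left: "[|j:I; k:I|]==>(+/i:I. u i*.m i j k) = (if j = k then 1. else 0.)"
		and unit_right: "[|i:I; k:I|]==>(+/j:I. u j*.m i j k) = (if i = k then 1. else 0.)"
		and assoc: "[|i:I; j:I; k:I; n:I|]==>(+/a:I. m i j a*.m a k n) = (+/a:I. m j k a*.m i a n)"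
		and coassoc: "[|i:I; j:I; k:I; n:I|]==>(+/a:I. d i a n*.d a j k) = (+/a:I. d i j a*.d a k n)"
		and counit_left: "[|i:I; k:I|]==>(+/j:I. ep j*.d i j k) = (if i = k then 1. else 0.)"
		and counit_right: "[|i:I; j:I|]==>(+/k:I. ep k*.d i j k) = (if i = j then 1. else 0.)"
		and bialgebra: "[|i:I; j:I; e:I; f:I|]==>(+/k:I. m i j k*.d k e f) =
				(+/a:I. +/b:I. +/c:I. +/g:I. (d i a b*.d j c g)*.(m a c e*.m b g f))"
		and ep_mult: "[|i:I; j:I|]==>(+/k:I. m i j k*.ep k) = ep i*.ep j"
		and ep_unit: "(+/i:I. u i*.ep i) = 1."
		and d_unit: "[|j:I; k:I|]==>(+/i:I. u i*.d i j k) = u j*.u k"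
		and antipode_left: "[|i:I; n:I|] ==>
				(+/k:I. +/j:I. +/a:I. S j a*.(d i j k*.m a k n)) = ep i*.u n"
		and antipode_right: "[|i:I; n:I|] ==>
				(+/j:I. +/k:I. +/a:I. S k a*.(d i j k*.m j a n)) = ep i*.u n"
		and t_integral: "[|i:I; k:I|]==>(+/j:I. t j*.m i j k) = ep i*.t k"
		and t_ep: "(+/i:I. t i*.ep i) = 1."
		and l_integral: "[|i:I; j:I|]==>(+/k:I. l k*.d i j k) = u j*.l i"
		and l_unit: "(+/i:I. l i*.u i) = 1."
		and t_shift: "[|h:I; i:I; j:I|]==>(+/b:I. (+/s:I. t s*.d s i b)*.m h b j) =
				(+/a:I. +/b:I. S h a*.(m a b i*.(+/s:I. t s*.d s b j)))"
		and l_shift: "[|h:I; i:I; j:I|]==>(+/b:I. (+/s:I. l s*.m i b s)*.d j h b) =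
				(+/a:I. +/b:I. S a h*.(d i a b*.(+/s:I. l s*.m b j s)))"
begin

lemma sum_closed[simp]: "(!!i. i:I==>f i:.L)==>(+/i:I. f i):.L" by(rule finsum_closed) auto

lemma sum_cong: "(!!i. i:I==>f i = g i)==>(!!i. i:I==>g i:.L)==>(+/i:I. f i) = (+/i:I. g i)"
	by(rule finsum_cong') auto

lemma sum_swap: "(!!i j. i:I==>j:I==>f i j:.L)==>(+/i:I. +/j:I. f i j) = (+/j:I. +/i:I. f i j)"
	by(rule finsum_swap[OF fin fin])

lemma sum_left: "c:.L==>(!!i. i:I==>f i:.L)==>c*.(+/i:I. f i) = (+/i:I. c*.f i)"
	by(rule finsum_rdistr[OF fin]) auto

lemma sum_right: "c:.L==>(!!i. i:I==>f i:.L)==>(+/i:I. f i)*.c = (+/i:I. f i*.c)"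
	by(rule finsum_ldistr[OF fin]) auto

lemma sum_delta: "a:I==>(!!i. i:I==>f i:.L)==>(+/i:I. (if i = a then 1. else 0.)*.f i) = f a"
	using finsum_delta[OF fin, of a f] sum_cong[of "%i. (if i = a then 1. else 0.)*.f i" "%i. if i = a then f i else 0."] by simp

text \<open>Product and coproduct, unit and counit, the two integrals and the two shift identities
  trade places, while the antipode is transposed. A result on commutative constants thereby yields
  one on cocommutative constants.\<close>

lemma dual: "hopf_constants L I (%i j k. d k i j) (%i j k. m j k i) (%i j. S j i) ep u l t"
proof (unfold_locales, goal_cases)
	case (9 j k)
	thus ?case using counit_left[of k j] by auto
next
	case (10 i k)
	thus ?case using counit_right[of k i] by auto
next
	case (11 i j k n)
	have "(+/a:I. d a i j*.d n a k) = (+/a:I. d n a k*.d a i j)" by(rule sum_cong) (use 11 in "auto simp: m_comm")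
	also have "... = (+/a:I. d n i a*.d a j k)" by(rule coassoc) (use 11 in auto)
	also have "... = (+/a:I. d a j k*.d n i a)" by(rule sum_cong) (use 11 in "auto simp: m_comm")
	finally show ?case .
next
	case (12 i j k n)
	have "(+/a:I. m a n i*.m j k a) = (+/a:I. m j k a*.m a n i)" by(rule sum_cong) (use 12 in "auto simp: m_comm")
	also have "... = (+/a:I. m k n a*.m j a i)" by(rule assoc) (use 12 in auto)
	also have "... = (+/a:I. m j a i*.m k n a)" by(rule sum_cong) (use 12 in "auto simp: m_comm")
	finally show ?case .
next
	case (13 i k)
	thus ?case using unit_left[of k i] by auto
next
	case (14 i j)
	thus ?case using unit_right[of j i] by auto
next
	case (15 i j e f)
	have "(+/k:I. d k i j*.m e f k) = (+/k:I. m e f k*.d k i j)" by(rule sum_cong) (use 15 in "auto simp: m_comm")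
	also have "... = (+/a:I. +/b:I. +/c:I. +/g:I. (d e a b*.d f c g)*.(m a c i*.m b g j))"
		by(rule bialgebra) (use 15 in auto)
	also have "... = (+/a:I. +/c:I. +/b:I. +/g:I. (d e a b*.d f c g)*.(m a c i*.m b g j))"
		by(rule sum_cong, rule sum_swap) (use 15 in auto)
	also have "... = (+/a:I. +/b:I. +/c:I. +/g:I. (m a b i*.m c g j)*.(d e a c*.d f b g))"
		by(intro sum_cong) (use 15 in "auto simp: m_ac")
	finally show ?case .
next
	case (16 i j)
	thus ?case using d_unit[of i j] sum_cong[of "%k. d k i j*.u k" "%k. u k*.d k i j"] by(auto simp: m_comm)
next
	case 17
	thus ?case using ep_unit sum_cong[of "%k. ep k*.u k" "%k. u k*.ep k"] by(auto simp: m_comm)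
next
	case (18 j k)
	thus ?case using ep_mult[of j k] sum_cong[of "%i. ep i*.m j k i" "%i. m j k i*.ep i"] by(auto simp: m_comm)
next
	case (19 i n)
	have "(+/k:I. +/j:I. +/a:I. S a j*.(m j k i*.d n a k)) = (+/k:I. +/a:I. +/j:I. S a j*.(m j k i*.d n a k))"
		by(rule sum_cong, rule sum_swap) (use 19 in auto)
	also have "... = (+/k:I. +/a:I. +/j:I. S a j*.(d n a k*.m j k i))"
		by(intro sum_cong) (use 19 in "auto simp: m_comm")
	also have "... = ep n*.u i" by(rule antipode_left) (use 19 in auto)
	finally show ?case using 19 by(simp add: m_comm)
next
	case (20 i n)
	have "(+/j:I. +/k:I. +/a:I. S a k*.(m j k i*.d n j a)) = (+/j:I. +/a:I. +/k:I. S a k*.(m j k i*.d n j a))"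
		by(rule sum_cong, rule sum_swap) (use 20 in auto)
	also have "... = (+/j:I. +/a:I. +/k:I. S a k*.(d n j a*.m j k i))"
		by(intro sum_cong) (use 20 in "auto simp: m_comm")
	also have "... = ep n*.u i" by(rule antipode_right) (use 20 in auto)
	finally show ?case using 20 by(simp add: m_comm)
next
	case (21 i k)
	thus ?case using l_integral[of k i] by simp
next
	case 22
	thus ?case using l_unit by simp
next
	case (23 i j)
	thus ?case using t_integral[of j i] by simp
next
	case 24
	thus ?case using t_ep by simp
next
	case (25 h i j)
	thus ?case using l_shift[of h i j] by simp
next
	case (26 h i j)
	thus ?case using t_shift[of h i j] by simp
qed (use fin in auto)

end

section \<open>Points of a commutative Hopf algebra over an algebraically closed field\<close>

locale split_hopf_constants = hopf_constants L I m d S u ep t l + algebraically_closed L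
	for L :: "('l, 'n) ring_scheme" (structure) and I :: "'i set" and m d S u ep t l +
	assumes comm: "[|i:I; j:I; k:I|]==>m i j k = m j i k"
begin

abbreviation V :: "('l, 'i => 'l) module"
	where "V \<equiv> free_space L I"

sublocale V: module L V by(rule free_space_module) (rule field_axioms)

lemma V_mem: "f:.V \<longleftrightarrow> (ALL i:I. f i:.L) & (ALL i. i ~: I --> f i = 0.)"
proof
	assume f: "(ALL i:I. f i:.L) & (ALL i. i ~: I --> f i = 0.)"
	hence "finite {i. f i ~= 0.}" by(intro finite_subset[OF _ fin]) auto
	moreover have "f i:.L" for i using f by(cases "i:I") auto
	ultimately show "f:.V" using f by(auto simp: free_space_simps)
qed (auto simp: free_space_simps)

lemma V_closed[simp]: "f:.V==>f i:.L" by(auto simp: free_space_simps)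

lemma V_eqI: "f:.V==>g:.V==>(!!i. i:I==>f i = g i)==>f = g"
	unfolding V_mem by(rule ext) metis

definition vec :: "('i => 'l) => 'i => 'l"
	where "vec f i = (if i:I then f i else 0.)"

lemma vec_apply[simp]: "i:I==>vec f i = f i" by(simp add: vec_def)

lemma vec_mem: "(!!i. i:I==>f i:.L)==>vec f:.V" by(auto simp: V_mem vec_def)

definition pair :: "('i => 'l) => ('i => 'l) => 'l"
	where "pair f g = (+/i:I. f i*.g i)"

lemma pair_closed[simp]: "(!!i. i:I==>f i:.L)==>(!!i. i:I==>g i:.L)==>pair f g:.L" by(simp add: pair_def)

text \<open>The algebra homomorphisms to \<open>L\<close>, recorded by their values on the basis:
  the points of the affine group scheme with this coordinate algebra.\<close>

definition points :: "('i => 'l) set"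
	where "points = {ph:car V. (ALL i:I. ALL j:I. (+/k:I. m i j k*.ph k) = ph i*.ph j) & (+/i:I. u i*.ph i) = 1.}"

lemma pointsD:
	assumes "ph:points"
	shows "ph:.V" "i:I==>j:I==>(+/k:I. m i j k*.ph k) = ph i*.ph j"
		"(+/i:I. u i*.ph i) = 1." "ph i:.L"
	using assms by(auto simp: points_def)

text \<open>Left multiplication by the basis element \<open>h\<close>, in coordinates: the regular
  representation.\<close>

definition T :: "'i => ('i => 'l) => 'i => 'l"
	where "T h x = vec (%k. +/j:I. m h j k*.x j)"

lemma T_closed: "h:I==>x:.V==>T h x:.V"
	unfolding T_def by(rule vec_mem) simp

lemma T_linear: "h:I==>lin L V V (T h)"
	unfolding linear_map_def
proof (intro conjI ballI funcsetI)
	assume h: "h:I"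
	fix x assume x: "x:.V"
	show "T h x:.V" by(rule T_closed[OF h x])
	show "T h (x+.$V y) = T h x+.$V T h y" if y: "y:.V" for y
	proof (rule V_eqI)
		fix k assume k: "k:I"
		have "(+/j:I. m h j k*.(x j+.y j)) = (+/j:I. m h j k*.x j+.m h j k*.y j)"
			by(rule sum_cong) (use h x y k in "auto simp: r_distr")
		also have "... = (+/j:I. m h j k*.x j)+.(+/j:I. m h j k*.y j)" by(rule finsum_addf) (use h x y k in auto)
		finally show "T h (x+.$V y) k = (T h x+.$V T h y) k" using k by(simp add: T_def free_space_simps)
	qed (use h x y T_closed in auto)
	show "T h (c.*$V x) = c.*$V T h x" if c: "c:.L" for c
	proof (rule V_eqI)
		fix k assume k: "k:I"
		have "(+/j:I. m h j k*.(c*.x j)) = (+/j:I. c*.(m h j k*.x j))"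
			by(rule sum_cong) (use h x c k in "auto simp: m_ac")
		also have "... = c*.(+/j:I. m h j k*.x j)" by(rule sum_left[symmetric]) (use h x c k in auto)
		finally show "T h (c.*$V x) k = (c.*$V T h x) k" using k by(simp add: T_def free_space_simps)
	qed (use h x c T_closed in auto)
qed

lemma T_T:
	assumes i: "i:I" and j: "j:I" and k: "k:I" and x: "x:.V"
	shows "T i (T j x) k = (+/a:I. m i j a*.T a x k)"
proof -
	have "T i (T j x) k = (+/b:I. m i b k*.(+/c:I. m j c b*.x c))"
		unfolding T_def using k by(simp, intro sum_cong) (use i j x in auto)
	also have "... = (+/b:I. +/c:I. m i b k*.(m j c b*.x c))" by(intro sum_cong sum_left) (use assms in auto)
	also have "... = (+/c:I. +/b:I. m i b k*.(m j c b*.x c))" by(rule sum_swap) (use assms in auto)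
	also have "... = (+/c:I. +/a:I. m i j a*.(m a c k*.x c))"
	proof (rule sum_cong)
		fix c assume c: "c:I"
		have "(+/b:I. m i b k*.(m j c b*.x c)) = (+/b:I. m j c b*.m i b k*.x c)"
			by(rule sum_cong) (use assms c in "auto simp: m_ac")
		also have "... = (+/b:I. m j c b*.m i b k)*.x c" by(rule sum_right[symmetric]) (use assms c in auto)
		also have "... = (+/a:I. m i j a*.m a c k)*.x c" using assoc[OF i j c k] by simp
		also have "... = (+/a:I. m i j a*.m a c k*.x c)" by(rule sum_right) (use assms c in auto)
		also have "... = (+/a:I. m i j a*.(m a c k*.x c))" by(rule sum_cong) (use assms c in "auto simp: m_assoc")
		finally show "(+/b:I. m i b k*.(m j c b*.x c)) = ..." .
	qed (use assms in auto)
	also have "... = (+/a:I. +/c:I. m i j a*.(m a c k*.x c))" by(rule sum_swap) (use assms in auto)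
	also have "... = (+/a:I. m i j a*.(+/c:I. m a c k*.x c))"
		by(intro sum_cong sum_left[symmetric]) (use assms in auto)
	finally show ?thesis using k by(simp add: T_def)
qed

lemma T_commute:
	assumes "i:I" "j:I" "x:.V"
	shows "T i (T j x) = T j (T i x)"
proof (rule V_eqI)
	fix k assume k: "k:I"
	show "T i (T j x) k = T j (T i x) k"
		unfolding T_T[OF assms(1,2) k assms(3)] T_T[OF assms(2,1) k assms(3)]
		by(rule sum_cong) (use assms k comm[of i j] T_closed in auto)
qed (use assms T_closed in auto)

lemma T_unit:
	assumes k: "k:I" and x: "x:.V"
	shows "(+/i:I. u i*.T i x k) = x k"
proof -
	have "(+/i:I. u i*.T i x k) = (+/i:I. +/j:I. u i*.(m i j k*.x j))"
		using k by(simp add: T_def, intro sum_cong sum_left) (use k x in auto)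
	also have "... = (+/j:I. +/i:I. u i*.(m i j k*.x j))" by(rule sum_swap) (use k x in auto)
	also have "... = (+/j:I. (if j = k then 1. else 0.)*.x j)"
	proof (rule sum_cong)
		fix j assume j: "j:I"
		have "(+/i:I. u i*.(m i j k*.x j)) = (+/i:I. u i*.m i j k*.x j)"
			by(rule sum_cong) (use k x j in "auto simp: m_assoc")
		also have "... = (+/i:I. u i*.m i j k)*.x j" by(rule sum_right[symmetric]) (use k x j in auto)
		finally show "(+/i:I. u i*.(m i j k*.x j)) = (if j = k then 1. else 0.)*.x j"
			using unit_left[OF j k] by simp
	qed (use x in auto)
	also have "... = x k" by(rule sum_delta[OF k]) (use x in auto)
	finally show ?thesis .
qed

text \<open>Eigenvalues multiply as the operators do and the unit acts as the identity; a nonzero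
  coordinate of the eigenvector can be cancelled.\<close>

lemma eigenvalues_point:
	assumes x: "x:.V" "x ~= 0.$V" and ch: "ch:.V" "!!h. h:I==>T h x = ch h.*$V x"
	shows "ch:points"
proof -
	obtain k where k: "k:I" "x k ~= 0."
		using x V_eqI[OF x(1) V.zero_closed] by(auto simp: free_space_simps(2))
	have Tx: "T h x k = ch h*.x k" if "h:I" for h using ch(2)[OF that] by(simp add: free_space_simps(4))
	have xk: "x k:.L" using x by simp
	have cancel: "a = b" if "a:.L" "b:.L" "a*.x k = b*.x k" for a b
		using that k(2) xk by(simp add: m_rcancel)
	have "(+/a:I. m i j a*.ch a) = ch i*.ch j" if ij: "i:I" "j:I" for i j
	proof (rule cancel)
		have "(+/a:I. m i j a*.ch a)*.x k = (+/a:I. m i j a*.ch a*.x k)" by(rule sum_right) (use ij ch x in auto)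
		also have "... = (+/a:I. m i j a*.T a x k)"
			by(rule sum_cong) (use ij ch x k Tx T_closed in "auto simp: m_assoc")
		also have "... = T i (T j x) k" by(rule T_T[symmetric]) (use ij k x in auto)
		also have "T i (T j x) = ch j.*$V T i x"
			using T_linear[OF ij(1)] x(1) ch(1) by(auto simp: ch(2)[OF ij(2)] linear_map_def)
		also have "... k = ch i*.ch j*.x k"
			using Tx[OF ij(1)] ch(1) xk by(simp add: free_space_simps(4) m_ac)
		finally show "(+/a:I. m i j a*.ch a)*.x k = ch i*.ch j*.x k" .
	qed (use ij ch in auto)
	moreover have "(+/i:I. u i*.ch i) = 1."
	proof (rule cancel)
		have "(+/i:I. u i*.ch i)*.x k = (+/i:I. u i*.ch i*.x k)" by(rule sum_right) (use ch x in auto)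
		also have "... = (+/i:I. u i*.T i x k)" by(rule sum_cong) (use ch x Tx T_closed in "auto simp: m_assoc")
		finally show "(+/i:I. u i*.ch i)*.x k = 1.*.x k" using T_unit[OF k(1) x(1)] xk by simp
	qed (use ch in auto)
	ultimately show ?thesis using ch(1) by(simp add: points_def)
qed

end

context split_hopf_constants
begin

lemma sum_prod:
	assumes "!!i. i:I==>f i:.L" "!!i. i:I==>g i:.L"
	shows "(+/i:I. f i)*.(+/j:I. g j) = (+/i:I. +/j:I. f i*.g j)"
proof -
	have "(+/i:I. f i)*.(+/j:I. g j) = (+/i:I. f i*.(+/j:I. g j))" by(rule sum_right) (use assms in auto)
	also have "... = (+/i:I. +/j:I. f i*.g j)" by(intro sum_cong sum_left) (use assms in auto)
	finally show ?thesis .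
qed

lemma sum_prod2:
	assumes "!!i j. i:I==>j:I==>f i j:.L" "!!i j. i:I==>j:I==>g i j:.L"
	shows "(+/a:I. +/b:I. f a b)*.(+/c:I. +/e:I. g c e) = (+/a:I. +/b:I. +/c:I. +/e:I. f a b*.g c e)"
proof -
	have "(+/a:I. +/b:I. f a b)*.(+/c:I. +/e:I. g c e) = (+/a:I. (+/b:I. f a b)*.(+/c:I. +/e:I. g c e))"
		by(rule sum_right) (use assms in auto)
	also have "... = (+/a:I. +/b:I. f a b*.(+/c:I. +/e:I. g c e))"
		by(intro sum_cong sum_right) (use assms in auto)
	also have "... = (+/a:I. +/b:I. +/c:I. f a b*.(+/e:I. g c e))"
		by(intro sum_cong sum_left) (use assms in auto)
	also have "... = (+/a:I. +/b:I. +/c:I. +/e:I. f a b*.g c e)"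
		by(intro sum_cong sum_left) (use assms in auto)
	finally show ?thesis .
qed

definition anti :: "('i => 'l) => 'i => 'l"
	where "anti ph = vec (%h. +/a:I. S h a*.ph a)"

definition conv :: "('i => 'l) => ('i => 'l) => 'i => 'l"
	where "conv ph ps = vec (%i. +/j:I. +/k:I. d i j k*.(ph j*.ps k))"

abbreviation cop_t :: "'i => 'i => 'l"
	where "cop_t j k \<equiv> +/s:I. t s*.d s j k"

text \<open>The coproduct of the integral \<open>t\<close> with its first leg contracted against
  \<open>ph\<close>. For a point \<open>ph\<close> the algebra acts on this vector through a
  character.\<close>

definition w :: "('i => 'l) => 'i => 'l"
	where "w ph = vec (%k. +/j:I. ph j*.cop_t j k)"

lemma anti_closed: "ph:.V==>anti ph:.V"
	unfolding anti_def by(rule vec_mem) simp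

lemma conv_closed: "ph:.V==>ps:.V==>conv ph ps:.V"
	unfolding conv_def by(rule vec_mem) simp

lemma w_closed: "ph:.V==>w ph:.V"
	unfolding w_def by(rule vec_mem) simp

text \<open>Contraction of \<open>t_shift\<close>: the antipode of \<open>h\<close> moves to the
  first leg, and since \<open>ph\<close> is multiplicative it comes out as a scalar.\<close>

lemma T_w:
	assumes ph: "ph:points" and h: "h:I"
	shows "T h (w ph) = anti ph h.*$V w ph"
proof (rule V_eqI)
	note phV = pointsD(1)[OF ph] and phc = pointsD(4)[OF ph]
	show "T h (w ph):.V" using T_closed[OF h w_closed[OF phV]] .
	show "anti ph h.*$V w ph:.V" using anti_closed[OF phV] w_closed[OF phV] by auto
	fix j assume j: "j:I"
	have "T h (w ph) j = (+/b:I. m h b j*.(+/i:I. ph i*.cop_t i b))"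
		using j by(simp add: T_def, intro sum_cong) (use h j phc in "auto simp: w_def")
	also have "... = (+/b:I. +/i:I. ph i*.(cop_t i b*.m h b j))"
	proof (rule sum_cong)
		fix b assume b: "b:I"
		have "m h b j*.(+/i:I. ph i*.cop_t i b) = (+/i:I. m h b j*.(ph i*.cop_t i b))"
			by(rule sum_left) (use h j b phc in auto)
		also have "... = (+/i:I. ph i*.(cop_t i b*.m h b j))"
			by(rule sum_cong) (use h j b phc in "auto simp: m_ac")
		finally show "m h b j*.(+/i:I. ph i*.cop_t i b) = ..." .
	qed (use h j phc in auto)
	also have "... = (+/i:I. +/b:I. ph i*.(cop_t i b*.m h b j))" by(rule sum_swap) (use h j phc in auto)
	also have "... = (+/i:I. ph i*.(+/b:I. cop_t i b*.m h b j))"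
		by(intro sum_cong sum_left[symmetric]) (use h j phc in auto)
	also have "... = (+/i:I. ph i*.(+/a:I. +/b:I. S h a*.(m a b i*.cop_t b j)))"
		by(rule sum_cong) (use h j phc t_shift in auto)
	also have "... = (+/i:I. +/a:I. +/b:I. ph i*.(S h a*.(m a b i*.cop_t b j)))"
	proof (rule sum_cong)
		fix i assume i: "i:I"
		have "ph i*.(+/a:I. +/b:I. S h a*.(m a b i*.cop_t b j)) =
				(+/a:I. ph i*.(+/b:I. S h a*.(m a b i*.cop_t b j)))" by(rule sum_left) (use h i j phc in auto)
		also have "... = (+/a:I. +/b:I. ph i*.(S h a*.(m a b i*.cop_t b j)))"
			by(intro sum_cong sum_left) (use h i j phc in auto)
		finally show "ph i*.(+/a:I. +/b:I. S h a*.(m a b i*.cop_t b j)) = ..." .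
	qed (use h j phc in auto)
	also have "... = (+/a:I. +/i:I. +/b:I. ph i*.(S h a*.(m a b i*.cop_t b j)))"
		by(rule sum_swap) (use h j phc in auto)
	also have "... = (+/a:I. +/b:I. S h a*.ph a*.(ph b*.cop_t b j))"
	proof (rule sum_cong)
		fix a assume a: "a:I"
		have "(+/i:I. +/b:I. ph i*.(S h a*.(m a b i*.cop_t b j))) =
				(+/b:I. +/i:I. ph i*.(S h a*.(m a b i*.cop_t b j)))" by(rule sum_swap) (use h j a phc in auto)
		also have "... = (+/b:I. S h a*.ph a*.(ph b*.cop_t b j))"
		proof (rule sum_cong)
			fix b assume b: "b:I"
			have "(+/i:I. ph i*.(S h a*.(m a b i*.cop_t b j))) = (+/i:I. m a b i*.ph i*.(S h a*.cop_t b j))"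
				by(rule sum_cong) (use h j a b phc in "auto simp: m_ac")
			also have "... = (+/i:I. m a b i*.ph i)*.(S h a*.cop_t b j)"
				by(rule sum_right[symmetric]) (use h j a b phc in auto)
			finally show "(+/i:I. ph i*.(S h a*.(m a b i*.cop_t b j))) = S h a*.ph a*.(ph b*.cop_t b j)"
				using h j a b phc pointsD(2)[OF ph a b] by(simp add: m_ac)
		qed (use h j a phc in auto)
		finally show "(+/i:I. +/b:I. ph i*.(S h a*.(m a b i*.cop_t b j))) = ..." .
	qed (use h j phc in auto)
	also have "... = (+/a:I. S h a*.ph a*.(+/b:I. ph b*.cop_t b j))"
		by(intro sum_cong sum_left[symmetric]) (use h j phc in auto)
	also have "... = (+/a:I. S h a*.ph a)*.(+/b:I. ph b*.cop_t b j)"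
		by(rule sum_right[symmetric]) (use h j phc in auto)
	finally show "T h (w ph) j = (anti ph h.*$V w ph) j"
		using h j by(simp add: anti_def w_def free_space_simps(4))
qed

lemma conv_apply: "i:I==>conv ph ps i = (+/j:I. +/k:I. d i j k*.(ph j*.ps k))" by(simp add: conv_def)

text \<open>The two antipode axioms with \<open>ph\<close> applied: multiplicativity of
  \<open>ph\<close> turns the products inside them into products of values.\<close>

lemma conv_anti:
	assumes ph: "ph:points" and i: "i:I"
	shows "conv ph (anti ph) i = ep i" "conv (anti ph) ph i = ep i"
proof -
	note phc = pointsD(4)[OF ph]
	have E: "(+/n:I. (ep i*.u n)*.ph n) = ep i"
	proof -
		have "(+/n:I. (ep i*.u n)*.ph n) = (+/n:I. ep i*.(u n*.ph n))"
			by(rule sum_cong) (use i phc in "auto simp: m_assoc")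
		also have "... = ep i*.(+/n:I. u n*.ph n)" by(rule sum_left[symmetric]) (use i phc in auto)
		finally show ?thesis using pointsD(3)[OF ph] i by simp
	qed
	have pull: "(+/n:I. (+/j:I. +/k:I. +/a:I. f j k a*.m' j k a n)*.ph n) = (+/j:I. +/k:I. +/a:I. f j k a*.(+/n:I. m' j k a n*.ph n))"
		if f: "!!j k a. j:I==>k:I==>a:I==>f j k a:.L"
			and m': "!!j k a n. j:I==>k:I==>a:I==>n:I==>m' j k a n:.L" for f m'
	proof -
		have "(+/n:I. (+/j:I. +/k:I. +/a:I. f j k a*.m' j k a n)*.ph n) =
				(+/n:I. +/j:I. +/k:I. +/a:I. f j k a*.m' j k a n*.ph n)"
			by(intro sum_cong) (use f m' phc in "auto simp: sum_right cong: sum_cong")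
		also have "... = (+/j:I. +/n:I. +/k:I. +/a:I. f j k a*.m' j k a n*.ph n)"
			by(rule sum_swap) (use f m' phc in auto)
		also have "... = (+/j:I. +/k:I. +/n:I. +/a:I. f j k a*.m' j k a n*.ph n)"
			by(rule sum_cong, rule sum_swap) (use f m' phc in auto)
		also have "... = (+/j:I. +/k:I. +/a:I. +/n:I. f j k a*.m' j k a n*.ph n)"
			by(rule sum_cong, rule sum_cong, rule sum_swap) (use f m' phc in auto)
		also have "... = (+/j:I. +/k:I. +/a:I. f j k a*.(+/n:I. m' j k a n*.ph n))"
			by(intro sum_cong) (use f m' phc in "auto simp: sum_left m_assoc cong: sum_cong")
		finally show ?thesis .
	qed
	have "conv ph (anti ph) i = (+/j:I. +/k:I. d i j k*.(ph j*.(+/a:I. S k a*.ph a)))"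
		unfolding conv_apply[OF i] by(intro sum_cong) (use i phc in "auto simp: anti_def")
	also have "... = (+/j:I. +/k:I. +/a:I. (S k a*.d i j k)*.(+/n:I. m j a n*.ph n))"
	proof (intro sum_cong)
		fix j k assume jk: "j:I" "k:I"
		have "d i j k*.(ph j*.(+/a:I. S k a*.ph a)) = (d i j k*.ph j)*.(+/a:I. S k a*.ph a)"
			using i jk phc by(simp add: m_assoc)
		also have "... = (+/a:I. (d i j k*.ph j)*.(S k a*.ph a))" by(rule sum_left) (use i jk phc in auto)
		also have "... = (+/a:I. (S k a*.d i j k)*.(+/n:I. m j a n*.ph n))"
			by(rule sum_cong) (use i jk phc pointsD(2)[OF ph jk(1)] in "auto simp: m_ac")
		finally show "d i j k*.(ph j*.(+/a:I. S k a*.ph a)) = ..." .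
	qed (use i phc in auto)
	also have "... = (+/n:I. (+/j:I. +/k:I. +/a:I. (S k a*.d i j k)*.m j a n)*.ph n)"
		by(rule pull[symmetric]) (use i in auto)
	also have "... = (+/n:I. (ep i*.u n)*.ph n)"
	proof (rule sum_cong)
		fix n assume n: "n:I"
		have "(+/j:I. +/k:I. +/a:I. (S k a*.d i j k)*.m j a n) = (+/j:I. +/k:I. +/a:I. S k a*.(d i j k*.m j a n))"
			by(intro sum_cong) (use i n in "auto simp: m_assoc")
		thus "(+/j:I. +/k:I. +/a:I. (S k a*.d i j k)*.m j a n)*.ph n = (ep i*.u n)*.ph n"
			using antipode_right[OF i n] by simp
	qed (use i phc in auto)
	finally show "conv ph (anti ph) i = ep i" using E by simp
	have "conv (anti ph) ph i = (+/j:I. +/k:I. d i j k*.((+/a:I. S j a*.ph a)*.ph k))"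
		unfolding conv_apply[OF i] by(intro sum_cong) (use i phc in "auto simp: anti_def")
	also have "... = (+/k:I. +/j:I. d i j k*.((+/a:I. S j a*.ph a)*.ph k))"
		by(rule sum_swap) (use i phc in auto)
	also have "... = (+/k:I. +/j:I. +/a:I. (S j a*.d i j k)*.(+/n:I. m a k n*.ph n))"
	proof (intro sum_cong)
		fix k j assume jk: "k:I" "j:I"
		have "d i j k*.((+/a:I. S j a*.ph a)*.ph k) = (d i j k*.ph k)*.(+/a:I. S j a*.ph a)"
			using i jk phc by(simp add: m_ac)
		also have "... = (+/a:I. (d i j k*.ph k)*.(S j a*.ph a))" by(rule sum_left) (use i jk phc in auto)
		also have "... = (+/a:I. (S j a*.d i j k)*.(+/n:I. m a k n*.ph n))"
			by(rule sum_cong) (use i jk phc pointsD(2)[OF ph _ jk(1)] in "auto simp: m_ac")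
		finally show "d i j k*.((+/a:I. S j a*.ph a)*.ph k) = ..." .
	qed (use i phc in auto)
	also have "... = (+/n:I. (+/k:I. +/j:I. +/a:I. (S j a*.d i j k)*.m a k n)*.ph n)"
		by(rule pull[symmetric]) (use i in auto)
	also have "... = (+/n:I. (ep i*.u n)*.ph n)"
	proof (rule sum_cong)
		fix n assume n: "n:I"
		have "(+/k:I. +/j:I. +/a:I. (S j a*.d i j k)*.m a k n) = (+/k:I. +/j:I. +/a:I. S j a*.(d i j k*.m a k n))"
			by(intro sum_cong) (use i n in "auto simp: m_assoc")
		thus "(+/k:I. +/j:I. +/a:I. (S j a*.d i j k)*.m a k n)*.ph n = (ep i*.u n)*.ph n"
			using antipode_left[OF i n] by simp
	qed (use i phc in auto)
	finally show "conv (anti ph) ph i = ep i" using E by simp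
qed

lemma pair_w:
	assumes ph: "ph:.V" and ps: "ps:.V"
	shows "pair ps (w ph) = (+/s:I. t s*.conv ph ps s)"
proof -
	have "pair ps (w ph) = (+/k:I. ps k*.(+/j:I. ph j*.cop_t j k))"
		unfolding pair_def by(rule sum_cong) (use ph ps in "auto simp: w_def")
	also have "... = (+/k:I. +/j:I. +/s:I. t s*.(d s j k*.(ph j*.ps k)))"
	proof (rule sum_cong)
		fix k assume k: "k:I"
		have "ps k*.(+/j:I. ph j*.cop_t j k) = (+/j:I. ps k*.(ph j*.cop_t j k))"
			by(rule sum_left) (use k ph ps in auto)
		also have "... = (+/j:I. +/s:I. t s*.(d s j k*.(ph j*.ps k)))"
		proof (rule sum_cong)
			fix j assume j: "j:I"
			have "ps k*.(ph j*.cop_t j k) = (ps k*.ph j)*.cop_t j k"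
				using j k ph ps by(simp add: m_assoc)
			also have "... = (+/s:I. (ps k*.ph j)*.(t s*.d s j k))" by(rule sum_left) (use j k ph ps in auto)
			also have "... = (+/s:I. t s*.(d s j k*.(ph j*.ps k)))" by(rule sum_cong) (use j k ph ps in "auto simp: m_ac")
			finally show "ps k*.(ph j*.cop_t j k) = ..." .
		qed (use k ph ps in auto)
		finally show "ps k*.(+/j:I. ph j*.cop_t j k) = ..." .
	qed (use ph ps in auto)
	also have "... = (+/j:I. +/k:I. +/s:I. t s*.(d s j k*.(ph j*.ps k)))" by(rule sum_swap) (use ph ps in auto)
	also have "... = (+/j:I. +/s:I. +/k:I. t s*.(d s j k*.(ph j*.ps k)))"
		by(rule sum_cong, rule sum_swap) (use ph ps in auto)
	also have "... = (+/s:I. +/j:I. +/k:I. t s*.(d s j k*.(ph j*.ps k)))" by(rule sum_swap) (use ph ps in auto)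
	also have "... = (+/s:I. t s*.conv ph ps s)"
		by(rule sum_cong) (use ph ps in "auto simp: conv_apply sum_left cong: sum_cong")
	finally show ?thesis .
qed

text \<open>By \<open>pair_w\<close> the value is the convolution of \<open>ph\<close> and
  \<open>anti ph\<close> taken at \<open>t\<close>, that is the counit of \<open>t\<close>. In
  particular \<open>w ph\<close> is not 0.\<close>

lemma pair_anti_w: "ph:points==>pair (anti ph) (w ph) = 1."
	using pair_w[OF pointsD(1) anti_closed[OF pointsD(1)]] t_ep
		sum_cong[of "%s. t s*.conv ph (anti ph) s" "%s. t s*.ep s"] by(simp add: conv_anti)

lemma w_nonzero: "ph:points==>w ph ~= 0.$V"
proof
	assume ph: "ph:points" and 0: "w ph = 0.$V"
	note ac = V_closed[OF anti_closed[OF pointsD(1)[OF ph]]]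
	have "pair (anti ph) (w ph) = (+/i:I. 0.)"
		unfolding pair_def 0 by(rule sum_cong) (use ac in "auto simp: free_space_simps(2)")
	thus False using pair_anti_w[OF ph] by simp
qed

text \<open>The values of \<open>anti ph\<close> are the eigenvalues on the nonzero vector
  \<open>w ph\<close>, and this makes them multiplicative; no multiplicativity of the antipode
  enters.\<close>

lemma anti_point: "ph:points==>anti ph:points"
	by(rule eigenvalues_point[OF w_closed w_nonzero anti_closed T_w]) (auto dest: pointsD)

text \<open>\<open>bialgebra\<close> expresses that the coproduct is multiplicative, so points
  applied to its two legs give a multiplicative map; the rest is a reordering of sixfold
  sums.\<close>

lemma conv_point:
	assumes ph: "ph:points" and ps: "ps:points"
	shows "conv ph ps:points"
proof -
	note phc = pointsD(4)[OF ph] and psc = pointsD(4)[OF ps]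
	have cc: "conv ph ps:.V" by(rule conv_closed) (use pointsD(1) ph ps in auto)
	have "(+/k:I. m i j k*.conv ph ps k) = conv ph ps i*.conv ph ps j" if i: "i:I" and j: "j:I" for i j
	proof -
		have "(+/k:I. m i j k*.conv ph ps k) = (+/k:I. +/e:I. +/f:I. (m i j k*.d k e f)*.(ph e*.ps f))"
			by(intro sum_cong) (use i j phc psc in "auto simp: conv_apply sum_left m_assoc cong: sum_cong")
		also have "... = (+/e:I. +/k:I. +/f:I. (m i j k*.d k e f)*.(ph e*.ps f))"
			by(rule sum_swap) (use i j phc psc in auto)
		also have "... = (+/e:I. +/f:I. +/k:I. (m i j k*.d k e f)*.(ph e*.ps f))"
			by(rule sum_cong, rule sum_swap) (use i j phc psc in auto)
		also have "... = (+/e:I. +/f:I. (+/k:I. m i j k*.d k e f)*.(ph e*.ps f))"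
			by(intro sum_cong sum_right[symmetric]) (use i j phc psc in auto)
		also have "... = (+/e:I. +/f:I. (+/a:I. +/b:I. +/c:I. +/g:I. (d i a b*.d j c g)*.(m a c e*.m b g f))*.(ph e*.ps f))"
			by(intro sum_cong) (use i j phc psc in "auto simp: bialgebra")
		also have "... = (+/e:I. +/f:I. +/a:I. +/b:I. +/c:I. +/g:I. ((d i a b*.d j c g)*.(m a c e*.m b g f))*.(ph e*.ps f))"
			by(intro sum_cong) (use i j phc psc in "auto simp: sum_right cong: sum_cong")
		also have "... = (+/e:I. +/f:I. +/a:I. +/b:I. +/c:I. +/g:I. (d i a b*.d j c g)*.((m a c e*.ph e)*.(m b g f*.ps f)))"
			by(intro sum_cong) (use i j phc psc in "auto simp: m_ac")
		also have "... = (+/a:I. +/b:I. +/c:I. +/g:I. +/e:I. +/f:I. (d i a b*.d j c g)*.((m a c e*.ph e)*.(m b g f*.ps f)))"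
		proof -
			let ?t = "%a b c g e f. (d i a b*.d j c g)*.((m a c e*.ph e)*.(m b g f*.ps f))"
			have sw: "(+/e:I. +/f:I. +/a:I. F a e f) = (+/a:I. +/e:I. +/f:I. F a e f)"
				if F: "!!a e f. a:I==>e:I==>f:I==>F a e f:.L" for F
			proof -
				have "(+/e:I. +/f:I. +/a:I. F a e f) = (+/e:I. +/a:I. +/f:I. F a e f)"
					by(rule sum_cong, rule sum_swap) (use F in auto)
				also have "... = (+/a:I. +/e:I. +/f:I. F a e f)" by(rule sum_swap) (use F in auto)
				finally show ?thesis .
			qed
			note c = i j phc psc
			have "(+/e:I. +/f:I. +/a:I. +/b:I. +/c:I. +/g:I. ?t a b c g e f) = (+/a:I. +/e:I. +/f:I. +/b:I. +/c:I. +/g:I. ?t a b c g e f)"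
				by(rule sw) (use c in auto)
			also have "... = (+/a:I. +/b:I. +/e:I. +/f:I. +/c:I. +/g:I. ?t a b c g e f)"
				by(rule sum_cong, rule sw) (use c in auto)
			also have "... = (+/a:I. +/b:I. +/c:I. +/e:I. +/f:I. +/g:I. ?t a b c g e f)"
				by(rule sum_cong, rule sum_cong, rule sw) (use c in auto)
			also have "... = (+/a:I. +/b:I. +/c:I. +/g:I. +/e:I. +/f:I. ?t a b c g e f)"
				by(rule sum_cong, rule sum_cong, rule sum_cong, rule sw) (use c in auto)
			finally show ?thesis .
		qed
		also have "... = (+/a:I. +/b:I. +/c:I. +/g:I. (d i a b*.(ph a*.ps b))*.(d j c g*.(ph c*.ps g)))"
		proof (intro sum_cong)
			fix a b c g assume I: "a:I" "b:I" "c:I" "g:I"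
			have "(+/e:I. +/f:I. (d i a b*.d j c g)*.((m a c e*.ph e)*.(m b g f*.ps f))) =
					(d i a b*.d j c g)*.((+/e:I. m a c e*.ph e)*.(+/f:I. m b g f*.ps f))"
			proof -
				have "(+/e:I. m a c e*.ph e)*.(+/f:I. m b g f*.ps f) =
						(+/e:I. +/f:I. (m a c e*.ph e)*.(m b g f*.ps f))" by(rule sum_prod) (use I phc psc in auto)
				moreover have "(d i a b*.d j c g)*.(+/e:I. +/f:I. (m a c e*.ph e)*.(m b g f*.ps f)) =
						(+/e:I. (d i a b*.d j c g)*.(+/f:I. (m a c e*.ph e)*.(m b g f*.ps f)))"
					by(rule sum_left) (use I i j phc psc in auto)
				moreover have "... = (+/e:I. +/f:I. (d i a b*.d j c g)*.((m a c e*.ph e)*.(m b g f*.ps f)))"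
					by(rule sum_cong, rule sum_left) (use I i j phc psc in auto)
				ultimately show ?thesis by simp
			qed
			thus "(+/e:I. +/f:I. (d i a b*.d j c g)*.((m a c e*.ph e)*.(m b g f*.ps f))) =
					(d i a b*.(ph a*.ps b))*.(d j c g*.(ph c*.ps g))"
				using I i j phc psc by(simp add: pointsD(2)[OF ph] pointsD(2)[OF ps] m_ac)
		qed (use i j phc psc in auto)
		also have "... = conv ph ps i*.conv ph ps j"
			using i j phc psc by(simp add: conv_apply sum_prod2 cong: sum_cong)
		finally show ?thesis .
	qed
	moreover have "(+/i:I. u i*.conv ph ps i) = 1."
	proof -
		have "(+/i:I. u i*.conv ph ps i) = (+/i:I. +/j:I. +/k:I. (u i*.d i j k)*.(ph j*.ps k))"
			by(intro sum_cong) (use phc psc in "auto simp: conv_apply sum_left m_assoc cong: sum_cong")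
		also have "... = (+/j:I. +/i:I. +/k:I. (u i*.d i j k)*.(ph j*.ps k))"
			by(rule sum_swap) (use phc psc in auto)
		also have "... = (+/j:I. +/k:I. +/i:I. (u i*.d i j k)*.(ph j*.ps k))"
			by(rule sum_cong, rule sum_swap) (use phc psc in auto)
		also have "... = (+/j:I. +/k:I. (+/i:I. u i*.d i j k)*.(ph j*.ps k))"
			by(intro sum_cong sum_right[symmetric]) (use phc psc in auto)
		also have "... = (+/j:I. +/k:I. (u j*.ph j)*.(u k*.ps k))"
			by(intro sum_cong) (use phc psc in "auto simp: d_unit m_ac")
		also have "... = (+/j:I. u j*.ph j)*.(+/k:I. u k*.ps k)"
			using phc psc by(simp add: sum_prod)
		finally show ?thesis by(simp add: pointsD(3)[OF ph] pointsD(3)[OF ps])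
	qed
	ultimately show ?thesis using cc by(simp add: points_def)
qed

lemma conv_assoc:
	assumes ph: "ph:.V" and ps: "ps:.V" and ch: "ch:.V"
	shows "conv (conv ph ps) ch = conv ph (conv ps ch)"
proof (rule V_eqI)
	fix i assume i: "i:I"
	have "conv (conv ph ps) ch i = (+/a:I. +/n:I. d i a n*.((+/j:I. +/k:I. d a j k*.(ph j*.ps k))*.ch n))"
		unfolding conv_apply[OF i] by(intro sum_cong) (use i ph ps ch in "auto simp: conv_apply")
	also have "... = (+/a:I. +/n:I. +/j:I. +/k:I. (d i a n*.d a j k)*.(ph j*.ps k*.ch n))"
		by(intro sum_cong) (use i ph ps ch in "auto simp: sum_right sum_left m_assoc cong: sum_cong")
	also have "... = (+/n:I. +/a:I. +/j:I. +/k:I. (d i a n*.d a j k)*.(ph j*.ps k*.ch n))"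
		by(rule sum_swap) (use i ph ps ch in auto)
	also have "... = (+/n:I. +/j:I. +/a:I. +/k:I. (d i a n*.d a j k)*.(ph j*.ps k*.ch n))"
		by(rule sum_cong, rule sum_swap) (use i ph ps ch in auto)
	also have "... = (+/n:I. +/j:I. +/k:I. +/a:I. (d i a n*.d a j k)*.(ph j*.ps k*.ch n))"
		by(rule sum_cong, rule sum_cong, rule sum_swap) (use i ph ps ch in auto)
	also have "... = (+/n:I. +/j:I. +/k:I. (+/a:I. d i a n*.d a j k)*.(ph j*.ps k*.ch n))"
		by(intro sum_cong sum_right[symmetric]) (use i ph ps ch in auto)
	also have "... = (+/n:I. +/j:I. +/k:I. (+/a:I. d i j a*.d a k n)*.(ph j*.ps k*.ch n))"
		by(intro sum_cong) (use i ph ps ch in "auto simp: coassoc")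
	also have "... = (+/j:I. +/n:I. +/k:I. (+/a:I. d i j a*.d a k n)*.(ph j*.ps k*.ch n))"
		by(rule sum_swap) (use i ph ps ch in auto)
	also have "... = (+/j:I. +/k:I. +/n:I. (+/a:I. d i j a*.d a k n)*.(ph j*.ps k*.ch n))"
		by(rule sum_cong, rule sum_swap) (use i ph ps ch in auto)
	also have "... = (+/j:I. +/k:I. +/n:I. +/a:I. (d i j a*.d a k n)*.(ph j*.ps k*.ch n))"
		by(intro sum_cong sum_right) (use i ph ps ch in auto)
	also have "... = (+/j:I. +/k:I. +/a:I. +/n:I. (d i j a*.d a k n)*.(ph j*.ps k*.ch n))"
		by(rule sum_cong, rule sum_cong, rule sum_swap) (use i ph ps ch in auto)
	also have "... = (+/j:I. +/a:I. +/k:I. +/n:I. (d i j a*.d a k n)*.(ph j*.ps k*.ch n))"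
		by(rule sum_cong, rule sum_swap) (use i ph ps ch in auto)
	also have "... = (+/j:I. +/a:I. +/k:I. +/n:I. d i j a*.(ph j*.(d a k n*.(ps k*.ch n))))"
		by(intro sum_cong) (use i ph ps ch in "auto simp: m_ac")
	also have "... = (+/j:I. +/a:I. d i j a*.(ph j*.(+/k:I. +/n:I. d a k n*.(ps k*.ch n))))"
		by(intro sum_cong) (use i ph ps ch in "auto simp: sum_left cong: sum_cong")
	also have "... = conv ph (conv ps ch) i"
		unfolding conv_apply[OF i] by(intro sum_cong) (use i ph ps ch in "auto simp: conv_apply")
	finally show "conv (conv ph ps) ch i = ..." .
qed (use assms conv_closed in auto)

lemma counit_point: "vec ep:points"
proof -
	have "(+/k:I. m i j k*.vec ep k) = ep i*.ep j" if "i:I" "j:I" for i j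
		using that ep_mult[OF that] sum_cong[of "%k. m i j k*.vec ep k" "%k. m i j k*.ep k"] by simp
	moreover have "(+/i:I. u i*.vec ep i) = 1."
		using ep_unit sum_cong[of "%k. u k*.vec ep k" "%k. u k*.ep k"] by simp
	ultimately show ?thesis by(simp add: points_def vec_mem)
qed

lemma conv_counit: "ph:.V==>conv (vec ep) ph = ph"
proof (rule V_eqI)
	fix i assume ph: "ph:.V" and i: "i:I"
	have "conv (vec ep) ph i = (+/j:I. +/k:I. (ep j*.d i j k)*.ph k)"
		unfolding conv_apply[OF i] by(intro sum_cong) (use i ph in "auto simp: m_ac")
	also have "... = (+/k:I. +/j:I. (ep j*.d i j k)*.ph k)" by(rule sum_swap) (use i ph in auto)
	also have "... = (+/k:I. (+/j:I. ep j*.d i j k)*.ph k)" by(intro sum_cong sum_right[symmetric]) (use i ph in auto)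
	also have "... = (+/k:I. (if k = i then 1. else 0.)*.ph k)" by(rule sum_cong) (use i ph counit_left in auto)
	also have "... = ph i" by(rule sum_delta[OF i]) (use ph in auto)
	finally show "conv (vec ep) ph i = ..." .
qed (auto intro!: conv_closed vec_mem)

section \<open>The finite group of points and its idempotents\<close>

definition PG :: "('i => 'l) monoid"
	where "PG = \<lparr>carrier = points, monoid.mult = conv, one = vec ep\<rparr>"

lemma PG_simps[simp]: "car PG = points" "ph*.$PG ps = conv ph ps" "1.$PG = vec ep" by(simp_all add: PG_def)

lemma conv_anti_eq:
	assumes ph: "ph:points" shows "conv ph (anti ph) = vec ep" "conv (anti ph) ph = vec ep"
	using conv_anti[OF ph] pointsD(1)[OF ph] anti_closed by(auto intro!: V_eqI conv_closed vec_mem)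

lemma group_PG: "group PG"
proof (rule groupI)
	show "EX y:car PG. y*.$PG x = 1.$PG" if "x:.PG" for x
		using that conv_anti_eq(2)[of x] anti_point by auto
qed (auto simp: conv_point counit_point conv_assoc conv_counit pointsD(1))

sublocale PG: group PG by(rule group_PG)

lemma PG_inv: "ph:points==>inv$PG ph = anti ph"
	using PG.inv_equality[of "anti ph" ph] conv_anti_eq anti_point by simp

lemma anti_anti: "ph:points==>anti (anti ph) = ph"
	using PG.inv_inv[of ph] by(simp add: PG_inv anti_point)

lemma pair_T:
	assumes ps: "ps:points" and h: "h:I" and x: "x:.V"
	shows "pair ps (T h x) = ps h*.pair ps x"
proof -
	note psc = pointsD(4)[OF ps]
	have "pair ps (T h x) = (+/k:I. +/j:I. (m h j k*.ps k)*.x j)"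
		unfolding pair_def T_def by(intro sum_cong) (use h x psc in "auto simp: sum_left m_ac cong: sum_cong")
	also have "... = (+/j:I. +/k:I. (m h j k*.ps k)*.x j)" by(rule sum_swap) (use h x psc in auto)
	also have "... = (+/j:I. (+/k:I. m h j k*.ps k)*.x j)" by(intro sum_cong sum_right[symmetric]) (use h x psc in auto)
	also have "... = (+/j:I. ps h*.(ps j*.x j))"
		by(rule sum_cong) (use h x psc pointsD(2)[OF ps h] in "auto simp: m_assoc")
	also have "... = ps h*.pair ps x" unfolding pair_def by(rule sum_left[symmetric]) (use h x psc in auto)
	finally show ?thesis .
qed

lemma pair_smult: "c:.L==>ps:.V==>x:.V==>pair ps (c.*$V x) = c*.pair ps x"
	unfolding pair_def by(subst sum_left) (auto simp: free_space_simps(4) m_ac intro!: sum_cong)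

lemma pair_add: "ps:.V==>x:.V==>y:.V==>pair ps (x+.$V y) = pair ps x+.pair ps y"
	unfolding pair_def by(subst finsum_addf[symmetric]) (auto simp: free_space_simps(3) r_distr intro!: sum_cong)

lemma pair_zero: "ps:.V==>pair ps 0.$V = 0."
	using pair_smult[of \<zero> ps "0.$V"] by simp

text \<open>The orthogonal idempotents belonging to the points, see \<open>b_mult\<close> and
  \<open>sum_b\<close>. The twist by \<open>anti\<close> makes the eigenvalues on
  \<open>b ph\<close> those of \<open>ph\<close> itself.\<close>

definition b :: "('i => 'l) => 'i => 'l"
	where "b ph = w (anti ph)"

lemma b_closed: "ph:points==>b ph:.V"
	unfolding b_def by(rule w_closed) (auto intro: pointsD anti_point)

text \<open>The value of the character \<open>ps\<close> at the product of \<open>h\<close> and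
  \<open>b ph\<close> can be computed with the factor ps h or with the factor ph h, so the pairing
  vanishes once these differ for some \<open>h\<close>. On the diagonal it is
  \<open>pair_anti_w\<close>.\<close>

lemma pair_b:
	assumes ph: "ph:points" and ps: "ps:points"
	shows "pair ps (b ph) = (if ps = ph then 1. else 0.)"
proof (cases "ps = ph")
	case True
	thus ?thesis using pair_anti_w[OF anti_point[OF ph]] by(simp add: b_def anti_anti[OF ph])
next
	case False
	have bc: "b ph:.V" by(rule b_closed[OF ph])
	obtain h where h: "h:I" "ps h ~= ph h" using False V_eqI pointsD(1) ph ps by blast
	have "T h (b ph) = ph h.*$V b ph" unfolding b_def using T_w[OF anti_point[OF ph] h(1)] by(simp add: anti_anti[OF ph])
	hence e: "ps h*.pair ps (b ph) = ph h*.pair ps (b ph)"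
		using pair_T[OF ps h(1) bc] pair_smult[OF pointsD(4)[OF ph] pointsD(1)[OF ps] bc] by simp
	have pc: "pair ps (b ph):.L" by(rule pair_closed) (use pointsD(4)[OF ps] bc in auto)
	have "pair ps (b ph) = 0."
	proof (rule ccontr)
		assume "pair ps (b ph) ~= 0."
		hence "ps h = ph h" using m_rcancel[OF _ pc pointsD(4)[OF ps] pointsD(4)[OF ph]] e by blast
		thus False using h by simp
	qed
	thus ?thesis using False by simp
qed

text \<open>The radical of the pairing is stable under multiplication; a common eigenvector \<open>v\<close> in it has
	an eigencharacter \<open>ch\<close> with \<open>ch v = 0\<close>, and contracting \<open>t_shift\<close> with \<open>v\<close> gives \<open>v = 0\<close>.\<close>

lemma points_separate:
	assumes x: "x:.V" "!!ph. ph:points==>pair ph x = 0."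
	shows "x = 0.$V"
proof (rule ccontr)
	assume nz: "x ~= 0.$V"
	define Q where "Q = {x:car V. ALL ph:points. pair ph x = 0.}"
	have Q: "submodule Q L V"
	proof (rule V.submoduleI)
		show "0.$V:Q" using pair_zero pointsD(1) by(auto simp: Q_def)
		show sm: "c.*$V a:Q" if "c:.L" "a:Q" for c a
			using that by(auto simp: Q_def pair_smult pointsD(1))
		show "-.$V a:Q" if "a:Q" for a
			using sm[of "-. 1." a] that by(simp add: Q_def V.smult_l_minus)
		show "a+.$V c:Q" if "a:Q" "c:Q" for a c
			using that by(auto simp: Q_def pair_add pointsD(1))
	qed (auto simp: Q_def)
	have TQ: "T h a:Q" if "h:I" "a:Q" for h a
		using that pointsD(4) by(auto simp: Q_def pair_T T_closed)
	have "x:Q" using x by(simp add: Q_def)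
	hence "Q ~= {0.$V}" using nz by blast
	have "EX ch. (ALL i:I. ch i:.L) & (EX x:Q. x ~= 0.$V & (ALL i:I. T i x = ch i.*$V x))"
		by(rule common_eigenvector[OF algebraically_closed_axioms V.module_axioms free_space_finite_dimensional[OF field_axioms fin] fin])
			(fact T_linear T_commute Q TQ \<open>Q \<noteq> {\<zero>\<^bsub>V\<^esub>}\<close>)+
	then obtain ch' v where v: "ALL h:I. ch' h:.L" "v:Q" "v ~= 0.$V" "ALL h:I. T h v = ch' h.*$V v" by blast
	define ch where "ch = vec ch'"
	have vc: "v:.V" using v by(simp add: Q_def)
	have ch: "ch:points" by(rule eigenvalues_point[OF vc v(3)]) (use v in "auto simp: ch_def intro: vec_mem")
	note chc = pointsD(4)[OF ch]
	have Tv: "T h v j = ch h*.v j" if "h:I" "j:I" for h j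
		using v(4) that by(simp add: ch_def free_space_simps(4))
	let ?ph = "anti ch"
	have ph: "?ph:points" by(rule anti_point[OF ch])
	have wc: "w ?ph:.V" by(rule w_closed[OF pointsD(1)[OF ph]])
	have "v j = 0." if j: "j:I" for j
	proof -
		\<comment> \<open>The product of \<open>v\<close> and \<open>w ?ph\<close>, in both orders. One
		  order gives ch(v) times \<open>w ?ph\<close>, which is 0; the other, by commutativity, gives
		  ch(w ?ph) times \<open>v\<close>, and ch(w ?ph) = 1.\<close>
		have "(+/h:I. v h*.T h (w ?ph) j) = (+/h:I. (v h*.ch h)*.w ?ph j)"
			by(rule sum_cong) (use T_w[OF ph] vc wc chc in "auto simp: anti_anti[OF ch] free_space_simps(4) m_assoc")
		also have "... = (+/h:I. v h*.ch h)*.w ?ph j" by(rule sum_right[symmetric]) (use vc wc chc in auto)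
		also have "(+/h:I. v h*.ch h) = pair ch v" unfolding pair_def by(rule sum_cong) (use vc chc in "auto simp: m_comm")
		also have "pair ch v = 0." using v(2) ch by(simp add: Q_def)
		finally have z: "(+/h:I. v h*.T h (w ?ph) j) = 0." using wc by simp
		have "(+/h:I. v h*.T h (w ?ph) j) = (+/h:I. +/k:I. w ?ph k*.(m k h j*.v h))"
		proof (rule sum_cong)
			fix h assume h: "h:I"
			have "v h*.T h (w ?ph) j = (+/k:I. v h*.(m h k j*.w ?ph k))"
				unfolding T_def using j by(simp, intro sum_left) (use h j vc wc in auto)
			also have "... = (+/k:I. w ?ph k*.(m k h j*.v h))"
				by(rule sum_cong) (use h j vc wc comm[of h _ j] in "auto simp: m_ac")
			finally show "v h*.T h (w ?ph) j = ..." .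
		qed (use j vc wc in auto)
		also have "... = (+/k:I. +/h:I. w ?ph k*.(m k h j*.v h))" by(rule sum_swap) (use j vc wc in auto)
		also have "... = (+/k:I. (ch k*.w ?ph k)*.v j)"
		proof (rule sum_cong)
			fix k assume k: "k:I"
			have "(+/h:I. w ?ph k*.(m k h j*.v h)) = w ?ph k*.T k v j"
				unfolding T_def using j by(simp, intro sum_left[symmetric]) (use k j vc wc in auto)
			thus "(+/h:I. w ?ph k*.(m k h j*.v h)) = (ch k*.w ?ph k)*.v j"
				using vc wc chc by(simp add: Tv[OF k j] m_ac)
		qed (use vc wc chc in auto)
		also have "... = pair ch (w ?ph)*.v j" unfolding pair_def by(rule sum_right[symmetric]) (use vc wc chc in auto)
		also have "pair ch (w ?ph) = 1." using pair_anti_w[OF ph] by(simp add: anti_anti[OF ch])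
		finally show ?thesis using z vc by simp
	qed
	hence "v = 0.$V" by(intro V_eqI[OF vc V.zero_closed]) (simp add: free_space_simps(2))
	thus False using v(3) by simp
qed

lemma pair_sum:
	assumes "finite J" "!!a. a:J==>c a:.L" "!!a. a:J==>x a:.V" "ps:.V"
	shows "(+/i:I. ps i*.(+/a:J. c a*.x a i)) = (+/a:J. c a*.pair ps (x a))"
proof -
	have xc: "x a i:.L" if "a:J" for a i using assms(3)[OF that] by simp
	have "(+/i:I. ps i*.(+/a:J. c a*.x a i)) = (+/i:I. +/a:J. ps i*.(c a*.x a i))"
		by(intro sum_cong finsum_rdistr) (use assms xc in auto)
	also have "... = (+/a:J. +/i:I. ps i*.(c a*.x a i))"
		by(rule finsum_swap[OF fin assms(1)]) (use assms xc in auto)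
	also have "... = (+/a:J. c a*.pair ps (x a))"
	proof (rule finsum_cong')
		fix a assume a: "a:J"
		have "c a*.pair ps (x a) = (+/i:I. c a*.(ps i*.x a i))"
			unfolding pair_def by(rule sum_left) (use assms xc a in auto)
		also have "... = (+/i:I. ps i*.(c a*.x a i))" by(rule sum_cong) (use assms xc a in "auto simp: m_ac")
		finally show "(+/i:I. ps i*.(c a*.x a i)) = c a*.pair ps (x a)" by simp
	qed (use assms xc in "auto intro!: m_closed pair_closed")
	finally show ?thesis .
qed

lemma sum_pair_b:
	assumes J: "finite J" "J <= points" "!!a. a:J==>c a:.L" and ps: "ps:J"
	shows "(+/i:I. ps i*.(+/a:J. c a*.b a i)) = c ps"
proof -
	have "(+/i:I. ps i*.(+/a:J. c a*.b a i)) = (+/a:J. c a*.pair ps (b a))"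
		by(rule pair_sum) (use J ps b_closed pointsD(1) in auto)
	also have "... = (+/a:J. if a = ps then c a else 0.)"
		by(rule finsum_cong') (use J ps in "auto simp: pair_b subsetD[OF J(2)]")
	also have "... = c ps" by(rule finsum_delta) (use J ps in auto)
	finally show ?thesis .
qed

text \<open>The vectors \<open>b a\<close> are dual to the points and hence independent, while |I| +
  1 of them satisfy a nontrivial relation.\<close>

lemma finite_points: "finite points"
proof (rule ccontr)
	assume "infinite points"
	then obtain J where J: "finite J" "card J = Suc (card I)" "J <= points"
		using infinite_arbitrarily_large by blast
	have bc: "b a i:.L" if "a:J" for a i using b_closed J that by auto
	obtain c where c: "ALL a:J. c a:.L" "EX a:J. c a ~= 0." "ALL i:I. (+/a:J. c a*.b a i) = 0."
		using homogeneous_system[OF fin J(1), of b] J(2) bc by auto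
	have "c ps = 0." if ps: "ps:J" for ps
	proof -
		have "c ps = (+/i:I. ps i*.(+/a:J. c a*.b a i))"
			using sum_pair_b[OF J(1,3) _ ps, of c] c(1) by simp
		also have "... = (+/i:I. 0.)" by(rule sum_cong) (use c(3) J(3) ps pointsD(4) in auto)
		finally show ?thesis by simp
	qed
	thus False using c(2) by blast
qed

text \<open>By duality the difference of the two sides pairs to 0 with every point, and points
  separate vectors.\<close>

lemma expand_b:
	assumes x: "x:.V" and j: "j:I"
	shows "x j = (+/a:points. pair a x*.b a j)"
proof -
	let ?y = "vec (%j. +/a:points. pair a x*.b a j)"
	have pc: "pair a x:.L" if "a:points" for a using that x pointsD(4) by(intro pair_closed) auto
	have bc: "b a i:.L" if "a:points" for a i using b_closed that by auto
	have yc: "?y:.V" by(rule vec_mem, rule finsum_closed) (use pc bc in auto)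
	have "pair ps ?y = pair ps x" if ps: "ps:points" for ps
	proof -
		have "pair ps ?y = (+/i:I. ps i*.(+/a:points. pair a x*.b a i))"
			unfolding pair_def by(rule sum_cong) (use pc bc pointsD(4)[OF ps] in "auto intro!: m_closed finsum_closed simp: pair_def[symmetric]")
		also have "... = pair ps x" by(rule sum_pair_b[OF finite_points]) (use pc ps in auto)
		finally show ?thesis .
	qed
	hence "pair ps (x -.$V ?y) = 0." if "ps:points" for ps
		using that x yc pair_add[of ps x "-.$V ?y"] pair_smult[of "-. 1." ps ?y] pc[OF that] pointsD(1)[OF that]
		by(simp add: a_minus_def V.smult_l_minus l_minus r_neg)
	hence "x -.$V ?y = 0.$V" by(intro points_separate) (use x yc in auto)
	moreover have "x = (x -.$V ?y)+.$V ?y" using x yc by(simp add: a_minus_def V.a_assoc V.l_neg)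
	ultimately have "x = ?y" using yc by simp
	hence "x j = ?y j" by(rule fun_cong)
	thus ?thesis using j by simp
qed

lemma b_delta:
	assumes "i:I" "j:I"
	shows "(+/a:points. a i*.b a j) = (if i = j then 1. else 0.)"
proof -
	let ?e = "vec (%k. if k = i then 1. else 0.)"
	have ec: "?e:.V" by(rule vec_mem) auto
	have p: "pair a ?e = a i" if "a:points" for a
	proof -
		have "pair a ?e = (+/k:I. (if k = i then 1. else 0.)*.a k)"
			unfolding pair_def by(rule sum_cong) (use pointsD(4)[OF that] in auto)
		also have "... = a i" by(rule sum_delta) (use assms pointsD(4)[OF that] in auto)
		finally show ?thesis .
	qed
	have "?e j = (+/a:points. pair a ?e*.b a j)" by(rule expand_b[OF ec assms(2)])
	also have "... = (+/a:points. a i*.b a j)" by(rule finsum_cong') (use p pointsD(4) b_closed in auto)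
	finally show ?thesis using assms by auto
qed

lemma sum_b: "j:I==>(+/a:points. b a j) = u j"
proof -
	assume j: "j:I"
	have p: "pair a (vec u) = 1." if "a:points" for a
		using sum_cong[of "%i. a i*.vec u i" "%i. u i*.a i"] pointsD(3,4)[OF that] by(simp add: pair_def m_comm)
	have "u j = (+/a:points. pair a (vec u)*.b a j)" using expand_b[of "vec u" j] j by(simp add: vec_mem)
	also have "... = (+/a:points. b a j)" by(rule finsum_cong') (use p b_closed in auto)
	finally show ?thesis by simp
qed

text \<open>Applying \<open>l\<close> to the second leg of the coproduct of \<open>t\<close> leaves
  l(t) times the unit in the first leg, where every point takes the value 1. So the result does not
  depend on \<open>a\<close>.\<close>

lemma sum_l_b:
	assumes a: "a:points"
	shows "(+/k:I. l k*.b a k) = (+/s:I. t s*.l s)"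
proof -
	let ?c = "anti a"
	have c: "?c:points" by(rule anti_point[OF a])
	note cc = pointsD(4)[OF c]
	have "(+/k:I. l k*.b a k) = (+/k:I. l k*.(+/j:I. ?c j*.(+/s:I. t s*.d s j k)))"
		unfolding b_def w_def by(rule sum_cong) (use cc in auto)
	also have "... = (+/k:I. +/j:I. +/s:I. l k*.(?c j*.(t s*.d s j k)))"
		by(intro sum_cong) (use cc in "auto simp: sum_left cong: sum_cong")
	also have "... = (+/j:I. +/k:I. +/s:I. l k*.(?c j*.(t s*.d s j k)))" by(rule sum_swap) (use cc in auto)
	also have "... = (+/j:I. +/s:I. +/k:I. l k*.(?c j*.(t s*.d s j k)))"
		by(rule sum_cong, rule sum_swap) (use cc in auto)
	also have "... = (+/j:I. +/s:I. +/k:I. (?c j*.t s)*.(l k*.d s j k))"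
		by(intro sum_cong) (use cc in "auto simp: m_ac")
	also have "... = (+/j:I. +/s:I. (?c j*.t s)*.(+/k:I. l k*.d s j k))"
		by(intro sum_cong sum_left[symmetric]) (use cc in auto)
	also have "... = (+/j:I. +/s:I. (u j*.?c j)*.(t s*.l s))"
		by(intro sum_cong) (use cc in "auto simp: l_integral m_ac")
	also have "... = (+/j:I. u j*.?c j)*.(+/s:I. t s*.l s)" by(rule sum_prod[symmetric]) (use cc in auto)
	finally show ?thesis by(simp add: pointsD(3)[OF c])
qed

text \<open>The \<open>b a\<close> add up to the unit, so 1 = l(1) is the sum of the numbers l(b a),
  all equal to l(t). Hence the group order is invertible in \<open>L\<close> with inverse
  l(t).\<close>

lemma sum_points: "(+/a:points. +/s:I. t s*.l s) = 1."
proof -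
	have bc: "b a i:.L" if "a:points" for a i using b_closed that by auto
	have "1. = (+/i:I. l i*.(+/a:points. b a i))"
		using l_unit sum_cong[of "%i. l i*.(+/a:points. b a i)" "%i. l i*.u i"] by(simp add: sum_b)
	also have "... = (+/i:I. +/a:points. l i*.b a i)"
		by(intro sum_cong finsum_rdistr finite_points finsum_closed) (use bc in auto)
	also have "... = (+/a:points. +/i:I. l i*.b a i)" by(rule finsum_swap[OF fin finite_points]) (use bc in auto)
	also have "... = (+/a:points. +/s:I. t s*.l s)" by(rule finsum_cong') (auto simp: sum_l_b)
	finally show ?thesis by simp
qed

lemma b_counit:
	assumes "a:points"
	shows "(+/i:I. b a i*.ep i) = (if a = 1.$PG then 1. else 0.)"
	using pair_b[OF assms counit_point] b_closed[OF assms]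
		sum_cong[of "%i. b a i*.ep i" "%i. vec ep i*.b a i"] by(auto simp: pair_def m_comm)

text \<open>\<open>b c\<close> is an eigenvector for the character \<open>c\<close>, so multiplying
  it by \<open>b a\<close> multiplies it by the value of \<open>c\<close> at
  \<open>b a\<close>.\<close>

lemma b_mult:
	assumes a: "a:points" and c: "c:points" and k: "k:I"
	shows "(+/i:I. +/j:I. (b a i*.b c j)*.m i j k) = (if a = c then b c k else 0.)"
proof -
	have bc: "b a i:.L" if "a:points" for a i using b_closed that by auto
	have T: "(+/j:I. m i j k*.b c j) = c i*.b c k" if i: "i:I" for i
	proof -
		have "T i (b c) = c i.*$V b c" unfolding b_def using T_w[OF anti_point[OF c] i] by(simp add: anti_anti[OF c])
		from fun_cong[OF this, of k] show ?thesis using k by(simp add: T_def free_space_simps(4))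
	qed
	have "(+/i:I. +/j:I. (b a i*.b c j)*.m i j k) = (+/i:I. +/j:I. b a i*.(m i j k*.b c j))"
		by(intro sum_cong) (use bc a c k in "auto simp: m_ac")
	also have "... = (+/i:I. b a i*.(+/j:I. m i j k*.b c j))"
		by(intro sum_cong sum_left[symmetric]) (use bc a c k in auto)
	also have "... = (+/i:I. (c i*.b a i)*.b c k)"
		by(rule sum_cong) (use bc a c k pointsD(4)[OF c] in "auto simp: T m_ac")
	also have "... = pair c (b a)*.b c k"
		unfolding pair_def by(rule sum_right[symmetric]) (use bc a c k pointsD(4)[OF c] in auto)
	finally show ?thesis using pair_b[OF a c] bc[OF c] by auto
qed

text \<open>Evaluating the two legs at points \<open>a\<close> and \<open>c\<close> gives the value
  of their convolution at \<open>b g\<close>, which is 1 exactly for c = a^-1 g and 0 otherwise.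
  Expansion in the basis dual to the points, once in each leg, gives the formula.\<close>

lemma b_comult:
	assumes g: "g:points" and j: "j:I" and k: "k:I"
	shows "(+/i:I. b g i*.d i j k) = (+/a:points. b a j*.b (inv$PG a*.$PG g) k)"
proof -
	have bc: "b a i:.L" if "a:points" for a i using b_closed that by auto
	note pc = pointsD(4)
	define f where "f i k = (+/s:I. b g s*.d s i k)" for i k
	have fc: "f i k:.L" if "i:I" "k:I" for i k unfolding f_def by(rule sum_closed) (use that bc g in auto)
	define q where "q a k = (+/i:I. a i*.f i k)" for a k
	have qc: "q a k:.L" if "a:points" "k:I" for a k unfolding q_def by(rule sum_closed) (use that fc pc in auto)
	have vc: "vec (q a):.V" if "a:points" for a by(rule vec_mem) (use that qc in auto)
	have pair_q: "pair c (vec (q a)) = (if c = inv$PG a*.$PG g then 1. else 0.)" if a: "a:points" and c: "c:points" for a c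
	proof -
		have "pair c (vec (q a)) = (+/k:I. c k*.(+/i:I. a i*.(+/s:I. b g s*.d s i k)))"
			unfolding pair_def by(rule sum_cong) (use a c pc bc g in "auto simp: q_def f_def")
		also have "... = (+/k:I. +/i:I. +/s:I. c k*.(a i*.(b g s*.d s i k)))"
			by(intro sum_cong) (use a c pc bc g in "auto simp: sum_left cong: sum_cong")
		also have "... = (+/k:I. +/s:I. +/i:I. c k*.(a i*.(b g s*.d s i k)))"
			by(rule sum_cong, rule sum_swap) (use a c pc bc g in auto)
		also have "... = (+/s:I. +/k:I. +/i:I. c k*.(a i*.(b g s*.d s i k)))"
			by(rule sum_swap) (use a c pc bc g in auto)
		also have "... = (+/s:I. +/i:I. +/k:I. c k*.(a i*.(b g s*.d s i k)))"
			by(rule sum_cong, rule sum_swap) (use a c pc bc g in auto)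
		also have "... = (+/s:I. +/i:I. +/k:I. (d s i k*.(a i*.c k))*.b g s)"
			by(intro sum_cong) (use a c pc bc g in "auto simp: m_ac")
		also have "... = (+/s:I. conv a c s*.b g s)"
			by(rule sum_cong) (use a c pc bc g in "auto simp: conv_apply sum_right cong: sum_cong")
		also have "... = pair (conv a c) (b g)" by(simp add: pair_def)
		also have "... = (if conv a c = g then 1. else 0.)" by(rule pair_b[OF g conv_point[OF a c]])
		also have "conv a c = g \<longleftrightarrow> c = inv$PG a*.$PG g"
			using PG.inv_solve_left[of c a g] a c g by auto
		finally show ?thesis .
	qed
	have ag: "inv$PG a*.$PG g:points" if "a:points" for a
		using PG.m_closed[OF PG.inv_closed, of a g] that g by simp
	have q: "q a k = b (inv$PG a*.$PG g) k" if a: "a:points" for a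
	proof -
		let ?g = "inv$PG a*.$PG g"
		have "q a k = (+/c:points. pair c (vec (q a))*.b c k)" using expand_b[OF vc[OF a] k] k by simp
		also have "... = (+/c:points. if c = ?g then b c k else 0.)"
			by(rule finsum_cong') (use bc pair_q[OF a] in auto)
		also have "... = b ?g k" by(rule finsum_delta[OF finite_points ag[OF a]]) (use bc ag[OF a] in auto)
		finally show ?thesis .
	qed
	have "f j k = vec (%i. f i k) j" using j by simp
	also have "... = (+/a:points. pair a (vec (%i. f i k))*.b a j)" by(rule expand_b[OF vec_mem j]) (use fc k in auto)
	also have "... = (+/a:points. b a j*.b (inv$PG a*.$PG g) k)"
	proof (rule finsum_cong')
		fix a assume a: "a:points"
		have "pair a (vec (%i. f i k)) = q a k" unfolding pair_def q_def by(rule sum_cong) (use a pc fc k in auto)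
		thus "pair a (vec (%i. f i k))*.b a j = b a j*.b (inv$PG a*.$PG g) k"
			using q[OF a] bc[OF a] bc[OF ag[OF a]] by(simp add: m_comm)
	qed (use bc ag in auto)
	finally show ?thesis by(simp add: f_def)
qed

end

section \<open>Crossed products over a split Hopf algebra\<close>

text \<open>An \<open>L\<close>-algebra is given by a central homomorphism \<open>ze\<close>. The
  tensor products to which this is applied carry a scalar multiplication by \<open>K\<close> only,
  while the scalars here come from the extension field.\<close>

locale scalar_ring = L: field L + B: ring B
	for L :: "('l, 'n) ring_scheme" and B :: "('b, 'p) ring_scheme" +
	fixes I :: "'i set" and ze :: "'l => 'b"
	assumes fin: "finite I"
		and ze_hom: "ze:ring_hom L B"
		and central: "c:.L==>x:.B==>x*.$B ze c = ze c*.$B x"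
begin

sublocale ze: ring_hom_ring L B ze by(rule ring_hom_ringI2[OF L.ring_axioms B.ring_axioms ze_hom])

lemma L_sum_closed[simp]: "(!!i. i:I==>f i:.L)==>(+/$L i:I. f i):.L" by(rule L.finsum_closed) auto

lemma sum_closed[simp]: "(!!i. i:I==>f i:.B)==>(+/$B i:I. f i):.B" by(rule B.finsum_closed) auto

lemma sum_cong: "(!!i. i:I==>f i = g i)==>(!!i. i:I==>g i:.B)==>(+/$B i:I. f i) = (+/$B i:I. g i)"
	by(rule B.finsum_cong') auto

lemma sum_swap: "finite J==>(!!i j. i:I==>j:J==>f i j:.B) ==>
		(+/$B i:I. +/$B j:J. f i j) = (+/$B j:J. +/$B i:I. f i j)" by(rule B.finsum_swap[OF fin])

lemma sum_left: "c:.B==>(!!i. i:I==>f i:.B)==>c*.$B (+/$B i:I. f i) = (+/$B i:I. c*.$B f i)"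
	by(rule B.finsum_rdistr[OF fin]) auto

lemma sum_right: "c:.B==>(!!i. i:I==>f i:.B)==>(+/$B i:I. f i)*.$B c = (+/$B i:I. f i*.$B c)"
	by(rule B.finsum_ldistr[OF fin]) auto

lemma scalar_left: "c:.L==>x:.B==>y:.B==>x*.$B (ze c*.$B y) = ze c*.$B (x*.$B y)"
	using central[of c x] B.m_assoc[of x "ze c" y] by(simp add: B.m_assoc)

lemma ze_sum:
	assumes "finite J" "!!a. a:J==>f a:.L"
	shows "ze (+/$L a:J. f a) = (+/$B a:J. ze (f a))"
	by(rule add_finsum[OF L.abelian_group_axioms B.abelian_group_axioms]) (use assms in auto)

text \<open>A family given on a basis, extended linearly and evaluated at the vector with
  coordinates \<open>be\<close>. The version \<open>ev2\<close> taken at the constants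
  \<open>d i\<close> is the Sweedler sum over the coproduct of the basis element
  \<open>i\<close>.\<close>

definition ev :: "('i => 'l) => ('i => 'b) => 'b"
	where "ev be f = (+/$B i:I. ze (be i)*.$B f i)"

definition ev2 :: "('i => 'i => 'l) => ('i => 'i => 'b) => 'b"
	where "ev2 de f = (+/$B i:I. +/$B j:I. ze (de i j)*.$B f i j)"

lemma ev_closed[simp]: "(!!i. i:I==>be i:.L)==>(!!i. i:I==>f i:.B)==>ev be f:.B" by(simp add: ev_def)

lemma ev2_closed[simp]: "(!!i j. i:I==>j:I==>de i j:.L)==>(!!i j. i:I==>j:I==>f i j:.B)==>ev2 de f:.B"
	by(simp add: ev2_def)

lemma ev_cong:
	"(!!i. i:I==>be i = ga i)==>(!!i. i:I==>f i = g i)==>(!!i. i:I==>ga i:.L) ==>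
		(!!i. i:I==>g i:.B)==>ev be f = ev ga g"
	unfolding ev_def by(rule sum_cong) auto

lemma ev_left:
	assumes "x:.B" "!!i. i:I==>be i:.L" "!!i. i:I==>f i:.B"
	shows "x*.$B ev be f = ev be (%i. x*.$B f i)"
proof -
	have "x*.$B ev be f = (+/$B i:I. x*.$B (ze (be i)*.$B f i))"
		unfolding ev_def by(rule sum_left) (use assms in auto)
	also have "... = ev be (%i. x*.$B f i)" unfolding ev_def by(rule sum_cong) (use assms in "auto simp: scalar_left")
	finally show ?thesis .
qed

lemma ev_right:
	assumes "x:.B" "!!i. i:I==>be i:.L" "!!i. i:I==>f i:.B"
	shows "ev be f*.$B x = ev be (%i. f i*.$B x)"
proof -
	have "ev be f*.$B x = (+/$B i:I. (ze (be i)*.$B f i)*.$B x)"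
		unfolding ev_def by(rule sum_right) (use assms in auto)
	also have "... = ev be (%i. f i*.$B x)" unfolding ev_def by(rule sum_cong) (use assms in "auto simp: B.m_assoc")
	finally show ?thesis .
qed

lemma ev_prod:
	assumes "!!i. i:I==>be i:.L" "!!i. i:I==>ga i:.L"
		"!!i. i:I==>f i:.B" "!!i. i:I==>g i:.B"
	shows "ev be (%i. ev ga (%k. f i*.$B g k)) = ev be f*.$B ev ga g"
proof -
	have "ev be (%i. ev ga (%k. f i*.$B g k)) = ev be (%i. f i*.$B ev ga g)"
		by(rule ev_cong) (use assms in "auto simp: ev_left")
	also have "... = ev be f*.$B ev ga g" by(rule ev_right[symmetric]) (use assms in auto)
	finally show ?thesis .
qed

lemma ev_finsum:
	assumes "finite J" "!!i. i:I==>be i:.L" "!!i a. i:I==>a:J==>f a i:.B"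
	shows "ev be (%i. +/$B a:J. f a i) = (+/$B a:J. ev be (f a))"
proof -
	have "ev be (%i. +/$B a:J. f a i) = (+/$B i:I. +/$B a:J. ze (be i)*.$B f a i)"
		unfolding ev_def by(intro sum_cong B.finsum_rdistr B.finsum_closed) (use assms in auto)
	also have "... = (+/$B a:J. ev be (f a))" unfolding ev_def by(rule sum_swap) (use assms in auto)
	finally show ?thesis .
qed

lemma ev_ev:
	assumes "!!i. i:I==>be i:.L" "!!i. i:I==>ga i:.L"
		"!!i j. i:I==>j:I==>f i j:.B"
	shows "ev be (%i. ev ga (f i)) = ev2 (%i j. be i*.$L ga j) f"
	unfolding ev_def ev2_def by(intro sum_cong, subst sum_left) (use assms in "auto simp: B.m_assoc intro!: sum_cong")

lemma ev_ev2:
	assumes "!!i. i:I==>be i:.L" "!!i j k. i:I==>j:I==>k:I==>d i j k:.L"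
		"!!i j. i:I==>j:I==>f i j:.B"
	shows "ev be (%i. ev2 (d i) f) = ev2 (%j k. +/$L i:I. be i*.$L d i j k) f"
proof -
	have "ev be (%i. ev2 (d i) f) = (+/$B i:I. +/$B j:I. +/$B k:I. (ze (be i)*.$B ze (d i j k))*.$B f j k)"
		unfolding ev_def ev2_def by(intro sum_cong) (use assms in "auto simp: sum_left B.m_assoc cong: sum_cong")
	also have "... = (+/$B j:I. +/$B i:I. +/$B k:I. (ze (be i)*.$B ze (d i j k))*.$B f j k)"
		by(rule sum_swap[OF fin]) (use assms in auto)
	also have "... = (+/$B j:I. +/$B k:I. +/$B i:I. (ze (be i)*.$B ze (d i j k))*.$B f j k)"
		by(rule sum_cong, rule sum_swap[OF fin]) (use assms in auto)
	also have "... = ev2 (%j k. +/$L i:I. be i*.$L d i j k) f"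
		unfolding ev2_def by(intro sum_cong) (use assms in "auto simp: ze_sum[OF fin] sum_right cong: sum_cong")
	finally show ?thesis .
qed

lemma ev_ev2_commute:
	assumes "!!i. i:I==>be i:.L" "!!j k. j:I==>k:I==>d j k:.L"
		"!!i j k. i:I==>j:I==>k:I==>f j k i:.B"
	shows "ev be (%i. ev2 d (%j k. f j k i)) = ev2 d (%j k. ev be (f j k))"
proof -
	have "ev be (%i. ev2 d (%j k. f j k i)) = (+/$B j:I. ev be (%i. +/$B k:I. ze (d j k)*.$B f j k i))"
		unfolding ev2_def by(rule ev_finsum[OF fin]) (use assms in auto)
	also have "... = (+/$B j:I. +/$B k:I. ev be (%i. ze (d j k)*.$B f j k i))"
		by(rule sum_cong, rule ev_finsum[OF fin]) (use assms in auto)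
	also have "... = ev2 d (%j k. ev be (f j k))"
		unfolding ev2_def by(intro sum_cong ev_left[symmetric]) (use assms in auto)
	finally show ?thesis .
qed

lemma ev2_finsum:
	assumes J: "finite J" "!!i a. i:I==>a:J==>ga a i:.L" "!!i a. i:I==>a:J==>de a i:.L"
		and f: "!!i j. i:I==>j:I==>f i j:.B"
	shows "ev2 (%i j. +/$L a:J. ga a i*.$L de a j) f = (+/$B a:J. ev (ga a) (%i. ev (de a) (f i)))"
proof -
	have "ev2 (%i j. +/$L a:J. ga a i*.$L de a j) f =
			(+/$B i:I. +/$B j:I. +/$B a:J. ze (ga a i*.$L de a j)*.$B f i j)"
		unfolding ev2_def
	proof (intro sum_cong)
		fix i j assume ij: "i:I" "j:I"
		have "ze (+/$L a:J. ga a i*.$L de a j) = (+/$B a:J. ze (ga a i*.$L de a j))"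
			by(rule ze_sum[OF J(1)]) (use J ij in auto)
		thus "ze (+/$L a:J. ga a i*.$L de a j)*.$B f i j = (+/$B a:J. ze (ga a i*.$L de a j)*.$B f i j)"
			by(simp only:) (rule B.finsum_ldistr[OF J(1)], use J ij f in auto)
	qed (use J f in "auto intro!: B.finsum_closed sum_closed")
	also have "... = (+/$B i:I. +/$B a:J. +/$B j:I. ze (ga a i*.$L de a j)*.$B f i j)"
		by(rule sum_cong, rule sum_swap[OF J(1)]) (use J f in "auto intro!: B.finsum_closed sum_closed")
	also have "... = (+/$B a:J. ev2 (%i j. ga a i*.$L de a j) f)"
		unfolding ev2_def by(rule sum_swap[OF J(1)]) (use J f in auto)
	also have "... = (+/$B a:J. ev (ga a) (%i. ev (de a) (f i)))"
		by(rule B.finsum_cong') (use J f in "auto simp: ev_ev")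
	finally show ?thesis .
qed

text \<open>Once the coproduct of the vector \<open>be\<close> is a sum over \<open>J\<close> of
  tensors of \<open>ga a\<close> and \<open>de a\<close>, a Sweedler sum becomes a sum of ordinary
  evaluations. \<open>J\<close> will be the group for idempotents and a one-element set for
  grouplike vectors.\<close>

lemma ev_comult:
	assumes J: "finite J" "!!i a. i:I==>a:J==>ga a i:.L" "!!i a. i:I==>a:J==>de a i:.L"
		and be: "!!i. i:I==>be i:.L" and d: "!!i j k. i:I==>j:I==>k:I==>d i j k:.L"
		and eq: "!!j k. j:I==>k:I==>(+/$L i:I. be i*.$L d i j k) = (+/$L a:J. ga a j*.$L de a k)"
		and f: "!!i j. i:I==>j:I==>f i j:.B"
	shows "ev be (%i. ev2 (d i) f) = (+/$B a:J. ev (ga a) (%i. ev (de a) (f i)))"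
proof -
	have "ev be (%i. ev2 (d i) f) = ev2 (%j k. +/$L i:I. be i*.$L d i j k) f" by(rule ev_ev2) (use be d f in auto)
	also have "... = ev2 (%j k. +/$L a:J. ga a j*.$L de a k) f"
		unfolding ev2_def by(intro sum_cong) (use J f in "auto simp: eq intro!: B.m_closed ze.hom_closed L.finsum_closed")
	also have "... = (+/$B a:J. ev (ga a) (%i. ev (de a) (f i)))" by(rule ev2_finsum[OF J f])
	finally show ?thesis .
qed

text \<open>The form for two arguments. The legs are grouped as in the identities for the cocycle
  and in the product of two basis elements of a crossed product: first legs into \<open>U\<close>,
  second legs into \<open>N\<close>.\<close>

lemma double_comult:
	assumes J: "finite J" "!!i a. i:I==>a:J==>ga a i:.L" "!!i a. i:I==>a:J==>de a i:.L"
		and J': "finite J'" "!!i a. i:I==>a:J'==>ga' a i:.L" "!!i a. i:I==>a:J'==>de' a i:.L"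
		and be: "!!i. i:I==>be i:.L" "!!i. i:I==>be' i:.L"
		and d: "!!i j k. i:I==>j:I==>k:I==>d i j k:.L"
		and eq: "!!j k. j:I==>k:I==>(+/$L i:I. be i*.$L d i j k) = (+/$L a:J. ga a j*.$L de a k)"
		and eq': "!!j k. j:I==>k:I==>(+/$L i:I. be' i*.$L d i j k) = (+/$L a:J'. ga' a j*.$L de' a k)"
		and U: "!!i j. i:I==>j:I==>U i j:.B" and N: "!!i j. i:I==>j:I==>N i j:.B"
	shows "ev be (%i. ev be' (%k. ev2 (d i) (%a b. ev2 (d k) (%c e. U a c*.$B N b e)))) =
		(+/$B x:J. +/$B y:J'. ev (ga x) (%a. ev (ga' y) (U a))*.$B ev (de x) (%b. ev (de' y) (N b)))"
proof -
	note c = J J' be d U N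
	have "ev be (%i. ev be' (%k. ev2 (d i) (%a b. ev2 (d k) (%c e. U a c*.$B N b e)))) =
			ev be (%i. ev2 (d i) (%a b. ev be' (%k. ev2 (d k) (%c e. U a c*.$B N b e))))"
		by(rule ev_cong, rule refl, rule ev_ev2_commute) (use c in auto)
	also have "... = (+/$B x:J. ev (ga x) (%a. ev (de x) (%b. ev be' (%k. ev2 (d k) (%c e. U a c*.$B N b e)))))"
		by(rule ev_comult[OF J]) (use c eq in auto)
	also have "... = (+/$B x:J. ev (ga x) (%a. ev (de x) (%b. +/$B y:J'. ev (ga' y) (U a)*.$B ev (de' y) (N b))))"
	proof (rule B.finsum_cong'[OF refl])
		fix x assume x: "x:J"
		show "ev (ga x) (%a. ev (de x) (%b. ev be' (%k. ev2 (d k) (%c e. U a c*.$B N b e)))) =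
				ev (ga x) (%a. ev (de x) (%b. +/$B y:J'. ev (ga' y) (U a)*.$B ev (de' y) (N b)))"
		proof (rule ev_cong, rule refl, rule ev_cong, rule refl)
			fix a b assume ab: "a:I" "b:I"
			have "ev be' (%k. ev2 (d k) (%c e. U a c*.$B N b e)) = (+/$B y:J'. ev (ga' y) (%c. ev (de' y) (%e. U a c*.$B N b e)))"
				by(rule ev_comult[OF J']) (use c eq' ab in auto)
			also have "... = (+/$B y:J'. ev (ga' y) (U a)*.$B ev (de' y) (N b))"
				by(rule B.finsum_cong'[OF refl _ ev_prod]) (use c ab in auto)
			finally show "ev be' (%k. ev2 (d k) (%c e. U a c*.$B N b e)) = ..." .
		qed (use c x in "auto intro!: B.finsum_closed ev_closed")
	qed (use c in "auto intro!: B.finsum_closed ev_closed")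
	also have "... = (+/$B x:J. +/$B y:J'. ev (ga x) (%a. ev (ga' y) (U a))*.$B ev (de x) (%b. ev (de' y) (N b)))"
	proof (rule B.finsum_cong'[OF refl])
		fix x assume x: "x:J"
		have "ev (ga x) (%a. ev (de x) (%b. +/$B y:J'. ev (ga' y) (U a)*.$B ev (de' y) (N b))) =
				ev (ga x) (%a. +/$B y:J'. ev (de x) (%b. ev (ga' y) (U a)*.$B ev (de' y) (N b)))"
			by(rule ev_cong, rule refl, rule ev_finsum[OF J'(1)]) (use c x in "auto intro!: B.finsum_closed ev_closed")
		also have "... = (+/$B y:J'. ev (ga x) (%a. ev (de x) (%b. ev (ga' y) (U a)*.$B ev (de' y) (N b))))"
			by(rule ev_finsum[OF J'(1)]) (use c x in auto)
		also have "... = (+/$B y:J'. ev (ga x) (%a. ev (ga' y) (U a))*.$B ev (de x) (%b. ev (de' y) (N b)))"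
			by(rule B.finsum_cong'[OF refl _ ev_prod]) (use c x in auto)
		finally show "ev (ga x) (%a. ev (de x) (%b. +/$B y:J'. ev (ga' y) (U a)*.$B ev (de' y) (N b))) = ..." .
	qed (use c in "auto intro!: B.finsum_closed ev_closed B.m_closed")
	finally show ?thesis .
qed

lemma ev_scalar:
	assumes "!!i. i:I==>be i:.L" "!!i. i:I==>c i:.L"
	shows "ev be (%i. ze (c i)) = ze (+/$L i:I. be i*.$L c i)"
	unfolding ev_def by(subst ze_sum[OF fin]) (use assms in "auto intro!: sum_cong")

lemma ev_mult:
	assumes "!!i. i:I==>be i:.L" "!!i. i:I==>ga i:.L"
		"!!i j k. i:I==>j:I==>k:I==>m i j k:.L" "!!i. i:I==>f i:.B"
	shows "ev be (%i. ev ga (%j. ev (m i j) f)) =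
		ev (%k. +/$L i:I. +/$L j:I. (be i*.$L ga j)*.$L m i j k) f"
proof -
	have "ev be (%i. ev ga (%j. ev (m i j) f)) = ev2 (%i j. be i*.$L ga j) (%i j. ev (m i j) f)"
		by(rule ev_ev) (use assms in auto)
	also have "... = (+/$B i:I. +/$B j:I. +/$B k:I. ze ((be i*.$L ga j)*.$L m i j k)*.$B f k)"
		unfolding ev2_def ev_def by(intro sum_cong, subst sum_left) (use assms in "auto simp: B.m_assoc intro!: sum_cong")
	also have "... = (+/$B i:I. +/$B k:I. +/$B j:I. ze ((be i*.$L ga j)*.$L m i j k)*.$B f k)"
		by(rule sum_cong, rule sum_swap[OF fin]) (use assms in auto)
	also have "... = (+/$B k:I. +/$B i:I. +/$B j:I. ze ((be i*.$L ga j)*.$L m i j k)*.$B f k)"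
		by(rule sum_swap[OF fin]) (use assms in auto)
	also have "... = (+/$B k:I. (+/$B i:I. +/$B j:I. ze ((be i*.$L ga j)*.$L m i j k))*.$B f k)"
		by(rule sum_cong) (use assms in "auto simp: sum_right cong: sum_cong")
	also have "... = ev (%k. +/$L i:I. +/$L j:I. (be i*.$L ga j)*.$L m i j k) f"
		unfolding ev_def by(rule sum_cong) (use assms in "auto simp: ze_sum[OF fin] cong: sum_cong")
	finally show ?thesis .
qed

end

section \<open>Crossed products in terms of structure constants\<close>

text \<open>\<open>W i\<close> models 1 # e for the basis element e with index \<open>i\<close>,
  \<open>j\<close> the inclusion of the coefficient ring, \<open>E\<close> the action,
  \<open>sg\<close> the cocycle and \<open>ta\<close> its convolution inverse. All Sweedler sums are
  evaluations along \<open>d\<close>.\<close>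

locale hopf_crossed_product = hopf_constants L I m d A u ep t l + Q: ring Q + B: ring B
	for L :: "('l, 'n) ring_scheme" and I :: "'i set" and m d A u ep t l
		and Q :: "('s, 'p) ring_scheme" and B :: "('b, 'q) ring_scheme" +
	fixes z :: "'l => 's" and j :: "'s => 'b" and W :: "'i => 'b" and P :: "'i => 'b => 's"
		and E :: "'i => 's => 's" and sg ta :: "'i => 'i => 's"
	assumes SQ: "scalar_ring L Q I z" and SB: "scalar_ring L B I (%c. j (z c))"
		and j_hom: "j:ring_hom Q B"
		and W_closed[simp]: "i:I==>W i:.B"
		and P_closed[simp]: "i:I==>x:.B==>P i x:.Q"
		and P_add: "i:I==>x:.B==>y:.B==>P i (x+.$B y) = P i x+.$Q P i y"
		and expand: "x:.B==>x = (+/$B i:I. j (P i x)*.$B W i)"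
		and P_basis: "i:I==>k:I==>s:.Q==>P i (j s*.$B W k) = (if k = i then s else 0.$Q)"
		and E_closed[simp]: "i:I==>s:.Q==>E i s:.Q"
		and sg_closed[simp]: "i:I==>k:I==>sg i k:.Q"
		and ta_closed[simp]: "i:I==>k:I==>ta i k:.Q"
		and W_j: "i:I==>s:.Q==>W i*.$B j s =
				scalar_ring.ev2 B I (%c. j (z c)) (d i) (%a b. j (E a s)*.$B W b)"
		and W_W: "i:I==>k:I==>W i*.$B W k =
				scalar_ring.ev2 B I (%c. j (z c)) (d i) (%a b. scalar_ring.ev2 B I (%c. j (z c)) (d k) (%c e.
					j (sg a c)*.$B scalar_ring.ev B I (%c. j (z c)) (m b e) W))"
		and ta_sg: "i:I==>k:I==>scalar_ring.ev2 Q I z (d i) (%a b. scalar_ring.ev2 Q I z (d k) (%c e.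
					ta a c*.$Q sg b e)) = z (ep i*.$L ep k)"
		and sg_ta: "i:I==>k:I==>scalar_ring.ev2 Q I z (d i) (%a b. scalar_ring.ev2 Q I z (d k) (%c e.
					sg a c*.$Q ta b e)) = z (ep i*.$L ep k)"
		and one_W: "1.$B = scalar_ring.ev B I (%c. j (z c)) u W"
begin

sublocale SQ: scalar_ring L Q I z by(rule SQ)
sublocale SB: scalar_ring L B I "%c. j (z c)" by(rule SB)
sublocale j: ring_hom_ring Q B j by(rule ring_hom_ringI2[OF Q.ring_axioms B.ring_axioms j_hom])

lemma j_ev:
	assumes "!!i. i:I==>be i:.L" "!!i. i:I==>f i:.Q"
	shows "j (SQ.ev be f) = SB.ev be (%i. j (f i))"
proof -
	have "j (SQ.ev be f) = (+/$B i:I. j (z (be i)*.$Q f i))" unfolding SQ.ev_def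
		by(rule add_finsum[OF Q.abelian_group_axioms B.abelian_group_axioms _ _ fin]) (use assms in auto)
	also have "... = SB.ev be (%i. j (f i))" unfolding SB.ev_def by(rule SB.sum_cong) (use assms in auto)
	finally show ?thesis .
qed

lemma P_coeff:
	assumes i: "i:I" and f: "!!k. k:I==>f k:.Q"
	shows "P i (+/$B k:I. j (f k)*.$B W k) = f i"
proof -
	have "P i (+/$B k:I. j (f k)*.$B W k) = (+/$Q k:I. P i (j (f k)*.$B W k))"
		by(rule add_finsum[OF B.abelian_group_axioms Q.abelian_group_axioms _ P_add fin]) (use i f in auto)
	also have "... = (+/$Q k:I. if k = i then f k else 0.$Q)" by(rule SQ.sum_cong) (use i f in "auto simp: P_basis")
	also have "... = f i" by(rule Q.finsum_delta[OF fin]) (use i f in auto)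
	finally show ?thesis .
qed

text \<open>Change from the basis \<open>W\<close> to one indexed by \<open>G\<close>:
  \<open>be\<close> and \<open>p\<close> are dual bases of the coordinate space, so the new
  coordinates are combinations of the old ones with coefficients \<open>p\<close>.\<close>

lemma dual_bases_free_extension:
	fixes be p :: "'g => 'i => 'l" and G :: "('g, 'y) monoid_scheme"
	assumes G: "group G" "finite (car G)"
		and be: "!!g i. g:.G==>i:I==>be g i:.L" and p: "!!g i. g:.G==>i:I==>p g i:.L"
		and dual: "!!g h. g:.G==>h:.G==>(+/$L i:I. p g i*.$L be h i) = (if g = h then 1.$L else 0.$L)"
		and complete: "!!i k. i:I==>k:I==>(+/$L g:car G. p g i*.$L be g k) = (if i = k then 1.$L else 0.$L)"
		and c: "c:.L" "(+/$L g:car G. c) = 1.$L"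
	shows "group_free_extension Q B G j (%g. SB.ev (be g) W) (%g x. SQ.ev (p g) (%i. P i x)) (z c)"
proof -
	interpret G: group G by fact
	show ?thesis
	proof unfold_locales
		show "finite (car G)" by fact
		show "j:ring_hom Q B" by(rule j_hom)
		show "SQ.ev (p g) (%i. P i (x+.$B y)) = SQ.ev (p g) (%i. P i x)+.$Q SQ.ev (p g) (%i. P i y)"
			if "g:.G" "x:.B" "y:.B" for g x y
		proof -
			have "SQ.ev (p g) (%i. P i (x+.$B y)) = (+/$Q i:I. z (p g i)*.$Q P i x+.$Q z (p g i)*.$Q P i y)"
				unfolding SQ.ev_def by(rule SQ.sum_cong) (use that p in "auto simp: P_add Q.r_distr")
			thus ?thesis unfolding SQ.ev_def by(simp only:) (rule Q.finsum_addf, use that p in auto)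
		qed
		show "(+/$Q g:car G. z c) = 1.$Q" using SQ.ze_sum[OF G(2), of "%_. c"] c by simp
	next
		fix x assume x: "x:.B"
		have "(+/$B g:car G. j (SQ.ev (p g) (%i. P i x))*.$B SB.ev (be g) W) =
				(+/$B g:car G. SB.ev (p g) (%i. SB.ev (be g) (%k. j (P i x)*.$B W k)))"
			by(rule B.finsum_cong'[OF refl]) (use x p be in "auto simp: j_ev SB.ev_prod")
		also have "... = SB.ev2 (%i k. +/$L g:car G. p g i*.$L be g k) (%i k. j (P i x)*.$B W k)"
			by(rule SB.ev2_finsum[OF G(2), symmetric]) (use x p be in auto)
		also have "... = (+/$B i:I. j (P i x)*.$B W i)" unfolding SB.ev2_def
		proof (rule SB.sum_cong)
			fix i assume i: "i:I"
			have "(+/$B k:I. j (z (+/$L g:car G. p g i*.$L be g k))*.$B (j (P i x)*.$B W k)) =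
					(+/$B k:I. if k = i then j (P i x)*.$B W k else 0.$B)"
				by(rule SB.sum_cong) (use i x in "auto simp: complete")
			thus "(+/$B k:I. j (z (+/$L g:car G. p g i*.$L be g k))*.$B (j (P i x)*.$B W k)) = j (P i x)*.$B W i"
				using B.finsum_delta[OF fin i, of "%k. j (P i x)*.$B W k"] i x by simp
		qed (use x in auto)
		finally show "x = (+/$B g:car G. j (SQ.ev (p g) (%i. P i x))*.$B SB.ev (be g) W)" using expand[OF x] by simp
	next
		fix g h s assume g: "g:.G" and h: "h:.G" and s: "s:.Q"
		have P: "P i (j s*.$B SB.ev (be h) W) = z (be h i)*.$Q s" if i: "i:I" for i
		proof -
			have "j s*.$B SB.ev (be h) W = SB.ev (be h) (%k. j s*.$B W k)" by(rule SB.ev_left) (use h s be in auto)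
			also have "... = (+/$B k:I. j (z (be h k)*.$Q s)*.$B W k)"
				unfolding SB.ev_def by(rule SB.sum_cong) (use h s be in "auto simp: B.m_assoc")
			finally show ?thesis using P_coeff[OF i, of "%k. z (be h k)*.$Q s"] h s be by simp
		qed
		have "SQ.ev (p g) (%i. P i (j s*.$B SB.ev (be h) W)) = SQ.ev (p g) (%i. z (be h i)*.$Q s)"
			by(rule SQ.ev_cong) (use g h s p be P in auto)
		also have "... = SQ.ev (p g) (%i. z (be h i))*.$Q s" by(rule SQ.ev_right[symmetric]) (use g h s p be in auto)
		also have "SQ.ev (p g) (%i. z (be h i)) = z (+/$L i:I. p g i*.$L be h i)" by(rule SQ.ev_scalar) (use g h s p be in auto)
		finally show "SQ.ev (p g) (%i. P i (j s*.$B SB.ev (be h) W)) = (if h = g then s else 0.$Q)"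
			using dual[OF g h] s by auto
	qed (use be p c in auto)
qed

lemma integral_closed: "(+/$L i:I. t i*.$L l i):.L" "(+/$L i:I. l i*.$L t i) = (+/$L i:I. t i*.$L l i)"
	by(simp, rule sum_cong) (auto simp: m_comm)

text \<open>The old and new coordinates are combinations of each other with central scalar
  coefficients, so all of them lie in the radical in one basis exactly when they do in the
  other.\<close>

lemma jacobson_radical_iff_span:
	assumes "group_free_extension Q B G j v R c" "!!x g. x:.B==>g:.G==>R g x = SQ.ev (p g) (%i. P i x)"
		and p: "!!g i. g:.G==>i:I==>p g i:.L"
		and be: "!!g i. g:.G==>i:I==>be g i:.L"
		and complete: "!!i k. i:I==>k:I==>(+/$L g:car G. p g i*.$L be g k) = (if i = k then 1.$L else 0.$L)"
		and iff: "x:rad B \<longleftrightarrow> x:.B & (ALL g:car G. R g x:rad Q)"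
	shows "x:rad B \<longleftrightarrow> x:.B & (ALL i:I. P i x:rad Q)"
proof -
	interpret E: group_free_extension Q B G j v R c by fact
	note JQ = Q.jacobson_closed
	have fsum: "(+/$Q a:M. f a):rad Q" if "finite M" "!!a. a:M==>f a:rad Q" for M and f :: "'z => 's"
		using that
	proof (induction M)
		case (insert a M)
		moreover have "f ` insert a M <= car Q" using insert by(auto simp: jacobson_radical_def)
		ultimately show ?case using JQ by(subst Q.finsum_insert) auto
	qed (use JQ in auto)
	have 1: "R g x:rad Q" if "x:.B" "ALL i:I. P i x:rad Q" "g:.G" for g
		unfolding assms(2)[OF that(1,3)] SQ.ev_def by(rule fsum[OF fin]) (use that p JQ in auto)
	have 2: "P i x:rad Q" if x: "x:.B" and g: "ALL g:car G. R g x:rad Q" and i: "i:I" for i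
	proof -
		have bz: "z (be g i):.Q" if "g:.G" "i:I" for g i using be[OF that] by simp
		have "(+/$Q g:car G. z (be g i)*.$Q R g x) = (+/$Q g:car G. SQ.ev (p g) (%k. z (be g i)*.$Q P k x))"
			by(rule Q.finsum_cong'[OF refl]) (use x i p bz assms(2) in "auto simp: SQ.ev_left")
		also have "... = (+/$Q k:I. +/$Q g:car G. z (p g k*.$L be g i)*.$Q P k x)"
			unfolding SQ.ev_def by(subst SQ.sum_swap[OF E.fin]) (use x i p be in "auto simp: Q.m_assoc intro!: Q.finsum_cong'")
		also have "... = (+/$Q k:I. if k = i then P k x else 0.$Q)"
		proof (rule SQ.sum_cong)
			fix k assume k: "k:I"
			have "(+/$Q g:car G. z (p g k*.$L be g i)*.$Q P k x) = (+/$Q g:car G. z (p g k*.$L be g i))*.$Q P k x"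
				by(rule Q.finsum_ldistr[OF E.fin, symmetric]) (use x i k p be in auto)
			also have "(+/$Q g:car G. z (p g k*.$L be g i)) = z (+/$L g:car G. p g k*.$L be g i)"
				by(rule SQ.ze_sum[OF E.fin, symmetric]) (use x i k p be in auto)
			finally show "(+/$Q g:car G. z (p g k*.$L be g i)*.$Q P k x) = (if k = i then P k x else 0.$Q)"
				using complete[OF k i] x k by auto
		qed (use x in auto)
		also have "... = P i x" by(rule Q.finsum_delta[OF fin]) (use i x in auto)
		finally have "P i x = (+/$Q g:car G. z (be g i)*.$Q R g x)" by simp
		also have "...:rad Q" by(rule fsum[OF E.fin]) (use g bz i JQ in auto)
		finally show ?thesis .
	qed
	show ?thesis using iff 1 2 by blast
qed

text \<open>A commutative split Hopf algebra is the function algebra of its group of points, with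
  the idempotents \<open>b\<close> as basis. By \<open>b_comult\<close> the coproduct becomes
  convolution over the group, and the crossed product becomes a
  \<open>cleft_group_extension\<close>.\<close>

theorem jacobson_radical_iff_comm:
	assumes closed_field: "algebraically_closed L" and comm: "!!i k n. i:I==>k:I==>n:I==>m i k n = m k i n"
	shows "x:rad B \<longleftrightarrow> x:.B & (ALL i:I. P i x:rad Q)"
proof -
	interpret L': algebraically_closed L by fact
	interpret sp: split_hopf_constants L I m d A u ep t l by unfold_locales (rule comm)
	let ?G = "sp.PG" and ?p = "%g::'i => 'l. g"
	have be: "sp.b g i:.L" if "g:sp.points" for g i using sp.b_closed[OF that] by simp
	have p: "g i:.L" if "g:sp.points" for g i using sp.pointsD(4)[OF that] .
	let ?c = "+/$L i:I. t i*.$L l i"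
	let ?v = "%g. SB.ev (sp.b g) W"
	let ?E = "%g s. SQ.ev (sp.b g) (%i. E i s)"
	let ?D = "%f g h. SQ.ev (sp.b g) (%i. SQ.ev (sp.b h) (f i))"
	have Gm: "inv$?G a*.$?G g:.?G" if "a:.?G" "g:.?G" for a g
		using that by(intro sp.PG.m_closed sp.PG.inv_closed)
	note Gm' = Gm[unfolded sp.PG_simps(1)]
	have free: "group_free_extension Q B ?G j ?v (%g x. SQ.ev (?p g) (%i. P i x)) (z ?c)"
	proof (rule dual_bases_free_extension[OF sp.group_PG])
		show "finite (car ?G)" using sp.finite_points by simp
		show "(+/$L i:I. g i*.$L sp.b h i) = (if g = h then 1.$L else 0.$L)" if "g:.?G" "h:.?G" for g h
			using sp.pair_b[of h g] that by(simp add: sp.pair_def)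
		show "(+/$L g:car ?G. ?c) = 1.$L" using sp.sum_points by simp
	qed (use be p integral_closed sp.b_delta in auto)
	then interpret F: group_free_extension Q B ?G j ?v "%g x. SQ.ev (?p g) (%i. P i x)" "z ?c" .
	have v: "?v g:.B" if "g:sp.points" for g using F.v_closed that by simp
	have D: "?D f g h:.Q" if "g:sp.points" "h:sp.points" "!!i k. i:I==>k:I==>f i k:.Q" for f g h
		using that be by auto
	interpret C: cleft_group_extension Q B ?G j ?v "%g x. SQ.ev (?p g) (%i. P i x)" "z ?c" ?E "?D sg" "?D ta"
	proof unfold_locales
		fix g s assume g: "g:.?G" and s: "s:.Q"
		hence g': "g:sp.points" by simp
		have "?v g*.$B j s = SB.ev (sp.b g) (%i. W i*.$B j s)" by(rule SB.ev_right) (use s be g' in auto)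
		also have "... = SB.ev (sp.b g) (%i. SB.ev2 (d i) (%a b. j (E a s)*.$B W b))"
			by(rule SB.ev_cong[OF refl W_j]) (use s be g' in auto)
		also have "... = (+/$B a:car ?G. SB.ev (sp.b a) (%x. SB.ev (sp.b (inv$?G a*.$?G g)) (%y. j (E x s)*.$B W y)))"
			by(rule SB.ev_comult) (use s be g' sp.finite_points Gm' sp.b_comult in auto)
		also have "... = (+/$B a:car ?G. j (?E a s)*.$B ?v (inv$?G a*.$?G g))"
		proof (rule B.finsum_cong'[OF refl])
			fix a assume a: "a:.?G"
			have bb: "sp.b (inv$?G a*.$?G g) i:.L" for i by(rule be) (use Gm[OF a g] in simp)
			show "SB.ev (sp.b a) (%x. SB.ev (sp.b (inv$?G a*.$?G g)) (%y. j (E x s)*.$B W y)) = j (?E a s)*.$B ?v (inv$?G a*.$?G g)"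
				by(subst j_ev, use a s be in simp, use a s be in simp, rule SB.ev_prod) (use a s be bb in auto)
		next
			show "(%a. j (?E a s)*.$B ?v (inv$?G a*.$?G g)):car ?G \<rightarrow> car B"
				by(intro funcsetI B.m_closed j.hom_closed SQ.ev_closed F.v_closed Gm) (use s g' be g in auto)
		qed
		finally show "?v g*.$B j s = ..." .
	next
		fix g h assume g: "g:.?G" and h: "h:.?G"
		hence gh: "g:sp.points" "h:sp.points" by auto
		let ?M = "%b e. SB.ev (m b e) W"
		have Mc: "?M b e:.B" if "b:I" "e:I" for b e using that by auto
		\<comment> \<open>Orthogonality of the idempotents: in the double sum for the product of
		  \<open>?v g\<close> and \<open>?v h\<close> only terms with equal group elements in the second
		  legs survive.\<close>
		have mul: "SB.ev (sp.b a) (%b. SB.ev (sp.b c) (?M b)) = (if a = c then ?v a else 0.$B)"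
			if "a:sp.points" "c:sp.points" for a c
		proof -
			have "SB.ev (sp.b a) (%b. SB.ev (sp.b c) (?M b)) = SB.ev (%k. if a = c then sp.b c k else 0.$L) W"
				by(subst SB.ev_mult, (use that be in simp)+, rule SB.ev_cong) (use that be sp.b_mult in auto)
			also have "... = (if a = c then ?v a else 0.$B)"
				using SB.sum_cong[of "%i. j (z 0.$L)*.$B W i" "%i. 0.$B"] by(auto simp: SB.ev_def)
			finally show ?thesis .
		qed
		have "?v g*.$B ?v h = SB.ev (sp.b g) (%i. SB.ev (sp.b h) (%k. W i*.$B W k))"
			by(rule SB.ev_prod[symmetric]) (use gh be in auto)
		also have "... = SB.ev (sp.b g) (%i. SB.ev (sp.b h) (%k. SB.ev2 (d i) (%a b. SB.ev2 (d k) (%c e. j (sg a c)*.$B ?M b e))))"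
			by(rule SB.ev_cong, rule refl, rule SB.ev_cong[OF refl W_W]) (use gh be in auto)
		also have "... = (+/$B x:car ?G. +/$B y:car ?G. SB.ev (sp.b x) (%a. SB.ev (sp.b y) (%c. j (sg a c)))*.$B
				SB.ev (sp.b (inv$?G x*.$?G g)) (%b. SB.ev (sp.b (inv$?G y*.$?G h)) (?M b)))"
			by(rule SB.double_comult) (use gh be sp.finite_points Gm' sp.b_comult Mc in auto)
		also have "... = (+/$B x:car ?G. j (?D sg x (h*.$?G (inv$?G g*.$?G x)))*.$B ?v (inv$?G x*.$?G g))"
		proof (rule B.finsum_cong'[OF refl])
			fix x assume x: "x:.?G"
			hence x': "x:sp.points" by simp
			\<comment> \<open>The unique \<open>y\<close> with x^-1 g = y^-1 h, namely h times the inverse of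
			  x^-1 g.\<close>
			let ?y = "h*.$?G (inv$?G g*.$?G x)"
			have y: "?y:.?G" by(intro sp.PG.m_closed sp.PG.inv_closed g h x)
			have "(+/$B y:car ?G. SB.ev (sp.b x) (%a. SB.ev (sp.b y) (%c. j (sg a c)))*.$B
					SB.ev (sp.b (inv$?G x*.$?G g)) (%b. SB.ev (sp.b (inv$?G y*.$?G h)) (?M b))) =
					(+/$B y:car ?G. if y = ?y then j (?D sg x y)*.$B ?v (inv$?G x*.$?G g) else 0.$B)"
			proof (rule B.finsum_cong'[OF refl])
				fix y assume y: "y:.?G"
				hence y': "y:sp.points" by simp
				have "SB.ev (sp.b x) (%a. SB.ev (sp.b y) (%c. j (sg a c))) = SB.ev (sp.b x) (%a. j (SQ.ev (sp.b y) (sg a)))"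
					by(rule SB.ev_cong) (use x' y' be in "auto simp: j_ev")
				also have "... = j (?D sg x y)" by(rule j_ev[symmetric]) (use x' y' be in auto)
				finally have 1: "SB.ev (sp.b x) (%a. SB.ev (sp.b y) (%c. j (sg a c))) = ..." .
				have "inv$?G x*.$?G g = inv$?G y*.$?G h \<longleftrightarrow> h = y*.$?G (inv$?G x*.$?G g)"
					by(rule sp.PG.inv_solve_left) (use x y g h Gm in auto)
				also have "... \<longleftrightarrow> y = h*.$?G inv$?G (inv$?G x*.$?G g)"
					by(subst sp.PG.inv_solve_right) (use x y g h Gm in auto)
				also have "inv$?G (inv$?G x*.$?G g) = inv$?G g*.$?G x"
					using sp.PG.inv_mult_group[OF sp.PG.inv_closed[OF x] g] sp.PG.inv_inv[OF x] by simp
				finally have 2: "inv$?G x*.$?G g = inv$?G y*.$?G h \<longleftrightarrow> y = ?y" .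
				have 3: "SB.ev (sp.b (inv$?G x*.$?G g)) (%b. SB.ev (sp.b (inv$?G y*.$?G h)) (?M b)) =
						(if y = ?y then ?v (inv$?G x*.$?G g) else 0.$B)"
					unfolding mul[OF Gm[OF x g, unfolded sp.PG_simps(1)] Gm[OF y h, unfolded sp.PG_simps(1)]] 2 ..
				show "SB.ev (sp.b x) (%a. SB.ev (sp.b y) (%c. j (sg a c)))*.$B
						SB.ev (sp.b (inv$?G x*.$?G g)) (%b. SB.ev (sp.b (inv$?G y*.$?G h)) (?M b)) =
						(if y = ?y then j (?D sg x y)*.$B ?v (inv$?G x*.$?G g) else 0.$B)"
					unfolding 1 3 using D[OF x' y', of sg] by simp
			next
				show "(%y. if y = ?y then j (?D sg x y)*.$B ?v (inv$?G x*.$?G g) else 0.$B):car ?G \<rightarrow> car B"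
					using D[OF x', of _ sg] v Gm'[OF x' gh(1)] by auto
			qed
			also have "... = j (?D sg x ?y)*.$B ?v (inv$?G x*.$?G g)"
				by(rule B.finsum_delta) (use sp.finite_points y D[OF x', of ?y sg] v Gm'[OF x' gh(1)] in auto)
			finally show "(+/$B y:car ?G. SB.ev (sp.b x) (%a. SB.ev (sp.b y) (%c. j (sg a c)))*.$B SB.ev (sp.b (inv$?G x*.$?G g)) (%b. SB.ev (sp.b (inv$?G y*.$?G h)) (?M b))) = ..." .
		next
			show "(%x. j (?D sg x (h*.$?G (inv$?G g*.$?G x)))*.$B ?v (inv$?G x*.$?G g)):car ?G \<rightarrow> car B"
				by(intro funcsetI B.m_closed j.hom_closed D F.v_closed Gm sg_closed g
						sp.PG.m_closed[OF h sp.PG.m_closed[OF sp.PG.inv_closed[OF g]], unfolded sp.PG_simps(1)]) auto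
		qed
		also have "... = (+/$B k:car ?G. j (?D sg (g*.$?G inv$?G k) (h*.$?G inv$?G k))*.$B ?v k)"
		proof -
			\<comment> \<open>The substitution x = g k^-1 makes \<open>k\<close> the index of the basis
			  vector and produces the arguments g k^-1 and h k^-1 of the cocycle.\<close>
			let ?F = "%x. j (?D sg x (h*.$?G (inv$?G g*.$?G x)))*.$B ?v (inv$?G x*.$?G g)"
			have bij: "bij_betw (%k. g*.$?G inv$?G k) (car ?G) (car ?G)"
				using bij_betw_trans[OF sp.PG.bij_inv sp.PG.bij_mult_left[OF g]] by(simp add: comp_def)
			have Fc: "?F x:.B" if "x:.?G" for x by(intro B.m_closed j.hom_closed D F.v_closed Gm sg_closed g
						sp.PG.m_closed[OF h sp.PG.m_closed[OF sp.PG.inv_closed[OF g]], unfolded sp.PG_simps(1)]) (use that in auto)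
			have "(+/$B x:car ?G. ?F x) = (+/$B k:car ?G. ?F (g*.$?G inv$?G k))"
				by(rule B.finsum_bij[OF bij, symmetric]) (rule Fc)
			also have "... = (+/$B k:car ?G. j (?D sg (g*.$?G inv$?G k) (h*.$?G inv$?G k))*.$B ?v k)"
			proof (rule B.finsum_cong'[OF refl])
				fix k assume k: "k:.?G"
				note ik = sp.PG.inv_closed[OF k] and ig = sp.PG.inv_closed[OF g]
				have "inv$?G g*.$?G (g*.$?G inv$?G k) = inv$?G k"
					using sp.PG.m_assoc[OF ig g ik] sp.PG.l_inv[OF g] sp.PG.l_one[OF ik] by simp
				moreover have "inv$?G (g*.$?G inv$?G k)*.$?G g = k"
					using sp.PG.inv_mult_group[OF g ik] sp.PG.inv_inv[OF k] sp.PG.m_assoc[OF k ig g] sp.PG.l_inv[OF g] sp.PG.r_one[OF k] by simp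
				ultimately show "?F (g*.$?G inv$?G k) = j (?D sg (g*.$?G inv$?G k) (h*.$?G inv$?G k))*.$B ?v k" by(simp only:)
			next
				show "(%k. j (?D sg (g*.$?G inv$?G k) (h*.$?G inv$?G k))*.$B ?v k):car ?G \<rightarrow> car B"
					by(intro funcsetI B.m_closed j.hom_closed D F.v_closed sg_closed
							sp.PG.m_closed[OF h sp.PG.inv_closed, unfolded sp.PG_simps(1)] sp.PG.m_closed[OF g sp.PG.inv_closed, unfolded sp.PG_simps(1)]) auto
			qed
			finally show ?thesis .
		qed
		finally show "?v g*.$B ?v h = ..." .
		have "(+/$Q a:car ?G. +/$Q c:car ?G. ?D ta a c*.$Q ?D sg (inv$?G a*.$?G g) (inv$?G c*.$?G h)) =
				SQ.ev (sp.b g) (%i. SQ.ev (sp.b h) (%k. SQ.ev2 (d i) (%a b. SQ.ev2 (d k) (%c e. ta a c*.$Q sg b e))))"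
			by(rule SQ.double_comult[symmetric]) (use gh be sp.finite_points Gm' sp.b_comult in auto)
		also have "... = SQ.ev (sp.b g) (%i. SQ.ev (sp.b h) (%k. z (ep i)*.$Q z (ep k)))"
			by(rule SQ.ev_cong, rule refl, rule SQ.ev_cong[OF refl]) (use gh be in "auto simp: ta_sg")
		also have "... = SQ.ev (sp.b g) (%i. z (ep i))*.$Q SQ.ev (sp.b h) (%i. z (ep i))"
			by(rule SQ.ev_prod) (use gh be in auto)
		also have "... = z (if g = 1.$?G then 1.$L else 0.$L)*.$Q z (if h = 1.$?G then 1.$L else 0.$L)"
			using gh be sp.b_counit[OF gh(1)] sp.b_counit[OF gh(2)] by(simp add: SQ.ev_scalar)
		finally show "(+/$Q a:car ?G. +/$Q c:car ?G. ?D ta a c*.$Q ?D sg (inv$?G a*.$?G g) (inv$?G c*.$?G h)) =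
				(if g = 1.$?G & h = 1.$?G then 1.$Q else 0.$Q)" by auto
	next
		have "(+/$B g:car ?G. ?v g) = (+/$B i:I. +/$B g:car ?G. j (z (sp.b g i))*.$B W i)"
			unfolding SB.ev_def by(rule SB.sum_swap[symmetric]) (use sp.finite_points be in auto)
		also have "... = SB.ev u W" unfolding SB.ev_def
		proof (rule SB.sum_cong)
			fix i assume i: "i:I"
			have "(+/$B g:car ?G. j (z (sp.b g i))*.$B W i) = (+/$B g:car ?G. j (z (sp.b g i)))*.$B W i"
				by(rule B.finsum_ldistr[symmetric]) (use sp.finite_points be i in auto)
			also have "(+/$B g:car ?G. j (z (sp.b g i))) = j (z (+/$L g:car ?G. sp.b g i))"
				by(rule SB.ze_sum[symmetric]) (use sp.finite_points be i in auto)
			finally show "(+/$B g:car ?G. j (z (sp.b g i))*.$B W i) = j (z (u i))*.$B W i"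
				using sp.sum_b[OF i] by simp
		qed auto
		finally show "1.$B = (+/$B g:car ?G. ?v g)" using one_W by simp
	qed (use be D in auto)
	show ?thesis by(rule jacobson_radical_iff_span[OF free refl _ _ _ C.jacobson_radical_iff, where be = sp.b])
			(use be p sp.b_delta in auto)
qed

text \<open>The dual is commutative, and its points are the grouplike elements of the algebra
  itself, while the idempotents of the dual serve as coordinates. Grouplike elements multiply as in
  the group up to the cocycle, which gives a \<open>group_crossed_product\<close>.\<close>

theorem jacobson_radical_iff_cocomm:
	assumes closed_field: "algebraically_closed L" and cocomm: "!!i k n. i:I==>k:I==>n:I==>d i k n = d i n k"
	shows "x:rad B \<longleftrightarrow> x:.B & (ALL i:I. P i x:rad Q)"
proof -
	interpret L': algebraically_closed L by fact
	interpret du: hopf_constants L I "%i j k. d k i j" "%i j k. m j k i" "%i j. A j i" ep u l t by(rule dual)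
	interpret sp: split_hopf_constants L I "%i j k. d k i j" "%i j k. m j k i" "%i j. A j i" ep u l t
		by unfold_locales (rule cocomm)
	let ?G = "sp.PG" and ?be = "%g::'i => 'l. g"
	have p: "sp.b g i:.L" if "g:sp.points" for g i using sp.b_closed[OF that] by simp
	have be: "g i:.L" if "g:sp.points" for g i using sp.pointsD(4)[OF that] .
	let ?c = "+/$L i:I. l i*.$L t i"
	let ?v = "%g. SB.ev (?be g) W"
	let ?E = "%g s. SQ.ev (?be g) (%i. E i s)"
	let ?D = "%f g h. SQ.ev (?be g) (%i. SQ.ev (?be h) (f i))"
	have free: "group_free_extension Q B ?G j ?v (%g x. SQ.ev (sp.b g) (%i. P i x)) (z ?c)"
	proof (rule dual_bases_free_extension[OF sp.group_PG])
		show "finite (car ?G)" using sp.finite_points by simp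
		show "(+/$L i:I. sp.b g i*.$L h i) = (if g = h then 1.$L else 0.$L)" if "g:.?G" "h:.?G" for g h
			using sp.pair_b[of g h] that sum_cong[of "%i. sp.b g i*.$L h i" "%i. h i*.$L sp.b g i"] be p
			by(auto simp: sp.pair_def m_comm)
		show "(+/$L g:car ?G. sp.b g i*.$L g k) = (if i = k then 1.$L else 0.$L)" if "i:I" "k:I" for i k
			using sp.b_delta[OF that(2,1)] finsum_cong'[OF refl, of "%g. g k*.$L sp.b g i" sp.points "%g. sp.b g i*.$L g k"] be p
			by(auto simp: m_comm)
		show "(+/$L g:car ?G. ?c) = 1.$L" using sp.sum_points by simp
	qed (use be p in auto)
	then interpret F: group_free_extension Q B ?G j ?v "%g x. SQ.ev (sp.b g) (%i. P i x)" "z ?c" .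
	have v: "?v g:.B" if "g:sp.points" for g using F.v_closed that by simp
	have D: "?D f g h:.Q" if "g:sp.points" "h:sp.points" "!!i k. i:I==>k:I==>f i k:.Q" for f g h
		using that be by auto
	\<comment> \<open>A point of the dual is multiplicative for the transposed coproduct, so the
	  coproduct of \<open>g\<close> is \<open>g\<close> tensor \<open>g\<close>: a sum with one term,
	  indexed by the unit type.\<close>
	have grouplike: "(+/$L i:I. g i*.$L d i a b) = (+/$L x:{()}. g a*.$L g b)" if "g:sp.points" "a:I" "b:I" for g a b
	proof -
		have "(+/$L i:I. g i*.$L d i a b) = (+/$L i:I. d i a b*.$L g i)" by(rule sum_cong) (use that be in "auto simp: m_comm")
		also have "... = g a*.$L g b" by(rule sp.pointsD(2)[OF that])
		finally show ?thesis using be that by simp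
	qed
	\<comment> \<open>At grouplike arguments the convolution product is the ordinary product of values.
	  Applied in both orders, this shows that the values of \<open>sg\<close> are units with inverses
	  given by \<open>ta\<close>.\<close>
	have comult2: "?D f g h*.$Q ?D f' g h = 1.$Q"
		if gh: "g:sp.points" "h:sp.points" and f: "!!i k. i:I==>k:I==>f i k:.Q" "!!i k. i:I==>k:I==>f' i k:.Q"
			and ff: "!!i k. i:I==>k:I==>SQ.ev2 (d i) (%a b. SQ.ev2 (d k) (%c e. f a c*.$Q f' b e)) = z (ep i*.$L ep k)" for f f' g h
	proof -
		have gu: "(+/$L i:I. g i*.$L ep i) = 1.$L" if "g:sp.points" for g
			using sp.pointsD(3)[OF that] sum_cong[of "%i. g i*.$L ep i" "%i. ep i*.$L g i"] be[OF that] by(simp add: m_comm)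
		have "SQ.ev g (%i. SQ.ev h (%k. SQ.ev2 (d i) (%a b. SQ.ev2 (d k) (%c e. f a c*.$Q f' b e)))) =
				(+/$Q x:{()}. +/$Q y:{()}. ?D f g h*.$Q ?D f' g h)"
			by(rule SQ.double_comult[where ga = "%_. g" and de = "%_. g" and ga' = "%_. h" and de' = "%_. h"]) (use gh be f grouplike in auto)
		moreover have "SQ.ev g (%i. SQ.ev h (%k. SQ.ev2 (d i) (%a b. SQ.ev2 (d k) (%c e. f a c*.$Q f' b e)))) =
				SQ.ev g (%i. SQ.ev h (%k. z (ep i)*.$Q z (ep k)))"
			by(rule SQ.ev_cong, rule refl, rule SQ.ev_cong[OF refl]) (use gh be in "auto simp: ff")
		moreover have "... = SQ.ev g (%i. z (ep i))*.$Q SQ.ev h (%i. z (ep i))"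
			by(rule SQ.ev_prod) (use gh be in auto)
		moreover have "... = 1.$Q" using gh be by(simp add: SQ.ev_scalar gu)
		ultimately show ?thesis using D[OF gh f(1)] D[OF gh f(2)] by simp
	qed
	interpret C: group_crossed_product Q B ?G j ?v "%g x. SQ.ev (sp.b g) (%i. P i x)" "z ?c" ?E "?D sg"
	proof unfold_locales
		fix g s assume g: "g:.?G" and s: "s:.Q"
		hence g': "g:sp.points" by simp
		have "?v g*.$B j s = SB.ev g (%i. W i*.$B j s)" by(rule SB.ev_right) (use s be g' in auto)
		also have "... = SB.ev g (%i. SB.ev2 (d i) (%a b. j (E a s)*.$B W b))"
			by(rule SB.ev_cong[OF refl W_j]) (use s be g' in auto)
		also have "... = (+/$B a:{()}. SB.ev g (%x. SB.ev g (%y. j (E x s)*.$B W y)))"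
			by(rule SB.ev_comult[where ga = "%_. g" and de = "%_. g"]) (use s be g' grouplike in auto)
		also have "... = SB.ev g (%x. SB.ev g (%y. j (E x s)*.$B W y))" using s be g' by simp
		also have "... = j (?E g s)*.$B ?v g"
			by(subst j_ev, use s g' be in simp, use s be in simp, rule SB.ev_prod) (use s be g' in auto)
		finally show "?v g*.$B j s = ..." .
	next
		fix g h assume g: "g:.?G" and h: "h:.?G"
		hence gh: "g:sp.points" "h:sp.points" by auto
		show "?D sg g h:Units Q"
			unfolding Units_def using comult2[OF gh, of ta sg] comult2[OF gh, of sg ta] D[OF gh, of sg] D[OF gh, of ta] ta_sg sg_ta by auto
		let ?M = "%b e. SB.ev (m b e) W"
		have Mc: "?M b e:.B" if "b:I" "e:I" for b e using that by auto
		have mul: "SB.ev g (%b. SB.ev h (?M b)) = ?v (g*.$?G h)"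
		proof -
			have "(+/$L i:I. +/$L j:I. (g i*.$L h j)*.$L m i j k) = sp.conv g h k" if k: "k:I" for k
				unfolding sp.conv_apply[OF k] by(intro sum_cong) (use gh be k in "auto simp: m_comm")
			moreover have "sp.conv g h k:.L" for k using sp.conv_closed[of g h] sp.pointsD(1) gh by simp
			moreover have "SB.ev g (%b. SB.ev h (?M b)) = SB.ev (%k. +/$L i:I. +/$L j:I. (g i*.$L h j)*.$L m i j k) W"
				by(rule SB.ev_mult[OF be[OF gh(1)] be[OF gh(2)]]) auto
			ultimately show ?thesis unfolding sp.PG_simps(2) by(simp only:) (rule SB.ev_cong, auto)
		qed
		have "?v g*.$B ?v h = SB.ev g (%i. SB.ev h (%k. W i*.$B W k))"
			by(rule SB.ev_prod[symmetric]) (use gh be in auto)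
		also have "... = SB.ev g (%i. SB.ev h (%k. SB.ev2 (d i) (%a b. SB.ev2 (d k) (%c e. j (sg a c)*.$B ?M b e))))"
			by(rule SB.ev_cong, rule refl, rule SB.ev_cong[OF refl W_W]) (use gh be in auto)
		also have "... = (+/$B x:{()}. +/$B y:{()}. SB.ev g (%a. SB.ev h (%c. j (sg a c)))*.$B SB.ev g (%b. SB.ev h (?M b)))"
			by(rule SB.double_comult[where ga = "%_. g" and de = "%_. g" and ga' = "%_. h" and de' = "%_. h"]) (use gh be grouplike Mc in auto)
		also have "... = SB.ev g (%a. SB.ev h (%c. j (sg a c)))*.$B ?v (g*.$?G h)"
			using gh be Mc F.v_closed[OF sp.PG.m_closed[OF g h]] by(simp add: mul)
		also have "SB.ev g (%a. SB.ev h (%c. j (sg a c))) = SB.ev g (%a. j (SQ.ev h (sg a)))"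
			by(rule SB.ev_cong) (use gh be in "auto simp: j_ev")
		also have "... = j (?D sg g h)" by(rule j_ev[symmetric]) (use gh be in auto)
		finally show "?v g*.$B ?v h = j (?D sg g h)*.$B ?v (g*.$?G h)" .
	next
		have "SB.ev 1.$?G W = SB.ev u W" by(rule SB.ev_cong) auto
		thus "SB.ev 1.$?G W = 1.$B" using one_W by simp
	qed (use be D in auto)
	show ?thesis
	proof (rule jacobson_radical_iff_span[OF free refl _ _ _ C.jacobson_radical_iff, where be = ?be])
		show "(+/$L g:car ?G. sp.b g i*.$L g k) = (if i = k then 1.$L else 0.$L)" if "i:I" "k:I" for i k
			using sp.b_delta[OF that(2,1)] finsum_cong'[OF refl, of "%g. g k*.$L sp.b g i" sp.points "%g. sp.b g i*.$L g k"] be p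
			by(auto simp: m_comm)
	qed (use be p in auto)
qed

end

section \<open>Tensor products of algebras and base change\<close>

lemma linI:
	assumes "!!x. x:.V==>f x:.W"
		"!!x y. x:.V==>y:.V==>f (x+.$V y) = f x+.$W f y"
		"!!c x. c:.K==>x:.V==>f (c.*$V x) = c.*$W f x"
	shows "lin K V W f"
	using assms by(auto simp: linear_map_def)

lemma linD:
	assumes "lin K V W f"
	shows "x:.V==>f x:.W"
		"x:.V==>y:.V==>f (x+.$V y) = f x+.$W f y"
		"c:.K==>x:.V==>f (c.*$V x) = c.*$W f x"
	using assms by(auto simp: linear_map_def)

lemma bilI:
	assumes "!!x y. x:.V==>y:.W==>B x y:.U"
		"!!x x' y. x:.V==>x':.V==>y:.W==>B (x+.$V x') y = B x y+.$U B x' y"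
		"!!c x y. c:.K==>x:.V==>y:.W==>B (c.*$V x) y = c.*$U B x y"
		"!!x y y'. x:.V==>y:.W==>y':.W==>B x (y+.$W y') = B x y+.$U B x y'"
		"!!c x y. c:.K==>x:.V==>y:.W==>B x (c.*$W y) = c.*$U B x y"
	shows "bil K V W U B"
	using assms by(auto simp: bilinear_map_def linear_map_def)

lemma bilD:
	assumes "bil K V W U B"
	shows "x:.V==>y:.W==>B x y:.U"
		"x:.V==>x':.V==>y:.W==>B (x+.$V x') y = B x y+.$U B x' y"
		"c:.K==>x:.V==>y:.W==>B (c.*$V x) y = c.*$U B x y"
		"x:.V==>y:.W==>y':.W==>B x (y+.$W y') = B x y+.$U B x y'"
		"c:.K==>x:.V==>y:.W==>B x (c.*$W y) = c.*$U B x y"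
	using assms by(auto simp: bilinear_map_def linear_map_def)

lemma lin_comp:
	"lin K V W f==>lin K W U g==>lin K V U (%x. g (f x))" by(auto simp: linear_map_def Pi_iff)

lemma lin_finsum:
	assumes "module K V" "module K W" "lin K V W f" "finite J" "!!a. a:J==>g a:.V"
	shows "f (+/$V a:J. g a) = (+/$W a:J. f (g a))"
	by(rule add_finsum[OF module.axioms(2)[OF assms(1)] module.axioms(2)[OF assms(2)] _ _ assms(4)])
		(use linD[OF assms(3)] assms(5) in auto)

lemma lin_zero:
	assumes "module K V" "module K W" "lin K V W f"
	shows "f 0.$V = 0.$W"
	using subgroup.one_closed[OF submodule.axioms(1)[OF linear_map_kernel[OF assms]]] by simp

lemma linear_equalizer:
	assumes "module K V" "module K W" "lin K V W f" "lin K V W g"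
	shows "submodule {x:car V. f x = g x} K V"
proof -
	interpret V: module K V by fact
	interpret W: module K W by fact
	note f = linD[OF assms(3)] and g = linD[OF assms(4)]
	note f0 = lin_zero[OF assms(1-3)] and g0 = lin_zero[OF assms(1,2,4)]
	have sm: "c.*$V x:{x:car V. f x = g x}" if "c:.K" "x:{x:car V. f x = g x}" for c x
		using that by(auto simp: f g)
	show ?thesis
	proof (rule V.submoduleI)
		show "-.$V x:{x:car V. f x = g x}" if "x:{x:car V. f x = g x}" for x
			using sm[of "-.$K 1.$K" x] that by(simp add: V.smult_l_minus)
	qed (auto simp: f g f0 g0)
qed

section \<open>Tensor products of vector spaces\<close>

locale vs_pair = K?: field K + V: module K V + W: module K W
	for K :: "('k, 'n) ring_scheme" (structure) and V :: "('k, 'v, 'm) module_scheme" and W :: "('k, 'w, 'l) module_scheme"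
begin

abbreviation TT where "TT \<equiv> tensor_space K V W"
abbreviation tn where "tn \<equiv> tensor K V W"

sublocale TT: module K TT by(rule tensor_space_module(1)) unfold_locales

lemmas VWK = K.field_axioms V.module_axioms W.module_axioms

lemmas tn_bilinear = tensor_bilinear[OF VWK]
lemmas tn_simps = bilD[OF tn_bilinear]
lemmas lift_tn = tensor_lift_tensor[OF VWK]
lemmas lift_linear = tensor_lift_linear[OF VWK]

text \<open>Induction over the support of a representative in the free space on pairs: splitting off
  one generator splits off one pure tensor.\<close>

lemma tensor_span:
	assumes N: "submodule N K TT" and pure: "!!x y. x:.V==>y:.W==>tn x y:N"
		and t: "t:.TT"
	shows "t:N"
proof -
	let ?P = "pair_space K V W" and ?c = "%f. tensor_relations K V W +>$(pair_space K V W) f"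
	interpret P: module K ?P by(rule free_space_module) (rule K.field_axioms)
	note ND = TT.submoduleE[OF N]
	have rel: "submodule (tensor_relations K V W) K ?P" by(rule tensor_relations_submodule[OF VWK])
	have main: "?c f:N" if "finite S" "f:.?P" "{p. f p ~= 0.} <= S" for S f
		using that
	proof (induction S arbitrary: f)
		case empty
		hence "f = 0.$?P" by(auto simp: free_space_simps)
		moreover have "?c 0.$?P = 0.$TT"
		proof -
			have "?c 0.$?P:.TT"
				using P.zero_closed by(auto simp: tensor_space_def A_RCOSETS_def')
			thus ?thesis
				using tensor_space_module(2)[OF VWK P.zero_closed K.zero_closed] by simp
		qed
		ultimately show ?case using TT.submoduleE(1,2)[OF N] subgroup.one_closed[OF submodule.axioms(1)[OF N]] by auto
	next
		case (insert p S)
		show ?case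
		proof (cases "f p = 0.")
			case True
			thus ?thesis using insert by auto
		next
			case False
			have fK: "f q:.K" for q using insert.prems by(auto simp: free_space_simps)
			obtain x y where p: "p = (x, y)" "x:.V" "y:.W"
				using False insert.prems(1) by(cases p) (auto simp: free_space_simps)
			let ?g = "%q. if q = p then 0. else f q"
			have "finite {s. ?g s ~= 0.}"
				by(rule finite_subset[of _ "{s. f s ~= 0.}"]) (use insert.prems(1) in "auto simp: free_space_simps")
			moreover have "range ?g <= car K" using fK by auto
			moreover have "ALL s. s ~: car V \<times> car W --> ?g s = 0." using insert.prems(1) unfolding free_space_simps(1) by auto
			ultimately have g: "?g:.?P" unfolding free_space_simps(1) by blast
			have gen: "free_gen K p:.?P" using p by(intro free_gen_closed) (auto intro: K.field_axioms)
			have f: "f = (f p.*$?P free_gen K p)+.$?P ?g"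
				unfolding free_space_simps(3,4) by(rule ext) (use fK in "simp add: free_gen_def")
			have "?c f = f p.*$TT tn x y+.$TT ?c ?g"
				by(subst f) (use gen g fK p in "simp add: tensor_space_module(2,3)[OF VWK, symmetric] tensor_def")
			moreover have "?c ?g:N" by(rule insert.IH[OF g]) (use insert.prems in auto)
			ultimately show ?thesis using pure[OF p(2,3)] fK ND by auto
		qed
	qed
	obtain f where "f:.?P" "t = ?c f" by(rule tensor_space_carrierE[OF VWK t])
	thus ?thesis using main[of "{p. f p ~= 0.}" f] by(auto simp: free_space_simps)
qed

lemma tensor_eqI:
	assumes "module K U" "lin K TT U f" "lin K TT U g"
		"!!x y. x:.V==>y:.W==>f (tn x y) = g (tn x y)" and t: "t:.TT"
	shows "f t = g t"
	using tensor_span[OF linear_equalizer[OF TT.module_axioms assms(1-3)] _ t] assms(4) tn_simps(1) by auto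

lemma lift_closed:
	assumes "module K U" "t:.TT" "!!x y. x:.V==>y:.W==>B x y:.U"
	shows "tensor_lift K U B t:.U"
	by(rule tensor_lift_closed[OF VWK assms(1) module.carrier_is_submodule[OF assms(1)] assms(2,3)])

lemma lift_hom:
	assumes "module K U" "module K U'" "lin K U U' e" "t:.TT"
		"!!x y. x:.V==>y:.W==>B x y:.U"
	shows "e (tensor_lift K U B t) = tensor_lift K U' (%x y. e (B x y)) t"
	by(rule tensor_lift_hom[OF VWK assms(1,2,3,4), symmetric]) (use assms(5) in auto)

lemma lift_cong:
	assumes "module K U" "t:.TT" "!!x y. x:.V==>y:.W==>B x y = B' x y"
		"!!x y. x:.V==>y:.W==>B' x y:.U"
	shows "tensor_lift K U B t = tensor_lift K U B' t"
	by(rule tensor_lift_hom[OF VWK assms(1,1) _ assms(2), where e = "%x. x"]) (use assms(3,4) in "auto simp: linear_map_def")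

lemma lift_smult:
	assumes "module K U" "t:.TT" "!!x y. x:.V==>y:.W==>B x y:.U" "c:.K"
	shows "tensor_lift K U (%x y. c.*$U B x y) t = c.*$U tensor_lift K U B t"
proof -
	interpret U: module K U by fact
	show ?thesis by(rule tensor_lift_hom[OF VWK assms(1,1) _ assms(2,3)])
			(use assms(4) in "auto simp: linear_map_def U.smult_r_distr U.smult_assoc1[symmetric] K.m_comm")
qed

lemma lift_add:
	assumes "module K U" "t:.TT" "!!x y. x:.V==>y:.W==>B x y:.U"
		"!!x y. x:.V==>y:.W==>B' x y:.U"
	shows "tensor_lift K U (%x y. B x y+.$U B' x y) t = tensor_lift K U B t+.$U tensor_lift K U B' t"
proof -
	interpret U: module K U by fact
	let ?f = "SOME f. f:t"
	have f: "?f:.(pair_space K V W)" using tensor_space_rep[OF VWK assms(2)] by blast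
	have fK: "?f p:.K" for p using f by(auto simp: free_space_simps)
	have sup: "p:car V \<times> car W" if "?f p ~= 0." for p using f that unfolding free_space_simps(1) by blast
	have B: "B (fst p) (snd p):.U" "B' (fst p) (snd p):.U" if "?f p ~= 0." for p
		using sup[OF that] assms(3,4) by auto
	have "(+/$U p:{p. ?f p ~= 0.}. ?f p.*$U (B (fst p) (snd p)+.$U B' (fst p) (snd p))) =
			(+/$U p:{p. ?f p ~= 0.}. ?f p.*$U B (fst p) (snd p)+.$U ?f p.*$U B' (fst p) (snd p))"
		by(rule U.finsum_cong'[OF refl]) (use B fK in "auto simp: U.smult_r_distr")
	also have "... = (+/$U p:{p. ?f p ~= 0.}. ?f p.*$U B (fst p) (snd p))+.$U (+/$U p:{p. ?f p ~= 0.}. ?f p.*$U B' (fst p) (snd p))"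
		by(rule U.finsum_addf) (use B fK in auto)
	finally show ?thesis by(simp add: tensor_lift_def formal_sum_def)
qed

end

locale algebra_pair = A: assoc_algebra K A + B: assoc_algebra K B
	for K :: "('k, 'n) ring_scheme" (structure) and A :: "('k, 'a, 'm) module_scheme" and B :: "('k, 'b, 'l) module_scheme"
begin

sublocale vs_pair K A B by unfold_locales

abbreviation TA where "TA \<equiv> tensor_algebra K A B"

lemma TA_simps[simp]: "car TA = car TT" "add TA = add TT" "0.$TA = 0.$TT" "smult TA = smult TT"
		"1.$TA = tn 1.$A 1.$B" by(simp_all add: tensor_algebra_def)

lemma inner_bilinear:
	"a:.A==>b:.B==>bil K A B TT (%a' b'. tn (a*.$A a') (b*.$B b'))"
	by(rule bilI) (auto simp: tn_simps A.r_distr B.r_distr A.smult_mult_right B.smult_mult_right)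

lemma outer_bilinear:
	assumes t: "t:.TT"
	shows "bil K A B TT (%a b. tensor_lift K TT (%a' b'. tn (a*.$A a') (b*.$B b')) t)"
proof (rule bilI, goal_cases)
	case 1
	thus ?case by(intro lift_closed[OF TT.module_axioms t]) (auto simp: tn_simps)
next
	case (2 x x' y)
	thus ?case by(subst lift_add[OF TT.module_axioms t, symmetric]) (auto simp: tn_simps A.l_distr intro!: lift_cong[OF TT.module_axioms t])
next
	case (3 c x y)
	thus ?case by(subst lift_smult[OF TT.module_axioms t, symmetric]) (auto simp: tn_simps A.smult_mult_left intro!: lift_cong[OF TT.module_axioms t])
next
	case (4 x y y')
	thus ?case by(subst lift_add[OF TT.module_axioms t, symmetric]) (auto simp: tn_simps B.l_distr intro!: lift_cong[OF TT.module_axioms t])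
next
	case (5 c x y)
	thus ?case by(subst lift_smult[OF TT.module_axioms t, symmetric]) (auto simp: tn_simps B.smult_mult_left intro!: lift_cong[OF TT.module_axioms t])
qed

lemma TA_mult: "s*.$TA t = tensor_lift K TT (%a b. tensor_lift K TT (%a' b'. tn (a*.$A a') (b*.$B b')) t) s"
	by(simp add: tensor_algebra_def)

lemma mult_linl: "t:.TT==>lin K TT TT (%s. s*.$TA t)"
	unfolding TA_mult by(rule lift_linear[OF TT.module_axioms outer_bilinear])

lemma mult_pure_left:
	"a:.A==>b:.B==>t:.TT ==>
		tn a b*.$TA t = tensor_lift K TT (%a' b'. tn (a*.$A a') (b*.$B b')) t"
	unfolding TA_mult by(rule lift_tn[OF TT.module_axioms outer_bilinear])

lemma mult_pure:
	"a:.A==>b:.B==>a':.A==>b':.B ==>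
		tn a b*.$TA tn a' b' = tn (a*.$A a') (b*.$B b')"
	by(subst mult_pure_left) (auto simp: tn_simps lift_tn[OF TT.module_axioms inner_bilinear])

text \<open>For a pure left factor the product is a lift of a bilinear map, hence linear on the
  right; the left factors for which this holds form a subspace.\<close>

lemma mult_linr:
	assumes s: "s:.TT"
	shows "lin K TT TT (%t. s*.$TA t)"
proof -
	let ?N = "{s:car TT. lin K TT TT (%t. s*.$TA t)}"
	note l = linD[OF mult_linl]
	have sm: "c.*$TT x:?N" if "c:.K" "x:?N" for c x
		using that by(auto simp: l linear_map_def TT.smult_r_distr TT.smult_assoc1[symmetric] A.K.m_comm Pi_iff)
	have N: "submodule ?N K TT"
	proof (rule TT.submoduleI)
		have z: "0.$TT*.$TA t = 0.$TT" if "t:.TT" for t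
			using lin_zero[OF TT.module_axioms TT.module_axioms mult_linl[OF that]] .
		show "0.$TT:?N" by(auto simp: linear_map_def z)
		show "-.$TT x:?N" if "x:?N" for x using sm[of "-. 1." x] that by(simp add: TT.smult_l_minus)
		show "x+.$TT y:?N" if "x:?N" "y:?N" for x y
			using that by(auto simp: l linear_map_def TT.smult_r_distr TT.a_ac Pi_iff)
		show "c.*$TT x:?N" if "c:.K" "x:?N" for c x by(rule sm[OF that])
	qed auto
	have "s:?N"
	proof (rule tensor_span[OF N _ s])
		fix a b assume a: "a:.A" "b:.B"
		have "lin K TT TT (tensor_lift K TT (%a' b'. tn (a*.$A a') (b*.$B b')))"
			by(rule lift_linear[OF TT.module_axioms inner_bilinear[OF a]])
		hence "lin K TT TT (%t. tn a b*.$TA t)"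
			using a by(auto simp: linear_map_def mult_pure_left Pi_iff)
		thus "tn a b:?N" using a by(simp add: tn_simps)
	qed
	thus ?thesis by simp
qed

lemma mult_closed: "s:.TT==>t:.TT==>s*.$TA t:.TT"
	using linD(1)[OF mult_linr] .

lemma mult_assoc:
	assumes "r:.TT" "s:.TT" "t:.TT"
	shows "r*.$TA s*.$TA t = r*.$TA (s*.$TA t)"
proof -
	note L = lin_comp[OF mult_linl mult_linl] and R = lin_comp[OF mult_linr mult_linr]
		and LR = lin_comp[OF mult_linl mult_linr] and RL = lin_comp[OF mult_linr mult_linl]
	have 1: "tn a b*.$TA tn a' b'*.$TA t = tn a b*.$TA (tn a' b'*.$TA t)"
		if "a:.A" "b:.B" "a':.A" "b':.B" for a b a' b'
		by(rule tensor_eqI[OF TT.module_axioms mult_linr R _ assms(3)])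
			(use that in "auto simp: tn_simps mult_closed mult_pure A.m_assoc B.m_assoc")
	have 2: "tn a b*.$TA s*.$TA t = tn a b*.$TA (s*.$TA t)" if "a:.A" "b:.B" for a b
		by(rule tensor_eqI[OF TT.module_axioms RL LR _ assms(2)]) (use that assms 1 in "auto simp: tn_simps mult_closed")
	show ?thesis
		by(rule tensor_eqI[OF TT.module_axioms L mult_linl _ assms(1)]) (use assms 2 in "auto simp: tn_simps mult_closed")
qed

lemma mult_one:
	assumes "t:.TT"
	shows "tn 1.$A 1.$B*.$TA t = t" "t*.$TA tn 1.$A 1.$B = t"
proof -
	have i: "lin K TT TT (%t. t)" by(auto simp: linear_map_def)
	show "tn 1.$A 1.$B*.$TA t = t" by(rule tensor_eqI[OF TT.module_axioms mult_linr i _ assms]) (auto simp: tn_simps mult_pure)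
	show "t*.$TA tn 1.$A 1.$B = t" by(rule tensor_eqI[OF TT.module_axioms mult_linl i _ assms]) (auto simp: tn_simps mult_pure)
qed

lemma tensor_ring: "ring TA"
proof (rule ringI)
	show "abelian_group TA"
		using TT.abelian_group_axioms by(simp add: abelian_group_def abelian_monoid_def abelian_group_axioms_def)
	show "monoid TA" by(rule monoidI) (auto simp: tn_simps mult_closed mult_assoc mult_one)
qed (auto simp: linD[OF mult_linl] linD[OF mult_linr])

sublocale TA: ring TA by(rule tensor_ring)

end

section \<open>Extension of scalars of an algebra\<close>

locale base_change = A: assoc_algebra K A + F: field F
	for K :: "('k, 'n) ring_scheme" (structure) and A :: "('k, 'a, 'm) module_scheme" and F :: "('f, 'q) ring_scheme" +
	fixes io :: "'k => 'f"
	assumes io_hom: "io:ring_hom K F"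
begin

abbreviation EF where "EF \<equiv> ext_algebra F io"

lemma EF_simps[simp]: "car EF = car F" "add EF = add F" "0.$EF = 0.$F" "monoid.mult EF = monoid.mult F"
		"1.$EF = 1.$F" "c.*$EF x = io c*.$F x" by(simp_all add: ext_algebra_def)

sublocale io: ring_hom_ring K F io by(rule ring_hom_ringI2[OF _ F.ring_axioms io_hom]) unfold_locales

lemma EF_algebra: "assoc_algebra K EF"
proof -
	have neg: "EX y:car F. y+.$F x = 0.$F" if "x:.F" for x
		using that by(intro bexI[of _ "-.$F x"] F.l_neg) auto
	have ag: "abelian_group EF" by(rule abelian_groupI) (auto simp: F.a_ac neg)
	have rg: "ring EF" by(rule ringI[OF ag]) (auto simp: F.l_distr F.r_distr F.m_assoc intro!: monoidI)
	have "module K EF"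
		by(rule moduleI) (use ag in "auto simp: F.l_distr F.r_distr F.m_assoc intro: A.K.is_cring")
	thus ?thesis
		by(intro assoc_algebra.intro assoc_algebra_axioms.intro rg) (auto simp: F.m_ac intro: A.K.field_axioms)
qed

sublocale algebra_pair K A EF by(rule algebra_pair.intro[OF A.assoc_algebra_axioms EF_algebra])

definition incl :: "'a => ('a \<times> 'f => 'k) set" where "incl x = tn x 1.$F"
definition scal :: "'f => ('a \<times> 'f => 'k) set" where "scal c = tn 1.$A c"

lemma tn_simps':
	"x:.A==>c:.F==>tn x c:.TT"
	"x:.A==>y:.A==>c:.F==>tn (x+.$A y) c = tn x c+.$TT tn y c"
	"x:.A==>c:.F==>e:.F==>tn x (c+.$F e) = tn x c+.$TT tn x e"
	"k:.K==>x:.A==>c:.F==>tn (k.*$A x) c = tn x (io k*.$F c)"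
	using tn_simps(1)[where x = x and y = c] tn_simps(2)[where x = x and x' = y and y = c]
		tn_simps(4)[where x = x and y = c and y' = e] tn_simps(3)[where c = k and x = x and y = c]
		tn_simps(5)[where c = k and x = x and y = c] by simp_all

lemma mult_pure': "a:.A==>b:.F==>a':.A==>b':.F ==>
		tn a b*.$TA tn a' b' = tn (a*.$A a') (b*.$F b')"
	using mult_pure[of a b a' b'] by simp

lemma scal_hom: "scal:ring_hom F TA" by(rule ring_hom_memI) (auto simp: scal_def tn_simps' mult_pure')

lemma incl_scal: "x:.A==>c:.F==>scal c*.$TA incl x = tn x c" by(simp add: incl_def scal_def mult_pure')

lemma scal_central:
	assumes c: "c:.F" and t: "t:.TT"
	shows "t*.$TA scal c = scal c*.$TA t" by(rule tensor_eqI[OF TT.module_axioms mult_linl mult_linr _ t])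
		(use c in "auto simp: scal_def tn_simps' mult_pure' F.m_comm")

end

section \<open>Linear functionals and dual bases\<close>

abbreviation scalars :: "('k, 'n) ring_scheme => ('k, 'k) module" where "scalars K \<equiv> ext_algebra K id"

lemma scalars_simps[simp]: "car (scalars K) = car K" "add (scalars K) = add K" "0.$(scalars K) = 0.$K"
		"c.*$(scalars K) x = c*.$K x" by(simp_all add: ext_algebra_def)

lemma (in field) scalars_module: "module R (scalars R)"
proof (rule moduleI)
	have neg: "EX y:car R. y+.x = 0." if "x:.R" for x
		using that by(intro bexI[of _ "-. x"] l_neg) auto
	show "abelian_group (scalars R)" by(rule abelian_groupI) (auto simp: a_ac neg)
qed (auto simp: l_distr r_distr m_assoc cring_axioms)

lemma scalars_finsum:
	assumes "field K" "finite J" "!!a. a:J==>f a:.K"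
	shows "(+/$(scalars K) a:J. f a) = (+/$K a:J. f a)"
proof -
	interpret K: field K by fact
	interpret S: module K "scalars K" by(rule K.scalars_module)
	show ?thesis using assms(2,3) by(induction J) auto
qed

lemma (in module) submodule_iff_osub: "submodule N R M \<longleftrightarrow> op_group.osub M ((%c x. c.*$M x) ` car R) N"
proof -
	interpret op_group M "(%c x. c.*$M x) ` car R" by unfold_locales (auto simp: smult_r_distr)
	show ?thesis
	proof
		assume N: "submodule N R M"
		note D = submoduleE[OF N]
		show "osub N" by(rule osubI) (use D subgroup.one_closed[OF submodule.axioms(1)[OF N]] in auto)
	next
		assume N: "osub N"
		show "submodule N R M"
		proof (rule submoduleI)
			show "c.*$M x:N" if "c:.R" "x:N" for c x
				using osubD(5)[OF N, of "%x. c.*$M x" x] that by blast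
		qed (use osubD(1-4)[OF N] in auto)
	qed
qed

lemma (in module) submodule_sum:
	assumes A: "submodule A R M" and B: "submodule B R M"
	shows "submodule {a+.$M b |a b. a:A & b:B} R M"
proof (rule submoduleI)
	note A' = submoduleE[OF A] and B' = submoduleE[OF B]
	have c: "a:A==>a:.M" "a:B==>a:.M" for a using A'(1) B'(1) by auto
	have z: "0.$M:A" "0.$M:B"
		using subgroup.one_closed[OF submodule.axioms(1)[OF A]] subgroup.one_closed[OF submodule.axioms(1)[OF B]] by auto
	show "0.$M:{a+.$M b |a b. a:A & b:B}" using z by force
	fix x assume "x:{a+.$M b |a b. a:A & b:B}"
	then obtain a b where x: "x = a+.$M b" "a:A" "b:B" by blast
	have "-.$M x = -.$M a+.$M -.$M b" using x c by(simp add: minus_add)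
	thus "-.$M x:{a+.$M b |a b. a:A & b:B}" using A'(3)[OF x(2)] B'(3)[OF x(3)] by blast
	show "r.*$M x:{a+.$M b |a b. a:A & b:B}" if r: "r:.R" for r
		using x c r A'(4)[OF r x(2)] B'(4)[OF r x(3)] by(auto simp: smult_r_distr)
	fix y assume "y:{a+.$M b |a b. a:A & b:B}"
	then obtain a' b' where y: "y = a'+.$M b'" "a':A" "b':B" by blast
	have "x+.$M y = (a+.$M a')+.$M (b+.$M b')" using x y c by(simp add: a_ac)
	thus "x+.$M y:{a+.$M b |a b. a:A & b:B}" using A'(5)[OF x(2) y(2)] B'(5)[OF x(3) y(3)] by blast
qed (use submoduleE(1)[OF A] submoduleE(1)[OF B] in auto)

lemma (in module) submodule_line:
	assumes v: "v:.M"
	shows "submodule {c.*$M v |c. c:.R} R M"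
proof (rule submoduleI)
	show "0.$M:{c.*$M v |c. c:.R}" using v smult_l_null by force
	fix x assume "x:{c.*$M v |c. c:.R}"
	then obtain c where x: "x = c.*$M v" "c:.R" by blast
	show "-.$M x:{c.*$M v |c. c:.R}"
	proof -
		have "-.$M x = (-.$R c).*$M v" using x v by(simp add: smult_l_minus)
		thus ?thesis using R.a_inv_closed[OF x(2)] by blast
	qed
	show "r.*$M x:{c.*$M v |c. c:.R}" if r: "r:.R" for r
	proof -
		have "r.*$M x = (r*.$R c).*$M v" using x v r by(simp add: smult_assoc1)
		thus ?thesis using R.m_closed[OF r x(2)] by blast
	qed
	fix y assume "y:{c.*$M v |c. c:.R}"
	then obtain e where y: "y = e.*$M v" "e:.R" by blast
	show "x+.$M y:{c.*$M v |c. c:.R}"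
	proof -
		have "x+.$M y = (c+.$R e).*$M v" using x y v by(simp add: smult_l_distr)
		thus ?thesis using R.a_closed[OF x(2) y(2)] by blast
	qed
qed (use v in auto)

text \<open>A subspace maximal among those containing \<open>N\<close> but not \<open>x\<close> is a
  hyperplane complementary to the line through \<open>x\<close>; the functional is the coefficient
  of \<open>x\<close> in that decomposition.\<close>

lemma exists_functional:
	assumes "field K" "module K V" "submodule N K V" and x: "x:.V" "x ~: N"
	shows "EX f. lin K V (scalars K) f & (ALL n:N. f n = 0.$K) & f x = 1.$K"
proof -
	interpret K: field K by fact
	interpret V: module K V by fact
	interpret O: op_group V "(%c x. c.*$V x) ` car K" by unfold_locales (auto simp: V.smult_r_distr)
	note iff = V.submodule_iff_osub
	obtain M where M: "O.osub M" "N <= M" "~ {x} <= M" "!!N'. O.osub N'==>M \<subset> N'==>{x} <= N'"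
	proof (rule O.exists_osub_maximal_avoiding[of N "{x}"])
		show "O.osub N" using assms(3) iff by simp
	qed (use x in auto)
	have Ms: "submodule M K V" using M(1) iff by simp
	note MD = V.submoduleE[OF Ms]
	have Mc: "m:.V" if "m:M" for m using MD(1) that by blast
	have M0: "0.$V:M" using subgroup.one_closed[OF submodule.axioms(1)[OF Ms]] by simp
	have xM: "x ~: M" using M(3) by simp
	have ex: "EX c. c:.K & (EX m:M. v = m+.$V c.*$V x)" if v: "v:.V" for v
	proof (cases "v:M")
		case True
		thus ?thesis using x v by(intro exI[of _ "0.$K"] conjI bexI[of _ v]) auto
	next
		case False
		let ?M' = "{a+.$V b |a b. a:M & b:{c.*$V v |c. c:.K}}"
		have sub: "submodule ?M' K V" by(rule V.submodule_sum[OF Ms V.submodule_line[OF v]])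
		have "M <= ?M'"
		proof
			fix m assume m: "m:M"
			have "m = m+.$V 0.$K.*$V v" using Mc[OF m] v by simp
			thus "m:?M'" using m K.zero_closed by blast
		qed
		moreover have "v:?M'"
		proof -
			have "v = 0.$V+.$V 1.$K.*$V v" using v by simp
			thus ?thesis using M0 K.one_closed by blast
		qed
		ultimately have "M \<subset> ?M'" using False by blast
		hence "x:?M'" using M(4)[of ?M'] sub iff by simp
		then obtain m c where mc: "m:M" "c:.K" "x = m+.$V c.*$V v" by blast
		have "c ~= 0.$K" using mc xM v Mc[OF mc(1)] by auto
		hence c: "inv$K c:.K" "inv$K c*.$K c = 1.$K"
			using mc(2) K.field_Units K.Units_inv_closed K.Units_l_inv by auto
		have m': "-.$V (inv$K c.*$V m):M" using MD(3)[OF MD(4)[OF c(1) mc(1)]] .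
		have "-.$V (inv$K c.*$V m)+.$V inv$K c.*$V x = -.$V (inv$K c.*$V m)+.$V (inv$K c.*$V m+.$V v)"
			using mc c v Mc[OF mc(1)] by(simp add: V.smult_r_distr V.smult_assoc1[symmetric])
		also have "... = v" using c v Mc[OF mc(1)] by(simp add: V.a_assoc[symmetric] V.l_neg)
		finally have e: "v = -.$V (inv$K c.*$V m)+.$V inv$K c.*$V x" by(rule sym)
		show ?thesis by(rule exI[of _ "inv$K c"], rule conjI[OF c(1)], rule bexI[OF _ m'], rule e)
	qed
	have uniq: "c = e" if c: "c:.K" "m:M" "v = m+.$V c.*$V x" and e: "e:.K" "n:M" "v = n+.$V e.*$V x" for c e m n v
	proof (rule ccontr)
		assume ne: "c ~= e"
		note cl = Mc[OF c(2)] Mc[OF e(2)] c(1) e(1) x(1)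
		have "c.*$V x = -.$V m+.$V (m+.$V c.*$V x)" using cl by(simp add: V.a_assoc[symmetric] V.l_neg)
		also have "... = (-.$V m+.$V n)+.$V e.*$V x" using cl c(3) e(3) by(simp add: V.a_assoc)
		finally have ce: "c.*$V x = ..." .
		have "(c -.$K e).*$V x = c.*$V x+.$V -.$V (e.*$V x)" using cl by(simp add: a_minus_def V.smult_l_distr V.smult_l_minus)
		also have "... = -.$V m+.$V n" using cl by(simp add: ce V.a_assoc V.r_neg)
		also have "...:M" using MD(5)[OF MD(3)[OF c(2)] e(2)] .
		finally have in_M: "(c -.$K e).*$V x:M" .
		have "c -.$K e ~= 0.$K" using ne cl by(simp add: K.r_right_minus_eq)
		hence u: "c -.$K e:Units K" using K.field_Units cl by auto
		have "x = (inv$K (c -.$K e)).*$V ((c -.$K e).*$V x)"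
			using cl u by(simp add: V.smult_assoc1[symmetric] K.Units_inv_closed K.Units_l_inv)
		thus False using xM MD(4)[OF K.Units_inv_closed[OF u] in_M] by simp
	qed
	define f where "f v = (THE c. c:.K & (EX m:M. v = m+.$V c.*$V x))" for v
	have f_eq: "f v = c" if "c:.K" "m:M" "v = m+.$V c.*$V x" for v c m
		unfolding f_def
	proof (rule the_equality)
		show "c:.K & (EX m:M. v = m+.$V c.*$V x)" using that by blast
		fix e assume "e:.K & (EX m:M. v = m+.$V e.*$V x)"
		then obtain n where "e:.K" "n:M" "v = n+.$V e.*$V x" by blast
		thus "e = c" by(rule uniq[OF _ _ _ that])
	qed
	have f_ex: "EX m:M. v = m+.$V f v.*$V x" "f v:.K" if "v:.V" for v
	proof -
		from ex[OF that] obtain c m where "c:.K" "m:M" "v = m+.$V c.*$V x" by blast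
		thus "EX m:M. v = m+.$V f v.*$V x" "f v:.K" using f_eq[of c m v] by auto
	qed
	show ?thesis
	proof (intro exI[of _ f] conjI linI ballI)
		fix v w assume v: "v:.V" and w: "w:.V"
		obtain m n where m: "m:M" "v = m+.$V f v.*$V x" and n: "n:M" "w = n+.$V f w.*$V x"
			using f_ex(1)[OF v] f_ex(1)[OF w] by blast
		have "v+.$V w = (m+.$V f v.*$V x)+.$V (n+.$V f w.*$V x)" using m(2) n(2) by simp
		also have "... = (m+.$V n)+.$V (f v+.$K f w).*$V x"
			using Mc[OF m(1)] Mc[OF n(1)] f_ex(2)[OF v] f_ex(2)[OF w] x(1) by(simp add: V.smult_l_distr V.a_ac)
		finally have e: "v+.$V w = ..." .
		show "f (v+.$V w) = f v+.$(scalars K) f w"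
			unfolding scalars_simps by(rule f_eq[OF K.a_closed[OF f_ex(2)[OF v] f_ex(2)[OF w]] MD(5)[OF m(1) n(1)] e])
	next
		fix c v assume c: "c:.K" and v: "v:.V"
		obtain m where m: "m:M" "v = m+.$V f v.*$V x" using f_ex(1)[OF v] by blast
		have "c.*$V v = c.*$V (m+.$V f v.*$V x)" using m(2) by simp
		also have "... = c.*$V m+.$V (c*.$K f v).*$V x"
			using Mc[OF m(1)] f_ex(2)[OF v] c x(1) by(simp add: V.smult_r_distr V.smult_assoc1)
		finally have e: "c.*$V v = ..." .
		show "f (c.*$V v) = c.*$(scalars K) f v"
			unfolding scalars_simps by(rule f_eq[OF K.m_closed[OF c f_ex(2)[OF v]] MD(4)[OF c m(1)] e])
	next
		fix n assume n: "n:N"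
		hence nM: "n:M" using M(2) by blast
		hence "n = n+.$V 0.$K.*$V x" using Mc x by simp
		thus "f n = 0.$K" by(rule f_eq[OF K.zero_closed nM])
	next
		have "x = 0.$V+.$V 1.$K.*$V x" using x by simp
		thus "f x = 1.$K" by(rule f_eq[OF K.one_closed M0])
	qed (simp add: f_ex(2))
qed

lemma (in module) submodule_combinations:
	assumes J: "finite J" and x: "!!j. j:J==>x j:.M"
	shows "submodule {+/$M j:J. c j.*$M x j |c. ALL j:J. c j:.R} R M" (is "submodule ?N R M")
proof -
	have cl: "(%j. c j.*$M x j):J \<rightarrow> car M" if "ALL j:J. c j:.R" for c using that x by auto
	have N: "(+/$M j:J. c j.*$M x j):?N" if "ALL j:J. c j:.R" for c using that by blast
	have sm: "r.*$M y:?N" if r: "r:.R" and y: "y:?N" for r y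
	proof -
		obtain c where c: "ALL j:J. c j:.R" "y = (+/$M j:J. c j.*$M x j)" using y by blast
		have "r.*$M y = (+/$M j:J. r.*$M (c j.*$M x j))" unfolding c(2) by(rule finsum_smult_ldistr[OF J r]) (use c x in auto)
		also have "... = (+/$M j:J. (r*.$R c j).*$M x j)" by(rule finsum_cong'[OF refl]) (use c x r in "auto simp: smult_assoc1")
		finally show ?thesis using N[of "%j. r*.$R c j"] c r by simp
	qed
	show ?thesis
	proof (rule submoduleI)
		show "?N <= car M" using finsum_closed[OF cl] by blast
		have "(+/$M j:J. 0.$R.*$M x j) = (+/$M j:J. 0.$M)" by(rule finsum_cong'[OF refl]) (use x in auto)
		thus "0.$M:?N" using N[of "%_. 0.$R"] by simp
		show "-.$M y:?N" if "y:?N" for y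
		proof -
			have "y:.M" using that finsum_closed[OF cl] by blast
			thus ?thesis using sm[OF _ that, of "-.$R 1.$R"] by(simp add: smult_l_minus)
		qed
		show "y+.$M z:?N" if yz: "y:?N" "z:?N" for y z
		proof -
			obtain c where c: "ALL j:J. c j:.R" "y = (+/$M j:J. c j.*$M x j)" using yz by blast
			obtain e where e: "ALL j:J. e j:.R" "z = (+/$M j:J. e j.*$M x j)" using yz by blast
			have "y+.$M z = (+/$M j:J. c j.*$M x j+.$M e j.*$M x j)"
				unfolding c(2) e(2) by(rule finsum_addf[symmetric]) (use c e x in auto)
			also have "... = (+/$M j:J. (c j+.$R e j).*$M x j)" by(rule finsum_cong'[OF refl]) (use c e x in "auto simp: smult_l_distr")
			finally show ?thesis using N[of "%j. c j+.$R e j"] c e by simp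
		qed
	qed (rule sm)
qed

text \<open>The dual functionals exist for a subfamily minimal among those with the same span.\<close>

lemma exists_dual_functionals:
	assumes "field K" "module K V" and J: "finite J" and x: "!!j. j:J==>x j:.V"
	shows "EX J' f. J' <= J & (ALL j:J'. lin K V (scalars K) (f j)) &
		(ALL i:J'. ALL j:J'. f j (x i) = (if i = j then 1.$K else 0.$K)) &
		(ALL i:J. x i = (+/$V j:J'. f j (x i).*$V x j))"
proof -
	interpret K: field K by fact
	interpret V: module K V by fact
	let ?C = "%J. {+/$V j:J. c j.*$V x j |c. ALL j:J. c j:.K}"
	have sub: "submodule (?C J') K V" if "J' <= J" for J'
		by(rule V.submodule_combinations) (use J x that finite_subset in auto)
	have mem: "x i:?C J'" if "J' <= J" "i:J'" for J' i
	proof -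
		have "(+/$V j:J'. (if j = i then 1.$K else 0.$K).*$V x j) = (+/$V j:J'. if j = i then x j else 0.$V)"
			by(rule V.finsum_cong'[OF refl]) (use x that in auto)
		also have "... = x i" by(rule V.finsum_delta) (use that J x finite_subset in auto)
		finally have e: "(+/$V j:J'. (if j = i then 1.$K else 0.$K).*$V x j) = x i" .
		show ?thesis by(rule CollectI, rule exI[of _ "%j. if j = i then 1.$K else 0.$K"]) (use e in simp)
	qed
	define spans where "spans J' \<longleftrightarrow> J' <= J & (ALL i:J. x i:?C J')" for J'
	have "spans J" using mem[OF subset_refl] by(simp only: spans_def) blast
	from ex_has_least_nat[of spans J card, OF this] obtain J' where J'_spans: "spans J'"
		and least': "!!J''. spans J''==>card J' \<le> card J''" by blast
	have J': "J' <= J" "ALL i:J. x i:?C J'" using J'_spans unfolding spans_def by(rule conjunct1, rule conjunct2)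
	have least: "card J' \<le> card J''" if "J'' <= J" "ALL i:J. x i:?C J''" for J''
		by(rule least', unfold spans_def, rule conjI[OF that])
	have fJ': "finite J'" using J J'(1) finite_subset by blast
	have xJ': "x j:.V" if "j:J'" for j using x J'(1) that by blast
	have ex: "EX f. lin K V (scalars K) f & (ALL n:?C (J' - {j}). f n = 0.$K) & f (x j) = 1.$K" if j: "j:J'" for j
	proof (rule exists_functional[OF assms(1,2) sub xJ'[OF j]])
		show s: "J' - {j} <= J" using J' by blast
		show "x j ~: ?C (J' - {j})"
		proof
			assume xj: "x j:?C (J' - {j})"
			have "x i:?C (J' - {j})" if i: "i:J" for i
			proof -
				obtain c where c: "ALL k:J'. c k:.K" "x i = (+/$V k:J'. c k.*$V x k)" using bspec[OF J'(2) i] by blast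
				have "x i = (+/$V k:insert j (J' - {j}). c k.*$V x k)" using c(2) insert_Diff[OF j] by simp
				also have "... = c j.*$V x j+.$V (+/$V k:J' - {j}. c k.*$V x k)"
					by(rule V.finsum_insert) (use fJ' xJ' c(1) j in auto)
				also have "...:?C (J' - {j})"
				proof (rule V.submoduleE(5)[OF sub[OF s]])
					show "c j.*$V x j:?C (J' - {j})" by(rule V.submoduleE(4)[OF sub[OF s] _ xj]) (use c j in auto)
					show "(+/$V k:J' - {j}. c k.*$V x k):?C (J' - {j})"
						by(rule CollectI, rule exI[of _ c]) (use c(1) in auto)
				qed
				finally show ?thesis .
			qed
			hence "card J' \<le> card (J' - {j})" by(intro least[OF s] ballI)
			thus False using j fJ' by(metis card_Diff1_less not_le)
		qed
	qed
	define f where "f j = (SOME f. lin K V (scalars K) f & (ALL n:?C (J' - {j}). f n = 0.$K) & f (x j) = 1.$K)" for j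
	have f': "lin K V (scalars K) (f j) & (ALL n:?C (J' - {j}). f j n = 0.$K) & f j (x j) = 1.$K" if "j:J'" for j
		unfolding f_def by(rule someI_ex[OF ex[OF that]])
	have f: "lin K V (scalars K) (f j)" "n:?C (J' - {j})==>f j n = 0.$K" "f j (x j) = 1.$K" if "j:J'" for j n
		using conjunct1[OF f'[OF that]] conjunct1[OF conjunct2[OF f'[OF that]]] conjunct2[OF conjunct2[OF f'[OF that]]] by simp_all
	have d: "f j (x i) = (if i = j then 1.$K else 0.$K)" if i: "i:J'" and j: "j:J'" for i j
	proof (cases "i = j")
		case False
		hence "x i:?C (J' - {j})" using i J'(1) by(intro mem) auto
		thus ?thesis using f(2)[OF j, of "x i"] False by(simp only: if_False)
	qed (simp add: f(3)[OF j])
	have "x i = (+/$V j:J'. f j (x i).*$V x j)" if i: "i:J" for i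
	proof -
		obtain c where c: "ALL k:J'. c k:.K" "x i = (+/$V k:J'. c k.*$V x k)" using bspec[OF J'(2) i] by blast
		have "f j (x i) = c j" if j: "j:J'" for j
		proof -
			have "f j (x i) = (+/$(scalars K) k:J'. f j (c k.*$V x k))"
				unfolding c(2) by(rule lin_finsum[OF assms(2) K.scalars_module f(1)[OF j] fJ']) (use c xJ' in auto)
			also have "... = (+/$K k:J'. f j (c k.*$V x k))"
				by(rule scalars_finsum[OF assms(1) fJ']) (use linD(1)[OF f(1)[OF j]] c xJ' in auto)
			also have "... = (+/$K k:J'. if k = j then c k else 0.$K)"
				by(rule K.finsum_cong'[OF refl]) (use linD(3)[OF f(1)[OF j]] c xJ' d[OF _ j] in auto)
			also have "... = c j" by(rule K.finsum_delta[OF fJ' j]) (use c j in auto)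
			finally show ?thesis .
		qed
		note fc = this
		have "(+/$V j:J'. f j (x i).*$V x j) = (+/$V k:J'. c k.*$V x k)"
			by(rule V.finsum_cong'[OF refl]) (use c(1) xJ' in "auto simp: fc")
		thus ?thesis unfolding c(2)[symmetric] by(rule sym)
	qed
	thus ?thesis by(intro exI[of _ J'] exI[of _ f] conjI ballI J'(1) f(1) d)
qed

text \<open>The index set is the support of a representative, so the indices are pairs of vectors.
  This is where the index type of the basis of a Hopf algebra comes from.\<close>

lemma (in vs_pair) tensor_finite_sum:
	assumes t: "t:.TT"
	shows "EX J x y. finite J & (ALL p:J. x p:.V & y p:.W) & t = (+/$TT p:J. tn (x p) (y (p :: 'v \<times> 'w)))"
proof -
	let ?f = "SOME f. f:t"
	let ?J = "{p. ?f p ~= 0.}"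
	have f: "?f:.(pair_space K V W)" using tensor_space_rep[OF VWK t] by blast
	have fK: "?f p:.K" for p using f by(auto simp: free_space_simps)
	have fin: "finite ?J" using f by(auto simp: free_space_simps)
	have sup: "fst p:.V" "snd p:.W" if "?f p ~= 0." for p
		using f that unfolding free_space_simps(1) by(cases p; fastforce)+
	have "t = tensor_lift K TT tn t"
		by(rule tensor_eqI[OF TT.module_axioms _ lift_linear[OF TT.module_axioms tn_bilinear] _ t])
			(auto simp: linear_map_def lift_tn[OF TT.module_axioms tn_bilinear])
	also have "... = (+/$TT p:?J. ?f p.*$TT tn (fst p) (snd p))" by(simp add: tensor_lift_def formal_sum_def)
	also have "... = (+/$TT p:?J. tn (?f p.*$V fst p) (snd p))"
		by(rule TT.finsum_cong'[OF refl]) (use fK sup in "auto simp: tn_simps")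
	finally have e: "t = ..." .
	show ?thesis
		by(rule exI[of _ ?J], rule exI[of _ "%p. ?f p.*$V fst p"], rule exI[of _ snd]) (use e fin fK sup in auto)
qed

section \<open>Semisimple and cosemisimple Hopf algebras\<close>

lemma (in module) submodule_finsum:
	assumes "submodule N R M" "finite J" "!!j. j:J==>g j:N"
	shows "(+/$M j:J. g j):N"
	using assms(2,3)
proof (induction J)
	case empty
	thus ?case using subgroup.one_closed[OF submodule.axioms(1)[OF assms(1)]] by simp
next
	case (insert a J)
	note N = submoduleE[OF assms(1)]
	have "(+/$M j:insert a J. g j) = g a+.$M (+/$M j:J. g j)" by(rule finsum_insert) (use insert N(1) in auto)
	thus ?case using N(5) insert by simp
qed

lemma linear_preimage:
	assumes "module K V" "module K W" "lin K V W f" "submodule N K W"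
	shows "submodule {x:car V. f x:N} K V"
proof -
	interpret V: module K V by fact
	interpret W: module K W by fact
	note f = linD[OF assms(3)] and N = W.submoduleE[OF assms(4)]
	have sm: "c.*$V x:{x:car V. f x:N}" if "c:.K" "x:{x:car V. f x:N}" for c x
		using that N(4) by(auto simp: f)
	show ?thesis
	proof (rule V.submoduleI)
		show "0.$V:{x:car V. f x:N}"
			using lin_zero[OF assms(1-3)] subgroup.one_closed[OF submodule.axioms(1)[OF assms(4)]] by simp
		show "-.$V x:{x:car V. f x:N}" if "x:{x:car V. f x:N}" for x
			using sm[of "-.$K 1.$K" x] that by(simp add: V.smult_l_minus)
	qed (use sm N(5) in "auto simp: f")
qed

lemma linear_map_sum:
	assumes "module K V" "module K W" "finite J" "!!j. j:J==>lin K V W (g j)"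
	shows "lin K V W (%x. +/$W j:J. g j x)"
proof -
	interpret W: module K W by fact
	note g = linD[OF assms(4)]
	show ?thesis
	proof (rule linI)
		show "(+/$W j:J. g j x):.W" if "x:.V" for x by(rule W.finsum_closed) (use g that in auto)
		show "(+/$W j:J. g j (x+.$V y)) = (+/$W j:J. g j x)+.$W (+/$W j:J. g j y)" if xy: "x:.V" "y:.V" for x y
		proof -
			have "(+/$W j:J. g j (x+.$V y)) = (+/$W j:J. g j x+.$W g j y)"
				by(rule W.finsum_cong'[OF refl]) (use g xy in auto)
			also have "... = (+/$W j:J. g j x)+.$W (+/$W j:J. g j y)" by(rule W.finsum_addf) (use g xy in auto)
			finally show ?thesis .
		qed
		show "(+/$W j:J. g j (c.*$V x)) = c.*$W (+/$W j:J. g j x)" if x: "x:.V" "c:.K" for x c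
		proof -
			have "(+/$W j:J. g j (c.*$V x)) = (+/$W j:J. c.*$W g j x)"
				by(rule W.finsum_cong'[OF refl]) (use g x in auto)
			also have "... = c.*$W (+/$W j:J. g j x)" by(rule W.finsum_smult_ldistr[OF assms(3) x(2), symmetric]) (use g x in auto)
			finally show ?thesis .
		qed
	qed
qed

lemma linear_map_scaled:
	assumes "module K W" "lin K V (scalars K) f" "w:.W"
	shows "lin K V W (%x. f x.*$W w)"
proof -
	interpret W: module K W by fact
	show ?thesis using linD[OF assms(2)] assms(3) by(auto simp: W.smult_l_distr W.smult_assoc1 intro!: linI)
qed

lemma subspace_span_mono: "S <= T==>subspace_span K V S <= subspace_span K V T"
	by(auto simp: subspace_span_def)

section \<open>Sweedler sums, the integral and finite dimension\<close>

context hopf_algebra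
begin

sublocale algebra_pair K H H by unfold_locales

abbreviation sw where "sw U h B \<equiv> sweedler2 K H U h B"
abbreviation KK where "KK \<equiv> scalars K"

lemma KK_module: "module K KK" by(rule K.scalars_module)

lemma comult_closed[simp]: "h:.H==>comult H h:.TT" by(rule linD(1)[OF comult_linear])

lemma counit_simps[simp]:
	"h:.H==>counit H h:.K"
	"g:.H==>h:.H==>counit H (g+.$H h) = counit H g+.$K counit H h"
	"c:.K==>h:.H==>counit H (c.*$H h) = c*.$K counit H h"
	"g:.H==>h:.H==>counit H (g*.$H h) = counit H g*.$K counit H h"
	"counit H 1.$H = 1.$K"
	using linD[OF counit_linear] ring_hom_mult[OF counit_hom] ring_hom_one[OF counit_hom] by auto

lemmas antipode_simps[simp] = linD[OF antipode_linear]

lemma comult_mult: "g:.H==>h:.H==>comult H (g*.$H h) = comult H g*.$TA comult H h"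
	by(rule ring_hom_mult[OF comult_hom])

lemma comult_one: "comult H 1.$H = tn 1.$H 1.$H"
	using ring_hom_one[OF comult_hom] by simp

lemma sw_linear: "module K U==>bil K H H U B==>lin K H U (%h. sw U h B)"
	unfolding sweedler2_def by(rule lin_comp[OF comult_linear lift_linear])

lemma sw_closed: "module K U==>h:.H==>(!!x y. x:.H==>y:.H==>B x y:.U)==>sw U h B:.U"
	unfolding sweedler2_def by(rule lift_closed) auto

lemma sw_hom: "module K U==>module K U'==>lin K U U' f==>h:.H ==>
		(!!x y. x:.H==>y:.H==>B x y:.U)==>f (sw U h B) = sw U' h (%x y. f (B x y))"
	unfolding sweedler2_def by(rule lift_hom) auto

lemma sw_cong: "module K U==>h:.H==>(!!x y. x:.H==>y:.H==>B x y = B' x y) ==>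
		(!!x y. x:.H==>y:.H==>B' x y:.U)==>sw U h B = sw U h B'"
	unfolding sweedler2_def by(rule lift_cong) auto

text \<open>The axiom compares two elements of the threefold tensor product; the linear map induced
  there by \<open>T\<close> carries the equality to any trilinear expression.\<close>

lemma coassoc_trilinear:
	assumes U: "module K U" and T: "!!x. x:.H==>bil K H H U (T x)"
		"!!y z. y:.H==>z:.H==>lin K H U (%x. T x y z)" and h: "h:.H"
	shows "sw U h (%x y. sw U x (%a b. T a b y)) = sw U h (%x y. sw U y (T x))"
proof -
	interpret T3: vs_pair K H TT by unfold_locales
	interpret U: module K U by fact
	note b = bilD[OF T(1)] and l = linD[OF T(2)]
	have "bil K H TT U (%x w. tensor_lift K U (T x) w)"
	proof (rule bilI, goal_cases)
		case (1 x w) thus ?case by(intro lift_closed[OF U]) (auto simp: b)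
	next
		case (2 x x' w)
		thus ?case by(subst lift_add[OF U, symmetric]) (auto simp: b l intro!: lift_cong[OF U])
	next
		case (3 c x w)
		thus ?case by(subst lift_smult[OF U, symmetric]) (auto simp: b l intro!: lift_cong[OF U])
	next
		case (4 x w w') thus ?case using linD(2)[OF lift_linear[OF U T(1)]] by auto
	next
		case (5 c x w) thus ?case using linD(3)[OF lift_linear[OF U T(1)]] by auto
	qed
	note bil = this
	define f where "f = tensor_lift K U (%x w. tensor_lift K U (T x) w)"
	have f: "lin K T3.TT U f" unfolding f_def by(rule T3.lift_linear[OF U bil])
	have ft: "f (T3.tn x w) = tensor_lift K U (T x) w" if "x:.H" "w:.TT" for x w
		unfolding f_def by(rule T3.lift_tn[OF U bil that])
	have ft3: "f (T3.tn x (tn y z)) = T x y z" if "x:.H" "y:.H" "z:.H" for x y z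
		using that by(simp add: ft tn_simps lift_tn[OF U T(1)])
	note M3 = T3.TT.module_axioms
	have in1: "sw T3.TT x (%a b. T3.tn a (tn b y)):.T3.TT" if "x:.H" "y:.H" for x y
		by(rule sw_closed[OF M3 that(1)]) (use that in "auto simp: tn_simps T3.tn_simps")
	have "sw U h (%x y. sw U x (%a b. T a b y)) = sw U h (%x y. f (sw T3.TT x (%a b. T3.tn a (tn b y))))"
	proof (rule sw_cong[OF U h])
		fix x y assume xy: "x:.H" "y:.H"
		have "f (sw T3.TT x (%a b. T3.tn a (tn b y))) = sw U x (%a b. f (T3.tn a (tn b y)))"
			by(rule sw_hom[OF M3 U f xy(1)]) (use xy in "auto simp: tn_simps T3.tn_simps")
		also have "... = sw U x (%a b. T a b y)" by(rule sw_cong[OF U xy(1)]) (use xy in "auto simp: ft3 b")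
		finally show "sw U x (%a b. T a b y) = f (sw T3.TT x (%a b. T3.tn a (tn b y)))" by simp
		show "f (sw T3.TT x (%a b. T3.tn a (tn b y))):.U" using linD(1)[OF f in1[OF xy]] .
	qed
	also have "... = f (sw T3.TT h (%x y. sw T3.TT x (%a b. T3.tn a (tn b y))))"
		by(rule sw_hom[OF M3 U f h, symmetric]) (rule in1)
	also have "... = f (sw T3.TT h (%x y. T3.tn x (comult H y)))" using coassoc[OF h] by simp
	also have "... = sw U h (%x y. f (T3.tn x (comult H y)))" by(rule sw_hom[OF M3 U f h]) (auto simp: T3.tn_simps)
	also have "... = sw U h (%x y. sw U y (T x))"
		by(rule sw_cong[OF U h]) (auto simp: ft sweedler2_def intro!: lift_closed[OF U] b)
	finally show ?thesis .
qed

text \<open>The kernel of the counit has a complementary left ideal, and \<open>t\<close> is the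
  component of 1 in it. For every \<open>h\<close> the element h t - counit(h) t lies in both ideals
  and is therefore 0.\<close>

lemma exists_integral:
	assumes ss: "semisimple_algebra H"
	shows "EX t:car H. counit H t = 1.$K & (ALL h:car H. h*.$H t = counit H h.*$H t)"
proof -
	let ?N = "{h:car H. counit H h = 0.$K}"
	have sub: "submodule ?N K H"
		using linear_map_kernel[OF VWK(2) KK_module counit_linear] by simp
	have "left_ideal H ?N"
		unfolding left_ideal_def using submodule.axioms(1)[OF sub] by(auto intro: additive_subgroup.intro)
	then obtain N' where N': "left_ideal H N'" "?N Int N' = {0.$H}" "?N <+>$H N' = car H"
		using ss unfolding semisimple_algebra_def by blast
	interpret N': additive_subgroup N' H using N'(1) by(simp add: left_ideal_def)
	have "1.$H:?N <+>$H N'" using N'(3) A.one_closed by simp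
	then obtain a t where at: "a:?N" "t:N'" "1.$H = a+.$H t" unfolding set_add_def' by blast
	have tc: "t:.H" using N'.a_Hcarr[OF at(2)] .
	have "counit H 1.$H = counit H a+.$K counit H t" using at tc by(subst at(3)) auto
	hence et: "counit H t = 1.$K" using at(1) tc by simp
	have "h*.$H t = counit H h.*$H t" if h: "h:.H" for h
	proof -
		let ?x = "h*.$H t -.$H counit H h.*$H t"
		have e: "counit H h.*$H t = (counit H h.*$H 1.$H)*.$H t" using h tc by(simp add: smult_mult_left)
		have "h*.$H t:N'" "counit H h.*$H t:N'"
			unfolding e using N'(1) at(2) h by(auto simp: left_ideal_def)
		hence "?x:N'" unfolding a_minus_def by(intro N'.a_closed N'.a_inv_closed)
		moreover have "counit H ?x = 0.$K"
			using linear_map_minus[OF VWK(2) KK_module counit_linear, of "h*.$H t" "counit H h.*$H t"] h tc et by simp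
		moreover have "?x:.H" using h tc by simp
		ultimately have "?x:?N Int N'" by(intro IntI CollectI conjI)
		hence "?x = 0.$H" unfolding N'(2) by(rule singletonD)
		thus ?thesis using h tc by(simp add: A.r_right_minus_eq)
	qed
	thus ?thesis using tc et by blast
qed

text \<open>1 tensor h is the sum of S(h1) h2 tensor h3. Multiplying the coproduct h2 tensor h3 into
  that of \<open>t\<close> gives the coproduct of a product with \<open>t\<close>, which is the
  counit times the coproduct of \<open>t\<close>; what remains in front is S(h) tensor 1.\<close>

lemma integral_shift:
	assumes t: "t:.H" "!!h. h:.H==>h*.$H t = counit H h.*$H t" and h: "h:.H"
	shows "tn 1.$H h*.$TA comult H t = tn (antipode H h) 1.$H*.$TA comult H t"
proof -
	note TM = TT.module_axioms and HM = VWK(2)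
	let ?S = "antipode H" and ?w = "comult H t"
	have "sw TT h (%x y. tn (?S x) 1.$H*.$TA comult H y) = sw TT h (%x y. sw TT y (%a b. tn (?S x*.$H a) b))"
	proof (rule sw_cong[OF TM h])
		fix x y assume xy: "x:.H" "y:.H"
		show "tn (?S x) 1.$H*.$TA comult H y = sw TT y (%a b. tn (?S x*.$H a) b)"
			unfolding sweedler2_def mult_pure_left[OF antipode_simps(1)[OF xy(1)] A.one_closed comult_closed[OF xy(2)]]
			by(rule lift_cong[OF TM comult_closed[OF xy(2)]]) (use xy in "auto simp: tn_simps")
		show "sw TT y (%a b. tn (?S x*.$H a) b):.TT" by(rule sw_closed[OF TM xy(2)]) (use xy in "auto simp: tn_simps")
	qed
	also have "... = sw TT h (%x y. sw TT x (%a b. tn (?S a*.$H b) y))"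
		by(rule coassoc_trilinear[OF TM _ _ h, symmetric])
			(auto simp: tn_simps A.r_distr A.l_distr smult_mult_left smult_mult_right intro!: bilI linI)
	also have "... = sw TT h (%x y. tn 1.$H (counit H x.*$H y))"
	proof (rule sw_cong[OF TM h])
		fix x y assume xy: "x:.H" "y:.H"
		have "sw TT x (%a b. tn (?S a*.$H b) y) = tn (sw H x (%a b. ?S a*.$H b)) y"
			by(rule sw_hom[OF HM TM _ xy(1), symmetric, where f = "%z. tn z y"]) (use xy in "auto simp: tn_simps intro!: linI")
		thus "sw TT x (%a b. tn (?S a*.$H b) y) = tn 1.$H (counit H x.*$H y)"
			using xy by(simp add: antipode_left tn_simps)
	qed (auto simp: tn_simps)
	also have "... = tn 1.$H (sw H h (%x y. counit H x.*$H y))"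
		by(rule sw_hom[OF HM TM _ h, symmetric, where f = "%z. tn 1.$H z"]) (auto simp: tn_simps intro!: linI)
	also have "... = tn 1.$H h" using counit_left[OF h] by simp
	finally have e: "tn 1.$H h = sw TT h (%x y. tn (?S x) 1.$H*.$TA comult H y)" by simp
	have wc: "?w:.TT" using t by simp
	have "tn 1.$H h*.$TA ?w = sw TT h (%x y. tn (?S x) 1.$H*.$TA comult H y*.$TA ?w)"
		unfolding e by(rule sw_hom[OF TM TM mult_linl[OF wc] h]) (auto simp: tn_simps mult_closed)
	also have "... = sw TT h (%x y. tn (?S (counit H y.*$H x)) 1.$H*.$TA ?w)"
	proof (rule sw_cong[OF TM h])
		fix x y assume xy: "x:.H" "y:.H"
		have sc: "tn (?S x) 1.$H:.TT" using xy by(simp add: tn_simps)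
		have "tn (?S x) 1.$H*.$TA comult H y*.$TA ?w = tn (?S x) 1.$H*.$TA comult H (y*.$H t)"
			using xy t(1) wc sc by(simp add: mult_assoc comult_mult)
		also have "... = tn (?S x) 1.$H*.$TA (counit H y.*$TT ?w)"
			using xy t linD(3)[OF comult_linear] by simp
		also have "... = (counit H y.*$TT tn (?S x) 1.$H)*.$TA ?w"
			using xy wc sc linD(3)[OF mult_linr[OF sc]] linD(3)[OF mult_linl[OF wc]] by simp
		finally show "tn (?S x) 1.$H*.$TA comult H y*.$TA ?w = tn (?S (counit H y.*$H x)) 1.$H*.$TA ?w"
			using xy by(simp add: tn_simps)
	qed (use wc in "auto simp: tn_simps mult_closed")
	also have "... = tn (?S (sw H h (%x y. counit H y.*$H x))) 1.$H*.$TA ?w"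
		by(rule sw_hom[OF HM TM _ h, symmetric, where f = "%z. tn (?S z) 1.$H*.$TA ?w"])
			(use wc in "auto simp: tn_simps linD[OF mult_linl[OF wc]] mult_closed intro!: linI")
	also have "sw H h (%x y. counit H y.*$H x) = h" by(rule counit_right[OF h])
	finally show ?thesis .
qed

lemma contract_left: "lin K H KK f==>bil K H H H (%a b. f a.*$H b)"
	by(rule bilI) (auto simp: linear_map_def Pi_iff smult_l_distr smult_r_distr smult_assoc1[symmetric] K.m_comm)

lemma contract_right: "lin K H KK f==>bil K H H H (%a b. f b.*$H a)"
	by(rule bilI) (auto simp: linear_map_def Pi_iff smult_l_distr smult_r_distr smult_assoc1[symmetric] K.m_comm)

lemma mult_bilinear: "bil K H H H (%a b. antipode H a*.$H b)"
	by(rule bilI) (auto simp: A.l_distr A.r_distr smult_mult_left smult_mult_right)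

text \<open>With \<open>\<Delta> t = \<Sum> x i \<otimes> y i\<close> and the \<open>x i\<close> independent, the formula for \<open>t\<^sub>1 \<otimes> h t\<^sub>2\<close> makes the span
	of the \<open>y i\<close> a left ideal, and \<open>1 = \<Sum> S (x i) (y i)\<close> lies in it.\<close>

lemma finite_basis:
	assumes t: "t:.H" "counit H t = 1.$K" "!!h. h:.H==>h*.$H t = counit H h.*$H t"
	shows "EX (I :: ('h \<times> 'h) set) e du. finite I & (ALL i:I. e i:.H) & (ALL i:I. lin K H KK (du i)) &
		(ALL i:I. ALL j:I. du j (e i) = (if i = j then 1.$K else 0.$K)) & (ALL h:car H. h = (+/$H i:I. du i h.*$H e i))"
proof -
	note TM = TT.module_axioms and HM = VWK(2)
	let ?w = "comult H t" and ?S = "antipode H"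
	have wc: "?w:.TT" using t by simp
	obtain J :: "('h \<times> 'h) set" and x y where J: "finite J" and xyJ: "ALL p:J. x p:.H & y p:.H"
		and w: "?w = (+/$TT p:J. tn (x p) (y p))" using tensor_finite_sum[OF wc] by(elim exE conjE) (rule that)
	have xy: "x p:.H" "y p:.H" if "p:J" for p using xyJ that by auto
	have "EX J' f. J' <= J & (ALL j:J'. lin K H KK (f j)) &
			(ALL i:J'. ALL j:J'. f j (x i) = (if i = j then 1.$K else 0.$K)) &
			(ALL i:J. x i = (+/$H j:J'. f j (x i).*$H x j))"
		by(rule exists_dual_functionals[OF VWK(1) HM J]) (rule xy(1))
	then obtain J' f where J': "J' <= J" and f: "ALL j:J'. lin K H KK (f j)"
		and fd: "ALL i:J'. ALL j:J'. f j (x i) = (if i = j then 1.$K else 0.$K)"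
		and fx: "ALL i:J. x i = (+/$H j:J'. f j (x i).*$H x j)" by(elim exE conjE) (rule that)
	have fJ': "finite J'" using J J' finite_subset by blast
	have fl: "lin K H KK (f j)" if "j:J'" for j using f that by blast
	have fc: "f j h:.K" if "j:J'" "h:.H" for j h using linD(1)[OF fl[OF that(1)] that(2)] by simp
	have xJ': "x j:.H" if "j:J'" for j using xy(1) J' that by blast
	\<comment> \<open>Regroups the coproduct of \<open>t\<close> over the independent first legs:
	  \<open>y' j\<close> collects all second legs that belong to \<open>x j\<close>.\<close>
	define y' where "y' j = (+/$H p:J. f j (x p).*$H y p)" for j
	have y'c: "y' j:.H" if "j:J'" for j unfolding y'_def by(rule finsum_closed) (use fc[OF that] xy in auto)
	have tl: "lin K H TT (%z. tn z b)" "lin K H TT (%z. tn b z)" if "b:.H" for b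
		using that by(auto simp: tn_simps intro!: linI)
	have w': "?w = (+/$TT j:J'. tn (x j) (y' j))"
	proof -
		have "?w = (+/$TT p:J. +/$TT j:J'. tn (x j) (f j (x p).*$H y p))"
			unfolding w
		proof (rule TT.finsum_cong'[OF refl])
			fix p assume p: "p:J"
			have "tn (x p) (y p) = tn (+/$H j:J'. f j (x p).*$H x j) (y p)" using bspec[OF fx p] by(rule arg_cong)
			also have "... = (+/$TT j:J'. tn (f j (x p).*$H x j) (y p))"
				by(rule lin_finsum[OF HM TM tl(1)[OF xy(2)[OF p]] fJ']) (use fc xJ' xy p in auto)
			also have "... = (+/$TT j:J'. tn (x j) (f j (x p).*$H y p))"
				by(rule TT.finsum_cong'[OF refl]) (use fc xJ' xy p in "auto simp: tn_simps")
			finally show "tn (x p) (y p) = ..." .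
		qed (use fc xJ' xy in "auto intro!: TT.finsum_closed tn_simps")
		also have "... = (+/$TT j:J'. +/$TT p:J. tn (x j) (f j (x p).*$H y p))"
			by(rule TT.finsum_swap[OF J fJ']) (use fc xJ' xy in "auto intro!: tn_simps")
		also have "... = (+/$TT j:J'. tn (x j) (y' j))"
		proof (rule TT.finsum_cong'[OF refl])
			fix j assume j: "j:J'"
			show "(+/$TT p:J. tn (x j) (f j (x p).*$H y p)) = tn (x j) (y' j)"
				unfolding y'_def by(rule lin_finsum[OF HM TM tl(2)[OF xJ'[OF j]] J, symmetric]) (use fc[OF j] xy in auto)
		qed (use xJ' y'c in "auto intro!: tn_simps")
		finally show ?thesis .
	qed
	have apply_w: "G ?w = (+/$H j:J'. G (tn (x j) (y' j)))" if "lin K TT H G" for G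
		unfolding w' by(rule lin_finsum[OF TM HM that fJ']) (use xJ' y'c in "auto intro!: tn_simps")
	let ?N = "{+/$H j:J'. c j.*$H y' j |c. ALL j:J'. c j:.K}"
	have N: "submodule ?N K H" by(rule submodule_combinations[OF fJ' y'c])
	\<comment> \<open>Contracting the first leg with the dual functional \<open>f j\<close> isolates
	  \<open>y' j\<close>. Applied after the shift of \<open>h\<close> to the first leg it writes h
	  times \<open>y' j\<close> as a combination of the \<open>y'\<close>.\<close>
	let ?c = "%j. tensor_lift K H (%a b. f j a.*$H b)"
	have cl: "lin K TT H (?c j)" if "j:J'" for j by(rule lift_linear[OF HM contract_left[OF fl[OF that]]])
	have ct: "?c j (tn a b) = f j a.*$H b" if "j:J'" "a:.H" "b:.H" for j a b
		by(rule lift_tn[OF HM contract_left[OF fl[OF that(1)]] that(2,3)])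
	have hy: "h*.$H y' j:?N" if h: "h:.H" and j: "j:J'" for h j
	proof -
		have t1: "tn 1.$H h:.TT" "tn (?S h) 1.$H:.TT" using h by(auto simp: tn_simps)
		have "?c j ?w = (+/$H i:J'. f j (x i).*$H y' i)"
			unfolding apply_w[OF cl[OF j]] by(rule finsum_cong'[OF refl]) (use j xJ' y'c fc ct in auto)
		also have "... = (+/$H i:J'. if i = j then y' i else 0.$H)"
			by(rule finsum_cong'[OF refl]) (use j fd y'c in auto)
		also have "... = y' j" by(rule finsum_delta[OF fJ' j]) (rule y'c[OF j])
		finally have cy: "?c j ?w = ..." .
		have lm: "lin K H H (%z. h*.$H z)" by(rule linI) (use h in "auto simp: A.r_distr smult_mult_right")
		have "h*.$H ?c j ?w = ?c j (tn 1.$H h*.$TA ?w)"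
			by(rule tensor_eqI[OF HM lin_comp[OF cl[OF j] lm] lin_comp[OF mult_linr[OF t1(1)] cl[OF j]] _ wc])
				(use h j fc[OF j] in "auto simp: ct mult_pure smult_mult_right")
		also have "... = ?c j (tn (?S h) 1.$H*.$TA ?w)" using integral_shift[OF t(1,3) h] by simp
		also have "... = (+/$H i:J'. ?c j (tn (?S h) 1.$H*.$TA tn (x i) (y' i)))"
			by(rule apply_w[OF lin_comp[OF mult_linr[OF t1(2)] cl[OF j]]])
		also have "... = (+/$H i:J'. f j (?S h*.$H x i).*$H y' i)"
			by(rule finsum_cong'[OF refl]) (use h j xJ' y'c fc[OF j] in "auto simp: ct mult_pure")
		finally have e: "h*.$H y' j = (+/$H i:J'. f j (?S h*.$H x i).*$H y' i)" unfolding cy .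
		show ?thesis unfolding e by(rule CollectI, rule exI[of _ "%i. f j (?S h*.$H x i)"]) (use h xJ' fc[OF j] in auto)
	qed
	have hN: "h*.$H n:?N" if h: "h:.H" and n: "n:?N" for h n
	proof -
		obtain c where c: "ALL j:J'. c j:.K" "n = (+/$H j:J'. c j.*$H y' j)" using n by blast
		have lm: "lin K H H (%z. h*.$H z)" by(rule linI) (use h in "auto simp: A.r_distr smult_mult_right")
		have "h*.$H n = (+/$H j:J'. h*.$H (c j.*$H y' j))" unfolding c(2) by(rule lin_finsum[OF HM HM lm fJ']) (use c y'c in auto)
		also have "... = (+/$H j:J'. c j.*$H (h*.$H y' j))" by(rule finsum_cong'[OF refl]) (use c(1) y'c h in "auto simp: smult_mult_right")
		also have "...:?N"
		proof (rule submodule_finsum[OF N fJ'], rule submoduleE(4)[OF N])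
			show "c j:.K" if "j:J'" for j using c(1) that by(rule bspec)
			show "h*.$H y' j:?N" if "j:J'" for j by(rule hy[OF h that])
		qed
		finally show ?thesis .
	qed
	have "1.$H = sw H t (%a b. ?S a*.$H b)" using antipode_left[OF t(1)] t(2) by simp
	also have "... = (+/$H j:J'. tensor_lift K H (%a b. ?S a*.$H b) (tn (x j) (y' j)))"
		unfolding sweedler2_def by(rule apply_w[OF lift_linear[OF HM mult_bilinear]])
	also have "...:?N"
	proof (rule submodule_finsum[OF N fJ'])
		fix j assume j: "j:J'"
		show "tensor_lift K H (%a b. ?S a*.$H b) (tn (x j) (y' j)):?N"
			unfolding lift_tn[OF HM mult_bilinear xJ'[OF j] y'c[OF j]] by(rule hy[OF antipode_simps(1)[OF xJ'[OF j]] j])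
	qed
	finally have oneN: "1.$H:?N" .
	have allN: "h:?N" if "h:.H" for h using hN[OF that oneN] that by simp
	\<comment> \<open>The \<open>y'\<close> span \<open>H\<close> but may be dependent; a second choice
	  of dual functionals extracts a basis.\<close>
	have "EX J2 f. J2 <= J' & (ALL j:J2. lin K H KK (f j)) &
			(ALL i:J2. ALL j:J2. f j (y' i) = (if i = j then 1.$K else 0.$K)) &
			(ALL i:J'. y' i = (+/$H j:J2. f j (y' i).*$H y' j))"
		by(rule exists_dual_functionals[OF VWK(1) HM fJ']) (rule y'c)
	then obtain J'' g where J'': "J'' <= J'" and g: "ALL j:J''. lin K H KK (g j)"
		and gd: "ALL i:J''. ALL j:J''. g j (y' i) = (if i = j then 1.$K else 0.$K)"
		and gy: "ALL i:J'. y' i = (+/$H j:J''. g j (y' i).*$H y' j)" by(elim exE conjE) (rule that)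
	have fJ'': "finite J''" using fJ' J'' finite_subset by blast
	have y'': "y' j:.H" if "j:J''" for j using y'c J'' that by blast
	have El: "lin K H H (%h. +/$H j:J''. g j h.*$H y' j)"
		by(rule linear_map_sum[OF HM HM fJ'' linear_map_scaled[OF HM]]) (use g y'' in auto)
	have il: "lin K H H (%h. h)" by(rule linI) auto
	have E: "submodule {h:car H. h = (+/$H j:J''. g j h.*$H y' j)} K H" (is "submodule ?E K H")
		by(rule linear_equalizer[OF HM HM il El])
	have "h:?E" if h: "h:.H" for h
	proof -
		obtain c where c: "ALL j:J'. c j:.K" "h = (+/$H j:J'. c j.*$H y' j)" using allN[OF h] by blast
		have "(+/$H j:J'. c j.*$H y' j):?E"
		proof (rule submodule_finsum[OF E fJ'], rule submoduleE(4)[OF E])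
			fix j assume j: "j:J'"
			show "c j:.K" using c(1) j by blast
			show "y' j:?E" by(rule CollectI, rule conjI[OF y'c[OF j] bspec[OF gy j]])
		qed
		thus ?thesis unfolding c(2)[symmetric] .
	qed
	note inE = this
	have hE: "ALL h:car H. h = (+/$H j:J''. g j h.*$H y' j)"
		by(rule ballI) (rule conjunct2[OF CollectD[OF inE]])
	show ?thesis by(rule exI[of _ J''], rule exI[of _ y'], rule exI[of _ g], intro conjI fJ'' ballI)
			(assumption | rule y'' g[rule_format] gd[rule_format] hE[rule_format])+
qed

section \<open>The integral on a cosemisimple Hopf algebra\<close>

text \<open>The line through 1 turns out to be one of the simple summands, and \<open>l\<close> is
  the coefficient of 1 along the sum of the others. Invariance is checked summand by summand: on the
  line it is immediate, and on every other summand both sides vanish.\<close>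

lemma exists_cointegral:
	assumes cs: "cosemisimple K H"
	shows "EX l. lin K H KK l & l 1.$H = 1.$K & (ALL h:car H. sw H h (%x y. l y.*$H x) = l h.*$H 1.$H)"
proof -
	note TM = TT.module_axioms and HM = VWK(2)
	obtain \<D> where simple: "ALL D:\<D>. simple_subcoalgebra K H D" and span: "subspace_span K H (\<Union>\<D>) = car H"
		and direct: "ALL D:\<D>. D Int subspace_span K H (\<Union>(\<D> - {D})) = {0.$H}"
		using cs unfolding cosemisimple_def by blast
	have sub: "submodule D K H" if "D:\<D>" for D
		using bspec[OF simple that] by(simp add: simple_subcoalgebra_def subcoalgebra_def)
	have Dc: "\<Union>\<F> <= car H" if "\<F> <= \<D>" for \<F> using submoduleE(1)[OF sub] that by blast
	have cop: "comult H h:tensor_image K H H D D" if "D:\<D>" "h:D" for D h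
		using bspec[OF simple that(1)] that(2) by(auto simp: simple_subcoalgebra_def subcoalgebra_def)
	let ?sp = "%\<F>. subspace_span K H (\<Union>\<F>)"
	have ss: "submodule (?sp \<F>) K H" if "\<F> <= \<D>" for \<F> by(rule subspace_span_submodule[OF HM Dc[OF that]])
	have zsub: "submodule {0.$H} K H" by(rule submoduleI) auto
	\<comment> \<open>Directness is only given as one summand against all the rest. By induction, an
	  element of a finite partial sum that lies, for each summand involved, in the sum of all the other
	  members of the family is 0.\<close>
	have indep: "x = 0.$H" if "finite \<F>" "\<F> <= \<D>" "x:?sp \<F>" "ALL D:\<F>. x:?sp (\<D> - {D})" for \<F> x
		using that
	proof (induction \<F> arbitrary: x)
		case empty
		thus ?case using subspace_span_least[OF zsub, of "{}"] by auto
	next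
		case (insert D \<F>)
		have D: "D:\<D>" and \<F>: "\<F> <= \<D>" using insert by auto
		have z: "0.$H:D" "0.$H:?sp \<F>"
			using subgroup.one_closed[OF submodule.axioms(1)[OF sub[OF D]]] subgroup.one_closed[OF submodule.axioms(1)[OF ss[OF \<F>]]] by auto
		have cD: "a:.H" if "a:D" for a using submoduleE(1)[OF sub[OF D]] that by blast
		have cF: "a:.H" if "a:?sp \<F>" for a using submoduleE(1)[OF ss[OF \<F>]] that by blast
		have "?sp (insert D \<F>) <= {a+.$H b |a b. a:D & b:?sp \<F>}"
		proof (rule subspace_span_least[OF submodule_sum[OF sub[OF D] ss[OF \<F>]]], rule subsetI)
			fix v assume v: "v:\<Union>(insert D \<F>)"
			show "v:{a+.$H b |a b. a:D & b:?sp \<F>}"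
			proof (cases "v:D")
				case True
				hence "v = v+.$H 0.$H" using cD by simp
				thus ?thesis using True z(2) by blast
			next
				case False
				hence vs: "v:?sp \<F>" using v subspace_span_superset[of "\<Union>\<F>" K H] by blast
				hence "v = 0.$H+.$H v" using cF by simp
				thus ?thesis using vs z(1) by blast
			qed
		qed
		then obtain a b where ab: "x = a+.$H b" "a:D" "b:?sp \<F>" using insert.prems(2) by blast
		have sD: "submodule (?sp (\<D> - {D})) K H" by(rule ss) blast
		have bD: "b:?sp (\<D> - {D})" using ab(3) subspace_span_mono[of "\<Union>\<F>" "\<Union>(\<D> - {D})" K H] insert.hyps(2) \<F> by blast
		have "x+.$H -.$H b:?sp (\<D> - {D})"
			by(rule submoduleE(5)[OF sD _ submoduleE(3)[OF sD bD]]) (use insert.prems(3) in blast)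
		moreover have "x+.$H -.$H b = a" using ab cD cF by(simp add: a_assoc r_neg)
		ultimately have "a = 0.$H" using bspec[OF direct D] ab(2) by blast
		hence xb: "x = b" using ab(1) cF[OF ab(3)] by simp
		show ?case by(rule insert.IH[OF \<F>]) (use xb ab(3) insert.prems(3) in auto)
	qed
	have fin_supp: "EX \<F>. finite \<F> & \<F> <= \<D> & x:?sp \<F>" if x: "x:.H" for x
	proof -
		let ?U = "{x:car H. EX \<F>. finite \<F> & \<F> <= \<D> & x:?sp \<F>}"
		have UI: "v:?U" if "v:.H" "finite \<F>" "\<F> <= \<D>" "v:?sp \<F>" for v \<F>
			by(rule CollectI, rule conjI[OF that(1)], rule exI[of _ \<F>], intro conjI that(2-4))
		have UE: "EX \<F>. finite \<F> & \<F> <= \<D> & v:?sp \<F>" "v:.H" if "v:?U" for v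
			using CollectD[OF that] by(rule conjunct2, rule conjunct1)
		have "submodule ?U K H"
		proof (rule submoduleI)
			have "0.$H:?sp {}" using subgroup.one_closed[OF submodule.axioms(1)[OF ss[of "{}"]]] by simp
			thus "0.$H:?U" by(intro UI[of _ "{}"]) auto
			show "-.$H a:?U" if a: "a:?U" for a
			proof -
				from UE(1)[OF a] obtain \<F> where F: "finite \<F>" "\<F> <= \<D>" "a:?sp \<F>" by(elim exE conjE)
				show ?thesis by(rule UI[OF a_inv_closed[OF UE(2)[OF a]] F(1,2) submoduleE(3)[OF ss[OF F(2)] F(3)]])
			qed
			show "c.*$H a:?U" if c: "c:.K" and a: "a:?U" for c a
			proof -
				from UE(1)[OF a] obtain \<F> where F: "finite \<F>" "\<F> <= \<D>" "a:?sp \<F>" by(elim exE conjE)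
				show ?thesis by(rule UI[OF smult_closed[OF c UE(2)[OF a]] F(1,2) submoduleE(4)[OF ss[OF F(2)] c F(3)]])
			qed
			show "a+.$H b:?U" if a: "a:?U" and b: "b:?U" for a b
			proof -
				from UE(1)[OF a] obtain \<F> where F: "finite \<F>" "\<F> <= \<D>" "a:?sp \<F>" by(elim exE conjE)
				from UE(1)[OF b] obtain \<G> where G: "finite \<G>" "\<G> <= \<D>" "b:?sp \<G>" by(elim exE conjE)
				have FG: "\<F> Un \<G> <= \<D>" by(rule Un_least[OF F(2) G(2)])
				have "?sp \<F> <= ?sp (\<F> Un \<G>)" "?sp \<G> <= ?sp (\<F> Un \<G>)" by(rule subspace_span_mono, simp)+
				hence "a+.$H b:?sp (\<F> Un \<G>)" by(intro submoduleE(5)[OF ss[OF FG]] subsetD[OF _ F(3)] subsetD[OF _ G(3)])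
				thus ?thesis by(rule UI[OF a_closed[OF UE(2)[OF a] UE(2)[OF b]] finite_UnI[OF F(1) G(1)] FG])
			qed
		qed (rule subsetI, erule UE(2))
		moreover have "\<Union>\<D> <= ?U"
		proof
			fix v assume "v:\<Union>\<D>"
			then obtain D where D: "D:\<D>" "v:D" by(rule UnionE)
			have "v:?sp {D}" using D(2) subspace_span_superset[of "\<Union>{D}" K H] by auto
			thus "v:?U" by(rule UI[OF subsetD[OF submoduleE(1)[OF sub[OF D(1)]] D(2)], of "{D}", rotated 2]) (use D(1) in simp_all)
		qed
		ultimately have "?sp \<D> <= ?U" by(rule subspace_span_least)
		hence "x:?U" using x unfolding span by(rule subsetD)
		thus ?thesis by(rule UE(1))
	qed
	have one_nz: "1.$H ~= 0.$H"
	proof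
		assume "1.$H = 0.$H"
		hence "counit H 1.$H = counit H 0.$H" by simp
		also have "counit H 0.$H = 0.$K" using lin_zero[OF HM KK_module counit_linear] by simp
		finally show False by simp
	qed
	obtain \<F> where F: "finite \<F>" "\<F> <= \<D>" "1.$H:?sp \<F>" using fin_supp[OF A.one_closed] by(elim exE conjE)
	\<comment> \<open>As 1 is not 0, it cannot lie in the sum of the others for every summand involved;
	  \<open>D\<close> is one for which it does not.\<close>
	then obtain D where D: "D:\<D>" "1.$H ~: ?sp (\<D> - {D})" using indep[OF F] one_nz by blast
	let ?ND = "?sp (\<D> - {D})"
	have sND: "submodule ?ND K H" by(rule ss) blast
	obtain l where l: "lin K H KK l" and l0: "ALL n:?ND. l n = 0.$K" and l1: "l 1.$H = 1.$K"
		using exists_functional[OF VWK(1) HM sND A.one_closed D(2)] by(elim exE conjE) (rule that)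
	have lc: "l a:.K" if "a:.H" for a using linD(1)[OF l that] by simp
	let ?c = "tensor_lift K H (%x y. l y.*$H x)"
	have cl: "lin K TT H ?c" by(rule lift_linear[OF HM contract_right[OF l]])
	have ct: "?c (tn a b) = l b.*$H a" if "a:.H" "b:.H" for a b by(rule lift_tn[OF HM contract_right[OF l] that])
	have cA: "?c w:A" if A: "submodule A K H" and B: "submodule B K H" and w: "w:tensor_image K H H A B" for A B w
	proof -
		have "tensor_image K H H A B <= {w:car TT. ?c w:A}"
			unfolding tensor_image_def
		proof (rule subspace_span_least[OF linear_preimage[OF TM HM cl A]], rule subsetI)
			fix v assume "v:{tn x y |x y. x:A & y:B}"
			then obtain a b where ab: "v = tn a b" "a:A" "b:B" by blast
			have abc: "a:.H" "b:.H" using ab submoduleE(1)[OF A] submoduleE(1)[OF B] by auto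
			show "v:{w:car TT. ?c w:A}" unfolding ab(1)
				using abc ct submoduleE(4)[OF A lc[OF abc(2)] ab(2)] by(simp add: tn_simps)
		qed
		thus ?thesis using w by blast
	qed
	have c0: "?c (comult H h) = 0.$H" if E: "E:\<D>" "E ~= D" "h:E" for E h
	proof -
		have EN: "E <= ?ND" using subspace_span_superset[of "\<Union>(\<D> - {D})" K H] E by blast
		have "tensor_image K H H E E <= {w:car TT. ?c w = 0.$H}"
			unfolding tensor_image_def
		proof (rule subspace_span_least[OF linear_map_kernel[OF TM HM cl]], rule subsetI)
			fix v assume "v:{tn x y |x y. x:E & y:E}"
			then obtain a b where ab: "v = tn a b" "a:E" "b:E" by blast
			have abc: "a:.H" "b:.H" using ab submoduleE(1)[OF sub[OF E(1)]] by auto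
			have "l b = 0.$K" using l0 ab(3) EN by blast
			thus "v:{w:car TT. ?c w = 0.$H}" unfolding ab(1) using abc ct by(simp add: tn_simps)
		qed
		thus ?thesis using cop[OF E(1,3)] by blast
	qed
	have swc: "sw H h (%x y. l y.*$H x) = ?c (comult H h)" for h by(simp add: sweedler2_def)
	have swl: "lin K H H (%h. ?c (comult H h))" by(rule lin_comp[OF comult_linear cl])
	\<comment> \<open>The map sending h to h1 l(h2) takes every summand into \<open>D\<close>, because
	  \<open>l\<close> kills the others and \<open>D\<close> is a subcoalgebra, and it fixes 1. Hence
	  the line through 1 is a subcoalgebra of the simple \<open>D\<close> and equals it.\<close>
	have "1.$H:D"
	proof -
		have z: "0.$H:D" using subgroup.one_closed[OF submodule.axioms(1)[OF sub[OF D(1)]]] by simp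
		have "\<Union>\<D> <= {h:car H. ?c (comult H h):D}"
		proof
			fix h assume "h:\<Union>\<D>"
			then obtain E where E: "E:\<D>" "h:E" by blast
			have hc: "h:.H" using E submoduleE(1)[OF sub[OF E(1)]] by blast
			show "h:{h:car H. ?c (comult H h):D}"
			proof (cases "E = D")
				case True
				thus ?thesis using cA[OF sub sub cop] D(1) E hc by blast
			next
				case False
				thus ?thesis using c0[OF E(1) False E(2)] z hc by simp
			qed
		qed
		hence "subspace_span K H (\<Union>\<D>) <= {h:car H. ?c (comult H h):D}"
			by(rule subspace_span_least[OF linear_preimage[OF HM HM swl sub[OF D(1)]]])
		hence "1.$H:{h:car H. ?c (comult H h):D}" unfolding span by(rule subsetD) (rule A.one_closed)
		hence "?c (comult H 1.$H):D" unfolding mem_Collect_eq by(rule conjunct2)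
		thus ?thesis by(simp add: comult_one ct l1)
	qed
	let ?L = "{c.*$H 1.$H |c. c:.K}"
	have Ls: "submodule ?L K H" by(rule submodule_line[OF A.one_closed])
	have oL: "1.$H:?L" using K.one_closed smult_one[OF A.one_closed] by force
	have "subcoalgebra K H ?L"
		unfolding subcoalgebra_def
	proof (intro conjI Ls subsetI)
		fix v assume "v:comult H ` ?L"
		then obtain c where c: "c:.K" "v = comult H (c.*$H 1.$H)" by blast
		have v: "v = tn (c.*$H 1.$H) 1.$H"
			using c linD(3)[OF comult_linear c(1) A.one_closed] by(simp add: comult_one tn_simps)
		show "v:tensor_image K H H ?L ?L" unfolding tensor_image_def v
			by(rule subsetD[OF subspace_span_superset]) (use c(1) oL in blast)
	qed
	moreover have "?L <= D" using submoduleE(4)[OF sub[OF D(1)] _ \<open>\<one>$H : D\<close>] by blast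
	ultimately have "?L = {0.$H} | ?L = D" using bspec[OF simple D(1)] unfolding simple_subcoalgebra_def by blast
	hence LD: "D = ?L" using oL one_nz by blast
	have ll: "lin K H H (%h. l h.*$H 1.$H)" by(rule linear_map_scaled[OF HM l A.one_closed])
	have "\<Union>\<D> <= {h:car H. ?c (comult H h) = l h.*$H 1.$H}"
	proof
		fix h assume "h:\<Union>\<D>"
		then obtain E where E: "E:\<D>" "h:E" by blast
		have hc: "h:.H" using E submoduleE(1)[OF sub[OF E(1)]] by blast
		have "?c (comult H h) = l h.*$H 1.$H"
		proof (cases "E = D")
			case True
			then obtain c where c: "c:.K" "h = c.*$H 1.$H" using E(2) LD by blast
			show ?thesis unfolding c(2) using linD(3)[OF swl c(1) A.one_closed] linD(3)[OF l c(1) A.one_closed] c(1)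
				by(simp add: comult_one ct l1)
		next
			case False
			have "E <= ?ND" using subspace_span_superset[of "\<Union>(\<D> - {D})" K H] E(1) False by blast
			hence "l h = 0.$K" using l0 E(2) by blast
			thus ?thesis using c0[OF E(1) False E(2)] by simp
		qed
		thus "h:{h:car H. ?c (comult H h) = l h.*$H 1.$H}" using hc by simp
	qed
	hence "subspace_span K H (\<Union>\<D>) <= {h:car H. ?c (comult H h) = l h.*$H 1.$H}"
		by(rule subspace_span_least[OF linear_equalizer[OF HM HM swl ll]])
	note sub1 = this[unfolded span]
	have "?c (comult H h) = l h.*$H 1.$H" if "h:.H" for h
		by(rule conjunct2[OF CollectD[OF subsetD[OF sub1 that]]])
	thus ?thesis by(intro exI[of _ l] conjI ballI l l1) (simp add: swc)
qed

end

section \<open>Structure constants of a Hopf algebra with a finite basis\<close>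

locale hopf_basis = hopf_algebra K H
	for K :: "('k, 'n) ring_scheme" (structure) and H :: "('k, 'h, 'm) hopf_algebra_scheme" (structure) +
	fixes I :: "'i set" and e :: "'i => 'h" and du :: "'i => 'h => 'k" and t :: 'h and l :: "'h => 'k"
	assumes fin: "finite I" and e_closed[simp]: "i:I==>e i:.H"
		and du_linear: "i:I==>lin K H KK (du i)"
		and du_e: "i:I==>j:I==>du j (e i) = (if i = j then 1.$K else 0.$K)"
		and basis: "h:.H==>h = (+/$H i:I. du i h.*$H e i)"
		and t_closed[simp]: "t:.H" and t_counit: "counit H t = 1.$K"
		and t_int: "h:.H==>h*.$H t = counit H h.*$H t"
		and l_linear: "lin K H KK l" and l_one: "l 1.$H = 1.$K"
		and l_int: "h:.H==>sw H h (%x y. l y.*$H x) = l h.*$H 1.$H"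
begin

lemmas HM = VWK(2)
lemmas TM = TT.module_axioms

lemma du_simps[simp]:
	"i:I==>x:.H==>du i x:.K"
	"i:I==>x:.H==>y:.H==>du i (x+.$H y) = du i x+.$K du i y"
	"i:I==>c:.K==>x:.H==>du i (c.*$H x) = c*.$K du i x"
	using linD[OF du_linear] by auto

lemma l_simps[simp]:
	"x:.H==>l x:.K"
	"x:.H==>y:.H==>l (x+.$H y) = l x+.$K l y"
	"c:.K==>x:.H==>l (c.*$H x) = c*.$K l x"
	using linD[OF l_linear] by auto

lemma sum_closed[simp]: "(!!i. i:I==>f i:.K)==>(+/$K i:I. f i):.K" by(rule K.finsum_closed) auto

lemma sum_cong: "(!!i. i:I==>f i = g i)==>(!!i. i:I==>g i:.K)==>(+/$K i:I. f i) = (+/$K i:I. g i)"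
	by(rule K.finsum_cong') auto

lemma sum_swap: "(!!i j. i:I==>j:I==>f i j:.K)==>(+/$K i:I. +/$K j:I. f i j) = (+/$K j:I. +/$K i:I. f i j)"
	by(rule K.finsum_swap[OF fin fin])

lemma sum_left: "c:.K==>(!!i. i:I==>f i:.K)==>c*.$K (+/$K i:I. f i) = (+/$K i:I. c*.$K f i)"
	by(rule K.finsum_rdistr[OF fin]) auto

lemma sum_right: "c:.K==>(!!i. i:I==>f i:.K)==>(+/$K i:I. f i)*.$K c = (+/$K i:I. f i*.$K c)"
	by(rule K.finsum_ldistr[OF fin]) auto

lemma sum_e: "a:I==>(!!i. i:I==>f i:.K)==>(+/$K i:I. f i*.$K du a (e i)) = f a"
	using K.finsum_delta[OF fin, of a f] sum_cong[of "%i. f i*.$K du a (e i)" "%i. if i = a then f i else 0.$K"]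
	by(simp add: du_e)

lemma lin:
	assumes U: "module K U" and f: "lin K H U f" and h: "h:.H"
	shows "f h = (+/$U i:I. du i h.*$U f (e i))"
proof -
	interpret U: module K U by fact
	have "f h = f (+/$H i:I. du i h.*$H e i)" using basis[OF h] by(rule arg_cong)
	also have "... = (+/$U i:I. f (du i h.*$H e i))" by(rule lin_finsum[OF HM U f fin]) (use h in auto)
	also have "... = (+/$U i:I. du i h.*$U f (e i))" by(rule U.finsum_cong'[OF refl]) (use h linD[OF f] in auto)
	finally show ?thesis .
qed

lemma linK:
	assumes f: "lin K H KK f" and h: "h:.H"
	shows "f h = (+/$K i:I. du i h*.$K f (e i))"
	using lin[OF KK_module f h] scalars_finsum[OF VWK(1) fin, of "%i. du i h*.$K f (e i)"] linD(1)[OF f] h by simp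

definition coef :: "('h \<times> 'h => 'k) set => 'i => 'i => 'k"
	where "coef w j k = tensor_lift K KK (%x y. du j x*.$K du k y) w"

lemma coef_bilinear: "j:I==>k:I==>bil K H H KK (%x y. du j x*.$K du k y)"
	by(rule bilI) (auto simp: K.l_distr K.r_distr K.m_ac)

lemma coef_linear: "j:I==>k:I==>lin K TT KK (%w. coef w j k)"
	unfolding coef_def by(rule lift_linear[OF KK_module coef_bilinear])

lemma coef_closed[simp]: "j:I==>k:I==>w:.TT==>coef w j k:.K"
	using linD(1)[OF coef_linear] by auto

lemma coef_tn: "j:I==>k:I==>a:.H==>b:.H==>coef (tn a b) j k = du j a*.$K du k b"
	unfolding coef_def by(rule lift_tn[OF KK_module coef_bilinear])

lemma tn_linear: "b:.H==>lin K H TT (%z. tn z b)" "b:.H==>lin K H TT (%z. tn b z)"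
	by(auto simp: tn_simps intro!: linI)

lemma w_expand:
	assumes U: "module K U" and G: "lin K TT U G" and w: "w:.TT"
	shows "G w = (+/$U j:I. +/$U k:I. coef w j k.*$U G (tn (e j) (e k)))"
proof -
	interpret U: module K U by fact
	have Gc: "G (tn a b):.U" if "a:.H" "b:.H" for a b using linD(1)[OF G] that by(simp add: tn_simps)
	show ?thesis
	proof (rule tensor_eqI[OF U G _ _ w])
		show "lin K TT U (%w. +/$U j:I. +/$U k:I. coef w j k.*$U G (tn (e j) (e k)))"
			by(rule linear_map_sum[OF TM U fin], rule linear_map_sum[OF TM U fin], rule linear_map_scaled[OF U coef_linear]) (use Gc in auto)
		fix a b assume ab: "a:.H" "b:.H"
		have "G (tn a b) = (+/$U j:I. du j a.*$U G (tn (e j) b))"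
			by(rule lin[OF U lin_comp[OF tn_linear(1)[OF ab(2)] G] ab(1)])
		also have "... = (+/$U j:I. +/$U k:I. coef (tn a b) j k.*$U G (tn (e j) (e k)))"
		proof (rule U.finsum_cong'[OF refl])
			fix j assume j: "j:I"
			have "G (tn (e j) b) = (+/$U k:I. du k b.*$U G (tn (e j) (e k)))"
				by(rule lin[OF U lin_comp[OF tn_linear(2)[OF e_closed[OF j]] G] ab(2)])
			hence "du j a.*$U G (tn (e j) b) = (+/$U k:I. du j a.*$U (du k b.*$U G (tn (e j) (e k))))"
				by(simp only:) (rule U.finsum_smult_ldistr[OF fin], use j ab Gc in auto)
			also have "... = (+/$U k:I. coef (tn a b) j k.*$U G (tn (e j) (e k)))"
				by(rule U.finsum_cong'[OF refl]) (use j ab Gc in "auto simp: coef_tn U.smult_assoc1 tn_simps")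
			finally show "du j a.*$U G (tn (e j) b) = ..." .
		qed (use ab Gc in "auto intro!: U.finsum_closed simp: tn_simps")
		finally show "G (tn a b) = ..." .
	qed
qed

lemma w_expandK:
	assumes G: "lin K TT KK G" and w: "w:.TT"
	shows "G w = (+/$K j:I. +/$K k:I. coef w j k*.$K G (tn (e j) (e k)))"
proof -
	have Gc: "G (tn a b):.K" if "a:.H" "b:.H" for a b using linD(1)[OF G] that by(simp add: tn_simps)
	have inner: "(+/$KK k:I. coef w j k*.$K G (tn (e j) (e k))) = (+/$K k:I. coef w j k*.$K G (tn (e j) (e k)))" if "j:I" for j
		by(rule scalars_finsum[OF VWK(1) fin]) (use that w Gc in auto)
	interpret KM: module K KK by(rule KK_module)
	have "G w = (+/$KK j:I. +/$K k:I. coef w j k*.$K G (tn (e j) (e k)))"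
		unfolding w_expand[OF KK_module G w] by(rule KM.finsum_cong'[OF refl]) (use w Gc in "auto simp: inner")
	also have "... = (+/$K j:I. +/$K k:I. coef w j k*.$K G (tn (e j) (e k)))"
		by(rule scalars_finsum[OF VWK(1) fin]) (use w Gc in auto)
	finally show ?thesis .
qed

lemma sw_expand:
	"module K U==>bil K H H U B==>h:.H ==>
		sw U h B = (+/$U j:I. +/$U k:I. coef (comult H h) j k.*$U B (e j) (e k))"
proof -
	assume U: "module K U" and B: "bil K H H U B" and h: "h:.H"
	interpret U: module K U by fact
	note b = bilD(1)[OF B]
	show ?thesis unfolding sweedler2_def w_expand[OF U lift_linear[OF U B] comult_closed[OF h]]
		by(intro U.finsum_cong'[OF refl]) (use h b in "auto simp: lift_tn[OF U B] intro!: U.finsum_closed")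
qed

lemma sw_expandK:
	assumes B: "bil K H H KK B" and h: "h:.H"
	shows "sw KK h B = (+/$K j:I. +/$K k:I. coef (comult H h) j k*.$K B (e j) (e k))"
	unfolding sweedler2_def w_expandK[OF lift_linear[OF KK_module B] comult_closed[OF h]]
	by(intro sum_cong) (use h bilD(1)[OF B] in "auto simp: lift_tn[OF KK_module B]")

definition mc where "mc i j k = du k (e i*.$H e j)"
definition dc where "dc i j k = coef (comult H (e i)) j k"
definition Sc where "Sc i j = du j (antipode H (e i))"
definition uc where "uc i = du i 1.$H"
definition epc where "epc i = counit H (e i)"
definition tc where "tc i = du i t"
definition lc where "lc i = l (e i)"

lemmas const_defs = mc_def dc_def Sc_def uc_def epc_def tc_def lc_def

lemma coef_comult: "h:.H==>j:I==>k:I==>coef (comult H h) j k = (+/$K i:I. du i h*.$K dc i j k)"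
	unfolding dc_def by(rule linK[OF lin_comp[OF comult_linear coef_linear]])

lemma du_mult:
	assumes "h:.H" "j:I" "k:I"
	shows "du k (h*.$H e j) = (+/$K i:I. du i h*.$K mc i j k)" "du k (e j*.$H h) = (+/$K i:I. du i h*.$K mc j i k)"
	unfolding mc_def using assms by(auto intro!: linK linI simp: A.l_distr A.r_distr smult_mult_left smult_mult_right)

lemma du_sw:
	assumes B: "bil K H H H B" and h: "h:.H" and n: "n:I"
	shows "du n (sw H h B) = (+/$K j:I. +/$K k:I. coef (comult H h) j k*.$K du n (B (e j) (e k)))"
proof -
	note b = bilD[OF B]
	have "du n (sw H h B) = sw KK h (%x y. du n (B x y))"
		by(rule sw_hom[OF HM KK_module du_linear[OF n] h b(1)])
	also have "... = (+/$K j:I. +/$K k:I. coef (comult H h) j k*.$K du n (B (e j) (e k)))"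
		by(rule sw_expandK[OF _ h], rule bilI) (use n in "auto simp: b")
	finally show ?thesis .
qed

text \<open>The dual of \<open>integral_shift\<close>. By invariance l(x2 y) 1 is the sum of x2 y1
  l(x3 y2), so on the left S(x1) x2 cancels and y1 l(x y2) remains. In coordinates this becomes the
  axiom \<open>l_shift\<close>.\<close>

lemma contract_shift:
	assumes x: "x:.H" and y: "y:.H"
	shows "sw H x (%a b. l (b*.$H y).*$H antipode H a) = sw H y (%a b. l (x*.$H b).*$H a)"
proof -
	let ?S = "antipode H" and ?w = "comult H y"
	have wc: "?w:.TT" using y by simp
	let ?c = "tensor_lift K H (%x y. l y.*$H x)"
	have cl: "lin K TT H ?c" by(rule lift_linear[OF HM contract_right[OF l_linear]])
	note cD = linD[OF cl]
	have ct: "?c (tn a b) = l b.*$H a" if "a:.H" "b:.H" for a b by(rule lift_tn[OF HM contract_right[OF l_linear] that])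
	have ci: "?c (comult H h) = l h.*$H 1.$H" if "h:.H" for h using l_int[OF that] by(simp add: sweedler2_def)
	note ml = linD[OF mult_linl] linD[OF mult_linr]
	have wcl: "z*.$TA ?w:.TT" if "z:.TT" for z using mult_closed[OF that wc] .
	have mlin: "lin K TT H (%z. ?c (z*.$TA ?w))" by(rule lin_comp[OF mult_linl[OF wc] cl])
	note mD = linD[OF mlin]
	have bil: "bil K H H H (%p q. ?S a*.$H ?c (tn p q*.$TA ?w))" if "a:.H" for a
		by(rule bilI) (use that in "auto simp: tn_simps mD A.r_distr smult_mult_right")
	have lin1: "lin K H H (%a. ?S a*.$H ?c (tn p q*.$TA ?w))" if "p:.H" "q:.H" for p q
		by(rule linI) (use that in "auto simp: tn_simps mD A.l_distr smult_mult_left")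
	have "sw H x (%a b. l (b*.$H y).*$H ?S a) = sw H x (%a b. sw H b (%p q. ?S a*.$H ?c (tn p q*.$TA ?w)))"
	proof (rule sw_cong[OF HM x])
		fix a b assume ab: "a:.H" "b:.H"
		have b1: "bil K H H TT tn" by(rule tn_bilinear)
		have "sw H b (%p q. ?S a*.$H ?c (tn p q*.$TA ?w)) = tensor_lift K H (%p q. ?S a*.$H ?c (tn p q*.$TA ?w)) (comult H b)"
			by(simp add: sweedler2_def)
		also have "... = ?S a*.$H ?c (comult H b*.$TA ?w)"
		proof (rule tensor_eqI[OF HM lift_linear[OF HM bil[OF ab(1)]] _ _ comult_closed[OF ab(2)]])
			show "lin K TT H (%z. ?S a*.$H ?c (z*.$TA ?w))"
				by(rule linI) (use ab in "auto simp: mD A.r_distr smult_mult_right")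
		qed (rule lift_tn[OF HM bil[OF ab(1)]])
		also have "comult H b*.$TA ?w = comult H (b*.$H y)" using comult_mult[OF ab(2) y] by simp
		finally show "l (b*.$H y).*$H ?S a = sw H b (%p q. ?S a*.$H ?c (tn p q*.$TA ?w))"
			using ab y by(simp add: ci smult_mult_right)
		show "sw H b (%p q. ?S a*.$H ?c (tn p q*.$TA ?w)):.H"
			by(rule sw_closed[OF HM ab(2)]) (rule bilD(1)[OF bil[OF ab(1)]])
	qed
	also have "... = sw H x (%a b. sw H a (%p q. ?S p*.$H ?c (tn q b*.$TA ?w)))"
		by(rule coassoc_trilinear[OF HM bil lin1 x, symmetric])
	also have "... = sw H x (%a b. ?c (tn 1.$H (counit H a.*$H b)*.$TA ?w))"
	proof (rule sw_cong[OF HM x])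
		fix a b assume ab: "a:.H" "b:.H"
		let ?z = "?c (tn 1.$H b*.$TA ?w)"
		have zc: "?z:.H" by(rule mD(1)) (use ab in "simp add: tn_simps")
		have q: "?c (tn q b*.$TA w) = q*.$H ?c (tn 1.$H b*.$TA w)" if q: "q:.H" and w: "w:.TT" for q w
		proof (rule tensor_eqI[OF HM _ _ _ w])
			show "lin K TT H (%w. ?c (tn q b*.$TA w))"
				by(rule lin_comp[OF mult_linr cl]) (use q ab in "simp add: tn_simps")
			have "lin K TT H (%w. ?c (tn 1.$H b*.$TA w))"
				by(rule lin_comp[OF mult_linr cl]) (use ab in "simp add: tn_simps")
			from linD[OF this] show "lin K TT H (%w. q*.$H ?c (tn 1.$H b*.$TA w))"
				by(intro linI) (use q in "auto simp: A.r_distr smult_mult_right")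
		qed (use q ab in "auto simp: mult_pure ct smult_mult_right")
		have lm: "lin K H H (%u. u*.$H ?z)" by(rule linI) (use zc in "auto simp: A.l_distr smult_mult_left")
		have "sw H a (%p q. ?S p*.$H ?c (tn q b*.$TA ?w)) = sw H a (%p q. (?S p*.$H q)*.$H ?z)"
		proof (rule sw_cong[OF HM ab(1)])
			fix p r assume pr: "p:.H" "r:.H"
			show "?S p*.$H ?c (tn r b*.$TA ?w) = (?S p*.$H r)*.$H ?z"
				unfolding q[OF pr(2) wc] using pr zc by(simp only: A.m_assoc antipode_simps(1))
			show "(?S p*.$H r)*.$H ?z:.H" using pr zc by simp
		qed
		also have "... = sw H a (%p q. ?S p*.$H q)*.$H ?z" by(rule sw_hom[OF HM HM lm ab(1), symmetric]) auto
		also have "... = counit H a.*$H ?z" using ab zc by(simp add: antipode_left smult_mult_left)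
		also have "... = ?c (tn 1.$H (counit H a.*$H b)*.$TA ?w)" using ab by(simp add: tn_simps mD)
		finally show "sw H a (%p q. ?S p*.$H ?c (tn q b*.$TA ?w)) = ..." .
		show "?c (tn 1.$H (counit H a.*$H b)*.$TA ?w):.H" by(rule mD(1)) (use ab in "simp add: tn_simps")
	qed
	also have "... = ?c (tn 1.$H (sw H x (%a b. counit H a.*$H b))*.$TA ?w)"
		by(rule sw_hom[OF HM HM lin_comp[OF tn_linear(2)[OF A.one_closed] mlin] x, symmetric]) auto
	also have "... = ?c (tn 1.$H x*.$TA ?w)" by(simp add: counit_left[OF x])
	also have "... = tensor_lift K H (%a b. l (x*.$H b).*$H a) ?w"
	proof (rule tensor_eqI[OF HM _ _ _ wc])
		have b2: "bil K H H H (%a b. l (x*.$H b).*$H a)"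
			by(rule contract_right) (use x in "auto simp: A.r_distr smult_mult_right intro!: linI")
		show "lin K TT H (tensor_lift K H (%a b. l (x*.$H b).*$H a))" by(rule lift_linear[OF HM b2])
		show "lin K TT H (%w. ?c (tn 1.$H x*.$TA w))"
			by(rule lin_comp[OF mult_linr cl]) (use x in "simp add: tn_simps")
		show "?c (tn 1.$H x*.$TA tn a b) = tensor_lift K H (%a b. l (x*.$H b).*$H a) (tn a b)" if "a:.H" "b:.H" for a b
			using that x by(simp add: mult_pure ct lift_tn[OF HM b2])
	qed
	finally show ?thesis by(simp add: sweedler2_def)
qed

end

context hopf_basis
begin

lemma collapse:
	assumes "a:I" "!!j k. j:I==>k:I==>f j k:.K" "!!j. j:I==>g j:.K"
	shows "(+/$K j:I. +/$K k:I. f j k*.$K (g j*.$K du a (e k))) = (+/$K j:I. f j a*.$K g j)"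
		"(+/$K j:I. +/$K k:I. f j k*.$K (g k*.$K du a (e j))) = (+/$K k:I. f a k*.$K g k)"
proof -
	have 1: "(+/$K j:I. +/$K k:I. f j k*.$K (g j*.$K du a (e k))) = (+/$K j:I. f j a*.$K g j)"
		if "!!j k. j:I==>k:I==>f j k:.K" for f
	proof (rule sum_cong)
		fix j assume j: "j:I"
		have "(+/$K k:I. f j k*.$K (g j*.$K du a (e k))) = (+/$K k:I. (f j k*.$K g j)*.$K du a (e k))"
			by(rule sum_cong) (use that assms(1,3) j in "auto simp: K.m_assoc")
		also have "... = f j a*.$K g j" by(rule sum_e) (use that assms(1,3) j in auto)
		finally show "(+/$K k:I. f j k*.$K (g j*.$K du a (e k))) = ..." .
	qed (use that assms(1,3) in auto)
	show "(+/$K j:I. +/$K k:I. f j k*.$K (g j*.$K du a (e k))) = (+/$K j:I. f j a*.$K g j)" by(rule 1[OF assms(2)])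
	have "(+/$K j:I. +/$K k:I. f j k*.$K (g k*.$K du a (e j))) = (+/$K k:I. +/$K j:I. f j k*.$K (g k*.$K du a (e j)))"
		by(rule sum_swap) (use assms in auto)
	also have "... = (+/$K k:I. f a k*.$K g k)" using 1[of "%k j. f j k"] assms(2) by simp
	finally show "(+/$K j:I. +/$K k:I. f j k*.$K (g k*.$K du a (e j))) = ..." .
qed

lemma consts_closed[simp]:
	"i:I==>j:I==>k:I==>mc i j k:.K" "i:I==>j:I==>k:I==>dc i j k:.K"
	"i:I==>j:I==>Sc i j:.K" "i:I==>uc i:.K" "i:I==>epc i:.K"
	"i:I==>tc i:.K" "i:I==>lc i:.K" by(auto simp: const_defs)

text \<open>\<open>coassoc_trilinear\<close> for the product of three coordinate
  functionals.\<close>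

lemma coassoc_constants:
	assumes "i:I" "j:I" "k:I" "n:I"
	shows "(+/$K a:I. dc i a n*.$K dc a j k) = (+/$K a:I. dc i j a*.$K dc a k n)"
proof -
	let ?T = "%x y z. (du j x*.$K du k y)*.$K du n z"
	have scale: "lin K KK KK (%x. x*.$K c)" "lin K KK KK (%x. c*.$K x)" if "c:.K" for c
		using that by(auto simp: K.l_distr K.r_distr K.m_ac intro!: linI)
	have cl: "lin K H KK (%x. coef (comult H x) p q)" if "p:I" "q:I" for p q
		by(rule lin_comp[OF comult_linear coef_linear[OF that]])
	note cD = linD[OF cl]
	have "(+/$K a:I. dc i a n*.$K dc a j k) = sw KK (e i) (%x y. coef (comult H x) j k*.$K du n y)"
	proof -
		have "bil K H H KK (%x y. coef (comult H x) j k*.$K du n y)"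
			by(rule bilI) (use assms cD[OF assms(2,3)] in "auto simp: K.l_distr K.r_distr K.m_ac")
		from sw_expandK[OF this e_closed[OF assms(1)]]
		have "sw KK (e i) (%x y. coef (comult H x) j k*.$K du n y) = (+/$K a:I. +/$K b:I. dc i a b*.$K (dc a j k*.$K du n (e b)))"
			by(simp add: dc_def)
		thus ?thesis using collapse(1)[of n "dc i" "%a. dc a j k"] assms by simp
	qed
	also have "... = sw KK (e i) (%x y. sw KK x (%a b. ?T a b y))"
	proof (rule sw_cong[OF KK_module e_closed[OF assms(1)]])
		fix x y assume xy: "x:.H" "y:.H"
		have "coef (comult H x) j k*.$K du n y = sw KK x (%a b. du j a*.$K du k b)*.$K du n y"
			by(simp add: coef_def sweedler2_def)
		also have "... = sw KK x (%a b. ?T a b y)"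
			by(rule sw_hom[OF KK_module KK_module scale(1) xy(1)]) (use assms xy in auto)
		finally show "coef (comult H x) j k*.$K du n y = ..." .
		thus "sw KK x (%a b. ?T a b y):.KK" using assms xy by(metis K.m_closed coef_closed comult_closed du_simps(1) scalars_simps(1))
	qed
	also have "... = sw KK (e i) (%x y. sw KK y (?T x))"
		by(rule coassoc_trilinear[OF KK_module _ _ e_closed[OF assms(1)]])
			(use assms in "auto simp: K.l_distr K.r_distr K.m_ac intro!: bilI linI")
	also have "... = sw KK (e i) (%x y. coef (comult H y) k n*.$K du j x)"
	proof (rule sw_cong[OF KK_module e_closed[OF assms(1)]])
		fix x y assume xy: "x:.H" "y:.H"
		have "coef (comult H y) k n*.$K du j x = sw KK y (%a b. du k a*.$K du n b)*.$K du j x"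
			by(simp add: coef_def sweedler2_def)
		also have "... = sw KK y (%a b. (du k a*.$K du n b)*.$K du j x)"
			by(rule sw_hom[OF KK_module KK_module scale(1) xy(2)]) (use assms xy in auto)
		also have "... = sw KK y (?T x)" by(rule sw_cong[OF KK_module xy(2)]) (use assms xy in "auto simp: K.m_ac")
		finally show "sw KK y (?T x) = coef (comult H y) k n*.$K du j x" by simp
	qed (use assms in auto)
	also have "... = (+/$K a:I. dc i j a*.$K dc a k n)"
	proof -
		have "bil K H H KK (%x y. coef (comult H y) k n*.$K du j x)"
			by(rule bilI) (use assms cD[OF assms(3,4)] in "auto simp: K.l_distr K.r_distr K.m_ac")
		from sw_expandK[OF this e_closed[OF assms(1)]]
		have "sw KK (e i) (%x y. coef (comult H y) k n*.$K du j x) = (+/$K a:I. +/$K b:I. dc i a b*.$K (dc b k n*.$K du j (e a)))"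
			by(simp add: dc_def)
		thus ?thesis using collapse(2)[of j "dc i" "%a. dc a k n"] assms by simp
	qed
	finally show ?thesis .
qed

lemma bialgebra_constants:
	assumes "i:I" "j:I" "p:I" "f:I"
	shows "(+/$K k:I. mc i j k*.$K dc k p f) =
		(+/$K a:I. +/$K b:I. +/$K c:I. +/$K g:I. (dc i a b*.$K dc j c g)*.$K (mc a c p*.$K mc b g f))"
proof -
	have wc: "comult H (e i):.TT" "comult H (e j):.TT" using assms by auto
	have tc: "tn (e a) (e b):.TT" if "a:I" "b:I" for a b using that by(simp add: tn_simps)
	have "(+/$K k:I. mc i j k*.$K dc k p f) = coef (comult H (e i*.$H e j)) p f"
		using coef_comult[of "e i*.$H e j" p f] assms by(simp add: mc_def)
	also have "... = coef (comult H (e i)*.$TA comult H (e j)) p f" using assms by(simp add: comult_mult)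
	also have "... = (+/$K a:I. +/$K b:I. dc i a b*.$K coef (tn (e a) (e b)*.$TA comult H (e j)) p f)"
		unfolding dc_def by(rule w_expandK[OF lin_comp[OF mult_linl[OF wc(2)] coef_linear] wc(1)]) (use assms in auto)
	also have "... = (+/$K a:I. +/$K b:I. +/$K c:I. +/$K g:I. (dc i a b*.$K dc j c g)*.$K (mc a c p*.$K mc b g f))"
	proof (rule sum_cong, rule sum_cong)
		fix a b assume ab: "a:I" "b:I"
		have "coef (tn (e a) (e b)*.$TA comult H (e j)) p f = (+/$K c:I. +/$K g:I. dc j c g*.$K coef (tn (e a) (e b)*.$TA tn (e c) (e g)) p f)"
			unfolding dc_def by(rule w_expandK[OF lin_comp[OF mult_linr[OF tc[OF ab]] coef_linear] wc(2)]) (use assms in auto)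
		also have "... = (+/$K c:I. +/$K g:I. dc j c g*.$K (mc a c p*.$K mc b g f))"
			by(intro sum_cong) (use ab assms in "auto simp: mult_pure coef_tn mc_def")
		finally show "dc i a b*.$K coef (tn (e a) (e b)*.$TA comult H (e j)) p f =
				(+/$K c:I. +/$K g:I. (dc i a b*.$K dc j c g)*.$K (mc a c p*.$K mc b g f))"
			using ab assms by(simp add: sum_left K.m_assoc cong: sum_cong)
	qed (use assms in auto)
	finally show ?thesis .
qed

theorem constants: "hopf_constants K I mc dc Sc uc epc tc lc"
proof (unfold_locales, goal_cases)
	case (9 j k)
	thus ?case using du_mult(1)[OF A.one_closed 9] by(simp add: uc_def du_e)
next
	case (10 i k)
	thus ?case using du_mult(2)[OF A.one_closed 10] by(simp add: uc_def du_e)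
next
	case (11 i j k n)
	have "(+/$K a:I. mc i j a*.$K mc a k n) = du n (e i*.$H e j*.$H e k)"
		using du_mult(1)[of "e i*.$H e j" k n] 11 by(simp add: mc_def)
	also have "... = (+/$K a:I. mc j k a*.$K mc i a n)"
		using du_mult(2)[of "e j*.$H e k" i n] 11 by(simp add: mc_def A.m_assoc)
	finally show ?case .
next
	case (12 i j k n)
	thus ?case by(rule coassoc_constants)
next
	case (13 i k)
	have "du k (e i) = (+/$K j:I. +/$K b:I. dc i j b*.$K (epc j*.$K du k (e b)))"
		using du_sw[OF contract_left[OF counit_linear] e_closed[OF 13(1)] 13(2)] 13
		by(simp add: counit_left dc_def epc_def cong: sum_cong)
	also have "... = (+/$K j:I. dc i j k*.$K epc j)" by(rule collapse(1)) (use 13 in auto)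
	also have "... = (+/$K j:I. epc j*.$K dc i j k)" by(rule sum_cong) (use 13 in "auto simp: K.m_comm")
	finally show ?case using 13 by(simp add: du_e)
next
	case (14 i j)
	have "du j (e i) = (+/$K a:I. +/$K k:I. dc i a k*.$K (epc k*.$K du j (e a)))"
		using du_sw[OF contract_right[OF counit_linear] e_closed[OF 14(1)] 14(2)] 14
		by(simp add: counit_right dc_def epc_def cong: sum_cong)
	also have "... = (+/$K k:I. dc i j k*.$K epc k)" by(rule collapse(2)) (use 14 in auto)
	also have "... = (+/$K k:I. epc k*.$K dc i j k)" by(rule sum_cong) (use 14 in "auto simp: K.m_comm")
	finally show ?case using 14 by(simp add: du_e)
next
	case (15 i j p f)
	thus ?case by(rule bialgebra_constants)
next
	case (16 i j)
	thus ?case using linK[OF counit_linear, of "e i*.$H e j"] by(simp add: mc_def epc_def)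
next
	case 17
	thus ?case using linK[OF counit_linear A.one_closed] by(simp add: uc_def epc_def)
next
	case (18 j k)
	thus ?case using coef_comult[OF A.one_closed 18] by(simp add: uc_def comult_one coef_tn)
next
	case (19 i n)
	have "epc i*.$K uc n = (+/$K j:I. +/$K k:I. dc i j k*.$K du n (antipode H (e j)*.$H e k))"
		using du_sw[OF mult_bilinear e_closed[OF 19(1)] 19(2)] 19 by(simp add: antipode_left dc_def epc_def uc_def)
	also have "... = (+/$K j:I. +/$K k:I. +/$K a:I. Sc j a*.$K (dc i j k*.$K mc a k n))"
	proof (rule sum_cong, rule sum_cong)
		fix j k assume jk: "j:I" "k:I"
		have "dc i j k*.$K du n (antipode H (e j)*.$H e k) = dc i j k*.$K (+/$K a:I. Sc j a*.$K mc a k n)"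
			using du_mult(1)[of "antipode H (e j)" k n] jk 19 by(simp add: Sc_def)
		also have "... = (+/$K a:I. dc i j k*.$K (Sc j a*.$K mc a k n))" by(rule sum_left) (use jk 19 in auto)
		also have "... = (+/$K a:I. Sc j a*.$K (dc i j k*.$K mc a k n))" by(rule sum_cong) (use jk 19 in "auto simp: K.m_lcomm")
		finally show "dc i j k*.$K du n (antipode H (e j)*.$H e k) = ..." .
	qed (use 19 in auto)
	also have "... = (+/$K k:I. +/$K j:I. +/$K a:I. Sc j a*.$K (dc i j k*.$K mc a k n))" by(rule sum_swap) (use 19 in auto)
	finally show ?case by(rule sym)
next
	case (20 i n)
	have B: "bil K H H H (%a b. a*.$H antipode H b)"
		by(rule bilI) (auto simp: A.l_distr A.r_distr smult_mult_left smult_mult_right)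
	have "epc i*.$K uc n = (+/$K j:I. +/$K k:I. dc i j k*.$K du n (e j*.$H antipode H (e k)))"
		using du_sw[OF B e_closed[OF 20(1)] 20(2)] 20 by(simp add: antipode_right dc_def epc_def uc_def)
	also have "... = (+/$K j:I. +/$K k:I. +/$K a:I. Sc k a*.$K (dc i j k*.$K mc j a n))"
	proof (rule sum_cong, rule sum_cong)
		fix j k assume jk: "j:I" "k:I"
		have "dc i j k*.$K du n (e j*.$H antipode H (e k)) = dc i j k*.$K (+/$K a:I. Sc k a*.$K mc j a n)"
			using du_mult(2)[of "antipode H (e k)" j n] jk 20 by(simp add: Sc_def)
		also have "... = (+/$K a:I. dc i j k*.$K (Sc k a*.$K mc j a n))" by(rule sum_left) (use jk 20 in auto)
		also have "... = (+/$K a:I. Sc k a*.$K (dc i j k*.$K mc j a n))" by(rule sum_cong) (use jk 20 in "auto simp: K.m_lcomm")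
		finally show "dc i j k*.$K du n (e j*.$H antipode H (e k)) = ..." .
	qed (use 20 in auto)
	finally show ?case by(rule sym)
next
	case (21 i k)
	thus ?case using du_mult(2)[OF t_closed 21] by(simp add: tc_def t_int epc_def)
next
	case 22
	thus ?case using linK[OF counit_linear t_closed] by(simp add: tc_def epc_def t_counit)
next
	case (23 i j)
	have "lc i*.$K uc j = (+/$K a:I. +/$K k:I. dc i a k*.$K (lc k*.$K du j (e a)))"
		using du_sw[OF contract_right[OF l_linear] e_closed[OF 23(1)] 23(2)] 23
		by(simp add: l_int dc_def lc_def uc_def cong: sum_cong)
	also have "... = (+/$K k:I. dc i j k*.$K lc k)" by(rule collapse(2)) (use 23 in auto)
	also have "... = (+/$K k:I. lc k*.$K dc i j k)" by(rule sum_cong) (use 23 in "auto simp: K.m_comm")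
	finally show ?case using 23 by(simp add: K.m_comm)
next
	case 24
	thus ?case using linK[OF l_linear A.one_closed] sum_cong[of "%i. du i 1.$H*.$K l (e i)" "%i. l (e i)*.$K du i 1.$H"]
		by(simp add: lc_def uc_def l_one K.m_comm)
next
	case (25 h i j)
	let ?w = "comult H t"
	have wc: "?w:.TT" by simp
	have cw: "(+/$K s:I. tc s*.$K dc s a b) = coef ?w a b" if "a:I" "b:I" for a b
		using coef_comult[OF t_closed that] by(simp add: tc_def)
	have tc1: "tn 1.$H (e h):.TT" "tn (antipode H (e h)) 1.$H:.TT" using 25 by(auto simp: tn_simps)
	have "(+/$K b:I. (+/$K s:I. tc s*.$K dc s i b)*.$K mc h b j) = (+/$K b:I. coef ?w i b*.$K mc h b j)"
		by(rule sum_cong) (use 25 cw in auto)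
	also have "... = (+/$K a:I. +/$K b:I. coef ?w a b*.$K (mc h b j*.$K du i (e a)))"
		by(rule collapse(2)[symmetric]) (use 25 in auto)
	also have "... = (+/$K a:I. +/$K b:I. coef ?w a b*.$K coef (tn 1.$H (e h)*.$TA tn (e a) (e b)) i j)"
		by(intro sum_cong) (use 25 in "auto simp: mult_pure coef_tn mc_def K.m_comm")
	also have "... = coef (tn 1.$H (e h)*.$TA ?w) i j"
		by(rule w_expandK[OF lin_comp[OF mult_linr[OF tc1(1)] coef_linear] wc, symmetric]) (use 25 in auto)
	also have "... = coef (tn (antipode H (e h)) 1.$H*.$TA ?w) i j" using integral_shift[OF t_closed t_int e_closed[OF 25(1)]] by simp
	also have "... = (+/$K a:I. +/$K b:I. coef ?w a b*.$K coef (tn (antipode H (e h)) 1.$H*.$TA tn (e a) (e b)) i j)"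
		by(rule w_expandK[OF lin_comp[OF mult_linr[OF tc1(2)] coef_linear] wc]) (use 25 in auto)
	also have "... = (+/$K a:I. +/$K b:I. coef ?w a b*.$K (du i (antipode H (e h)*.$H e a)*.$K du j (e b)))"
		by(intro sum_cong) (use 25 in "auto simp: mult_pure coef_tn")
	also have "... = (+/$K b:I. coef ?w b j*.$K du i (antipode H (e h)*.$H e b))"
		by(rule collapse(1)) (use 25 in auto)
	also have "... = (+/$K b:I. +/$K a:I. Sc h a*.$K (mc a b i*.$K (+/$K s:I. tc s*.$K dc s b j)))"
	proof (rule sum_cong)
		fix b assume b: "b:I"
		have "coef ?w b j*.$K du i (antipode H (e h)*.$H e b) = coef ?w b j*.$K (+/$K a:I. Sc h a*.$K mc a b i)"
			using du_mult(1)[of "antipode H (e h)" b i] b 25 by(simp add: Sc_def)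
		also have "... = (+/$K a:I. coef ?w b j*.$K (Sc h a*.$K mc a b i))" by(rule sum_left) (use b 25 in auto)
		also have "... = (+/$K a:I. Sc h a*.$K (mc a b i*.$K (+/$K s:I. tc s*.$K dc s b j)))"
			by(rule sum_cong) (use b 25 in "auto simp: cw K.m_ac")
		finally show "coef ?w b j*.$K du i (antipode H (e h)*.$H e b) = ..." .
	qed (use 25 in auto)
	also have "... = (+/$K a:I. +/$K b:I. Sc h a*.$K (mc a b i*.$K (+/$K s:I. tc s*.$K dc s b j)))"
		by(rule sum_swap) (use 25 in auto)
	finally show ?case .
next
	case (26 h i j)
	have lin1: "lin K H KK (%b. l (b*.$H e j))" "lin K H KK (%b. l (e i*.$H b))"
		by(rule linI; use 26 in "simp add: A.l_distr A.r_distr smult_mult_left smult_mult_right")+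
	have ls: "(+/$K s:I. lc s*.$K mc a b s) = l (e a*.$H e b)" if "a:I" "b:I" for a b
		using linK[OF l_linear, of "e a*.$H e b"] that sum_cong[of "%s. lc s*.$K mc a b s" "%s. du s (e a*.$H e b)*.$K l (e s)"]
		by(simp add: lc_def mc_def K.m_comm)
	have B: "bil K H H H (%a b. l (b*.$H e j).*$H antipode H a)"
		by(rule bilI) (use 26 in "auto simp: A.l_distr smult_mult_left smult_l_distr smult_r_distr smult_assoc1[symmetric] K.m_comm")
	have "(+/$K b:I. (+/$K s:I. lc s*.$K mc i b s)*.$K dc j h b) = (+/$K b:I. dc j h b*.$K l (e i*.$H e b))"
		by(rule sum_cong) (use 26 in "auto simp: ls K.m_comm")
	also have "... = (+/$K a:I. +/$K b:I. dc j a b*.$K (l (e i*.$H e b)*.$K du h (e a)))"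
		by(rule collapse(2)[symmetric]) (use 26 in auto)
	also have "... = du h (sw H (e j) (%a b. l (e i*.$H b).*$H a))"
		using du_sw[OF contract_right[OF lin1(2)] e_closed[OF 26(3)] 26(1)] 26 by(simp add: dc_def cong: sum_cong)
	also have "... = du h (sw H (e i) (%a b. l (b*.$H e j).*$H antipode H a))"
		using contract_shift[OF e_closed[OF 26(2)] e_closed[OF 26(3)]] by simp
	also have "... = (+/$K a:I. +/$K b:I. dc i a b*.$K (l (e b*.$H e j)*.$K Sc a h))"
		using du_sw[OF B e_closed[OF 26(2)] 26(1)] 26 by(simp add: dc_def Sc_def cong: sum_cong)
	also have "... = (+/$K a:I. +/$K b:I. Sc a h*.$K (dc i a b*.$K (+/$K s:I. lc s*.$K mc b j s)))"
		by(intro sum_cong) (use 26 in "auto simp: ls K.m_ac")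
	finally show ?case .
qed (use fin in auto)

end

text \<open>Each axiom is a polynomial identity with integer coefficients between the constants, so
  a ring homomorphism preserves it. This takes the place of a Hopf algebra structure on the scalar
  extension of \<open>H\<close>.\<close>

lemma hopf_constants_hom:
	assumes "hopf_constants K I m d S u ep t l" and F: "field F" and io: "io:ring_hom K F"
	shows "hopf_constants F I (%i j k. io (m i j k)) (%i j k. io (d i j k)) (%i j. io (S i j)) (%i. io (u i)) (%i. io (ep i)) (%i. io (t i)) (%i. io (l i))"
proof -
	interpret K: hopf_constants K I m d S u ep t l by fact
	interpret F: field F by fact
	interpret io: ring_hom_ring K F io by(rule ring_hom_ringI2[OF K.ring_axioms F.ring_axioms io])
	have hs: "io (+/$K i:I. f i) = (+/$F i:I. io (f i))" if "!!i. i:I==>f i:.K" for f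
		by(rule add_finsum[OF K.abelian_group_axioms F.abelian_group_axioms _ _ K.fin]) (use that in auto)
	have sc[simp]: "(+/$F i:I. f i):.F" if "!!i. i:I==>f i:.F" for f
		by(rule F.finsum_closed) (use that in auto)
	have sg: "(+/$F i:I. f i) = (+/$F i:I. g i)" if "!!i. i:I==>f i = g i" "!!i. i:I==>g i:.F" for f g
		by(rule F.finsum_cong') (use that in auto)
	show ?thesis
	proof (unfold_locales, goal_cases)
		case (9 j k)
		thus ?case using arg_cong[OF K.unit_left[OF 9], of io] by(simp add: hs cong: sg split: if_splits)
	next
		case (10 i k)
		thus ?case using arg_cong[OF K.unit_right[OF 10], of io] by(simp add: hs cong: sg split: if_splits)
	next
		case (11 i j k n)
		thus ?case using arg_cong[OF K.assoc[OF 11], of io] by(simp add: hs cong: sg)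
	next
		case (12 i j k n)
		thus ?case using arg_cong[OF K.coassoc[OF 12], of io] by(simp add: hs cong: sg)
	next
		case (13 i k)
		thus ?case using arg_cong[OF K.counit_left[OF 13], of io] by(simp add: hs cong: sg split: if_splits)
	next
		case (14 i j)
		thus ?case using arg_cong[OF K.counit_right[OF 14], of io] by(simp add: hs cong: sg split: if_splits)
	next
		case (15 i j p f)
		thus ?case using arg_cong[OF K.bialgebra[OF 15], of io] by(simp add: hs cong: sg)
	next
		case (16 i j)
		thus ?case using arg_cong[OF K.ep_mult[OF 16], of io] by(simp add: hs cong: sg)
	next
		case 17
		thus ?case using arg_cong[OF K.ep_unit, of io] by(simp add: hs cong: sg)
	next
		case (18 j k)
		thus ?case using arg_cong[OF K.d_unit[OF 18], of io] by(simp add: hs cong: sg)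
	next
		case (19 i n)
		thus ?case using arg_cong[OF K.antipode_left[OF 19], of io] by(simp add: hs cong: sg)
	next
		case (20 i n)
		thus ?case using arg_cong[OF K.antipode_right[OF 20], of io] by(simp add: hs cong: sg)
	next
		case (21 i k)
		thus ?case using arg_cong[OF K.t_integral[OF 21], of io] by(simp add: hs cong: sg)
	next
		case 22
		thus ?case using arg_cong[OF K.t_ep, of io] by(simp add: hs cong: sg)
	next
		case (23 i j)
		thus ?case using arg_cong[OF K.l_integral[OF 23], of io] by(simp add: hs cong: sg)
	next
		case 24
		thus ?case using arg_cong[OF K.l_unit, of io] by(simp add: hs cong: sg)
	next
		case (25 h i j)
		thus ?case using arg_cong[OF K.t_shift[OF 25], of io] by(simp add: hs cong: sg)
	next
		case (26 h i j)
		thus ?case using arg_cong[OF K.l_shift[OF 26], of io] by(simp add: hs cong: sg)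
	qed (use K.fin in auto)
qed

section \<open>Crossed products\<close>

context vs_pair
begin

lemma lift_linear_param:
	assumes "module K U" "t:.TT" "!!x y. x:.V==>y:.W==>lin K Z U (%v. B v x y)"
	shows "lin K Z U (%v. tensor_lift K U (B v) t)"
proof -
	note b = linD[OF assms(3)]
	show ?thesis
	proof (rule linI)
		show "tensor_lift K U (B v) t:.U" if "v:.Z" for v
			by(rule lift_closed[OF assms(1,2)]) (use that b in auto)
		show "tensor_lift K U (B (v+.$Z w)) t = tensor_lift K U (B v) t+.$U tensor_lift K U (B w) t" if vw: "v:.Z" "w:.Z" for v w
		proof -
			interpret U: module K U by fact
			have "tensor_lift K U (B (v+.$Z w)) t = tensor_lift K U (%x y. B v x y+.$U B w x y) t"
				by(rule lift_cong[OF assms(1,2)]) (use vw b in auto)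
			also have "... = tensor_lift K U (B v) t+.$U tensor_lift K U (B w) t"
				by(rule lift_add[OF assms(1,2)]) (use vw b in auto)
			finally show ?thesis .
		qed
		show "tensor_lift K U (B (c.*$Z v)) t = c.*$U tensor_lift K U (B v) t" if vw: "v:.Z" "c:.K" for v c
		proof -
			interpret U: module K U by fact
			have "tensor_lift K U (B (c.*$Z v)) t = tensor_lift K U (%x y. c.*$U B v x y) t"
				by(rule lift_cong[OF assms(1,2)]) (use vw b in auto)
			also have "... = c.*$U tensor_lift K U (B v) t" by(rule lift_smult[OF assms(1,2)]) (use vw b in auto)
			finally show ?thesis .
		qed
	qed
qed

end

lemma (in hopf_algebra) sw_linear_param:
	"module K U==>h:.H==>(!!x y. x:.H==>y:.H==>lin K Z U (%v. B v x y)) ==>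
		lin K Z U (%v. sw U h (B v))"
	unfolding sweedler2_def by(rule lift_linear_param) auto

lemma bilI_lin:
	"(!!x. x:.V==>lin K W U (B x))==>(!!y. y:.W==>lin K V U (%x. B x y))==>bil K V W U B"
	by(auto simp: bilinear_map_def)

section \<open>Unit laws and multiplication rules of the crossed product\<close>

locale crossed_product_algebra = twisted_module_algebra K H R act sg +
		Hb: hopf_basis K H I e du t l + A: assoc_algebra K "crossed_product K H R act sg"
	for K :: "('k, 'n) ring_scheme" (structure) and H :: "('k, 'h, 'm) hopf_algebra_scheme" (structure)
		and R :: "('k, 'r, 'p) module_scheme" (structure) and act sg and I :: "'i set" and e du t l +
	fixes ta :: "'h => 'h => 'r"
	assumes ta: "convolution_inverse K H R sg ta"
begin

abbreviation A where "A \<equiv> crossed_product K H R act sg"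

sublocale RH: vs_pair K R H by(intro vs_pair.intro H.VWK(1) H.VWK(2) R.module_axioms)

lemmas fieldK = H.VWK(1) and HM = H.VWK(2) and RM = R.module_axioms and AM = RH.TT.module_axioms

abbreviation sm (infix "#" 80) where "sm r h \<equiv> tensor K R H r h"

lemma A_simps[simp]: "car A = car RH.TT" "add A = add RH.TT" "0.$A = 0.$RH.TT" "smult A = smult RH.TT"
		"1.$A = 1.$R # 1.$H" by(simp_all add: crossed_product_def)

lemmas act_simps[simp] = bilD[OF act_bilinear]

lemma sg_bilinear: "bil K H H R sg" and ta_bilinear: "bil K H H R ta"
	using ta by(auto simp: convolution_inverse_def)

lemmas sg_simps[simp] = bilD[OF sg_bilinear]
lemmas ta_simps[simp] = bilD[OF ta_bilinear]

lemmas R_simps = R.smult_mult_left R.smult_mult_right R.A.l_distr R.A.r_distr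

definition MM where "MM a h b g = sweedler3 K H RH.TT h (%h\<^sub>1 h\<^sub>2 h\<^sub>3. H.sw RH.TT g (%g\<^sub>1 g\<^sub>2.
		(a*.$R act h\<^sub>1 b*.$R sg h\<^sub>2 g\<^sub>1) # (h\<^sub>3*.$H g\<^sub>2)))"

lemma base_linear:
	assumes "a:.R" "h1:.H" "b:.R" "h2:.H" "g1:.H" "h3:.H" "g2:.H"
	shows "lin K R RH.TT (%a. (a*.$R act h1 b*.$R sg h2 g1) # (h3*.$H g2))"
		"lin K H RH.TT (%h1. (a*.$R act h1 b*.$R sg h2 g1) # (h3*.$H g2))"
		"lin K R RH.TT (%b. (a*.$R act h1 b*.$R sg h2 g1) # (h3*.$H g2))"
		"lin K H RH.TT (%h2. (a*.$R act h1 b*.$R sg h2 g1) # (h3*.$H g2))"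
		"lin K H RH.TT (%g1. (a*.$R act h1 b*.$R sg h2 g1) # (h3*.$H g2))"
		"lin K H RH.TT (%h3. (a*.$R act h1 b*.$R sg h2 g1) # (h3*.$H g2))"
		"lin K H RH.TT (%g2. (a*.$R act h1 b*.$R sg h2 g1) # (h3*.$H g2))"
	by(rule linI; use assms in "simp add: RH.tn_simps R_simps H.A.l_distr H.A.r_distr H.smult_mult_left H.smult_mult_right")+

lemmas LP = H.sw_linear_param[OF AM]
lemmas LH = H.sw_linear[OF AM]

lemma MM_linear:
	assumes "a:.R" "h:.H" "b:.R" "g:.H"
	shows "lin K R RH.TT (%a. MM a h b g)" "lin K H RH.TT (%h. MM a h b g)"
		"lin K R RH.TT (%b. MM a h b g)" "lin K H RH.TT (%g. MM a h b g)"
proof -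
	show "lin K R RH.TT (%a. MM a h b g)" unfolding MM_def sweedler3_def
		by(rule LP[OF assms(2)], rule LP, assumption, rule LP[OF assms(4)], rule base_linear) (use assms in auto)
	show "lin K R RH.TT (%b. MM a h b g)" unfolding MM_def sweedler3_def
		by(rule LP[OF assms(2)], rule LP, assumption, rule LP[OF assms(4)], rule base_linear) (use assms in auto)
	have B: "bil K H H RH.TT (%g1 g2. (a*.$R act h1 b*.$R sg h2 g1) # (h3*.$H g2))"
		if "h1:.H" "h2:.H" "h3:.H" for h1 h2 h3 by(rule bilI_lin) (rule base_linear, use that assms in auto)+
	show "lin K H RH.TT (%g. MM a h b g)" unfolding MM_def sweedler3_def
		by(rule LP[OF assms(2)], rule LP, assumption, rule LH, rule B) auto
	show "lin K H RH.TT (%h. MM a h b g)" unfolding MM_def sweedler3_def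
	proof (rule LH, rule bilI_lin)
		fix x assume x: "x:.H"
		show "lin K H RH.TT (%h'. H.sw RH.TT h' (%h2 h3. H.sw RH.TT g (%g1 g2. (a*.$R act x b*.$R sg h2 g1) # (h3*.$H g2))))"
		proof (rule LH, rule bilI_lin)
			show "lin K H RH.TT (%h3. H.sw RH.TT g (%g1 g2. (a*.$R act x b*.$R sg h2 g1) # (h3*.$H g2)))" if "h2:.H" for h2
				by(rule LP[OF assms(4)], rule base_linear) (use x that assms in auto)
			show "lin K H RH.TT (%h2. H.sw RH.TT g (%g1 g2. (a*.$R act x b*.$R sg h2 g1) # (h3*.$H g2)))" if "h3:.H" for h3
				by(rule LP[OF assms(4)], rule base_linear) (use x that assms in auto)
		qed
		show "lin K H RH.TT (%h1. H.sw RH.TT x (%h2 h3. H.sw RH.TT g (%g1 g2. (a*.$R act h1 b*.$R sg h2 g1) # (h3*.$H g2))))"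
			by(rule LP[OF x], rule LP[OF assms(4)], rule base_linear) (use assms in auto)
	qed
qed

lemma mult_sm:
	assumes "a:.R" "h:.H" "b:.R" "g:.H"
	shows "(a # h)*.$A (b # g) = MM a h b g"
proof -
	have inner: "bil K R H RH.TT (MM a h)" if "a:.R" "h:.H" for a h
		by(rule bilI_lin) (use that in "auto intro: MM_linear")
	have outer: "bil K R H RH.TT (%a h. tensor_lift K RH.TT (MM a h) (b # g))"
		by(rule bilI_lin; rule RH.lift_linear_param[OF AM]; (rule MM_linear)?) (use assms in "auto simp: RH.tn_simps")
	have "(a # h)*.$A (b # g) = tensor_lift K RH.TT (%a h. tensor_lift K RH.TT (MM a h) (b # g)) (a # h)"
		by(simp add: crossed_product_def MM_def[abs_def])
	also have "... = tensor_lift K RH.TT (MM a h) (b # g)" by(rule RH.lift_tn[OF AM outer assms(1,2)])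
	also have "... = MM a h b g" by(rule RH.lift_tn[OF AM inner[OF assms(1,2)] assms(3,4)])
	finally show ?thesis .
qed

text \<open>The counit on the second tensor factor; it turns identities in the crossed product into
  identities in \<open>R\<close>, and later members of one radical into members of the
  other.\<close>

definition red :: "('r \<times> 'h => 'k) set => 'r"
	where "red = tensor_lift K R (%r h. counit H h.*$R r)"

lemma red_bilinear: "bil K R H R (%r h. counit H h.*$R r)"
	by(rule bilI) (auto simp: R.smult_l_distr R.smult_r_distr R.smult_assoc1[symmetric] H.K.m_comm)

lemma red_linear: "lin K RH.TT R red" unfolding red_def by(rule RH.lift_linear[OF RM red_bilinear])
lemma red_sm: "r:.R==>h:.H==>red (r # h) = counit H h.*$R r"
	unfolding red_def by(rule RH.lift_tn[OF RM red_bilinear])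

lemma sw_one: "module K U==>bil K H H U B==>H.sw U 1.$H B = B 1.$H 1.$H"
	by(simp add: sweedler2_def H.comult_one H.lift_tn)

text \<open>In the convolution algebra \<open>f = (\<lambda>h. act h 1)\<close> satisfies \<open>f * f = f\<close> and, by the unit axiom,
	\<open>f * sg(-, 1) = ep\<close>; hence \<open>f = ep\<close>.\<close>

lemma counit_sw_right:
	assumes f: "lin K H R f" and h: "h:.H"
	shows "H.sw R h (%x y. counit H y.*$R f x) = f h" "H.sw R h (%x y. counit H x.*$R f y) = f h"
proof -
	have "f (H.sw H h (%x y. counit H y.*$H x)) = H.sw R h (%x y. f (counit H y.*$H x))"
		by(rule H.sw_hom[OF HM RM f h]) auto
	also have "... = H.sw R h (%x y. counit H y.*$R f x)" by(rule H.sw_cong[OF RM h]) (use linD[OF f] in auto)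
	finally show "H.sw R h (%x y. counit H y.*$R f x) = f h" using H.counit_right[OF h] by simp
	have "f (H.sw H h (%x y. counit H x.*$H y)) = H.sw R h (%x y. f (counit H x.*$H y))"
		by(rule H.sw_hom[OF HM RM f h]) auto
	also have "... = H.sw R h (%x y. counit H x.*$R f y)" by(rule H.sw_cong[OF RM h]) (use linD[OF f] in auto)
	finally show "H.sw R h (%x y. counit H x.*$R f y) = f h" using H.counit_left[OF h] by simp
qed

lemma lin_act: "r:.R==>lin K H R (%h. act h r)" by(rule linI) auto
lemma lin_sg: "g:.H==>lin K H R (%h. sg h g)" "g:.H==>lin K H R (sg g)" by(rule linI; simp)+

text \<open>The right unit law for 1 # h, with the counit applied to the last leg.\<close>

lemma conv_unit:
	assumes h: "h:.H"
	shows "H.sw R h (%x y. act x 1.$R*.$R sg y 1.$H) = counit H h.*$R 1.$R"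
proof -
	have B: "bil K H H RH.TT (%g1 g2. (act h1 1.$R*.$R sg h2 g1) # (h3*.$H g2))"
		if "h1:.H" "h2:.H" "h3:.H" for h1 h2 h3
		by(rule bilI) (use that in "auto simp: RH.tn_simps R_simps H.A.r_distr H.smult_mult_right")
	have "1.$R # h = (1.$R # h)*.$A 1.$A" using h by(subst A.A.r_one) (auto simp: RH.tn_simps)
	also have "... = MM 1.$R h 1.$R 1.$H" using h by(simp add: mult_sm)
	also have "... = H.sw RH.TT h (%h1 h'. H.sw RH.TT h' (%h2 h3. (act h1 1.$R*.$R sg h2 1.$H) # h3))"
		unfolding MM_def sweedler3_def
		by(intro H.sw_cong[OF AM] h H.sw_closed[OF AM]) (auto simp: sw_one[OF AM B] RH.tn_simps)
	finally have e: "1.$R # h = ..." .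
	have c: "H.sw RH.TT h' (%h2 h3. (act h1 1.$R*.$R sg h2 1.$H) # h3):.RH.TT" if "h1:.H" "h':.H" for h1 h'
		by(rule H.sw_closed[OF AM that(2)]) (use that in "auto simp: RH.tn_simps")
	have "counit H h.*$R 1.$R = red (1.$R # h)" using h by(simp add: red_sm)
	also have "... = H.sw R h (%h1 h'. red (H.sw RH.TT h' (%h2 h3. (act h1 1.$R*.$R sg h2 1.$H) # h3)))"
		unfolding e by(rule H.sw_hom[OF AM RM red_linear h c])
	also have "... = H.sw R h (%x y. act x 1.$R*.$R sg y 1.$H)"
	proof (rule H.sw_cong[OF RM h])
		fix x y assume xy: "x:.H" "y:.H"
		have "red (H.sw RH.TT y (%h2 h3. (act x 1.$R*.$R sg h2 1.$H) # h3)) = H.sw R y (%h2 h3. red ((act x 1.$R*.$R sg h2 1.$H) # h3))"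
			by(rule H.sw_hom[OF AM RM red_linear xy(2)]) (use xy in "auto simp: RH.tn_simps")
		also have "... = H.sw R y (%h2 h3. counit H h3.*$R (act x 1.$R*.$R sg h2 1.$H))"
			by(rule H.sw_cong[OF RM xy(2)]) (use xy in "auto simp: red_sm")
		also have "... = act x 1.$R*.$R sg y 1.$H"
			by(rule counit_sw_right(1)[OF _ xy(2)], rule linI) (use xy in "auto simp: R_simps")
		finally show "red (H.sw RH.TT y (%h2 h3. (act x 1.$R*.$R sg h2 1.$H) # h3)) = ..." .
	qed auto
	finally show ?thesis by simp
qed

lemma act_unit: "h:.H==>act h 1.$R = counit H h.*$R 1.$R"
proof -
	assume h: "h:.H"
	let ?f = "%h. act h 1.$R" and ?g = "%h. sg h 1.$H"
	have ff: "H.sw R h (%x y. ?f x*.$R ?f y) = ?f h" if "h:.H" for h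
		using act_mult[OF that R.A.one_closed R.A.one_closed] by simp
	have "counit H h.*$R 1.$R = H.sw R h (%x y. ?f x*.$R ?g y)" using conv_unit[OF h] by simp
	also have "... = H.sw R h (%x y. H.sw R x (%a b. ?f a*.$R ?f b*.$R ?g y))"
	proof (rule H.sw_cong[OF RM h])
		fix x y assume xy: "x:.H" "y:.H"
		have "H.sw R x (%a b. ?f a*.$R ?f b)*.$R ?g y = H.sw R x (%a b. ?f a*.$R ?f b*.$R ?g y)"
			by(rule H.sw_hom[OF RM RM _ xy(1)], rule linI) (use xy in "auto simp: R_simps")
		thus "?f x*.$R ?g y = H.sw R x (%a b. ?f a*.$R ?f b*.$R ?g y)" using ff[OF xy(1)] by simp
		show "H.sw R x (%a b. ?f a*.$R ?f b*.$R ?g y):.R" by(rule H.sw_closed[OF RM xy(1)]) (use xy in auto)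
	qed
	also have "... = H.sw R h (%x y. H.sw R y (%b c. ?f x*.$R ?f b*.$R ?g c))"
		by(rule H.coassoc_trilinear[OF RM _ _ h]) (auto simp: R_simps intro!: bilI linI)
	also have "... = H.sw R h (%x y. counit H y.*$R ?f x)"
	proof (rule H.sw_cong[OF RM h])
		fix x y assume xy: "x:.H" "y:.H"
		have "?f x*.$R H.sw R y (%b c. ?f b*.$R ?g c) = H.sw R y (%b c. ?f x*.$R (?f b*.$R ?g c))"
			by(rule H.sw_hom[OF RM RM _ xy(2)], rule linI) (use xy in "auto simp: R_simps")
		also have "... = H.sw R y (%b c. ?f x*.$R ?f b*.$R ?g c)"
			by(rule H.sw_cong[OF RM xy(2)]) (use xy in "auto simp: R.A.m_assoc")
		finally show "H.sw R y (%b c. ?f x*.$R ?f b*.$R ?g c) = counit H y.*$R ?f x"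
			using conv_unit[OF xy(2)] xy by(simp add: R_simps)
	qed auto
	also have "... = ?f h" by(rule counit_sw_right(1)[OF lin_act[OF R.A.one_closed] h])
	finally show ?thesis by simp
qed

lemma sg_unit_right: "h:.H==>sg h 1.$H = counit H h.*$R 1.$R"
proof -
	assume h: "h:.H"
	have "H.sw R h (%x y. act x 1.$R*.$R sg y 1.$H) = H.sw R h (%x y. counit H x.*$R sg y 1.$H)"
		by(rule H.sw_cong[OF RM h]) (auto simp: act_unit R_simps)
	also have "... = sg h 1.$H" by(rule counit_sw_right(2)[OF lin_sg(1) h]) simp
	finally show ?thesis using conv_unit[OF h] by simp
qed

lemma MM_one_left:
	assumes "a:.R" "b:.R" "g:.H"
	shows "MM a 1.$H b g = H.sw RH.TT g (%g1 g2. (a*.$R b*.$R sg 1.$H g1) # g2)"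
proof -
	have lin: "lin K H RH.TT (%h. H.sw RH.TT h (%h2 h3. H.sw RH.TT g (%g1 g2. (a*.$R act x b*.$R sg h2 g1) # (h3*.$H g2))))"
		"bil K H H RH.TT (%h2 h3. H.sw RH.TT g (%g1 g2. (a*.$R act x b*.$R sg h2 g1) # (h3*.$H g2)))"
		if x: "x:.H" for x
	proof -
		show B: "bil K H H RH.TT (%h2 h3. H.sw RH.TT g (%g1 g2. (a*.$R act x b*.$R sg h2 g1) # (h3*.$H g2)))"
			by(rule bilI_lin; rule LP[OF assms(3)], rule base_linear) (use x assms in auto)
		show "lin K H RH.TT (%h. H.sw RH.TT h (%h2 h3. H.sw RH.TT g (%g1 g2. (a*.$R act x b*.$R sg h2 g1) # (h3*.$H g2))))"
			by(rule LH[OF B])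
	qed
	have B2: "bil K H H RH.TT (%h1 h'. H.sw RH.TT h' (%h2 h3. H.sw RH.TT g (%g1 g2. (a*.$R act h1 b*.$R sg h2 g1) # (h3*.$H g2))))"
	proof (rule bilI_lin)
		show "lin K H RH.TT (%h1. H.sw RH.TT y (%h2 h3. H.sw RH.TT g (%g1 g2. (a*.$R act h1 b*.$R sg h2 g1) # (h3*.$H g2))))" if "y:.H" for y
			by(rule LP[OF that], rule LP[OF assms(3)], rule base_linear) (use assms in auto)
	qed (rule lin)
	have "MM a 1.$H b g = H.sw RH.TT g (%g1 g2. (a*.$R act 1.$H b*.$R sg 1.$H g1) # (1.$H*.$H g2))"
		unfolding MM_def sweedler3_def by(simp only: sw_one[OF AM B2] sw_one[OF AM lin(2)] H.A.one_closed)
	also have "... = H.sw RH.TT g (%g1 g2. (a*.$R b*.$R sg 1.$H g1) # g2)"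
		by(rule H.sw_cong[OF AM assms(3)]) (use assms in "auto simp: act_one RH.tn_simps")
	finally show ?thesis .
qed

text \<open>The cocycle is not assumed normalized; this half of the normalization is read off from
  the left unit law for 1 # g by means of \<open>red\<close>.\<close>

lemma sg_unit_left: "g:.H==>sg 1.$H g = counit H g.*$R 1.$R"
proof -
	assume g: "g:.H"
	have "1.$R # g = 1.$A*.$A (1.$R # g)" using g by(subst A.A.l_one) (auto simp: RH.tn_simps)
	also have "... = MM 1.$R 1.$H 1.$R g" using g by(simp add: mult_sm)
	also have "... = H.sw RH.TT g (%g1 g2. sg 1.$H g1 # g2)"
		unfolding MM_one_left[OF R.A.one_closed R.A.one_closed g] by(rule H.sw_cong[OF AM g]) (auto simp: RH.tn_simps)
	finally have e: "1.$R # g = ..." .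
	have "counit H g.*$R 1.$R = red (1.$R # g)" using g by(simp add: red_sm)
	also have "... = H.sw R g (%g1 g2. red (sg 1.$H g1 # g2))"
		unfolding e by(rule H.sw_hom[OF AM RM red_linear g]) (auto simp: RH.tn_simps)
	also have "... = H.sw R g (%g1 g2. counit H g2.*$R sg 1.$H g1)" by(rule H.sw_cong[OF RM g]) (auto simp: red_sm)
	also have "... = sg 1.$H g" by(rule counit_sw_right(1)[OF lin_sg(2) g]) simp
	finally show ?thesis by simp
qed

lemma mult_R:
	assumes "a:.R" "b:.R" "g:.H"
	shows "(a # 1.$H)*.$A (b # g) = (a*.$R b) # g"
proof -
	have "(a # 1.$H)*.$A (b # g) = H.sw RH.TT g (%g1 g2. (a*.$R b*.$R sg 1.$H g1) # g2)"
		using assms by(simp add: mult_sm MM_one_left)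
	also have "... = H.sw RH.TT g (%g1 g2. (a*.$R b) # (counit H g1.*$H g2))"
		by(rule H.sw_cong[OF AM assms(3)]) (use assms in "auto simp: sg_unit_left R_simps RH.tn_simps")
	also have "... = (a*.$R b) # H.sw H g (%g1 g2. counit H g1.*$H g2)"
		by(rule H.sw_hom[OF HM AM _ assms(3), symmetric], rule linI) (use assms in "auto simp: RH.tn_simps")
	finally show ?thesis using H.counit_left[OF assms(3)] by simp
qed

lemma mult_H_R:
	assumes "h:.H" "b:.R"
	shows "(1.$R # h)*.$A (b # 1.$H) = H.sw RH.TT h (%x y. act x b # y)"
proof -
	have B: "bil K H H RH.TT (%g1 g2. (act h1 b*.$R sg h2 g1) # (h3*.$H g2))"
		if "h1:.H" "h2:.H" "h3:.H" for h1 h2 h3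
		by(rule bilI) (use that assms in "auto simp: RH.tn_simps R_simps H.A.r_distr H.smult_mult_right")
	have "(1.$R # h)*.$A (b # 1.$H) = H.sw RH.TT h (%h1 h'. H.sw RH.TT h' (%h2 h3. act h1 b # (counit H h2.*$H h3)))"
		using assms unfolding mult_sm[OF R.A.one_closed assms(1,2) H.A.one_closed] MM_def sweedler3_def
		by(intro H.sw_cong[OF AM] H.sw_closed[OF AM]) (auto simp: sw_one[OF AM B] RH.tn_simps sg_unit_right R_simps)
	also have "... = H.sw RH.TT h (%x y. act x b # y)"
	proof (rule H.sw_cong[OF AM assms(1)])
		fix x y assume xy: "x:.H" "y:.H"
		have "H.sw RH.TT y (%h2 h3. act x b # (counit H h2.*$H h3)) = act x b # H.sw H y (%h2 h3. counit H h2.*$H h3)"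
			by(rule H.sw_hom[OF HM AM _ xy(2), symmetric], rule linI) (use xy assms in "auto simp: RH.tn_simps")
		thus "H.sw RH.TT y (%h2 h3. act x b # (counit H h2.*$H h3)) = act x b # y" using H.counit_left[OF xy(2)] by simp
	qed (use assms in "auto simp: RH.tn_simps")
	finally show ?thesis .
qed

lemma mult_H_H:
	assumes h: "h:.H" and g: "g:.H"
	shows "(1.$R # h)*.$A (1.$R # g) = H.sw RH.TT h (%x y. H.sw RH.TT g (%a b. sg x a # (y*.$H b)))"
proof -
	let ?G = "%z. H.sw RH.TT z (%x y. H.sw RH.TT g (%a b. sg x a # (y*.$H b)))"
	have inner: "H.sw RH.TT g (%a b. sg x a # (y*.$H b)):.RH.TT" if "x:.H" "y:.H" for x y
		by(rule H.sw_closed[OF AM g]) (use that in "auto simp: RH.tn_simps")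
	have Bl: "bil K H H RH.TT (%x y. H.sw RH.TT g (%a b. sg x a # (y*.$H b)))"
		by(rule bilI_lin; rule LP[OF g], rule linI)
			(auto simp: RH.tn_simps H.A.l_distr H.smult_mult_left)
	have Gl: "lin K H RH.TT ?G" by(rule LH[OF Bl])
	note GD = linD[OF Gl]
	have "(1.$R # h)*.$A (1.$R # g) = H.sw RH.TT h (%h1 h'. counit H h1.*$RH.TT ?G h')"
		unfolding mult_sm[OF R.A.one_closed h R.A.one_closed g] MM_def sweedler3_def
	proof (rule H.sw_cong[OF AM h])
		fix h1 h' assume hh: "h1:.H" "h':.H"
		have lm: "lin K RH.TT RH.TT (%z. counit H h1.*$RH.TT z)"
			by(rule linI) (use hh in "auto simp: RH.TT.smult_r_distr RH.TT.smult_assoc1[symmetric] H.K.m_comm")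
		have "counit H h1.*$RH.TT ?G h' = H.sw RH.TT h' (%x y. counit H h1.*$RH.TT H.sw RH.TT g (%a b. sg x a # (y*.$H b)))"
			by(rule H.sw_hom[OF AM AM lm hh(2) inner])
		also have "... = H.sw RH.TT h' (%x y. H.sw RH.TT g (%a b. (1.$R*.$R act h1 1.$R*.$R sg x a) # (y*.$H b)))"
		proof (rule H.sw_cong[OF AM hh(2)])
			fix x y assume xy: "x:.H" "y:.H"
			have "counit H h1.*$RH.TT H.sw RH.TT g (%a b. sg x a # (y*.$H b)) = H.sw RH.TT g (%a b. counit H h1.*$RH.TT (sg x a # (y*.$H b)))"
				by(rule H.sw_hom[OF AM AM lm g]) (use xy in "auto simp: RH.tn_simps")
			also have "... = H.sw RH.TT g (%a b. (1.$R*.$R act h1 1.$R*.$R sg x a) # (y*.$H b))"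
				by(rule H.sw_cong[OF AM g]) (use xy hh in "auto simp: RH.tn_simps act_unit R_simps")
			finally show "counit H h1.*$RH.TT H.sw RH.TT g (%a b. sg x a # (y*.$H b)) = ..." .
			show "H.sw RH.TT g (%a b. (1.$R*.$R act h1 1.$R*.$R sg x a) # (y*.$H b)):.RH.TT"
				by(rule H.sw_closed[OF AM g]) (use xy hh in "auto simp: RH.tn_simps")
		qed
		finally show "H.sw RH.TT h' (%x y. H.sw RH.TT g (%a b. (1.$R*.$R act h1 1.$R*.$R sg x a) # (y*.$H b))) = counit H h1.*$RH.TT ?G h'" by simp
		show "counit H h1.*$RH.TT ?G h':.RH.TT" using hh GD(1) by simp
	qed
	also have "... = H.sw RH.TT h (%h1 h'. ?G (counit H h1.*$H h'))" by(rule H.sw_cong[OF AM h]) (use GD in auto)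
	also have "... = ?G (H.sw H h (%h1 h'. counit H h1.*$H h'))" by(rule H.sw_hom[OF HM AM Gl h, symmetric]) auto
	finally show ?thesis using H.counit_left[OF h] by simp
qed

end

section \<open>Base change of a crossed product\<close>

lemma (in abelian_monoid) finsum_cong2:
	assumes "!!a b. a:I==>b:J==>f a b = g a b" "!!a b. a:I==>b:J==>g a b:.G"
	shows "(+/a:I. +/b:J. f a b) = (+/a:I. +/b:J. g a b)"
	by(intro finsum_cong'[OF refl]) (use assms in "auto intro!: finsum_closed")

lemma (in algebra_pair) finsum_TA: "finsum TA f J = finsum TT f J" by(simp add: finsum_def)

context base_change
begin

lemma F_one: "1.$F:.F" and io_closed: "c:.K==>io c:.F" by auto

lemma scal_tn: "k:.K==>x:.A==>c:.F==>scal (io k)*.$TA tn x c = tn (k.*$A x) c"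
	by(simp add: scal_def mult_pure' tn_simps')

lemma tn_linear_left: "c:.F==>lin K A TT (%x. tn x c)" by(rule linI) (auto simp: tn_simps(1-3))

lemma tn_expand:
	assumes "finite J" "!!a. a:J==>f a:.A" "!!a. a:J==>k a:.K" "c:.F"
	shows "tn (+/$A a:J. k a.*$A f a) c = (+/$TT a:J. scal (io (k a))*.$TA tn (f a) c)"
proof -
	have "tn (+/$A a:J. k a.*$A f a) c = (+/$TT a:J. tn (k a.*$A f a) c)"
		by(rule lin_finsum[OF VWK(2) TT.module_axioms tn_linear_left[OF assms(4)] assms(1)]) (use assms in auto)
	also have "... = (+/$TT a:J. scal (io (k a))*.$TA tn (f a) c)"
		by(rule TT.finsum_cong'[OF refl]) (use assms scal_tn tn_simps' in auto)
	finally show ?thesis .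
qed

lemma tn_expand2:
	assumes "finite J" "!!a b. a:J==>b:J==>f a b:.A" "!!a b. a:J==>b:J==>k a b:.K" "c:.F"
	shows "tn (+/$A a:J. +/$A b:J. k a b.*$A f a b) c = (+/$TT a:J. +/$TT b:J. scal (io (k a b))*.$TA tn (f a b) c)"
proof -
	note fc = abelian_monoid.finsum_closed[OF abelian_group.axioms(1)[OF module.axioms(2)[OF VWK(2)]]]
	have "tn (+/$A a:J. +/$A b:J. k a b.*$A f a b) c = (+/$TT a:J. tn (+/$A b:J. k a b.*$A f a b) c)"
		by(rule lin_finsum[OF VWK(2) TT.module_axioms tn_linear_left[OF assms(4)] assms(1)]) (use assms in "auto intro!: fc")
	also have "... = (+/$TT a:J. +/$TT b:J. scal (io (k a b))*.$TA tn (f a b) c)"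
		by(rule TT.finsum_cong'[OF refl _ tn_expand]) (use assms scal_tn tn_simps' in "auto intro!: TT.finsum_closed")
	finally show ?thesis .
qed

text \<open>A functional vanishing on \<open>N\<close> but not at \<open>x\<close> extends to \<open>A \<otimes> F\<close>.\<close>

lemma incl_in_image:
	assumes N: "submodule N K A" and x: "x:.A"
	shows "incl x:tensor_image K A EF N (car F) \<longleftrightarrow> x:N"
proof
	assume "x:N"
	thus "incl x:tensor_image K A EF N (car F)"
		unfolding tensor_image_def incl_def by(intro subsetD[OF subspace_span_superset]) auto
next
	assume xi: "incl x:tensor_image K A EF N (car F)"
	show "x:N"
	proof (rule ccontr)
		assume "x ~: N"
		then obtain f where f: "lin K A (scalars K) f" "ALL n:N. f n = 0.$K" "f x = 1.$K"
			using exists_functional[OF VWK(1) VWK(2) N x] by blast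
		note fD = linD[OF f(1)]
		have B: "bil K A EF EF (%a c. io (f a)*.$F c)"
			by(rule bilI) (use fD in "auto simp: F.l_distr F.r_distr F.m_ac")
		note EM = VWK(3)
		let ?g = "tensor_lift K EF (%a c. io (f a)*.$F c)"
		have g: "lin K TT EF ?g" by(rule lift_linear[OF EM B])
		have gt: "?g (tn a c) = io (f a)*.$F c" if "a:.A" "c:.F" for a c
			by(rule lift_tn[OF EM B]) (use that in auto)
		have NA: "a:.A" if "a:N" for a using module.submoduleE(1)[OF VWK(2) N] that by blast
		have "tensor_image K A EF N (car F) <= {w:car TT. ?g w = 0.$EF}"
			unfolding tensor_image_def
		proof (rule subspace_span_least[OF linear_map_kernel[OF TT.module_axioms EM g]], rule subsetI)
			fix v assume "v:{tn a c |a c. a:N & c:.F}"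
			then obtain a c where ac: "v = tn a c" "a:N" "c:.F" by blast
			have "f a = 0.$K" using f(2) ac(2) by blast
			thus "v:{w:car TT. ?g w = 0.$EF}" using gt[OF NA[OF ac(2)] ac(3)] tn_simps'(1)[OF NA[OF ac(2)] ac(3)] ac by simp
		qed
		hence "?g (incl x) = 0.$F" using subsetD[OF _ xi] by auto
		moreover have "?g (incl x) = 1.$F" using gt[OF x F_one] f(3) by(simp add: incl_def)
		ultimately show False by simp
	qed
qed

end

definition base_map where
	"base_map K V' EE f = tensor_lift K (tensor_space K V' EE) (%x c. tensor K V' EE (f x) c)"

lemma base_map:
	assumes "field K" "module K V" "module K V'" "module K EE" "lin K V V' f"
	shows "lin K (tensor_space K V EE) (tensor_space K V' EE) (base_map K V' EE f)"
		"x:.V==>c:.EE==>base_map K V' EE f (tensor K V EE x c) = tensor K V' EE (f x) c"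
proof -
	interpret V: vs_pair K V EE by(intro vs_pair.intro assms)
	interpret V': vs_pair K V' EE by(intro vs_pair.intro assms)
	have B: "bil K V EE V'.TT (%x c. V'.tn (f x) c)"
		by(rule bilI) (use linD[OF assms(5)] in "auto simp: V'.tn_simps")
	show "lin K V.TT V'.TT (base_map K V' EE f)" unfolding base_map_def by(rule V.lift_linear[OF V'.TT.module_axioms B])
	show "x:.V==>c:.EE==>base_map K V' EE f (V.tn x c) = V'.tn (f x) c"
		unfolding base_map_def by(rule V.lift_tn[OF V'.TT.module_axioms B])
qed

section \<open>The crossed product over the extension field\<close>

locale crossed_product_base_change = crossed_product_algebra K H R act sg I e du t l ta + F: field F
	for K :: "('k, 'n) ring_scheme" (structure) and H :: "('k, 'h, 'm) hopf_algebra_scheme" (structure)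
		and R :: "('k, 'r, 'p) module_scheme" (structure) and act sg and I :: "'i set" and e du t l ta
		and F :: "('f, 'q) ring_scheme" +
	fixes io :: "'k => 'f"
	assumes ioF: "io:ring_hom K F"
begin

sublocale BR: base_change K R F io
	by(intro base_change.intro base_change_axioms.intro R.assoc_algebra_axioms F.field_axioms ioF)

sublocale BA: base_change K A F io
	by(intro base_change.intro base_change_axioms.intro A.assoc_algebra_axioms F.field_axioms ioF)

abbreviation "EF \<equiv> ext_algebra F io"

lemmas EM = BR.VWK(3)
lemmas AAM = BA.VWK(2)

lemma A_finsum: "finsum A f J = finsum RH.TT f J" by(simp add: finsum_def)

lemma A_linear: "lin K Z A f = lin K Z RH.TT f" "lin K A Z' g = lin K RH.TT Z' g"
	by(simp_all add: linear_map_def)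

lemma sm_closed[simp]: "r:.R==>h:.H==>r # h:.RH.TT" by(rule RH.tn_simps)

definition cd :: "'i => ('r \<times> 'h => 'k) set => 'r"
	where "cd i = tensor_lift K R (%r h. du i h.*$R r)"

lemma cd_bilinear: "i:I==>bil K R H R (%r h. du i h.*$R r)"
	by(rule bilI) (auto simp: R.smult_l_distr R.smult_r_distr R.smult_assoc1[symmetric] H.K.m_comm)

lemma cd_linear: "i:I==>lin K RH.TT R (cd i)" unfolding cd_def by(rule RH.lift_linear[OF RM cd_bilinear])
lemma cd_sm: "i:I==>r:.R==>h:.H==>cd i (r # h) = du i h.*$R r"
	unfolding cd_def by(rule RH.lift_tn[OF RM cd_bilinear])
lemma cd_closed[simp]: "i:I==>x:.RH.TT==>cd i x:.R" using linD(1)[OF cd_linear] .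

lemma sm_linear: "h:.H==>lin K R RH.TT (%r. r # h)" "r:.R==>lin K H RH.TT (%h. r # h)"
	by(rule linI; simp add: RH.tn_simps)+

lemma cd_expand:
	assumes x: "x:.RH.TT"
	shows "x = (+/$RH.TT i:I. cd i x # e i)"
proof (rule RH.tensor_eqI[OF AM _ _ _ x])
	show "lin K RH.TT RH.TT (%x. x)" by(rule linI) auto
	show "lin K RH.TT RH.TT (%x. +/$RH.TT i:I. cd i x # e i)"
		by(rule linear_map_sum[OF AM AM Hb.fin], rule lin_comp[OF cd_linear sm_linear(1)]) auto
	fix r h assume rh: "r:.R" "h:.H"
	have "r # h = (+/$RH.TT i:I. du i h.*$RH.TT (r # e i))" by(rule Hb.lin[OF AM sm_linear(2)[OF rh(1)] rh(2)])
	also have "... = (+/$RH.TT i:I. cd i (r # h) # e i)"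
		by(rule RH.TT.finsum_cong'[OF refl]) (use rh in "auto simp: cd_sm RH.tn_simps")
	finally show "r # h = ..." .
qed

text \<open>With the five definitions that follow, the data required by
  \<open>hopf_crossed_product\<close>: the inclusion of \<open>R\<close> into the crossed product,
  its coordinates, the action of basis elements, the elements 1 # e i, the cocycle and its inverse,
  all extended to \<open>F\<close>.\<close>

definition jj where "jj = base_map K A EF (%r. r # 1.$H)"
definition PP where "PP i = base_map K R EF (cd i)"
definition EE where "EE i = base_map K R EF (act (e i))"
definition WW where "WW i = BA.tn (1.$R # e i) 1.$F"
definition s0 where "s0 i k = BR.tn (sg (e i) (e k)) 1.$F"
definition t0 where "t0 i k = BR.tn (ta (e i) (e k)) 1.$F"

lemma jj_linear: "lin K BR.TT BA.TT jj" unfolding jj_def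
	by(rule base_map[OF fieldK RM AAM EM]) (simp add: A_linear sm_linear)
lemma jj_tn: "r:.R==>c:.F==>jj (BR.tn r c) = BA.tn (r # 1.$H) c" unfolding jj_def
	by(rule base_map(2)[OF fieldK RM AAM EM]) (auto simp: A_linear sm_linear)
lemma PP_linear: "i:I==>lin K BA.TT BR.TT (PP i)" unfolding PP_def
	by(rule base_map[OF fieldK AAM RM EM]) (simp add: A_linear cd_linear)
lemma PP_tn: "i:I==>x:.RH.TT==>c:.F==>PP i (BA.tn x c) = BR.tn (cd i x) c" unfolding PP_def
	by(rule base_map(2)[OF fieldK AAM RM EM]) (auto simp: A_linear cd_linear)
lemma EE_linear: "i:I==>lin K BR.TT BR.TT (EE i)" unfolding EE_def
	by(rule base_map[OF fieldK RM RM EM], rule linI) auto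
lemma EE_tn: "i:I==>r:.R==>c:.F==>EE i (BR.tn r c) = BR.tn (act (e i) r) c" unfolding EE_def
	by(rule base_map(2)[OF fieldK RM RM EM], rule linI) auto

lemma BR_tn_closed[simp]: "r:.R==>c:.F==>BR.tn r c:.BR.TT" by(rule BR.tn_simps')
lemma BA_tn_closed[simp]: "x:.RH.TT==>c:.F==>BA.tn x c:.BA.TT" using BA.tn_simps'(1) by simp

lemma BA_mult: "x:.RH.TT==>y:.RH.TT==>b:.F==>c:.F ==>
		BA.tn x b*.$BA.TA BA.tn y c = BA.tn (x*.$A y) (b*.$F c)"
	using BA.mult_pure' by simp

lemma A_mult_closed[simp]: "x:.RH.TT==>y:.RH.TT==>x*.$A y:.RH.TT"
	using A.A.m_closed by simp

lemma WW_closed[simp]: "i:I==>WW i:.BA.TT" by(simp add: WW_def)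

lemma jz: "c:.F==>jj (BR.scal c) = BA.scal c" by(simp add: BR.scal_def BA.scal_def jj_tn)

lemma BA_scal_closed[simp]: "c:.F==>BA.scal c:.BA.TT" by(simp add: BA.scal_def)
lemma BR_scal_closed[simp]: "c:.F==>BR.scal c:.BR.TT" by(simp add: BR.scal_def)

lemmas BATM = BA.TT.module_axioms and BRTM = BR.TT.module_axioms

lemma jj_hom: "jj:ring_hom BR.TA BA.TA"
proof (rule ring_hom_memI)
	fix x y assume xy: "x:.BR.TA" "y:.BR.TA"
	show "jj x:.BA.TA" using linD(1)[OF jj_linear] xy by simp
	show "jj (x+.$BR.TA y) = jj x+.$BA.TA jj y" using linD(2)[OF jj_linear] xy by simp
	have xy': "x:.BR.TT" "y:.BR.TT" using xy by auto
	note jc = linD(1)[OF jj_linear]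
	have 1: "jj (BR.tn r c*.$BR.TA y) = jj (BR.tn r c)*.$BA.TA jj y" if "r:.R" "c:.F" for r c
	proof (rule BR.tensor_eqI[OF BATM lin_comp[OF BR.mult_linr jj_linear] lin_comp[OF jj_linear BA.mult_linr] _ xy'(2)])
		fix s b assume sb: "s:.R" "b:.EF"
		hence b: "b:.F" by simp
		show "jj (BR.tn r c*.$BR.TA BR.tn s b) = jj (BR.tn r c)*.$BA.TA jj (BR.tn s b)"
			using that sb(1) b by(simp add: BR.mult_pure' jj_tn BA_mult mult_R)
	qed (use that jc in auto)
	show "jj (x*.$BR.TA y) = jj x*.$BA.TA jj y"
		by(rule BR.tensor_eqI[OF BATM lin_comp[OF BR.mult_linl jj_linear] lin_comp[OF jj_linear BA.mult_linl] _ xy'(1)])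
			(use xy' jc 1 in auto)
qed (simp add: jj_tn)

lemma SQ: "scalar_ring F BR.TA I BR.scal"
	by(intro scalar_ring.intro scalar_ring_axioms.intro F.field_axioms BR.TA.ring_axioms Hb.fin BR.scal_hom)
		(simp add: BR.scal_central)

lemma SB: "scalar_ring F BA.TA I (%c. jj (BR.scal c))"
proof (intro scalar_ring.intro scalar_ring_axioms.intro F.field_axioms BA.TA.ring_axioms Hb.fin)
	show "(%c. jj (BR.scal c)):ring_hom F BA.TA"
		using ring_hom_trans[OF BR.scal_hom jj_hom] by(simp add: comp_def)
qed (simp add: jz BA.scal_central)

lemma BR_coef: "k:.K==>io k:.F" by(rule BR.io_closed)

lemma sm_mult: "r:.R==>h:.H==>(r # 1.$H)*.$A (1.$R # h) = r # h" by(simp add: mult_R)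

lemma WW_jj:
	assumes i: "i:I" and s: "s:.BR.TT"
	shows "WW i*.$BA.TA jj s = (+/$BA.TT a:I. +/$BA.TT b:I. BA.scal (io (Hb.dc i a b))*.$BA.TA (jj (EE a s)*.$BA.TA WW b))"
proof (rule BR.tensor_eqI[OF BATM _ _ _ s])
	show "lin K BR.TT BA.TT (%s. WW i*.$BA.TA jj s)" by(rule lin_comp[OF jj_linear BA.mult_linr]) (use i in auto)
	show "lin K BR.TT BA.TT (%s. +/$BA.TT a:I. +/$BA.TT b:I. BA.scal (io (Hb.dc i a b))*.$BA.TA (jj (EE a s)*.$BA.TA WW b))"
		by(intro linear_map_sum[OF BRTM BATM Hb.fin] lin_comp[OF _ BA.mult_linr] lin_comp[OF _ BA.mult_linl]
				lin_comp[OF EE_linear jj_linear]) (use i BR_coef in auto)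
	fix r c assume rc: "r:.R" "c:.EF"
	hence c: "c:.F" by simp
	have B: "bil K H H RH.TT (%x y. act x r # y)" by(rule bilI) (use rc in "auto simp: RH.tn_simps")
	have "WW i*.$BA.TA jj (BR.tn r c) = BA.tn ((1.$R # e i)*.$A (r # 1.$H)) c"
		using i rc(1) c by(simp add: WW_def jj_tn BA_mult)
	also have "(1.$R # e i)*.$A (r # 1.$H) = (+/$A a:I. +/$A b:I. Hb.dc i a b.*$A (act (e a) r # e b))"
		using i rc(1) by(simp add: mult_H_R Hb.sw_expand[OF AM B] Hb.dc_def A_finsum)
	also have "BA.tn ... c = (+/$BA.TT a:I. +/$BA.TT b:I. BA.scal (io (Hb.dc i a b))*.$BA.TA BA.tn (act (e a) r # e b) c)"
		by(rule BA.tn_expand2[OF Hb.fin _ _ c]) (use i rc(1) in auto)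
	also have "... = (+/$BA.TT a:I. +/$BA.TT b:I. BA.scal (io (Hb.dc i a b))*.$BA.TA (jj (EE a (BR.tn r c))*.$BA.TA WW b))"
		by(intro BA.TT.finsum_cong'[OF refl])
			(use i rc(1) c BR_coef in "auto simp: EE_tn jj_tn WW_def BA_mult sm_mult intro!: BA.TT.finsum_closed BA.mult_closed")
	finally show "WW i*.$BA.TA jj (BR.tn r c) = ..." .
qed

lemma WW_comb:
	assumes h: "h:.H"
	shows "(+/$BA.TT n:I. BA.scal (io (du n h))*.$BA.TA WW n) = BA.tn (1.$R # h) 1.$F"
proof -
	have "1.$R # h = (+/$A n:I. du n h.*$A (1.$R # e n))"
		using Hb.lin[OF AM sm_linear(2)[OF R.A.one_closed] h] by(simp add: A_finsum)
	hence "BA.tn (1.$R # h) 1.$F = BA.tn (+/$A n:I. du n h.*$A (1.$R # e n)) 1.$F" by simp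
	also have "... = (+/$BA.TT n:I. BA.scal (io (du n h))*.$BA.TA BA.tn (1.$R # e n) 1.$F)"
		by(rule BA.tn_expand[OF Hb.fin]) (use h in auto)
	finally show ?thesis by(simp add: WW_def)
qed

lemma WW_WW:
	assumes i: "i:I" and k: "k:I"
	shows "WW i*.$BA.TA WW k = (+/$BA.TT a:I. +/$BA.TT b:I. BA.scal (io (Hb.dc i a b))*.$BA.TA
		(+/$BA.TT c:I. +/$BA.TT f:I. BA.scal (io (Hb.dc k c f))*.$BA.TA
			(jj (s0 a c)*.$BA.TA (+/$BA.TT n:I. BA.scal (io (Hb.mc b f n))*.$BA.TA WW n))))"
proof -
	let ?Y = "%a b. +/$BA.TT c:I. +/$BA.TT f:I. BA.scal (io (Hb.dc k c f))*.$BA.TA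
			(jj (s0 a c)*.$BA.TA (+/$BA.TT n:I. BA.scal (io (Hb.mc b f n))*.$BA.TA WW n))"
	have B1: "bil K H H RH.TT (%c f. sg x c # (y*.$H f))" if "x:.H" "y:.H" for x y
		by(rule bilI) (use that in "auto simp: RH.tn_simps H.A.r_distr H.smult_mult_right")
	have B2: "bil K H H RH.TT (%x y. H.sw RH.TT g (%c f. sg x c # (y*.$H f)))" if "g:.H" for g
		by(rule bilI_lin; rule LP[OF that], rule linI)
			(auto simp: RH.tn_simps H.A.l_distr H.smult_mult_left)
	let ?X = "%a b. +/$A c:I. +/$A f:I. Hb.dc k c f.*$A (sg (e a) (e c) # (e b*.$H e f))"
	have X: "?X a b = H.sw RH.TT (e k) (%c f. sg (e a) c # (e b*.$H f))" if "a:I" "b:I" for a b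
		using Hb.sw_expand[OF AM B1 Hb.e_closed[OF k]] that by(simp add: Hb.dc_def A_finsum)
	have Xc: "?X a b:.A" if "a:I" "b:I" for a b
		unfolding X[OF that] using that k by(simp, intro H.sw_closed[OF AM]) auto
	have t1: "BA.tn (?X a b) 1.$F = ?Y a b" if ab: "a:I" "b:I" for a b
	proof -
		have "BA.tn (?X a b) 1.$F = (+/$BA.TT c:I. +/$BA.TT f:I. BA.scal (io (Hb.dc k c f))*.$BA.TA BA.tn (sg (e a) (e c) # (e b*.$H e f)) 1.$F)"
			by(rule BA.tn_expand2[OF Hb.fin]) (use ab k in auto)
		also have "... = (+/$BA.TT c:I. +/$BA.TT f:I. BA.scal (io (Hb.dc k c f))*.$BA.TA
				(jj (s0 a c)*.$BA.TA BA.tn (1.$R # (e b*.$H e f)) 1.$F))" by(intro BA.TT.finsum_cong'[OF refl])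
				(use ab k BR_coef in "auto simp: s0_def jj_tn BA_mult sm_mult intro!: BA.TT.finsum_closed BA.mult_closed")
		also have "... = ?Y a b"
		proof -
			have "BA.tn (1.$R # (e b*.$H e f)) 1.$F = (+/$BA.TT n:I. BA.scal (io (Hb.mc b f n))*.$BA.TA WW n)" if "f:I" for f
				using WW_comb[of "e b*.$H e f"] ab that by(simp add: Hb.mc_def)
			moreover have "jj (s0 a c):.BA.TT" if "c:I" for c using linD(1)[OF jj_linear] ab that by(simp add: s0_def)
			moreover have "(+/$BA.TT n:I. BA.scal (io (Hb.mc b f n))*.$BA.TA WW n):.BA.TT" if "f:I" for f
				using that ab BR_coef by(auto intro!: BA.TT.finsum_closed BA.mult_closed)
			ultimately show ?thesis
				by(intro BA.TT.finsum_cong'[OF refl]) (use ab k BR_coef in "auto intro!: BA.TT.finsum_closed BA.mult_closed")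
		qed
		finally show ?thesis .
	qed
	have Yc: "?Y a b:.BA.TT" if "a:I" "b:I" for a b
		using BA.tn_simps'(1)[OF Xc[OF that] BR.F_one] unfolding t1[OF that] .
	have "WW i*.$BA.TA WW k = BA.tn ((1.$R # e i)*.$A (1.$R # e k)) 1.$F"
		using i k by(simp add: WW_def BA_mult)
	also have "(1.$R # e i)*.$A (1.$R # e k) = (+/$A a:I. +/$A b:I. Hb.dc i a b.*$A ?X a b)"
	proof -
		have "(1.$R # e i)*.$A (1.$R # e k) = (+/$A a:I. +/$A b:I. Hb.dc i a b.*$A H.sw RH.TT (e k) (%c f. sg (e a) c # (e b*.$H f)))"
			using i k by(simp add: mult_H_H Hb.sw_expand[OF AM B2] Hb.dc_def A_finsum)
		also have "... = (+/$A a:I. +/$A b:I. Hb.dc i a b.*$A ?X a b)"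
		proof -
			have "H.sw RH.TT (e k) (%c f. sg (e a) c # (e b*.$H f)):.RH.TT" if "a:I" "b:I" for a b
				using Xc[OF that] unfolding X[OF that] by simp
			thus ?thesis unfolding A_finsum A_simps(4)
				by(intro RH.TT.finsum_cong2) (use i X[unfolded A_finsum A_simps(4)] in auto)
		qed
		finally show ?thesis .
	qed
	also have "BA.tn ... 1.$F = (+/$BA.TT a:I. +/$BA.TT b:I. BA.scal (io (Hb.dc i a b))*.$BA.TA BA.tn (?X a b) 1.$F)"
		by(rule BA.tn_expand2[OF Hb.fin Xc]) (use i in auto)
	also have "... = (+/$BA.TT a:I. +/$BA.TT b:I. BA.scal (io (Hb.dc i a b))*.$BA.TA
		?Y a b)" by(rule BA.TT.finsum_cong2, simp only: t1, rule BA.mult_closed[OF _ Yc]) (use i BR_coef in auto)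
	finally show ?thesis .
qed

text \<open>Stated for two maps \<open>f\<close> and \<open>g\<close> so that it serves both orders
  of the cocycle and its convolution inverse.\<close>

lemma cocycle_inverse:
	assumes f: "bil K H H R f" "bil K H H R g"
		and fg: "!!h k. h:.H==>k:.H ==>
			H.sw R h (%a b. H.sw R k (%c d. f a c*.$R g b d)) = (counit H h*.$K counit H k).*$R 1.$R"
		and i: "i:I" and k: "k:I"
	shows "(+/$BR.TT a:I. +/$BR.TT b:I. BR.scal (io (Hb.dc i a b))*.$BR.TA
		(+/$BR.TT c:I. +/$BR.TT d:I. BR.scal (io (Hb.dc k c d))*.$BR.TA (BR.tn (f (e a) (e c)) 1.$F*.$BR.TA BR.tn (g (e b) (e d)) 1.$F))) =
		BR.scal (io (Hb.epc i)*.$F io (Hb.epc k))"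
proof -
	let ?Y = "%a b. +/$BR.TT c:I. +/$BR.TT d:I. BR.scal (io (Hb.dc k c d))*.$BR.TA
			(BR.tn (f (e a) (e c)) 1.$F*.$BR.TA BR.tn (g (e b) (e d)) 1.$F)"
	note fD = bilD[OF f(1)] and gD = bilD[OF f(2)]
	have B1: "bil K H H R (%c d. f x c*.$R g y d)" if "x:.H" "y:.H" for x y
		by(rule bilI) (use that in "auto simp: fD gD R_simps")
	have B2: "bil K H H R (%x y. H.sw R z (%c d. f x c*.$R g y d))" if "z:.H" for z
		by(rule bilI_lin; rule H.sw_linear_param[OF RM that], rule linI) (auto simp: fD gD R_simps)
	let ?X = "%a b. +/$R c:I. +/$R d:I. Hb.dc k c d.*$R (f (e a) (e c)*.$R g (e b) (e d))"
	have X: "?X a b = H.sw R (e k) (%c d. f (e a) c*.$R g (e b) d)" if "a:I" "b:I" for a b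
		using Hb.sw_expand[OF RM B1 Hb.e_closed[OF k]] that by(simp add: Hb.dc_def)
	have Xc: "?X a b:.R" if "a:I" "b:I" for a b
		unfolding X[OF that] by(rule H.sw_closed[OF RM]) (use that k fD gD in auto)
	have t1: "BR.tn (?X a b) 1.$F = ?Y a b" if ab: "a:I" "b:I" for a b
	proof -
		have "BR.tn (?X a b) 1.$F = (+/$BR.TT c:I. +/$BR.TT d:I. BR.scal (io (Hb.dc k c d))*.$BR.TA BR.tn (f (e a) (e c)*.$R g (e b) (e d)) 1.$F)"
			by(rule BR.tn_expand2[OF Hb.fin]) (use ab k fD gD in auto)
		also have "... = ?Y a b" by(intro BR.TT.finsum_cong'[OF refl])
				(use ab k BR_coef fD gD in "auto simp: BR.mult_pure' intro!: BR.TT.finsum_closed BR.mult_closed")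
		finally show ?thesis .
	qed
	have Yc: "?Y a b:.BR.TT" if "a:I" "b:I" for a b
		using BR_tn_closed[OF Xc[OF that] BR.F_one] unfolding t1[OF that] .
	have "(+/$R a:I. +/$R b:I. Hb.dc i a b.*$R ?X a b) = H.sw R (e i) (%a b. H.sw R (e k) (%c d. f a c*.$R g b d))"
	proof -
		have "H.sw R (e i) (%a b. H.sw R (e k) (%c d. f a c*.$R g b d)) = (+/$R a:I. +/$R b:I. Hb.dc i a b.*$R H.sw R (e k) (%c d. f (e a) c*.$R g (e b) d))"
			using i k by(simp add: Hb.sw_expand[OF RM B2] Hb.dc_def)
		also have "... = (+/$R a:I. +/$R b:I. Hb.dc i a b.*$R ?X a b)"
			by(rule abelian_monoid.finsum_cong2[OF abelian_group.axioms(1)[OF module.axioms(2)[OF RM]], symmetric]) (use i k Xc X in auto)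
		finally show ?thesis by simp
	qed
	also have "... = (Hb.epc i*.$K Hb.epc k).*$R 1.$R" using fg i k by(simp add: Hb.epc_def)
	finally have s: "(+/$R a:I. +/$R b:I. Hb.dc i a b.*$R ?X a b) = ..." .
	have "BR.tn (+/$R a:I. +/$R b:I. Hb.dc i a b.*$R ?X a b) 1.$F = (+/$BR.TT a:I. +/$BR.TT b:I. BR.scal (io (Hb.dc i a b))*.$BR.TA BR.tn (?X a b) 1.$F)"
		by(rule BR.tn_expand2[OF Hb.fin Xc]) (use i in auto)
	also have "... = (+/$BR.TT a:I. +/$BR.TT b:I. BR.scal (io (Hb.dc i a b))*.$BR.TA
		?Y a b)" by(rule BR.TT.finsum_cong2, simp only: t1, rule BR.mult_closed[OF _ Yc]) (use i BR_coef in auto)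
	finally show ?thesis unfolding s using i k BR.scal_tn[of "Hb.epc i*.$K Hb.epc k" "1.$R" "1.$F"] BR.mult_one(2)[of "BR.scal (io (Hb.epc i*.$K Hb.epc k))"]
			BR_coef[of "Hb.epc i*.$K Hb.epc k"] by simp
qed

text \<open>The identities are linear in each tensor that occurs, so they are checked on pure
  tensors, where they are the multiplication rules of the crossed product over \<open>K\<close>
  expanded in the basis of \<open>H\<close>.\<close>

theorem hopf_crossed_product_base_change:
	"hopf_crossed_product F I (%i j k. io (Hb.mc i j k)) (%i j k. io (Hb.dc i j k)) (%i j. io (Hb.Sc i j)) (%i. io (Hb.uc i))
		(%i. io (Hb.epc i)) (%i. io (Hb.tc i)) (%i. io (Hb.lc i)) BR.TA BA.TA BR.scal jj WW PP EE s0 t0"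
proof -
	interpret SQ: scalar_ring F BR.TA I BR.scal by(rule SQ)
	interpret SB: scalar_ring F BA.TA I "%c. jj (BR.scal c)" by(rule SB)
	have evQ: "SQ.ev2 (%a b. io (q a b)) f = (+/$BR.TT a:I. +/$BR.TT b:I. BR.scal (io (q a b))*.$BR.TA f a b)" for q f
		by(simp add: SQ.ev2_def BR.finsum_TA)
	have evB: "SB.ev2 (%a b. io (q a b)) f = (+/$BA.TT a:I. +/$BA.TT b:I. jj (BR.scal (io (q a b)))*.$BA.TA f a b)" for q f
		by(simp add: SB.ev2_def BA.finsum_TA)
	have jzd: "jj (BR.scal (io (Hb.dc i a b))) = BA.scal (io (Hb.dc i a b))" "jj (BR.scal (io (Hb.mc i a b))) = BA.scal (io (Hb.mc i a b))"
		if "i:I" "a:I" "b:I" for i a b using that jz BR_coef by auto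
	note jc = linD(1)[OF jj_linear] and s0c = BR_tn_closed[OF _ BR.F_one]
	have cong2: "(+/$BA.TT a:I. +/$BA.TT b:I. f a b) = (+/$BA.TT a:I. +/$BA.TT b:I. g a b)"
		if "!!a b. a:I==>b:I==>f a b = g a b" "!!a b. a:I==>b:I==>g a b:.BA.TT" for f g
		by(intro BA.TT.finsum_cong'[OF refl]) (use that in "auto intro!: BA.TT.finsum_closed")
	have sum2c: "(+/$BA.TT a:I. +/$BA.TT b:I. g a b):.BA.TT" if "!!a b. a:I==>b:I==>g a b:.BA.TT" for g
		using that by(auto intro!: BA.TT.finsum_closed)
	show ?thesis
	proof (intro hopf_crossed_product.intro hopf_crossed_product_axioms.intro)
		show "hopf_constants F I (%i j k. io (Hb.mc i j k)) (%i j k. io (Hb.dc i j k)) (%i j. io (Hb.Sc i j)) (%i. io (Hb.uc i))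
			(%i. io (Hb.epc i)) (%i. io (Hb.tc i)) (%i. io (Hb.lc i))"
			by(rule hopf_constants_hom[OF Hb.constants F.field_axioms ioF])
		show "scalar_ring F BR.TA I BR.scal" by(rule SQ)
		show "scalar_ring F BA.TA I (%c. jj (BR.scal c))" by(rule SB)
		show "jj:ring_hom BR.TA BA.TA" by(rule jj_hom)
		show "ring BR.TA" "ring BA.TA" by(rule BR.TA.ring_axioms BA.TA.ring_axioms)+
		fix i assume i: "i:I"
		show "WW i:.BA.TA" using i by simp
		show "PP i x:.BR.TA" if "x:.BA.TA" for x using linD(1)[OF PP_linear[OF i]] that by simp
		show "PP i (x+.$BA.TA y) = PP i x+.$BR.TA PP i y" if "x:.BA.TA" "y:.BA.TA" for x y
			using linD(2)[OF PP_linear[OF i]] that by simp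
		show "EE i s:.BR.TA" if "s:.BR.TA" for s using linD(1)[OF EE_linear[OF i]] that by simp
		show "WW i*.$BA.TA jj s = SB.ev2 (%j k. io (Hb.dc i j k)) (%a b. jj (EE a s)*.$BA.TA WW b)" if s: "s:.BR.TA" for s
		proof -
			have s': "s:.BR.TT" using s by simp
			show ?thesis unfolding WW_jj[OF i s'] evB
				by(rule cong2) (use i s' jzd jc linD(1)[OF EE_linear] BR_coef in "auto intro!: BA.mult_closed")
		qed
		fix k assume k: "k:I"
		show "s0 i k:.BR.TA" "t0 i k:.BR.TA" using i k by(auto simp: s0_def t0_def)
		show "PP i (jj s*.$BA.TA WW k) = (if k = i then s else 0.$BR.TA)" if s: "s:.BR.TA" for s
		proof -
			have s': "s:.BR.TT" using s by simp
			have "PP i (jj s*.$BA.TA WW k) = (if k = i then 1.$K else 0.$K).*$BR.TT s"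
			proof (rule BR.tensor_eqI[OF BRTM _ _ _ s'])
				show "lin K BR.TT BR.TT (%s. PP i (jj s*.$BA.TA WW k))"
					by(rule lin_comp[OF lin_comp[OF jj_linear BA.mult_linl] PP_linear]) (use i k in auto)
				show "lin K BR.TT BR.TT (%s. (if k = i then 1.$K else 0.$K).*$BR.TT s)"
					by(rule linI) (auto simp: BR.TT.smult_r_distr)
				fix r c assume rc: "r:.R" "c:.EF"
				hence c: "c:.F" by simp
				have "PP i (jj (BR.tn r c)*.$BA.TA WW k) = BR.tn (du i (e k).*$R r) c"
					using rc(1) c i k by(simp add: jj_tn WW_def BA_mult sm_mult PP_tn cd_sm)
				thus "PP i (jj (BR.tn r c)*.$BA.TA WW k) = (if k = i then 1.$K else 0.$K).*$BR.TT BR.tn r c"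
					using BR.tn_simps(3)[where c = "du i (e k)" and x = r and y = c] rc i k by(simp add: Hb.du_e)
			qed
			thus ?thesis using s' by simp
		qed
		show "WW i*.$BA.TA WW k = SB.ev2 (%j k. io (Hb.dc i j k)) (%a b. SB.ev2 (%j n. io (Hb.dc k j n)) (%c f.
				jj (s0 a c)*.$BA.TA SB.ev (%n. io (Hb.mc b f n)) WW))"
		proof -
			have ev: "SB.ev (%n. io (Hb.mc b f n)) WW = (+/$BA.TT n:I. BA.scal (io (Hb.mc b f n))*.$BA.TA WW n)" if "b:I" "f:I" for b f
				unfolding SB.ev_def BA.finsum_TA by(rule BA.TT.finsum_cong'[OF refl]) (use that jzd BR_coef in "auto intro!: BA.mult_closed")
			have evc: "(+/$BA.TT n:I. BA.scal (io (Hb.mc b f n))*.$BA.TA WW n):.BA.TT" if "b:I" "f:I" for b f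
				using that BR_coef by(auto intro!: BA.TT.finsum_closed BA.mult_closed)
			have jsc: "jj (s0 a c):.BA.TT" if "a:I" "c:I" for a c using jc that by(simp add: s0_def)
			have inner: "SB.ev2 (%j n. io (Hb.dc k j n)) (%c f. jj (s0 a c)*.$BA.TA SB.ev (%n. io (Hb.mc b f n)) WW) =
					(+/$BA.TT c:I. +/$BA.TT f:I. BA.scal (io (Hb.dc k c f))*.$BA.TA
						(jj (s0 a c)*.$BA.TA (+/$BA.TT n:I. BA.scal (io (Hb.mc b f n))*.$BA.TA WW n)))" if "a:I" "b:I" for a b
				unfolding evB by(rule cong2) (use that k jzd ev evc jsc BR_coef in "auto intro!: BA.mult_closed")
			show ?thesis unfolding WW_WW[OF i k] evB[of "Hb.dc i"]
				by(rule cong2) (use i k jzd jc inner evc jsc BR_coef in "auto intro!: BA.mult_closed sum2c")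
		qed
		show "SQ.ev2 (%j k. io (Hb.dc i j k)) (%a b. SQ.ev2 (%j n. io (Hb.dc k j n)) (%c f. t0 a c*.$BR.TA s0 b f)) = BR.scal (io (Hb.epc i)*.$F io (Hb.epc k))"
			unfolding evQ s0_def t0_def
			by(rule cocycle_inverse[OF ta_bilinear sg_bilinear _ i k]) (use ta in "simp add: convolution_inverse_def")
		show "SQ.ev2 (%j k. io (Hb.dc i j k)) (%a b. SQ.ev2 (%j n. io (Hb.dc k j n)) (%c f. s0 a c*.$BR.TA t0 b f)) = BR.scal (io (Hb.epc i)*.$F io (Hb.epc k))"
			unfolding evQ s0_def t0_def
			by(rule cocycle_inverse[OF sg_bilinear ta_bilinear _ i k]) (use ta in "simp add: convolution_inverse_def")
	next
		fix x assume x: "x:.BA.TA"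
		hence x': "x:.BA.TT" by simp
		show "x = (+/$BA.TA i:I. jj (PP i x)*.$BA.TA WW i)"
			unfolding BA.finsum_TA
		proof (rule BA.tensor_eqI[OF BATM _ _ _ x'])
			show "lin K BA.TT BA.TT (%x. x)" by(rule linI) auto
			show "lin K BA.TT BA.TT (%x. +/$BA.TT i:I. jj (PP i x)*.$BA.TA WW i)"
				by(intro linear_map_sum[OF BATM BATM Hb.fin] lin_comp[OF lin_comp[OF PP_linear jj_linear] BA.mult_linl]) auto
			fix y c assume yc: "y:.A" "c:.EF"
			hence c: "c:.F" and y: "y:.RH.TT" by auto
			have "BA.tn y c = BA.tn (+/$A i:I. cd i y # e i) c" using cd_expand[OF y] by(simp add: A_finsum)
			also have "... = (+/$BA.TT i:I. BA.tn (cd i y # e i) c)"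
				by(rule lin_finsum[OF AAM BATM BA.tn_linear_left[OF c] Hb.fin]) (use y in auto)
			also have "... = (+/$BA.TT i:I. jj (PP i (BA.tn y c))*.$BA.TA WW i)"
				by(rule BA.TT.finsum_cong'[OF refl]) (use y c in "auto simp: PP_tn jj_tn WW_def BA_mult sm_mult intro!: BA.mult_closed")
			finally show "BA.tn y c = ..." .
		qed
	next
		have "SB.ev (%i. io (Hb.uc i)) WW = (+/$BA.TT n:I. BA.scal (io (du n 1.$H))*.$BA.TA WW n)"
			unfolding SB.ev_def BA.finsum_TA
			by(rule BA.TT.finsum_cong'[OF refl]) (use jz BR_coef in "auto simp: Hb.uc_def intro!: BA.mult_closed")
		thus "1.$BA.TA = SB.ev (%i. io (Hb.uc i)) WW" using WW_comb[OF H.A.one_closed] by simp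
	qed
qed

end

section \<open>The radicals\<close>

text \<open>The quotient is carried by chosen representatives instead of cosets, so that its
  elements are vectors of \<open>V\<close> and can be multiplied there; \<open>rh\<close> sends a
  vector to its representative.\<close>

lemma quotient_module:
	fixes V :: "('k, 'v, 'm) module_scheme"
	assumes "module K V" "submodule N K V"
	obtains M :: "('k, 'v) module" and rh where "module K M" "lin K V M rh" "car M <= car V"
		"!!x. x:.M==>rh x = x" "!!x. x:.V==>rh x = 0.$M \<longleftrightarrow> x:N"
proof -
	interpret V: module K V by fact
	note N = V.submoduleE[OF assms(2)]
	have Nc: "n:.V" if "n:N" for n using N(1) that by blast
	have N0: "0.$V:N" using subgroup.one_closed[OF submodule.axioms(1)[OF assms(2)]] by simp
	define rh where "rh x = (SOME y. y:.V & (EX n:N. x = y+.$V n))" for x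
	have rh: "rh x:.V & (EX n:N. x = rh x+.$V n)" if "x:.V" for x
		unfolding rh_def by(rule someI[of _ x]) (use that N0 in \<open>auto intro!: bexI[of _ "0.$V"]\<close>)
	have rhc: "rh x:.V" if "x:.V" for x using rh[OF that] by blast
	have eqI: "rh x = rh y" if x: "x:.V" and y: "y:.V" and n: "n:N" "x = y+.$V n" for x y n
	proof -
		have yn: "y = x+.$V -.$V n" using y Nc[OF n(1)] by(simp add: n(2) V.a_assoc V.r_neg)
		have "(z:.V & (EX n:N. x = z+.$V n)) = (z:.V & (EX n:N. y = z+.$V n))" for z
		proof (rule conj_cong[OF refl])
			assume z: "z:.V"
			show "(EX n:N. x = z+.$V n) = (EX n:N. y = z+.$V n)"
			proof
				assume "EX n:N. x = z+.$V n"
				then obtain p where p: "p:N" "x = z+.$V p" by blast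
				have "y = z+.$V (p+.$V -.$V n)" using yn p(2) z Nc[OF p(1)] Nc[OF n(1)] by(simp add: V.a_assoc)
				thus "EX n:N. y = z+.$V n" using N(5)[OF p(1) N(3)[OF n(1)]] by blast
			next
				assume "EX n:N. y = z+.$V n"
				then obtain p where p: "p:N" "y = z+.$V p" by blast
				have "x = z+.$V (p+.$V n)" using n(2) p(2) z Nc[OF p(1)] Nc[OF n(1)] by(simp add: V.a_assoc)
				thus "EX n:N. x = z+.$V n" using N(5)[OF p(1) n(1)] by blast
			qed
		qed
		thus ?thesis unfolding rh_def by simp
	qed
	have idem: "rh (rh x) = rh x" if x: "x:.V" for x
	proof -
		obtain n where n: "n:N" "x = rh x+.$V n" using rh[OF x] by blast
		show ?thesis by(rule eqI[OF x rhc[OF x] n, symmetric])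
	qed
	have add: "rh (rh x+.$V rh y) = rh (x+.$V y)" if x: "x:.V" and y: "y:.V" for x y
	proof -
		obtain n where n: "n:N" "x = rh x+.$V n" using rh[OF x] by blast
		obtain p where p: "p:N" "y = rh y+.$V p" using rh[OF y] by blast
		have "x+.$V y = (rh x+.$V n)+.$V (rh y+.$V p)" using n(2) p(2) by simp
		also have "... = (rh x+.$V rh y)+.$V (n+.$V p)"
			using rhc[OF x] rhc[OF y] Nc[OF n(1)] Nc[OF p(1)] by(simp add: V.a_ac)
		finally have e: "x+.$V y = ..." .
		show ?thesis by(rule eqI[OF _ _ N(5)[OF n(1) p(1)] e, symmetric]) (use x y rhc in auto)
	qed
	have smul: "rh (c.*$V rh x) = rh (c.*$V x)" if c: "c:.K" and x: "x:.V" for c x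
	proof -
		obtain n where n: "n:N" "x = rh x+.$V n" using rh[OF x] by blast
		have "c.*$V x = c.*$V (rh x+.$V n)" using n(2) by simp
		also have "... = c.*$V rh x+.$V c.*$V n" using c rhc[OF x] Nc[OF n(1)] by(simp add: V.smult_r_distr)
		finally have e: "c.*$V x = ..." .
		show ?thesis by(rule eqI[OF _ _ N(4)[OF c n(1)] e, symmetric]) (use x c rhc in auto)
	qed
	define M :: "('k, 'v) module" where "M = \<lparr>carrier = rh ` car V, monoid.mult = undefined, monoid.one = undefined,
			ring.zero = rh 0.$V, ring.add = (%x y. rh (x+.$V y)), smult = (%c x. rh (c.*$V x))\<rparr>"
	have Ms: "car M = rh ` car V" "0.$M = rh 0.$V" "x+.$M y = rh (x+.$V y)" "c.*$M x = rh (c.*$V x)" for x y c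
		by(simp_all add: M_def)
	have Ma: "rh x+.$M rh y = rh (x+.$V y)" if "x:.V" "y:.V" for x y using add that by(simp add: Ms)
	have Mm: "c.*$M rh x = rh (c.*$V x)" if "c:.K" "x:.V" for x c using smul that by(simp add: Ms)
	have ag: "abelian_group M"
	proof (rule abelian_groupI)
		show "EX y:car M. y+.$M x = 0.$M" if xM: "x:.M" for x
		proof -
			obtain v where v: "v:.V" "x = rh v" using xM by(auto simp: Ms)
			show ?thesis by(rule bexI[of _ "rh (-.$V v)"]) (use v in "auto simp: Ma V.l_neg Ms(1,2)")
		qed
	qed (auto simp: Ms(1,2) Ma V.a_ac)
	have "module K M"
		by(rule moduleI[OF V.R.is_cring ag]) (auto simp: Ms(1) Ma Mm V.smult_l_distr V.smult_r_distr V.smult_assoc1)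
	moreover have "lin K V M rh" by(rule linI) (auto simp: Ms(1) Ma Mm)
	moreover have "car M <= car V" using rhc by(auto simp: Ms)
	moreover have "rh x = x" if "x:.M" for x using that idem by(auto simp: Ms)
	moreover have "rh x = 0.$M \<longleftrightarrow> x:N" if x: "x:.V" for x
	proof
		assume "x:N"
		thus "rh x = 0.$M" unfolding Ms(2) by(rule eqI[OF x V.zero_closed]) (use x in simp)
	next
		assume e: "rh x = 0.$M"
		obtain n where n: "n:N" "x = rh x+.$V n" using rh[OF x] by blast
		obtain p where p: "p:N" "0.$V = rh 0.$V+.$V p" using rh[OF V.zero_closed] by blast
		have pc: "rh 0.$V = -.$V p" using V.minus_equality[OF p(2)[symmetric] Nc[OF p(1)] rhc[OF V.zero_closed]] by simp
		show "x:N" by(subst n(2), rule N(5)) (use e pc N(3)[OF p(1)] n(1) in "auto simp: Ms(2)")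
	qed
	ultimately show thesis by(rule that)
qed

lemma (in assoc_algebra) jacobson_submodule: "submodule (rad A) K A"
proof (rule submoduleI)
	note J = A.jacobson_closed
	have sm: "c.*$A x:rad A" if "c:.K" "x:rad A" for c x
	proof -
		have xc: "x:.A" by(rule A.radD[OF that(2)])
		have "(c.*$A 1.$A)*.$A x:rad A" by(rule J(3)) (use that in auto)
		thus ?thesis using that xc by(simp add: smult_mult_left)
	qed
	show "c.*$A x:rad A" if "c:.K" "x:rad A" for c x by(rule sm[OF that])
	show "-.$A x:rad A" if "x:rad A" for x
		using sm[of "-.$K 1.$K" x] that A.radD[OF that] by(simp add: smult_l_minus)
qed (use A.radD(1) A.jacobson_closed in auto)

lemma (in hopf_basis) dc_cocommutative:
	assumes "cocommutative K H" "i:I" "k:I" "n:I"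
	shows "dc i k n = dc i n k"
proof -
	have ei: "e i:.H" using assms by simp
	have "dc i k n = coef (sw TT (e i) (%x y. tn y x)) k n"
		using assms(1) ei by(simp add: dc_def cocommutative_def)
	also have "... = sw KK (e i) (%x y. coef (tn y x) k n)"
		by(rule sw_hom[OF TM KK_module coef_linear ei]) (use assms in "auto simp: tn_simps")
	also have "... = sw KK (e i) (%x y. du n x*.$K du k y)"
		by(rule sw_cong[OF KK_module ei]) (use assms in "auto simp: coef_tn K.m_comm")
	also have "... = dc i n k" by(simp add: dc_def coef_def sweedler2_def)
	finally show ?thesis .
qed

section \<open>The coordinate criterion and its consequences\<close>

context crossed_product_base_change
begin

lemma jacobson_base_change:
	assumes "algebraically_closed F" "commutative_algebra H | cocommutative K H"
	shows "x:rad BA.TA \<longleftrightarrow> x:.BA.TA & (ALL i:I. PP i x:rad BR.TA)"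
proof -
	interpret C: hopf_crossed_product F I "%i j k. io (Hb.mc i j k)" "%i j k. io (Hb.dc i j k)" "%i j. io (Hb.Sc i j)" "%i. io (Hb.uc i)"
		"%i. io (Hb.epc i)" "%i. io (Hb.tc i)" "%i. io (Hb.lc i)" BR.TA BA.TA BR.scal jj WW PP EE s0 t0
		by(rule hopf_crossed_product_base_change)
	show ?thesis using assms(2)
	proof
		assume c: "commutative_algebra H"
		show ?thesis
			by(rule C.jacobson_radical_iff_comm[OF assms(1)]) (use c in "simp add: Hb.mc_def commutative_algebra_def")
	next
		assume c: "cocommutative K H"
		show ?thesis by(rule C.jacobson_radical_iff_cocomm[OF assms(1)]) (use Hb.dc_cocommutative[OF c] in simp)
	qed
qed

lemma A_submodule: "submodule N K A = submodule N K RH.TT" by(simp add: submodule_def submodule_axioms_def)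

lemmas JR_sub = R.jacobson_submodule
lemmas JA_sub = A.jacobson_submodule[unfolded A_submodule]

lemma red_cd:
	assumes "x:.RH.TT"
	shows "red x = (+/$R i:I. counit H (e i).*$R cd i x)"
proof -
	have "red x = red (+/$RH.TT i:I. cd i x # e i)" using cd_expand[OF assms] by simp
	also have "... = (+/$R i:I. red (cd i x # e i))"
		by(rule lin_finsum[OF AM RM red_linear Hb.fin]) (use assms in auto)
	also have "... = (+/$R i:I. counit H (e i).*$R cd i x)"
		by(rule abelian_monoid.finsum_cong'[OF abelian_group.axioms(1)[OF module.axioms(2)[OF RM]] refl]) (use assms in "auto simp: red_sm")
	finally show ?thesis .
qed

end

text \<open>Separates what the passage to \<open>F\<close> has to supply, the coordinate criterion
  over \<open>K\<close>, from the consequences drawn over \<open>K\<close> alone.\<close>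

locale crossed_product_radical = crossed_product_base_change K H R act sg I e du t l ta F io
	for K :: "('k, 'n) ring_scheme" (structure) and H :: "('k, 'h, 'm) hopf_algebra_scheme" (structure)
		and R :: "('k, 'r, 'p) module_scheme" (structure) and act sg and I :: "'i set" and e du t l ta
		and F :: "('f, 'q) ring_scheme" and io :: "'k => 'f" +
	assumes J_iff: "x:.RH.TT==>x:rad A \<longleftrightarrow> (ALL i:I. cd i x:rad R)"
begin

lemma JR_closed: "r:rad R==>r:.R" by(rule R.A.radD)

lemma JR_lift: "r:rad R==>h:.H==>r # h:rad A"
	by(subst J_iff) (auto simp: JR_closed cd_sm intro: R.submoduleE(4)[OF JR_sub])

lemma red_JA:
	assumes "x:rad A" shows "red x:rad R"
proof -
	have x: "x:.RH.TT" using A.A.radD[OF assms] by simp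
	show ?thesis unfolding red_cd[OF x]
		by(rule R.submodule_finsum[OF JR_sub Hb.fin], rule R.submoduleE(4)[OF JR_sub]) (use J_iff[OF x] assms in auto)
qed

text \<open>The product of 1 # h and r # 1 lies in the radical of the crossed product. Applying the
  counit to its second leg gives an element of the radical of \<open>R\<close>, and this element is
  \<open>act h r\<close>.\<close>

lemma act_JR:
	assumes r: "r:rad R" and h: "h:.H"
	shows "act h r:rad R"
proof -
	have rc: "r:.R" by(rule JR_closed[OF r])
	have "(1.$R # h)*.$A (r # 1.$H):rad A" by(rule A.A.jacobson_closed(3)) (use h JR_lift[OF r] in auto)
	hence "red (H.sw RH.TT h (%x y. act x r # y)):rad R"
		using red_JA by(simp add: mult_H_R[OF h rc])
	moreover have "red (H.sw RH.TT h (%x y. act x r # y)) = H.sw R h (%x y. red (act x r # y))"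
		by(rule H.sw_hom[OF AM RM red_linear h]) (use rc in auto)
	moreover have "... = H.sw R h (%x y. counit H y.*$R act x r)" by(rule H.sw_cong[OF RM h]) (use rc in "auto simp: red_sm")
	moreover have "... = act h r" by(rule counit_sw_right(1)[OF lin_act[OF rc] h])
	ultimately show ?thesis by simp
qed

lemma JA_tensor_image: "rad A = tensor_image K R H (rad R) (car H)"
proof
	have sub: "submodule (tensor_image K R H (rad R) (car H)) K RH.TT"
		unfolding tensor_image_def by(rule subspace_span_submodule[OF AM]) (use JR_closed in auto)
	show "tensor_image K R H (rad R) (car H) <= rad A"
		unfolding tensor_image_def by(rule subspace_span_least[OF JA_sub]) (use JR_lift in auto)
	show "rad A <= tensor_image K R H (rad R) (car H)"
	proof
		fix x assume x: "x:rad A"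
		hence xc: "x:.RH.TT" using A.A.radD by fastforce
		have "(+/$RH.TT i:I. cd i x # e i):tensor_image K R H (rad R) (car H)"
		proof (rule RH.TT.submodule_finsum[OF sub Hb.fin])
			fix i assume i: "i:I"
			have "cd i x:rad R" using J_iff[OF xc] x i by blast
			thus "cd i x # e i:tensor_image K R H (rad R) (car H)"
				unfolding tensor_image_def using i
				by(intro subsetD[OF subspace_span_superset] CollectI exI[of _ "cd i x"] exI[of _ "e i"]) simp
		qed
		thus "x:tensor_image K R H (rad R) (car H)" using cd_expand[OF xc] by simp
	qed
qed

lemma JR_annihilates:
	fixes M :: "('k, 'x, 'y) module_scheme"
	assumes irr: "RH_irreducible K H R act sg M lact hact" and r: "r:rad R" and m: "m:.M"
	shows "lact r m = 0.$M"
proof -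
	interpret M: RH_irreducible K H R act sg M lact hact by(rule irr)
	note MM = M.module_axioms
	note l = bilD[OF M.lact_bilinear] and hh = bilD[OF M.hact_bilinear]
	have llin: "lin K M M (lact a)" if "a:.R" for a by(rule linI) (use that l in auto)
	have hlin: "lin K M M (hact h)" if "h:.H" for h by(rule linI) (use that hh in auto)
	have lz: "lact a 0.$M = 0.$M" if "a:.R" for a by(rule lin_zero[OF MM MM llin[OF that]])
	have hz: "hact h 0.$M = 0.$M" if "h:.H" for h by(rule lin_zero[OF MM MM hlin[OF that]])
	have swN: "H.sw M h B:N" if "submodule N K M" "h:.H" "!!x y. x:.H==>y:.H==>B x y:N" for N h B
		unfolding sweedler2_def by(rule tensor_lift_closed[OF H.VWK MM that(1) H.comult_closed[OF that(2)] that(3)])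
	\<comment> \<open>\<open>act x 1\<close> is the counit of \<open>x\<close> times 1, so
	  multiplication by the unit of \<open>R\<close> commutes with \<open>H\<close>.\<close>
	have one_hact: "hact h (lact 1.$R m) = lact 1.$R (hact h m)" if h: "h:.H" and m: "m:.M" for h m
	proof -
		have hl: "lin K H M (%z. lact 1.$R (hact z m))" by(rule linI) (use m l hh in auto)
		have "hact h (lact 1.$R m) = H.sw M h (%x y. lact (act x 1.$R) (hact y m))" by(rule M.hact_lact[OF h R.A.one_closed m])
		also have "... = H.sw M h (%x y. lact 1.$R (hact (counit H x.*$H y) m))"
			by(rule H.sw_cong[OF MM h]) (use m l hh in "auto simp: act_unit")
		also have "... = lact 1.$R (hact (H.sw H h (%x y. counit H x.*$H y)) m)"
			by(rule H.sw_hom[OF HM MM hl h, symmetric]) auto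
		finally show ?thesis by(simp add: H.counit_left[OF h])
	qed
	\<comment> \<open>An irreducible module is not unital by definition. The vectors killed by the unit
	  of \<open>R\<close> form an invariant subspace, proper because R M is not 0, hence 0; the
	  differences m - 1 m all lie in it.\<close>
	have unital: "lact 1.$R m = m" if m: "m:.M" for m
	proof -
		let ?N = "{m:car M. lact 1.$R m = 0.$M}"
		have killed: "lact a n = 0.$M" if "a:.R" "n:?N" for a n
			using M.lact_mult[of a "1.$R" n] that lz by simp
		have "?N = {0.$M} | ?N = car M"
		proof (rule M.irreducible[OF linear_map_kernel[OF MM MM llin[OF R.A.one_closed]]])
			show "lact a n:?N" if "a:.R" "n:?N" for a n using killed[OF that] lz by simp
			show "hact h n:?N" if "h:.H" "n:?N" for h n
				using one_hact[OF that(1), of n] that hz hh(1) by auto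
		qed
		moreover have "?N ~= car M" using M.lact_nonzero killed by blast
		ultimately have N: "?N = {0.$M}" by blast
		have "lact 1.$R (m -.$M lact 1.$R m) = 0.$M"
			by(rule linear_map_minus[OF MM MM llin[OF R.A.one_closed] m]) (use m l M.lact_mult[of "1.$R" "1.$R" m] in auto)
		hence "m -.$M lact 1.$R m:?N" using m l by simp
		hence z: "m -.$M lact 1.$R m = 0.$M" unfolding N by simp
		have lc: "lact 1.$R m:.M" using m l by simp
		have "m = (m -.$M lact 1.$R m)+.$M lact 1.$R m" using m lc by(simp add: a_minus_def M.a_assoc M.l_neg)
		thus ?thesis using z lc by simp
	qed
	interpret LA: left_action R M lact by unfold_locales (use l M.lact_mult unital in auto)
	have osub_sub: "submodule N K M" if N: "LA.osub N" for N
	proof (rule M.submoduleI)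
		note D = LA.osubD(1-4)[OF N]
		show "c.*$M x:N" if "c:.K" "x:N" for c x
		proof -
			have xc: "x:.M" using D(1) that by blast
			have "c.*$M x = lact (c.*$R 1.$R) x" using that xc l unital by simp
			thus ?thesis using LA.osub_l[OF N, of "c.*$R 1.$R" x] that by simp
		qed
	qed (use LA.osubD(1-4)[OF N] in auto)
	obtain a0 m0 where m0: "a0:.R" "m0:.M" "lact a0 m0 ~= 0.$M" using M.lact_nonzero by blast
	let ?gen = "(%i. hact (e i) m0) ` I"
	\<comment> \<open>\<open>M\<close> is generated over \<open>R\<close> by the finitely many vectors
	  \<open>hact (e i) m0\<close>, which provides a maximal submodule. For, the vectors whose images
	  under all of \<open>H\<close> stay in \<open>N\<close> form an invariant subspace, and it
	  contains \<open>m0\<close>.\<close>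
	have full: "N = car M" if N: "LA.osub N" "?gen <= N" for N
	proof -
		note Ns = osub_sub[OF N(1)]
		have hN: "hact h m0:N" if h: "h:.H" for h
		proof -
			have "hact h m0 = (+/$M i:I. du i h.*$M hact (e i) m0)"
				by(rule Hb.lin[OF MM _ h]) (rule linI, use m0 hh in auto)
			also have "...:N" by(rule M.submodule_finsum[OF Ns Hb.fin], rule M.submoduleE(4)[OF Ns]) (use h N(2) in auto)
			finally show ?thesis .
		qed
		let ?C = "{x:car M. ALL h:car H. hact h x:N}"
		have "?C = {0.$M} | ?C = car M"
		proof (rule M.irreducible)
			show "submodule ?C K M"
			proof (rule M.submoduleI)
				show "0.$M:?C" using hz LA.osubD(2)[OF N(1)] by simp
				have sm: "c.*$M x:?C" if "c:.K" "x:?C" for c x using that hh M.submoduleE(4)[OF Ns] by auto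
				show "c.*$M x:?C" if "c:.K" "x:?C" for c x by(rule sm[OF that])
				show "-.$M x:?C" if "x:?C" for x using sm[of "-.$K 1.$K" x] that by(simp add: M.smult_l_minus)
				show "x+.$M y:?C" if "x:?C" "y:?C" for x y using that hh M.submoduleE(5)[OF Ns] by auto
			qed auto
			show "lact a n:?C" if an: "a:.R" "n:?C" for a n
			proof -
				have "hact h (lact a n):N" if h: "h:.H" for h
					unfolding M.hact_lact[OF h an(1) CollectD[OF an(2), THEN conjunct1]]
					by(rule swN[OF Ns h], rule LA.osub_l[OF N(1)]) (use an in auto)
				thus ?thesis using an l(1) by auto
			qed
			show "hact g n:?C" if gn: "g:.H" "n:?C" for g n
			proof -
				have "hact h (hact g n):N" if h: "h:.H" for h
					unfolding M.hact_hact[OF h gn(1) CollectD[OF gn(2), THEN conjunct1]]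
					by(rule swN[OF Ns h], rule swN[OF Ns gn(1)], rule LA.osub_l[OF N(1)]) (use gn in auto)
				thus ?thesis using gn hh(1) by auto
			qed
		qed
		moreover have "m0:?C" using m0 hN by simp
		moreover have "m0 ~= 0.$M" using m0 lz by auto
		ultimately have C: "?C = car M" by blast
		have "x:N" if "x:.M" for x
		proof -
			have "x:?C" using that C by simp
			hence "hact 1.$H x:N" by simp
			thus ?thesis using M.hact_one[OF that] by simp
		qed
		thus ?thesis using LA.osubD(1)[OF N(1)] by blast
	qed
	have z: "LA.osub {0.$M}" by(rule LA.osubI) (use lz in auto)
	have z': "{0.$M} ~= car M" using l(1)[OF m0(1,2)] m0(3) by blast
	have gen: "?gen <= car M" using m0 hh(1) by auto
	have "EX W. LA.max_osub W & {0.$M} <= W"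
		by(rule LA.exists_maximal_osub[of _ ?gen]; rule z z' gen finite_imageI[OF Hb.fin] full; assumption)
	then obtain W where W: "LA.max_osub W" by blast
	have oW: "LA.osub W" "W ~= car M" using W by(auto simp: LA.max_osub_def)
	note Ws = osub_sub[OF oW(1)]
	have JW: "lact s n:W" if "s:rad R" "n:.M" for s n by(rule LA.jacobson_maximal_osub[OF W that])
	\<comment> \<open>The largest \<open>H\<close>-stable subspace of \<open>W\<close>. It lies in
	  \<open>W\<close> because the unit of \<open>H\<close> acts as the identity, so it is proper and
	  by irreducibility 0.\<close>
	let ?C = "{x:car M. ALL h:car H. hact h x:W}"
	have "?C = {0.$M} | ?C = car M"
	proof (rule M.irreducible)
		show "submodule ?C K M"
		proof (rule M.submoduleI)
			show "0.$M:?C" using hz LA.osubD(2)[OF oW(1)] by simp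
			have sm: "c.*$M x:?C" if "c:.K" "x:?C" for c x using that hh M.submoduleE(4)[OF Ws] by auto
			show "c.*$M x:?C" if "c:.K" "x:?C" for c x by(rule sm[OF that])
			show "-.$M x:?C" if "x:?C" for x using sm[of "-.$K 1.$K" x] that by(simp add: M.smult_l_minus)
			show "x+.$M y:?C" if "x:?C" "y:?C" for x y using that hh M.submoduleE(5)[OF Ws] by auto
		qed auto
		show "lact a n:?C" if an: "a:.R" "n:?C" for a n
		proof -
			have "hact h (lact a n):W" if h: "h:.H" for h
				unfolding M.hact_lact[OF h an(1) CollectD[OF an(2), THEN conjunct1]]
				by(rule swN[OF Ws h], rule LA.osub_l[OF oW(1)]) (use an in auto)
			thus ?thesis using an l(1) by auto
		qed
		show "hact g n:?C" if gn: "g:.H" "n:?C" for g n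
		proof -
			have "hact h (hact g n):W" if h: "h:.H" for h
				unfolding M.hact_hact[OF h gn(1) CollectD[OF gn(2), THEN conjunct1]]
				by(rule swN[OF Ws h], rule swN[OF Ws gn(1)], rule LA.osub_l[OF oW(1)]) (use gn in auto)
			thus ?thesis using gn hh(1) by auto
		qed
	qed
	moreover have "?C <= W"
	proof
		fix x assume x: "x:?C"
		hence "hact 1.$H x:W" by simp
		thus "x:W" using M.hact_one[of x] x by simp
	qed
	ultimately have C0: "?C = {0.$M}" using oW(2) LA.osubD(1)[OF oW(1)] by blast
	have rc: "r:.R" by(rule JR_closed[OF r])
	have "hact h (lact r m):W" if h: "h:.H" for h
		unfolding M.hact_lact[OF h rc m] by(rule swN[OF Ws h], rule JW) (use act_JR[OF r] m hh in auto)
	hence "lact r m:?C" using rc m l by simp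
	thus ?thesis unfolding C0 by simp
qed

end

lemma (in assoc_algebra) left_ideal_submodule:
	assumes "left_ideal A N" shows "submodule N K A"
proof -
	interpret N: additive_subgroup N A using assms by(simp add: left_ideal_def)
	show ?thesis
	proof (rule submoduleI)
		show "c.*$A x:N" if c: "c:.K" and x: "x:N" for c x
		proof -
			have "(c.*$A 1.$A)*.$A x:N" using assms c x by(auto simp: left_ideal_def)
			thus ?thesis using c N.a_Hcarr[OF x] by(simp add: smult_mult_left)
		qed
		show "-.$A x:N" if "x:N" for x by(rule N.a_inv_closed[OF that])
	qed (auto simp: N.a_Hcarr)
qed

context crossed_product_radical
begin

lemma A_mult_linear:
	assumes "a:.RH.TT"
	shows "lin K RH.TT RH.TT (%x. a*.$A x)" "lin K RH.TT RH.TT (%x. x*.$A a)"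
	by(rule linI; use assms A.A.r_distr A.A.l_distr A.smult_mult_right A.smult_mult_left in simp)+

text \<open>A maximal left ideal \<open>N\<close> of the crossed product \<open>A\<close> yields the irreducible module \<open>A / N\<close>.\<close>

lemma H_radical_maximal:
	assumes r: "r:H_jacobson_radical K H R act sg" and N: "maximal_left_ideal A N"
	shows "r # 1.$H:N"
proof -
	have rc: "r:.R" using r by(simp add: H_jacobson_radical_def)
	have li: "left_ideal A N" and NA: "N ~= car RH.TT"
		and mx: "!!N'. left_ideal A N'==>N <= N'==>N' = N | N' = car RH.TT"
		using N unfolding maximal_left_ideal_def A_simps(1) by blast+
	have sub: "submodule N K RH.TT" using A.left_ideal_submodule[OF li] unfolding A_submodule .
	note ND = RH.TT.submoduleE[OF sub]
	have lm: "a*.$A x:N" if "a:.RH.TT" "x:N" for a x using li that by(auto simp: left_ideal_def)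
	have Nc: "x:.RH.TT" if "x:N" for x using ND(1) that by blast
	obtain M :: "('k, ('r \<times> 'h => 'k) set) module" and rh where MM: "module K M" and rh: "lin K RH.TT M rh"
		and Mc: "car M <= car RH.TT" and rhid: "!!x. x:.M==>rh x = x"
		and rh0: "!!x. x:.RH.TT==>rh x = 0.$M \<longleftrightarrow> x:N"
		by(rule quotient_module[OF AM sub]) (rule that)
	interpret M: module K M by(rule MM)
	note rhD = linD[OF rh]
	have MT: "m:.RH.TT" if "m:.M" for m using Mc that by blast
	define o' where "o' = 1.$R # 1.$H"
	have oc': "o':.RH.TT" by(simp add: o'_def)
	have ol: "o'*.$A x = x" and orr: "x*.$A o' = x" if "x:.RH.TT" for x
		using A.A.l_one[of x] A.A.r_one[of x] that by(auto simp: o'_def)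
	\<comment> \<open>\<open>N\<close> is a left ideal, so a vector may be replaced by its
	  representative before it is multiplied and reduced.\<close>
	have key: "rh (a*.$A rh x) = rh (a*.$A x)" if a: "a:.RH.TT" and x: "x:.RH.TT" for a x
	proof -
		note al = linD[OF A_mult_linear(1)[OF a]]
		have rx: "rh x:.RH.TT" by(rule MT[OF rhD(1)[OF x]])
		let ?d = "x -.$RH.TT rh x"
		have "rh ?d = 0.$M" by(rule linear_map_minus[OF AM MM rh x rx]) (simp add: rhid[OF rhD(1)[OF x]])
		hence dN: "?d:N" using rh0[of ?d] x rx by simp
		have xd: "x = rh x+.$RH.TT ?d" using x rx by(simp add: a_minus_def RH.TT.a_lcomm RH.TT.r_neg)
		have "a*.$A x = a*.$A (rh x+.$RH.TT ?d)" using xd by simp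
		also have "... = a*.$A rh x+.$RH.TT a*.$A ?d" by(rule al(2)[OF rx Nc[OF dN]])
		finally have "rh (a*.$A x) = rh (a*.$A rh x)+.$M rh (a*.$A ?d)" using rhD(2) al(1)[OF rx] al(1)[OF Nc[OF dN]] by simp
		moreover have "rh (a*.$A ?d) = 0.$M" using rh0[OF al(1)[OF Nc[OF dN]]] lm[OF a dN] by simp
		ultimately show ?thesis using rhD(1)[OF al(1)[OF rx]] by simp
	qed
	have la: "lin K M M (%m. rh (a*.$A m))" if a: "a:.RH.TT" for a
	proof (rule linI)
		note al = linD[OF A_mult_linear(1)[OF a]]
		show "rh (a*.$A m):.M" if "m:.M" for m by(rule rhD(1)[OF al(1)[OF MT[OF that]]])
		show "rh (a*.$A (m+.$M m')) = rh (a*.$A m)+.$M rh (a*.$A m')" if m: "m:.M" "m':.M" for m m'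
		proof -
			note mt = MT[OF m(1)] MT[OF m(2)]
			have "m+.$M m' = rh (m+.$RH.TT m')" using rhD(2)[OF mt] m by(simp add: rhid)
			hence "rh (a*.$A (m+.$M m')) = rh (a*.$A (m+.$RH.TT m'))" using key[OF a, of "m+.$RH.TT m'"] mt by simp
			thus ?thesis using al(2)[OF mt] rhD(2)[OF al(1)[OF mt(1)] al(1)[OF mt(2)]] by simp
		qed
		show "rh (a*.$A (c.*$M m)) = c.*$M rh (a*.$A m)" if c: "c:.K" and m: "m:.M" for c m
		proof -
			note mt = MT[OF m]
			have "c.*$M m = rh (c.*$RH.TT m)" using rhD(3)[OF c mt] m by(simp add: rhid)
			hence "rh (a*.$A (c.*$M m)) = rh (a*.$A (c.*$RH.TT m))" using key[OF a, of "c.*$RH.TT m"] mt c by simp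
			thus ?thesis using al(3)[OF c mt] rhD(3)[OF c al(1)[OF mt]] by simp
		qed
	qed
	have lr: "lin K RH.TT M (%z. rh (z*.$A m))" if "m:.RH.TT" for m
		by(rule lin_comp[OF A_mult_linear(2)[OF that] rh])
	define lact where "lact r m = rh ((r # 1.$H)*.$A m)" for r m
	define hact where "hact h m = rh ((1.$R # h)*.$A m)" for h m
	have lh: "lact a (hact h m) = rh ((a # h)*.$A m)" if "a:.R" "h:.H" "m:.RH.TT" for a h m
	proof -
		have "lact a (hact h m) = rh ((a # 1.$H)*.$A ((1.$R # h)*.$A m))"
			unfolding lact_def hact_def by(rule key) (use that in auto)
		also have "... = rh (((a # 1.$H)*.$A (1.$R # h))*.$A m)" using that A.A.m_assoc by simp
		finally show ?thesis using that by(simp add: sm_mult)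
	qed
	have assoc2: "rh (a*.$A rh (b*.$A m)) = rh ((a*.$A b)*.$A m)"
		if "a:.RH.TT" "b:.RH.TT" "m:.RH.TT" for a b m
		using key[OF that(1), of "b*.$A m"] that A.A.m_assoc by simp
	have one0: "rh o' ~= 0.$M"
	proof
		assume "rh o' = 0.$M"
		hence oN: "o':N" using rh0[OF oc'] by simp
		have "x:N" if "x:.RH.TT" for x using lm[OF that oN] orr[OF that] by simp
		thus False using NA ND(1) by blast
	qed
	have irr: "RH_irreducible K H R act sg M lact hact"
	proof (intro RH_irreducible.intro RH_module.intro RH_module_axioms.intro RH_irreducible_axioms.intro MM)
		show "bil K R M M lact"
			unfolding lact_def by(rule bilI_lin[OF la lin_comp[OF sm_linear(1)[OF H.A.one_closed] lr[OF MT]]]) auto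
		show "bil K H M M hact"
			unfolding hact_def by(rule bilI_lin[OF la lin_comp[OF sm_linear(2)[OF R.A.one_closed] lr[OF MT]]]) auto
	next
		fix a b m assume abm: "a:.R" "b:.R" "m:.M"
		thus "lact (a*.$R b) m = lact a (lact b m)"
			unfolding lact_def using assoc2[of "a # 1.$H" "b # 1.$H" m] MT by(simp add: mult_R)
	next
		fix m assume "m:.M"
		thus "hact 1.$H m = m" unfolding hact_def using ol[OF MT] rhid by(simp add: o'_def)
	next
		fix h a m assume h: "h:.H" and a: "a:.R" and m: "m:.M"
		note mt = MT[OF m]
		have "hact h (lact a m) = rh (((1.$R # h)*.$A (a # 1.$H))*.$A m)"
			unfolding hact_def lact_def by(rule assoc2) (use h a mt in auto)
		also have "... = rh (H.sw RH.TT h (%x y. act x a # y)*.$A m)" by(simp only: mult_H_R[OF h a])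
		also have "... = H.sw M h (%x y. rh ((act x a # y)*.$A m))"
			by(rule H.sw_hom[OF AM MM lr[OF mt] h]) (use a in auto)
		also have "... = H.sw M h (%x y. lact (act x a) (hact y m))"
			by(rule H.sw_cong[OF MM h]) (use a mt rhD(1) in "auto simp: lh")
		finally show "hact h (lact a m) = ..." .
	next
		fix h g m assume h: "h:.H" and g: "g:.H" and m: "m:.M"
		note mt = MT[OF m]
		have ic: "H.sw RH.TT g (%a b. sg x a # (y*.$H b)):.RH.TT" if "x:.H" "y:.H" for x y
			by(rule H.sw_closed[OF AM g]) (use that in auto)
		have inner: "rh (H.sw RH.TT g (%a b. sg x a # (y*.$H b))*.$A m) = H.sw M g (%a b. lact (sg x a) (hact (y*.$H b) m))"
			if xy: "x:.H" "y:.H" for x y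
		proof -
			have "rh (H.sw RH.TT g (%a b. sg x a # (y*.$H b))*.$A m) = H.sw M g (%a b. rh ((sg x a # (y*.$H b))*.$A m))"
				by(rule H.sw_hom[OF AM MM lr[OF mt] g]) (use xy in auto)
			also have "... = H.sw M g (%a b. lact (sg x a) (hact (y*.$H b) m))"
				by(rule H.sw_cong[OF MM g]) (use xy mt rhD(1) in "auto simp: lh")
			finally show ?thesis .
		qed
		have ic': "H.sw M g (%a b. lact (sg x a) (hact (y*.$H b) m)):.M" if "x:.H" "y:.H" for x y
			by(rule H.sw_closed[OF MM g]) (use that mt rhD(1) in "auto simp: lh")
		have "hact h (hact g m) = rh (((1.$R # h)*.$A (1.$R # g))*.$A m)"
			unfolding hact_def by(rule assoc2) (use h g mt in auto)
		also have "... = rh (H.sw RH.TT h (%x y. H.sw RH.TT g (%a b. sg x a # (y*.$H b)))*.$A m)" by(simp only: mult_H_H[OF h g])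
		also have "... = H.sw M h (%x y. rh (H.sw RH.TT g (%a b. sg x a # (y*.$H b))*.$A m))"
			by(rule H.sw_hom[OF AM MM lr[OF mt] h ic])
		also have "... = H.sw M h (%x y. H.sw M g (%a b. lact (sg x a) (hact (y*.$H b) m)))"
			by(rule H.sw_cong[OF MM h inner ic'])
		finally show "hact h (hact g m) = ..." .
	next
		have "lact 1.$R (rh o') = rh o'"
			unfolding lact_def using key[OF oc' oc'] ol[OF oc'] by(simp add: o'_def)
		thus "EX a:car R. EX m:car M. lact a m ~= 0.$M"
			using one0 rhD(1)[OF oc'] by(intro bexI[of _ "1.$R"] bexI[of _ "rh o'"]) auto
	next
		fix L assume L: "submodule L K M" "!!a n. a:.R==>n:L==>lact a n:L"
			"!!h n. h:.H==>n:L==>hact h n:L"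
		have LM: "y:.M" if "y:L" for y using M.submoduleE(1)[OF L(1)] that by blast
		let ?P = "{x:car RH.TT. rh x:L}"
		have P: "submodule ?P K RH.TT" by(rule linear_preimage[OF AM MM rh L(1)])
		have "left_ideal A ?P"
			unfolding left_ideal_def
		proof (intro conjI ballI)
			show "additive_subgroup ?P A"
				using submodule.axioms(1)[OF P[folded A_submodule]] by(rule additive_subgroup.intro)
			fix a x assume a: "a:.A" and x: "x:?P"
			hence ac: "a:.RH.TT" and xc: "x:.RH.TT" and xL: "rh x:L" by auto
			\<comment> \<open>Stability under the whole crossed product follows from stability under
			  \<open>R\<close> and \<open>H\<close>, since s # h acts as the composite of
			  \<open>lact s\<close> and \<open>hact h\<close>.\<close>
			have "a:{z:car RH.TT. rh (z*.$A x):L}"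
			proof (rule RH.tensor_span[OF linear_preimage[OF AM MM lr[OF xc] L(1)] _ ac])
				fix s h assume sh: "s:.R" "h:.H"
				have "rh ((s # h)*.$A x) = lact s (hact h (rh x))"
					using key[of "s # h" x] lh[OF sh MT[OF LM[OF xL]]] sh xc by simp
				thus "s # h:{z:car RH.TT. rh (z*.$A x):L}" using L(2)[OF sh(1) L(3)[OF sh(2) xL]] sh by simp
			qed
			thus "a*.$A x:?P" using ac xc by simp
		qed
		moreover have "N <= ?P"
		proof
			fix x assume x: "x:N"
			have "rh x = 0.$M" using rh0[OF Nc[OF x]] x by simp
			thus "x:?P" using Nc[OF x] subgroup.one_closed[OF submodule.axioms(1)[OF L(1)]] by simp
		qed
		ultimately have "?P = N | ?P = car RH.TT" by(rule mx)
		thus "L = {0.$M} | L = car M"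
		proof
			assume e: "?P = N"
			have "L <= {0.$M}"
			proof
				fix y assume y: "y:L"
				have "y:?P" using y MT[OF LM[OF y]] rhid[OF LM[OF y]] by simp
				hence "y:N" by(simp only: e)
				hence "y = 0.$M" using rh0[OF MT[OF LM[OF y]]] rhid[OF LM[OF y]] by simp
				thus "y:{0.$M}" by simp
			qed
			moreover have "{0.$M} <= L" using subgroup.one_closed[OF submodule.axioms(1)[OF L(1)]] by simp
			ultimately show ?thesis by(intro disjI1 equalityI)
		next
			assume e: "?P = car RH.TT"
			have "y:L" if y: "y:.M" for y
			proof -
				have "y:?P" unfolding e by(rule MT[OF y])
				thus ?thesis using rhid[OF y] by simp
			qed
			thus ?thesis using LM by blast
		qed
	qed
	\<comment> \<open>\<open>r\<close> kills the class of the unit, and its product with that class is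
	  the class of r # 1.\<close>
	have "lact r (rh o') = 0.$M" by(rule H_jacobson_radical_annihilates[OF irr r rhD(1)[OF oc']])
	moreover have "lact r (rh o') = rh (r # 1.$H)"
		unfolding lact_def using key[of "r # 1.$H" o'] orr[of "r # 1.$H"] oc' rc by simp
	ultimately show ?thesis using rh0[of "r # 1.$H"] rc by simp
qed

theorem H_radical_eq: "H_jacobson_radical K H R act sg = rad R"
proof
	show "H_jacobson_radical K H R act sg <= rad R"
	proof
		fix r assume r: "r:H_jacobson_radical K H R act sg"
		hence rc: "r:.R" by(simp add: H_jacobson_radical_def)
		have "r # 1.$H:rad A"
			unfolding jacobson_radical_def using H_radical_maximal[OF r] rc by simp
		hence "red (r # 1.$H):rad R" by(rule red_JA)
		thus "r:rad R" using rc by(simp add: red_sm)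
	qed
	show "rad R <= H_jacobson_radical K H R act sg"
		unfolding H_jacobson_radical_def using JR_closed JR_annihilates by(intro subsetI CollectI conjI allI impI ballI)
qed

theorem core_eq: "H_core H R act (rad R) = rad R"
proof
	show "H_core H R act (rad R) <= rad R"
	proof
		fix x assume "x:H_core H R act (rad R)"
		hence "act 1.$H x:rad R" "x:.R" by(auto simp: H_core_def)
		thus "x:rad R" by(simp add: act_one)
	qed
qed (use act_JR JR_closed in "auto simp: H_core_def")

end

text \<open>By the assumption on the crossed product, \<open>x\<close> is in its radical iff the
  image of \<open>x\<close> is in the radical of the scalar extension, where the criterion over
  \<open>F\<close> applies. The assumption on \<open>R\<close> brings the resulting condition on
  coordinates back to \<open>K\<close>.\<close>

lemma (in crossed_product_base_change) crossed_product_radicalI: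
	assumes "algebraically_closed F" "commutative_algebra H | cocommutative K H"
		and JR: "rad BR.TA = tensor_image K R EF (rad R) (car F)"
		and JA: "rad BA.TA = tensor_image K A EF (rad A) (car F)"
	shows "crossed_product_radical K H R act sg I e du t l ta F io"
proof (rule crossed_product_radical.intro[OF crossed_product_base_change_axioms], rule crossed_product_radical_axioms.intro)
	fix x assume x: "x:.RH.TT"
	have ic: "BA.incl x:.BA.TA" using x by(simp add: BA.incl_def)
	have xA: "x:.A" using x by simp
	have "x:rad A \<longleftrightarrow> BA.incl x:rad BA.TA"
		unfolding JA by(rule BA.incl_in_image[OF A.jacobson_submodule xA, symmetric])
	also have "... \<longleftrightarrow> (ALL i:I. PP i (BA.incl x):rad BR.TA)"
		using jacobson_base_change[OF assms(1,2), of "BA.incl x"] ic by blast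
	also have "... \<longleftrightarrow> (ALL i:I. cd i x:rad R)"
	proof (rule ball_cong[OF refl])
		fix i assume i: "i:I"
		have "PP i (BA.incl x) = BR.incl (cd i x)" by(simp add: BA.incl_def BR.incl_def PP_tn[OF i x])
		thus "PP i (BA.incl x):rad BR.TA \<longleftrightarrow> cd i x:rad R"
			using BR.incl_in_image[OF R.jacobson_submodule cd_closed[OF i x]] by(simp add: JR)
	qed
	finally show "x:rad A \<longleftrightarrow> ..." .
qed

theorem theorem2p12:
  fixes K :: "('k, 'n) ring_scheme"
    and H :: "('k, 'h, 'm) hopf_algebra_scheme"
    and R :: "('k, 'r, 'p) module_scheme"
    and F :: "('f, 'q) ring_scheme"
    and act :: "'h \<Rightarrow> 'r \<Rightarrow> 'r"
    and \<sigma> :: "'h \<Rightarrow> 'h \<Rightarrow> 'r"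
    and \<iota> :: "'k \<Rightarrow> 'f"
  assumes "field K"
    and "hopf_algebra K H"
    and "semisimple_algebra H"
    and "cosemisimple K H"
    and "commutative_algebra H \<or> cocommutative K H"
    and "assoc_algebra K R"
    and "twisted_module_algebra K H R act \<sigma>"
    and "assoc_algebra K (crossed_product K H R act \<sigma>)"
    and "\<iota> \<in> ring_hom K F"
    and "algebraic_closure F (\<iota> ` carrier K)"
    and "jacobson_radical (tensor_algebra K R (ext_algebra F \<iota>)) =
           tensor_image K R (ext_algebra F \<iota>) (jacobson_radical R) (carrier F)"
    and "jacobson_radical (tensor_algebra K (crossed_product K H R act \<sigma>) (ext_algebra F \<iota>)) =
           tensor_image K (crossed_product K H R act \<sigma>) (ext_algebra F \<iota>)
             (jacobson_radical (crossed_product K H R act \<sigma>)) (carrier F)"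
  shows "(jacobson_radical R = H_jacobson_radical K H R act \<sigma> \<and>
           H_jacobson_radical K H R act \<sigma> = H_core H R act (jacobson_radical R)) \<and>
         jacobson_radical (crossed_product K H R act \<sigma>) =
           tensor_image K R H (H_jacobson_radical K H R act \<sigma>) (carrier H)"
proof -
	obtain \<tau> where \<tau>: "convolution_inverse K H R \<sigma> \<tau>"
		using twisted_module_algebra.twisted[OF assms(7)] by(elim exE conjE) (rule that)
	obtain t where t: "t:.H" "counit H t = 1.$K" "ALL h:car H. h*.$H t = counit H h.*$H t"
		using hopf_algebra.exists_integral[OF assms(2,3)] by(elim bexE conjE) (rule that)
	have t3: "h*.$H t = counit H h.*$H t" if "h:.H" for h using t(3) that by blast
	obtain I :: "('h \<times> 'h) set" and e du where I: "finite I" "ALL i:I. e i:.H" "ALL i:I. lin K H (scalars K) (du i)"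
			"ALL i:I. ALL j:I. du j (e i) = (if i = j then 1.$K else 0.$K)" "ALL h:car H. h = (+/$H i:I. du i h.*$H e i)"
		by(rule hopf_algebra.finite_basis[OF assms(2) t(1,2) t3, elim_format], assumption) (elim exE conjE, rule that)
	obtain l where l: "lin K H (scalars K) l" "l 1.$H = 1.$K"
			"ALL h:car H. sweedler2 K H H h (%x y. l y.*$H x) = l h.*$H 1.$H"
		using hopf_algebra.exists_cointegral[OF assms(2,4)] by(elim exE conjE) (rule that)
	have hb: "hopf_basis K H I e du t l"
		by(intro hopf_basis.intro hopf_basis_axioms.intro assms(2) I(1) bspec[OF I(2)] bspec[OF I(3)]
				bspec[OF bspec[OF I(4)]] bspec[OF I(5)] t(1,2) bspec[OF t(3)] l(1,2) bspec[OF l(3)])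
	have ca: "crossed_product_algebra K H R act \<sigma> I e du t l \<tau>"
		by(intro crossed_product_algebra.intro crossed_product_algebra_axioms.intro assms(7,8) hb \<tau>)
	have F: "field F" by(rule algebraic_closure.axioms(1)[OF assms(10)])
	interpret F: algebraic_closure F "\<iota> ` car K" by(rule assms(10))
	have cb: "crossed_product_base_change K H R act \<sigma> I e du t l \<tau> F \<iota>"
		by(intro crossed_product_base_change.intro crossed_product_base_change_axioms.intro ca F assms(9))
	have cr: "crossed_product_radical K H R act \<sigma> I e du t l \<tau> F \<iota>"
		by(rule crossed_product_base_change.crossed_product_radicalI[OF cb F.algebraically_closed_axioms assms(5,11,12)])
	note J = crossed_product_radical.H_radical_eq[OF cr] crossed_product_radical.core_eq[OF cr] crossed_product_radical.JA_tensor_image[OF cr]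
	show ?thesis unfolding J(1,2) by(intro conjI refl J(3))
qed

end
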